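(* Let $\omega\in\mathcal{E}$. The dual space of $A^1(\omega^{1/2})$ can be identified, with equivalent norms, with $A^\infty(\omega^{1/2})$ under the integral pairing $$\langle f,g\rangle_\omega=\int_{\mathbb{D}}f(z)\,\overline{g(z)}\,\omega(z)\,dA(z).$$ That is, for each $g\in A^\infty(\omega^{1/2})$ the functional $\Lambda_g(f)=\langle f,g\rangle_\omega$ is bounded on $A^1(\omega^{1/2})$; every bounded linear functional on $A^1(\omega^{1/2})$ is equal to $\Lambda_g$ for a unique $g\in A^\infty(\omega^{1/2})$; and $\|\Lambda_g\|\asymp\|g\|_{A^\infty(\omega^{1/2})}$ with constants independent of $g$.
   Context: $\mathbb{D}$ is the open unit disk in $\mathbb{C}$, $dA=\frac{dx\,dy}{\pi}$ is normalized area measure, and $H(\mathbb{D})$ is the space of analytic functions on $\mathbb{D}$. A weight is a positive function $\omega\in L^1(\mathbb{D},dA)$. The notation $a\asymp b$ means that $C^{-1}b\le a\le Cb$ for some constant $C>0$ independent of the variables. Class $\mathcal{L}$: a positive function $\tau$ on $\mathbb{D}$ is in $\mathcal{L}$ if (A) there is a constant $c_1$ with $\tau(z)\le c_1(1-|z|)$ for all $z\in\mathbb{D}$, and (B) there is a constant $c_2$ with $|\tau(z)-\tau(\zeta)|\le c_2|z-\zeta|$ for all $z,\zeta\in\mathbb{D}$. Class $\mathcal{L}^*$: a weight $\omega$ is in $\mathcal{L}^*$ if $\omega=e^{-2\varphi}$ with $\varphi\in C^2(\mathbb{D})$, $\Delta\varphi>0$ ($\Delta$ is the classical Laplacian), and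 $(\Delta\varphi(z))^{-1/2}\asymp\tau(z)$ on $\mathbb{D}$ for some $\tau\in\mathcal{L}$, called the associated function of $\omega$. Class $\mathcal{E}$: a weight $\omega$ is in $\mathcal{E}$ if $\omega\in\mathcal{L}^*$ and its associated function $\tau$ satisfies: for each $m\ge1$ there are constants $b_m>0$ and $0<t_m<1/m$ such that $\tau(z)\le\tau(\xi)+t_m|z-\xi|$ for all $z,\xi\in\mathbb{D}$ with $|z-\xi|>b_m\tau(\xi)$. $A^1(\omega^{1/2})$ is the Banach space of $f\in H(\mathbb{D})$ with $\|f\|_{A^1(\omega^{1/2})}=\int_{\mathbb{D}}|f|\,\omega^{1/2}\,dA<\infty$. $A^\infty(\omega^{1/2})$ is the Banach space of $f\in H(\mathbb{D})$ with $\|f\|_{A^\infty(\omega^{1/2})}=\sup_{z\in\mathbb{D}}|f(z)|\,\omega(z)^{1/2}<\infty$. *)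

theory Defs
  imports "HOL-Complex_Analysis.Complex_Analysis"
begin

abbreviation disk :: "complex set"
  where "disk \<equiv> ball 0 1"

definition disk_area :: "complex measure"
  where "disk_area = scale_measure (ennreal (1 / pi)) (lebesgue_on disk)"

definition comparable_on :: "'a set \<Rightarrow> ('a \<Rightarrow> real) \<Rightarrow> ('a \<Rightarrow> real) \<Rightarrow> bool"
  where "comparable_on S a b \<longleftrightarrow> (\<exists>C>0. \<forall>x\<in>S. inverse C * b x \<le> a x \<and> a x \<le> C * b x)"

text \<open>
  The space \<open>C\<^sup>2(U)\<close> for open \<open>U\<close>; differentiability is over the reals, so the
  derivatives are bounded real-linear maps.
\<close>

definition C2_on :: "complex set \<Rightarrow> (complex \<Rightarrow> real) \<Rightarrow> bool"
  where "C2_on U f \<longleftrightarrow>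
    (\<exists>(f' :: complex \<Rightarrow> complex \<Rightarrow>\<^sub>L real) (f'' :: complex \<Rightarrow> complex \<Rightarrow>\<^sub>L complex \<Rightarrow>\<^sub>L real).
      (\<forall>z\<in>U. (f has_derivative blinfun_apply (f' z)) (at z)) \<and>
      (\<forall>z\<in>U. (f' has_derivative blinfun_apply (f'' z)) (at z)) \<and>
      continuous_on U f'')"

definition dir_deriv :: "complex \<Rightarrow> (complex \<Rightarrow> real) \<Rightarrow> complex \<Rightarrow> real"
  where "dir_deriv v f z = deriv (\<lambda>t::real. f (z + of_real t * v)) 0"

definition laplacian :: "(complex \<Rightarrow> real) \<Rightarrow> complex \<Rightarrow> real"
  where "laplacian f z =
    dir_deriv 1 (dir_deriv 1 f) z + dir_deriv \<i> (dir_deriv \<i> f) z"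

text \<open>
  Weights and the functions \<open>\<tau>\<close>, \<open>\<phi>\<close> live on the disk: their values elsewhere are
  arbitrary and never used.
\<close>

definition weight :: "(complex \<Rightarrow> real) \<Rightarrow> bool"
  where "weight \<omega> \<longleftrightarrow> (\<forall>z\<in>disk. 0 < \<omega> z) \<and> integrable disk_area \<omega>"

definition class_L :: "(complex \<Rightarrow> real) \<Rightarrow> bool"
  where "class_L \<tau> \<longleftrightarrow>
    (\<forall>z\<in>disk. 0 < \<tau> z) \<and>
    (\<exists>c1. \<forall>z\<in>disk. \<tau> z \<le> c1 * (1 - norm z)) \<and>
    (\<exists>c2. \<forall>z\<in>disk. \<forall>\<zeta>\<in>disk. \<bar>\<tau> z - \<tau> \<zeta>\<bar> \<le> c2 * norm (z - \<zeta>))"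

text \<open>
  The associated function of a weight in \<open>\<L>\<^sup>*\<close> is determined only up to \<open>\<asymp>\<close>, so being
  associated is a relation. A weight is in \<open>\<E>\<close> if some associated function satisfies the
  additional growth condition.
\<close>

definition associated_function :: "(complex \<Rightarrow> real) \<Rightarrow> (complex \<Rightarrow> real) \<Rightarrow> bool"
  where "associated_function \<omega> \<tau> \<longleftrightarrow>
    class_L \<tau> \<and>
    (\<exists>\<phi>. C2_on disk \<phi> \<and>
      (\<forall>z\<in>disk. \<omega> z = exp (- 2 * \<phi> z)) \<and>
      (\<forall>z\<in>disk. 0 < laplacian \<phi> z) \<and>
      comparable_on disk (\<lambda>z. laplacian \<phi> z powr (- 1 / 2)) \<tau>)"

definition class_Lstar :: "(complex \<Rightarrow> real) \<Rightarrow> bool"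
  where "class_Lstar \<omega> \<longleftrightarrow> weight \<omega> \<and> (\<exists>\<tau>. associated_function \<omega> \<tau>)"

definition class_E :: "(complex \<Rightarrow> real) \<Rightarrow> bool"
  where "class_E \<omega> \<longleftrightarrow>
    class_Lstar \<omega> \<and>
    (\<exists>\<tau>. associated_function \<omega> \<tau> \<and>
      (\<forall>m::nat. 1 \<le> m \<longrightarrow>
        (\<exists>b t. 0 < b \<and> 0 < t \<and> t < 1 / real m \<and>
          (\<forall>z\<in>disk. \<forall>\<xi>\<in>disk. b * \<tau> \<xi> < norm (z - \<xi>) \<longrightarrow>
            \<tau> z \<le> \<tau> \<xi> + t * norm (z - \<xi>)))))"

text \<open>
  Functions on the disk are represented by their extension by zero, so that equality of
  functions on the disk is equality of HOL functions and the pointwise operations are the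
  vector space operations.
\<close>

definition analytic_disk :: "(complex \<Rightarrow> complex) set"
  where "analytic_disk = {f. f holomorphic_on disk \<and> (\<forall>z. z \<notin> disk \<longrightarrow> f z = 0)}"

definition A1 :: "(complex \<Rightarrow> real) \<Rightarrow> (complex \<Rightarrow> complex) set"
  where "A1 v = {f \<in> analytic_disk. integrable disk_area (\<lambda>z. norm (f z) * v z)}"

definition A1_norm :: "(complex \<Rightarrow> real) \<Rightarrow> (complex \<Rightarrow> complex) \<Rightarrow> real"
  where "A1_norm v f = (\<integral>z. norm (f z) * v z \<partial>disk_area)"

definition Ainf :: "(complex \<Rightarrow> real) \<Rightarrow> (complex \<Rightarrow> complex) set"
  where "Ainf v = {f \<in> analytic_disk. bdd_above ((\<lambda>z. norm (f z) * v z) ` disk)}"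

definition Ainf_norm :: "(complex \<Rightarrow> real) \<Rightarrow> (complex \<Rightarrow> complex) \<Rightarrow> real"
  where "Ainf_norm v f = (SUP z\<in>disk. norm (f z) * v z)"

definition pairing ::
    "(complex \<Rightarrow> real) \<Rightarrow> (complex \<Rightarrow> complex) \<Rightarrow> (complex \<Rightarrow> complex) \<Rightarrow> complex"
  where "pairing \<omega> f g = (\<integral>z. f z * cnj (g z) * of_real (\<omega> z) \<partial>disk_area)"

text \<open>
  Bounded complex-linear functionals on a space \<open>V\<close> of functions with norm \<open>N\<close>, and their
  operator norm. Only the values of \<open>\<Lambda>\<close> on \<open>V\<close> are relevant.
\<close>

definition bounded_functional_on ::
    "(complex \<Rightarrow> complex) set \<Rightarrow> ((complex \<Rightarrow> complex) \<Rightarrow> real)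
      \<Rightarrow> ((complex \<Rightarrow> complex) \<Rightarrow> complex) \<Rightarrow> bool"
  where "bounded_functional_on V N \<Lambda> \<longleftrightarrow>
    (\<forall>f\<in>V. \<forall>g\<in>V. \<Lambda> (\<lambda>z. f z + g z) = \<Lambda> f + \<Lambda> g) \<and>
    (\<forall>c. \<forall>f\<in>V. \<Lambda> (\<lambda>z. c * f z) = c * \<Lambda> f) \<and>
    (\<exists>C. \<forall>f\<in>V. norm (\<Lambda> f) \<le> C * N f)"

definition functional_norm ::
    "(complex \<Rightarrow> complex) set \<Rightarrow> ((complex \<Rightarrow> complex) \<Rightarrow> real)
      \<Rightarrow> ((complex \<Rightarrow> complex) \<Rightarrow> complex) \<Rightarrow> real"
  where "functional_norm V N \<Lambda> = (SUP f\<in>{f \<in> V. N f \<le> 1}. norm (\<Lambda> f))"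

end

theory Submission
  imports Defs
begin

text \<open>
  Write \<open>\<omega> = e\<^sup>-\<^sup>2\<^sup>\<phi>\<close> and pass to \<open>H = h e\<^sup>-\<^sup>\<phi>\<close>, so that the weighted Bergman projection \<open>P\<close> becomes
  an orthogonal projection in unweighted \<open>L\<^sup>2\<close>. By Weyl's lemma \<open>H - P H\<close> is a limit of functions \<open>Q = e\<^sup>\<phi> \<partial>b\<close>
  with \<open>b\<close> of compact support, and \<open>\<parallel>e\<^sup>\<phi> \<partial>b\<parallel>\<close> dominates \<open>\<parallel>e\<^sup>\<phi> b / \<tau>\<parallel>\<close> because \<open>\<Delta>\<phi>\<close> is comparable to
  \<open>\<tau>\<close> to the power \<open>-2\<close>. Multiplying \<open>Q\<close> by \<open>\<rho> = R\<^sup>2 / (R\<^sup>2 + |z - z\<^sub>0|\<^sup>2)\<close>, where \<open>R\<close> is a large multiple of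
  \<open>\<tau>(z\<^sub>0)\<close>, costs only a small error: by class \<open>\<E>\<close> the derivative of \<open>\<rho>\<close> is at most a small multiple of
  \<open>\<rho> / \<tau>\<close>. This localises the estimate at \<open>z\<^sub>0\<close>, and the sub-mean value property gives \<open>|P H| \<le> K\<close>
  whenever \<open>|H| \<le> 1\<close>, without any bound on the kernel of \<open>P\<close>. By duality \<open>P\<close> is bounded in \<open>L\<^sup>1\<close>, and projections
  of cutoffs show that \<open>A\<^sup>2\<close> is dense in \<open>A\<^sup>1\<close>. A functional on \<open>A\<^sup>1\<close> is represented on \<open>A\<^sup>2\<close> by some \<open>g\<close> by Riesz,
  the \<open>L\<^sup>1\<close> bound for \<open>P\<close> makes \<open>g e\<^sup>-\<^sup>\<phi>\<close> bounded, and density extends the representation to \<open>A\<^sup>1\<close>.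
  Uniqueness is \<open>\<langle>g, g\<rangle> = 0 \<Longrightarrow> g = 0\<close>, since bounded functions belong to \<open>A\<^sup>1\<close>.
\<close>

section \<open>Wirtinger derivatives\<close>

text \<open>A sup norm bound for the projection is commonly read off from decay of its kernel,
  whereas the estimates available here live in L2. A match of scales makes them pointwise: \<rho>
  decays like |z - z0|^-2, so over the plane it has L2 norm of order R, hence of order \<tau>(z0),
  and the sub-mean value property on a disk of radius comparable to \<tau>(z0) loses exactly the
  factor 1/\<tau>(z0). The Lipschitz condition of class \<L> alone bounds the quotient of \<tau>
  times the derivative of \<rho> by \<rho> by some fixed constant, which in general cannot be
  absorbed into the constant c of the basic inequality; class \<E> supplies slopes below c/32.
  Density meets a second obstacle: the potential b is not holomorphic, so e^\<phi> b / \<tau> is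
  controlled in local L2 averages and not pointwise. The holomorphic factor of the pairing takes
  over the averaging, and the logarithmic cutoff contributes the small factor.\<close>

definition has_wirt :: "(complex \<Rightarrow> complex) \<Rightarrow> complex \<Rightarrow> complex \<Rightarrow> complex \<Rightarrow> bool"
  where "has_wirt f p q z \<longleftrightarrow> (f has_derivative (\<lambda>h. p * h + q * cnj h)) (at z)"

named_theorems wirt_intros

lemma has_wirt_eq:
  "has_wirt f p q z \<Longrightarrow> p = p' \<Longrightarrow> q = q' \<Longrightarrow> has_wirt f p' q' z"
  by simp

lemma has_wirt_const [wirt_intros]: "has_wirt (\<lambda>w. c) 0 0 z"
  by (simp add: has_wirt_def)

lemma has_wirt_ident [wirt_intros]: "has_wirt (\<lambda>w. w) 1 0 z"
  by (simp add: has_wirt_def)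

lemma has_wirt_cnj [wirt_intros]:
  assumes "has_wirt f p q z"
  shows "has_wirt (\<lambda>w. cnj (f w)) (cnj q) (cnj p) z"
proof -
  have "((\<lambda>w. cnj (f w)) has_derivative (\<lambda>h. cnj (p * h + q * cnj h))) (at z)"
    using assms unfolding has_wirt_def by (rule has_derivative_cnj)
  then show ?thesis
    unfolding has_wirt_def by (simp add: add.commute)
qed

lemma has_wirt_add [wirt_intros]:
  assumes "has_wirt f p q z" "has_wirt g p' q' z"
  shows "has_wirt (\<lambda>w. f w + g w) (p + p') (q + q') z"
  using has_derivative_add[OF assms[unfolded has_wirt_def]]
  unfolding has_wirt_def by (simp add: algebra_simps)

lemma has_wirt_diff [wirt_intros]:
  assumes "has_wirt f p q z" "has_wirt g p' q' z"
  shows "has_wirt (\<lambda>w. f w - g w) (p - p') (q - q') z"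
  using has_derivative_diff[OF assms[unfolded has_wirt_def]]
  unfolding has_wirt_def by (simp add: algebra_simps)

lemma has_wirt_mult [wirt_intros]:
  assumes "has_wirt f p q z" "has_wirt g p' q' z"
  shows "has_wirt (\<lambda>w. f w * g w) (p * g z + f z * p') (q * g z + f z * q') z"
  using has_derivative_mult[OF assms[unfolded has_wirt_def]]
  unfolding has_wirt_def by (simp add: algebra_simps)

lemma has_wirt_chain:
  assumes "has_wirt f p q z" "(g has_field_derivative d) (at (f z))"
  shows "has_wirt (\<lambda>w. g (f w)) (d * p) (d * q) z"
proof -
  have "((\<lambda>w. g (f w)) has_derivative (\<lambda>h. d * (p * h + q * cnj h))) (at z)"
    using has_derivative_compose[OF assms(1)[unfolded has_wirt_def], of g "(*) d"] assms(2)
    unfolding has_field_derivative_def by blast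
  then show ?thesis
    unfolding has_wirt_def by (simp add: algebra_simps)
qed

lemma has_wirt_holomorphic:
  assumes "(g has_field_derivative d) (at z)"
  shows "has_wirt g d 0 z"
  using has_wirt_chain[OF has_wirt_ident assms] by simp

text \<open>Since \<open>r\<close> is real-valued, \<open>p * h + q * cnj h\<close> is real in every
  direction \<open>h\<close>, and the real derivative \<open>d\<close> can act on it by
  multiplication.\<close>

lemma has_wirt_real_chain:
  assumes "has_wirt (\<lambda>w. complex_of_real (r w)) p q z" "(g has_real_derivative d) (at (r z))"
  shows "has_wirt (\<lambda>w. complex_of_real (g (r w))) (of_real d * p) (of_real d * q) z"
proof -
  have 1: "((\<lambda>w. Re (complex_of_real (r w))) has_derivative (\<lambda>h. Re (p * h + q * cnj h))) (at z)"
    using assms(1) unfolding has_wirt_def by (rule has_derivative_Re)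
  have im: "Im (p * h + q * cnj h) = 0" for h
  proof -
    have "((\<lambda>w. Im (complex_of_real (r w))) has_derivative (\<lambda>h. Im (p * h + q * cnj h))) (at z)"
      using assms(1) unfolding has_wirt_def by (rule has_derivative_Im)
    moreover have "((\<lambda>w. Im (complex_of_real (r w))) has_derivative (\<lambda>h. 0)) (at z)"
      by simp
    ultimately have "(\<lambda>h. Im (p * h + q * cnj h)) = (\<lambda>h. 0)"
      by (rule has_derivative_unique)
    then show ?thesis by meson
  qed
  have "((\<lambda>w. complex_of_real (g (r w))) has_derivative
      (\<lambda>h. complex_of_real (d * Re (p * h + q * cnj h)))) (at z)"
    using has_derivative_of_real[OF has_derivative_compose[OF 1, of g "(*) d"]] assms(2)
    unfolding has_field_derivative_def by simp
  also have "(\<lambda>h. complex_of_real (d * Re (p * h + q * cnj h))) =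
      (\<lambda>h. of_real d * p * h + of_real d * q * cnj h)"
  proof
    fix h
    have "complex_of_real (Re (p * h + q * cnj h)) = p * h + q * cnj h"
      using im[of h] by (simp add: complex_eq_iff)
    then show "complex_of_real (d * Re (p * h + q * cnj h)) =
        of_real d * p * h + of_real d * q * cnj h"
      by (simp only: of_real_mult) (simp add: algebra_simps)
  qed
  finally show ?thesis unfolding has_wirt_def .
qed

lemma has_wirt_transform:
  assumes "has_wirt f p q z" "open S" "z \<in> S" "\<And>w. w \<in> S \<Longrightarrow> f w = g w"
  shows "has_wirt g p q z"
  using assms unfolding has_wirt_def by (rule has_derivative_transform_within_open)

text \<open>The directions 1 and \<i> determine \<open>p + q\<close> and
  \<open>p - q\<close>.\<close>

lemma has_wirt_unique:
  assumes "has_wirt f p q z" "has_wirt f p' q' z"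
  shows "p = p'" "q = q'"
proof -
  have *: "(\<lambda>h. p * h + q * cnj h) = (\<lambda>h. p' * h + q' * cnj h)"
    using assms unfolding has_wirt_def by (rule has_derivative_unique)
  have "p + q = p' + q'" using fun_cong[OF *, of 1] by simp
  moreover have "\<i> * (p - q) = \<i> * (p' - q')"
    using fun_cong[OF *, of \<i>] by (simp add: algebra_simps)
  then have "p - q = p' - q'" by simp
  ultimately show "p = p'" "q = q'"
    by (simp_all add: complex_eq_iff)
qed

lemma has_wirt_scale:
  assumes "has_wirt f p q (of_real t * z)"
  shows "has_wirt (\<lambda>w. f (of_real t * w)) (of_real t * p) (of_real t * q) z"
proof -
  have 1: "((\<lambda>w. complex_of_real t * w) has_derivative (\<lambda>h. of_real t * h)) (at z)"
    by (auto intro!: derivative_eq_intros)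
  show ?thesis
    using has_derivative_compose[OF 1 assms[unfolded has_wirt_def]]
    unfolding has_wirt_def by (simp add: algebra_simps)
qed

lemma has_wirt_shift:
  assumes "has_wirt f p q (z + a)"
  shows "has_wirt (\<lambda>w. f (w + a)) p q z"
proof -
  have 1: "((\<lambda>w. w + a) has_derivative (\<lambda>h. h)) (at z)"
    by (auto intro!: derivative_eq_intros)
  show ?thesis
    using has_derivative_compose[OF 1 assms[unfolded has_wirt_def]]
    unfolding has_wirt_def by (simp add: algebra_simps)
qed

text \<open>The derivatives are arguments and not values of an operator: the calculus rules then
  build them symbolically, and integrands can be matched against them.\<close>

definition C1w :: "complex set \<Rightarrow> (complex \<Rightarrow> complex) \<Rightarrow> (complex \<Rightarrow> complex) \<Rightarrow> (complex \<Rightarrow> complex) \<Rightarrow> bool"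
  where "C1w U f p q \<longleftrightarrow>
    (\<forall>z\<in>U. has_wirt f (p z) (q z) z) \<and> continuous_on U p \<and> continuous_on U q"

lemma C1wI:
  "(\<And>z. z \<in> U \<Longrightarrow> has_wirt f (p z) (q z) z) \<Longrightarrow> continuous_on U p \<Longrightarrow> continuous_on U q \<Longrightarrow> C1w U f p q"
  by (simp add: C1w_def)

lemma C1w_D: "C1w U f p q \<Longrightarrow> z \<in> U \<Longrightarrow> has_wirt f (p z) (q z) z"
  by (simp add: C1w_def)

lemma has_wirt_imp_continuous: "has_wirt f p q z \<Longrightarrow> continuous (at z) f"
  unfolding has_wirt_def by (rule has_derivative_continuous)

lemma C1w_continuous:
  assumes "C1w U f p q"
  shows "continuous_on U f" "continuous_on U p" "continuous_on U q"
  using assms unfolding C1w_def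
  by (auto intro!: continuous_at_imp_continuous_on has_wirt_imp_continuous)

lemma C1w_mult:
  assumes f: "C1w U f p q" and g: "C1w U g p' q'"
  shows "C1w U (\<lambda>z. f z * g z) (\<lambda>z. p z * g z + f z * p' z) (\<lambda>z. q z * g z + f z * q' z)"
  by (intro C1wI has_wirt_mult continuous_intros C1w_continuous[OF f] C1w_continuous[OF g]
      C1w_D[OF f] C1w_D[OF g])

lemma C1w_add:
  assumes f: "C1w U f p q" and g: "C1w U g p' q'"
  shows "C1w U (\<lambda>z. f z + g z) (\<lambda>z. p z + p' z) (\<lambda>z. q z + q' z)"
  by (intro C1wI has_wirt_add continuous_intros C1w_continuous[OF f] C1w_continuous[OF g]
      C1w_D[OF f] C1w_D[OF g])

lemma C1w_cnj:
  assumes f: "C1w U f p q"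
  shows "C1w U (\<lambda>z. cnj (f z)) (\<lambda>z. cnj (q z)) (\<lambda>z. cnj (p z))"
  by (intro C1wI has_wirt_cnj continuous_intros C1w_continuous[OF f] C1w_D[OF f])

lemma C1w_const: "C1w U (\<lambda>z. c) (\<lambda>z. 0) (\<lambda>z. 0)"
  by (intro C1wI has_wirt_const continuous_intros)

lemma C1w_subset: "C1w U f p q \<Longrightarrow> V \<subseteq> U \<Longrightarrow> C1w V f p q"
  unfolding C1w_def by (meson continuous_on_subset subsetD)

lemma C1w_Un:
  assumes "C1w U f p q" "C1w V f p q" "open U" "open V"
  shows "C1w (U \<union> V) f p q"
  using assms unfolding C1w_def by (auto intro: continuous_on_open_Un)

lemma C1w_transform:
  assumes "C1w U f p q" "open U" "\<And>z. z \<in> U \<Longrightarrow> f z = g z" "\<And>z. z \<in> U \<Longrightarrow> p z = p' z"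
    "\<And>z. z \<in> U \<Longrightarrow> q z = q' z"
  shows "C1w U g p' q'"
proof (rule C1wI)
  fix z assume z: "z \<in> U"
  show "has_wirt g (p' z) (q' z) z"
    using has_wirt_transform[OF C1w_D[OF assms(1) z] assms(2) z assms(3)] assms(4,5)[OF z] by simp
next
  show "continuous_on U p'" "continuous_on U q'"
    using C1w_continuous(2,3)[OF assms(1)] assms(4,5) continuous_on_cong by metis+
qed

text \<open>Symmetry is part of the definition: \<open>m\<close> is both of the mixed second derivatives.\<close>

definition C2w :: "complex set \<Rightarrow> (complex \<Rightarrow> complex) \<Rightarrow> (complex \<Rightarrow> complex) \<Rightarrow> (complex \<Rightarrow> complex) \<Rightarrow> (complex \<Rightarrow> complex) \<Rightarrow> bool"
  where "C2w U f p q m \<longleftrightarrow> C1w U f p q \<and> (\<exists>r. C1w U p r m) \<and> (\<exists>r. C1w U q m r)"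

lemma C2w_mult:
  assumes "C2w U f p q m" "C2w U g p' q' m'"
  shows "C2w U (\<lambda>z. f z * g z) (\<lambda>z. p z * g z + f z * p' z) (\<lambda>z. q z * g z + f z * q' z)
    (\<lambda>z. m z * g z + p z * q' z + (q z * p' z + f z * m' z))"
proof -
  from assms obtain r s r' s' where
    1: "C1w U f p q" "C1w U p r m" "C1w U q m s" "C1w U g p' q'" "C1w U p' r' m'" "C1w U q' m' s'"
    unfolding C2w_def by blast
  have 2: "C1w U (\<lambda>z. p z * g z + f z * p' z)
      (\<lambda>z. (r z * g z + p z * p' z) + (p z * p' z + f z * r' z))
      (\<lambda>z. m z * g z + p z * q' z + (q z * p' z + f z * m' z))"
    using C1w_add[OF C1w_mult[OF 1(2,4)] C1w_mult[OF 1(1,5)]] by simp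
  have "C1w U (\<lambda>z. q z * g z + f z * q' z)
      (\<lambda>z. m z * g z + q z * p' z + (p z * q' z + f z * m' z))
      (\<lambda>z. (s z * g z + q z * q' z) + (q z * q' z + f z * s' z))"
    using C1w_add[OF C1w_mult[OF 1(3,4)] C1w_mult[OF 1(1,6)]] by simp
  moreover have "(\<lambda>z. m z * g z + q z * p' z + (p z * q' z + f z * m' z)) =
      (\<lambda>z. m z * g z + p z * q' z + (q z * p' z + f z * m' z))"
    by (simp add: algebra_simps)
  ultimately show ?thesis
    unfolding C2w_def using 2 C1w_mult[OF 1(1,4)] by auto
qed

lemma C2w_cnj:
  assumes "C2w U f p q m"
  shows "C2w U (\<lambda>z. cnj (f z)) (\<lambda>z. cnj (q z)) (\<lambda>z. cnj (p z)) (\<lambda>z. cnj (m z))"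
  using assms unfolding C2w_def by (auto dest: C1w_cnj)

lemma C2w_add:
  assumes "C2w U f p q m" "C2w U g p' q' m'"
  shows "C2w U (\<lambda>z. f z + g z) (\<lambda>z. p z + p' z) (\<lambda>z. q z + q' z) (\<lambda>z. m z + m' z)"
  using assms unfolding C2w_def by (blast intro: C1w_add)

lemma C2w_const: "C2w U (\<lambda>z. c) (\<lambda>z. 0) (\<lambda>z. 0) (\<lambda>z. 0)"
  unfolding C2w_def by (blast intro: C1w_const)

lemma C2w_subset: "C2w U f p q m \<Longrightarrow> V \<subseteq> U \<Longrightarrow> C2w V f p q m"
  unfolding C2w_def by (blast intro: C1w_subset)

lemma C2w_transform:
  assumes "C2w U f p q m" "open U" "\<And>z. z \<in> U \<Longrightarrow> f z = g z" "\<And>z. z \<in> U \<Longrightarrow> p z = p' z"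
    "\<And>z. z \<in> U \<Longrightarrow> q z = q' z" "\<And>z. z \<in> U \<Longrightarrow> m z = m' z"
  shows "C2w U g p' q' m'"
proof -
  from assms(1) obtain r s where 1: "C1w U f p q" "C1w U p r m" "C1w U q m s"
    unfolding C2w_def by blast
  have "C1w U g p' q'"
    by (rule C1w_transform[OF 1(1) assms(2-5)])
  moreover have "C1w U p' r m'"
    by (rule C1w_transform[OF 1(2) assms(2,4) refl assms(6)])
  moreover have "C1w U q' m' s"
    by (rule C1w_transform[OF 1(3) assms(2,5,6) refl])
  ultimately show ?thesis
    unfolding C2w_def by blast
qed

lemma C1w_holomorphic:
  assumes "g holomorphic_on U" "open U"
  shows "C1w U g (deriv g) (\<lambda>z. 0)"
  using assms by (intro C1wI has_wirt_holomorphic holomorphic_derivI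
      holomorphic_on_imp_continuous_on holomorphic_deriv continuous_intros)

lemma C2w_holomorphic:
  assumes "g holomorphic_on U" "open U"
  shows "C2w U g (deriv g) (\<lambda>z. 0) (\<lambda>z. 0)"
  unfolding C2w_def
  using C1w_holomorphic[OF assms] C1w_holomorphic[OF holomorphic_deriv[OF assms] assms(2)] C1w_const[of U 0]
  by blast

lemma C1w_real_chain:
  assumes "C1w U (\<lambda>z. of_real (r z)) p q" "\<And>z. z \<in> U \<Longrightarrow> (g has_real_derivative g' (r z)) (at (r z))"
    "continuous_on (r ` U) g'"
  shows "C1w U (\<lambda>z. of_real (g (r z))) (\<lambda>z. of_real (g' (r z)) * p z) (\<lambda>z. of_real (g' (r z)) * q z)"
proof -
  have "continuous_on U (\<lambda>z. Re (complex_of_real (r z)))"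
    by (intro continuous_on_Re C1w_continuous(1)[OF assms(1)])
  then have r: "continuous_on U r" by simp
  have "continuous_on U (\<lambda>z. g' (r z))"
    using continuous_on_compose[OF r assms(3)] by (simp add: o_def)
  then show ?thesis
    using assms by (intro C1wI has_wirt_real_chain continuous_intros)
      (auto intro: C1w_continuous C1w_D)
qed

text \<open>Both orders of differentiation lead to \<open>g'' p q + g' m\<close>, which is symmetric
  in \<open>p\<close> and \<open>q\<close>; so the chain rule preserves the symmetry built into
  \<open>C2w\<close>.\<close>

lemma C2w_real_chain:
  assumes "C2w U (\<lambda>z. of_real (r z)) p q m" "\<And>z. z \<in> U \<Longrightarrow> (g has_real_derivative g' (r z)) (at (r z))"
    "\<And>z. z \<in> U \<Longrightarrow> (g' has_real_derivative g'' (r z)) (at (r z))" "continuous_on (r ` U) g''"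
  shows "C2w U (\<lambda>z. of_real (g (r z))) (\<lambda>z. of_real (g' (r z)) * p z) (\<lambda>z. of_real (g' (r z)) * q z)
    (\<lambda>z. of_real (g'' (r z)) * p z * q z + of_real (g' (r z)) * m z)"
proof -
  from assms(1) obtain s s' where
    1: "C1w U (\<lambda>z. of_real (r z)) p q" "C1w U p s m" "C1w U q m s'"
    unfolding C2w_def by blast
  have cg': "continuous_on (r ` U) g'"
    by (intro continuous_at_imp_continuous_on ballI) (use assms(3) DERIV_isCont in fastforce)
  have 2: "C1w U (\<lambda>z. of_real (g' (r z))) (\<lambda>z. of_real (g'' (r z)) * p z) (\<lambda>z. of_real (g'' (r z)) * q z)"
    by (rule C1w_real_chain[OF 1(1) assms(3,4)])
  have "C1w U (\<lambda>z. of_real (g' (r z)) * p z) (\<lambda>z. of_real (g'' (r z)) * p z * p z + of_real (g' (r z)) * s z)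
     (\<lambda>z. of_real (g'' (r z)) * p z * q z + of_real (g' (r z)) * m z)"
    using C1w_mult[OF 2 1(2)] by (simp add: mult.assoc mult.commute[of "q _"])
  moreover have "C1w U (\<lambda>z. of_real (g' (r z)) * q z) 
     (\<lambda>z. of_real (g'' (r z)) * p z * q z + of_real (g' (r z)) * m z)
     (\<lambda>z. of_real (g'' (r z)) * q z * q z + of_real (g' (r z)) * s' z)"
    using C1w_mult[OF 2 1(3)] by (simp add: mult.assoc)
  ultimately show ?thesis
    unfolding C2w_def using C1w_real_chain[OF 1(1) assms(2) cg'] by blast
qed

text \<open>The seed of the chain rule: the cutoffs, the bump and the twist \<open>rho\<close> below
  are all real functions of a squared distance.\<close>

lemma C2w_norm_sq: "C2w U (\<lambda>z. of_real ((norm (z - a))\<^sup>2)) (\<lambda>z. cnj (z - a)) (\<lambda>z. z - a) (\<lambda>z. 1)"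
proof -
  have eq: "complex_of_real ((norm (z - a))\<^sup>2) = (z - a) * cnj (z - a)" for z
    by (simp only: complex_norm_square)
  have 1: "C1w U (\<lambda>z. z - a) (\<lambda>z. 1) (\<lambda>z. 0)"
    by (intro C1wI continuous_intros) (rule has_wirt_eq, (rule wirt_intros)+, auto)
  from C1w_cnj[OF this] have 2: "C1w U (\<lambda>z. cnj (z - a)) (\<lambda>z. 0) (\<lambda>z. 1)"
    by simp
  show ?thesis
    unfolding C2w_def eq using C1w_mult[OF 1 2] 1 2 by auto
qed

section \<open>Integration by parts\<close>

lemma lborel_integral_shift:
  fixes f :: "complex \<Rightarrow> 'b::{banach, second_countable_topology}"
  assumes "f \<in> borel_measurable borel"
  shows "(\<integral>z. f (z + h) \<partial>lborel) = (\<integral>z. f z \<partial>lborel)"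
proof -
  have "(\<integral>z. f z \<partial>lborel) = (\<integral>z. f z \<partial>distr lborel borel ((+) h))"
    by (simp add: lborel_distr_plus)
  also have "\<dots> = (\<integral>z. f (h + z) \<partial>lborel)"
    using assms by (intro integral_distr) auto
  finally show ?thesis by (simp add: add.commute)
qed

lemma lborel_integrable_shift:
  fixes f :: "complex \<Rightarrow> 'b::{banach, second_countable_topology}"
  assumes "integrable lborel f"
  shows "integrable lborel (\<lambda>z. f (z + h))"
proof -
  have "integrable (distr lborel borel ((+) h)) f"
    using assms by (simp add: lborel_distr_plus)
  then show ?thesis
    using assms by (subst (asm) integrable_distr_eq) (auto simp: add.commute)
qed

lemma integrable_compact_support:
  fixes f :: "complex \<Rightarrow> 'b::{banach, second_countable_topology}"
  assumes "compact K" "continuous_on K f" "\<And>z. z \<notin> K \<Longrightarrow> f z = 0"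
  shows "integrable lborel f"
proof -
  have "integrable lborel (\<lambda>z. indicator K z *\<^sub>R f z)"
    by (rule borel_integrable_compact[OF assms(1,2)])
  also have "(\<lambda>z. indicator K z *\<^sub>R f z) = f"
    using assms(3) by (auto simp: indicator_def)
  finally show ?thesis .
qed

text \<open>The integral of a difference quotient vanishes by translation invariance.\<close>

lemma integral_wirt_eq_0_UNIV:
  assumes C1: "C1w UNIV V p q" and K: "compact K"
    and 0: "\<And>z. z \<notin> K \<Longrightarrow> V z = 0" "\<And>z. z \<notin> K \<Longrightarrow> p z = 0" "\<And>z. z \<notin> K \<Longrightarrow> q z = 0"
  shows "(\<integral>z. p z \<partial>lborel) = 0" "(\<integral>z. q z \<partial>lborel) = 0"
proof -
  note cont = C1w_continuous[OF C1]
  have "bounded (p ` K)" "bounded (q ` K)"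
    using K cont by (auto intro!: compact_imp_bounded compact_continuous_image intro: continuous_on_subset)
  then obtain B1 B2 where "\<And>z. z \<in> K \<Longrightarrow> norm (p z) \<le> B1" "\<And>z. z \<in> K \<Longrightarrow> norm (q z) \<le> B2"
    unfolding bounded_iff by auto
  note B12 = this
  define B where "B = max 0 (max B1 B2)"
  have B: "norm (p z) \<le> B" "norm (q z) \<le> B" "B \<ge> 0" for z
    using B12[of z] 0(2,3)[of z] unfolding B_def by (cases "z \<in> K"; force)+
  have lip: "norm (V x - V y) \<le> 2 * B * norm (x - y)" for x y
  proof (rule differentiable_bound[where S = UNIV and f' = "\<lambda>z h. p z * h + q z * cnj h"])
    fix z :: complex
    show "(V has_derivative (\<lambda>h. p z * h + q z * cnj h)) (at z within UNIV)"
      using C1w_D[OF C1, of z] by (simp add: has_wirt_def)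
    have "norm (p z * h + q z * cnj h) \<le> 2 * B * norm h" for h
    proof -
      have "norm (p z * h + q z * cnj h) \<le> norm (p z) * norm h + norm (q z) * norm h"
        by (metis norm_triangle_ineq norm_mult complex_mod_cnj)
      also have "\<dots> \<le> B * norm h + B * norm h"
        by (intro add_mono mult_right_mono B) auto
      finally show ?thesis by simp
    qed
    then show "onorm (\<lambda>h. p z * h + q z * cnj h) \<le> 2 * B"
      using B(3) by (intro onorm_bound) auto
  qed auto
  have iV: "integrable lborel V" and ip: "integrable lborel p" and iq: "integrable lborel q"
    using 0 cont K by (auto intro!: integrable_compact_support intro: continuous_on_subset)
  obtain R where R: "K \<subseteq> cball 0 R"
    using bounded_subset_ballD[OF compact_imp_bounded[OF K], of 0] ball_subset_cball by blast
  have *: "(\<integral>z. p z * e + q z * cnj e \<partial>lborel) = 0" for e :: complex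
  proof -
    define h where "h n = e * of_real (inverse (real (Suc n)))" for n
    have hl: "h \<longlonglongrightarrow> 0"
      unfolding h_def using tendsto_mult[OF tendsto_const tendsto_of_real[OF LIMSEQ_inverse_real_of_nat], of e]
      by simp
    have hn: "norm (h n) * (real n + 1) = norm e" for n
      unfolding h_def norm_mult norm_of_real by (simp add: field_simps)
    define F where "F n z = (V (z + h n) - V z) * of_real (real n + 1)" for n z
    have "(\<lambda>n. \<integral>z. F n z \<partial>lborel) \<longlonglongrightarrow> (\<integral>z. p z * e + q z * cnj e \<partial>lborel)"
    \<comment> \<open>\<open>lip\<close> bounds the quotient by \<open>2 * B * norm e\<close>. Since
      \<open>norm (h n) <= norm e\<close>, both values of \<open>V\<close> vanish once
      \<open>z\<close> is outside the ball of radius \<open>R + norm e\<close>.\<close>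
    proof (rule integral_dominated_convergence[where w = "\<lambda>z. indicator (cball 0 (R + norm e)) z * (2 * B * norm e)"])
      show "(\<lambda>z. p z * e + q z * cnj e) \<in> borel_measurable lborel"
        using ip iq by auto
      show "F n \<in> borel_measurable lborel" for n
        using borel_measurable_integrable[OF iV] unfolding F_def by measurable
      show "integrable lborel (\<lambda>z::complex. indicator (cball 0 (R + norm e)) z * (2 * B * norm e))"
        by (intro integrable_mult_left integrable_real_indicator) (use emeasure_lborel_cball_finite[of "0::complex" "R + norm e"] in \<open>auto simp: infinity_ennreal_def\<close>)
      show "AE z in lborel. (\<lambda>n. F n z) \<longlonglongrightarrow> p z * e + q z * cnj e"
      proof (rule AE_I2)
        fix z
        show "(\<lambda>n. F n z) \<longlonglongrightarrow> p z * e + q z * cnj e"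
        proof (cases "e = 0")
          case True
          then show ?thesis by (simp add: F_def h_def)
        next
          case False
          have "(\<lambda>h. norm (V (z + h) - V z - (p z * h + q z * cnj h)) / norm h) \<midarrow>0\<rightarrow> 0"
            using C1w_D[OF C1, of z] by (simp add: has_wirt_def has_derivative_at)
          moreover have h0: "h n \<noteq> 0" for n
            using hn[of n] False by auto
          then have "filterlim h (at 0) sequentially"
            using hl by (simp add: filterlim_at)
          ultimately have "(\<lambda>n. norm (V (z + h n) - V z - (p z * h n + q z * cnj (h n))) / norm (h n)) \<longlonglongrightarrow> 0"
            by (rule filterlim_compose)
          then have "(\<lambda>n. norm (V (z + h n) - V z - (p z * h n + q z * cnj (h n))) / norm (h n) * norm e) \<longlonglongrightarrow> 0"
            by (rule tendsto_mult_left_zero)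
          also have "(\<lambda>n. norm (V (z + h n) - V z - (p z * h n + q z * cnj (h n))) / norm (h n) * norm e) =
              (\<lambda>n. norm (F n z - (p z * e + q z * cnj e)))"
          proof
            fix n
            have "F n z - (p z * e + q z * cnj e) =
                (V (z + h n) - V z - (p z * h n + q z * cnj (h n))) * of_real (real n + 1)"
            proof -
              have "complex_of_real (inverse (real (Suc n))) * of_real (real n + 1) = 1"
                unfolding of_real_mult[symmetric] by (simp add: field_simps)
              then have e: "e = h n * of_real (real n + 1)"
                unfolding h_def mult.assoc by simp
              then have "cnj e = cnj (h n) * of_real (real n + 1)"
                by (metis complex_cnj_complex_of_real complex_cnj_mult)
              with e show ?thesis
                unfolding F_def by (simp only: left_diff_distrib distrib_right mult.assoc)
            qed
            then have "norm (F n z - (p z * e + q z * cnj e)) =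
                norm (V (z + h n) - V z - (p z * h n + q z * cnj (h n))) * (real n + 1)"
              by (simp only: norm_mult norm_of_real)
            moreover have "norm (h n) \<noteq> 0"
              using h0 by simp
            ultimately show "norm (V (z + h n) - V z - (p z * h n + q z * cnj (h n))) / norm (h n) * norm e =
                norm (F n z - (p z * e + q z * cnj e))"
              by (simp flip: hn[of n])
          qed
          finally show ?thesis
            by (rule LIM_zero_cancel[OF tendsto_norm_zero_cancel])
        qed
      qed
      show "AE z in lborel. norm (F n z) \<le> indicator (cball 0 (R + norm e)) z * (2 * B * norm e)" for n
      proof (rule AE_I2)
        fix z
        have hn': "norm (h n) \<le> norm e"
          unfolding h_def norm_mult norm_of_real by (simp add: mult_left_le field_simps)
        have n: "norm (F n z) \<le> 2 * B * norm e"
        proof -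
          have "norm (F n z) = norm (V (z + h n) - V z) * (real n + 1)"
            unfolding F_def norm_mult norm_of_real by simp
          also have "\<dots> \<le> (2 * B * norm (h n)) * (real n + 1)"
            using lip[of "z + h n" z] by (intro mult_right_mono) auto
          finally show ?thesis using hn[of n] by (simp add: mult.assoc)
        qed
        show "norm (F n z) \<le> indicator (cball 0 (R + norm e)) z * (2 * B * norm e)"
        proof (cases "z \<in> cball 0 (R + norm e)")
          case True
          then show ?thesis using n by simp
        next
          case False
          then have "norm z > R + norm e" by simp
          moreover have "norm (z + h n) \<ge> norm z - norm (h n)"
            by (metis norm_diff_ineq)
          ultimately have "norm z > R" "norm (z + h n) > R"
            using hn' norm_ge_zero[of e] by linarith+
          then have "z \<notin> K" "z + h n \<notin> K"
            using R by auto
          then show ?thesis using False 0(1) by (simp add: F_def)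
        qed
      qed
    qed
    moreover have "(\<integral>z. F n z \<partial>lborel) = 0" for n
    proof -
      have "(\<integral>z. V (z + h n) - V z \<partial>lborel) = 0"
        using iV lborel_integrable_shift[OF iV, of "h n"] lborel_integral_shift[of V "h n"]
        by (subst Bochner_Integration.integral_diff) auto
      then show ?thesis
        unfolding F_def by (subst integral_mult_left_zero) (simp del: integral_diff)
    qed
    ultimately show ?thesis
      by (simp add: LIMSEQ_const_iff)
  qed
  \<comment> \<open>The directions 1 and \<i> yield the sum and the difference of the two
    integrals.\<close>
  have "(\<integral>z. p z \<partial>lborel) + (\<integral>z. q z \<partial>lborel) = 0"
    using *[of 1] ip iq by (simp add: Bochner_Integration.integral_add)
  moreover have "\<i> * ((\<integral>z. p z \<partial>lborel) - (\<integral>z. q z \<partial>lborel)) = 0"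
  proof -
    have "(\<integral>z. p z * \<i> + q z * - \<i> \<partial>lborel) = 0"
      using *[of \<i>] by simp
    also have "(\<integral>z. p z * \<i> + q z * - \<i> \<partial>lborel) =
        (\<integral>z. p z * \<i> \<partial>lborel) + (\<integral>z. q z * - \<i> \<partial>lborel)"
      using ip iq by (intro Bochner_Integration.integral_add integrable_mult_left)
    also have "\<dots> = (\<integral>z. p z \<partial>lborel) * \<i> + (\<integral>z. q z \<partial>lborel) * - \<i>"
      by (subst (1 2) integral_mult_left_zero) simp
    finally show ?thesis by (simp add: algebra_simps)
  qed
  ultimately show "(\<integral>z. p z \<partial>lborel) = 0" "(\<integral>z. q z \<partial>lborel) = 0"
    by (simp_all add: complex_eq_iff)
qed

text \<open>Off \<open>K\<close> the function is locally zero, so uniqueness makes its derivatives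
  vanish there. The extension by zero is glued along the open cover of the plane by \<open>U\<close>
  and the complement of \<open>K\<close>.\<close>

lemma C1w_compact_support:
  assumes C1: "C1w U V p q" and K: "compact K" "K \<subseteq> U" and U: "open U"
    and 0: "\<And>z. z \<in> U \<Longrightarrow> z \<notin> K \<Longrightarrow> V z = 0"
  shows "z \<in> U \<Longrightarrow> z \<notin> K \<Longrightarrow> p z = 0" "z \<in> U \<Longrightarrow> z \<notin> K \<Longrightarrow> q z = 0"
    and "C1w UNIV (\<lambda>z. if z \<in> K then V z else 0) (\<lambda>z. if z \<in> K then p z else 0) (\<lambda>z. if z \<in> K then q z else 0)"
proof -
  have o: "open (U - K)" "open (- K)"
    using U K compact_imp_closed by auto
  have *: "p z = 0 \<and> q z = 0" if "z \<in> U" "z \<notin> K" for z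
  proof -
    have "has_wirt (\<lambda>w. 0) (p z) (q z) z"
      by (rule has_wirt_transform[OF C1w_D[OF C1 that(1)] o(1)]) (use that 0 in auto)
    then show ?thesis
      using has_wirt_unique[OF _ has_wirt_const] by blast
  qed
  then show "z \<in> U \<Longrightarrow> z \<notin> K \<Longrightarrow> p z = 0" "z \<in> U \<Longrightarrow> z \<notin> K \<Longrightarrow> q z = 0"
    by auto
  have "C1w (U \<union> - K) (\<lambda>z. if z \<in> K then V z else 0) (\<lambda>z. if z \<in> K then p z else 0) (\<lambda>z. if z \<in> K then q z else 0)"
  proof (rule C1w_Un)
    show "C1w U (\<lambda>z. if z \<in> K then V z else 0) (\<lambda>z. if z \<in> K then p z else 0) (\<lambda>z. if z \<in> K then q z else 0)"
      by (rule C1w_transform[OF C1 U]) (use 0 * in auto)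
    show "C1w (- K) (\<lambda>z. if z \<in> K then V z else 0) (\<lambda>z. if z \<in> K then p z else 0) (\<lambda>z. if z \<in> K then q z else 0)"
      by (rule C1w_transform[OF C1w_const[of _ 0] o(2)]) auto
  qed (use U o in auto)
  also have "U \<union> - K = UNIV"
    using K by auto
  finally show "C1w UNIV (\<lambda>z. if z \<in> K then V z else 0) (\<lambda>z. if z \<in> K then p z else 0) (\<lambda>z. if z \<in> K then q z else 0)" .
qed

lemma integrable_restrict_compact_support:
  fixes f :: "complex \<Rightarrow> 'b::{banach, second_countable_topology}"
  assumes K: "compact K" "K \<subseteq> U" and U: "open U" and cont: "continuous_on U f"
    and 0: "\<And>z. z \<in> U \<Longrightarrow> z \<notin> K \<Longrightarrow> f z = 0"
  shows "integrable (restrict_space lborel U) f"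
    and "integral\<^sup>L (restrict_space lborel U) f = (\<integral>z. (if z \<in> K then f z else 0) \<partial>lborel)"
proof -
  have "continuous_on K f"
    using cont K continuous_on_subset by blast
  then have i: "integrable lborel (\<lambda>z. if z \<in> K then f z else 0)"
    using continuous_on_cong by (intro integrable_compact_support[OF K(1)]) force+
  have eq: "(\<lambda>z. indicator U z *\<^sub>R f z) = (\<lambda>z. if z \<in> K then f z else 0)"
    using K 0 by (auto simp: indicator_def fun_eq_iff)
  show "integrable (restrict_space lborel U) f"
    using U i by (subst integrable_restrict_space) (auto simp: eq)
  show "integral\<^sup>L (restrict_space lborel U) f = (\<integral>z. (if z \<in> K then f z else 0) \<partial>lborel)"
    using U by (subst integral_restrict_space) (auto simp: eq)
qed

text \<open>The source of all integrations by parts below. It is stated on an open set because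
  weights and potentials have derivatives on the disk only.\<close>

lemma integral_wirt_eq_0:
  assumes C1: "C1w U V p q" and K: "compact K" "K \<subseteq> U" and U: "open U"
    and 0: "\<And>z. z \<in> U \<Longrightarrow> z \<notin> K \<Longrightarrow> V z = 0"
  shows "integral\<^sup>L (restrict_space lborel U) p = 0" "integral\<^sup>L (restrict_space lborel U) q = 0"
proof -
  note c = C1w_compact_support[OF assms]
  note [simp] = integrable_restrict_compact_support(2)[OF K U C1w_continuous(2)[OF C1] c(1)]
    integrable_restrict_compact_support(2)[OF K U C1w_continuous(3)[OF C1] c(2)]
  show "integral\<^sup>L (restrict_space lborel U) p = 0" "integral\<^sup>L (restrict_space lborel U) q = 0"
    using integral_wirt_eq_0_UNIV[OF c(3) K(1)] by auto
qed

section \<open>Square integrable functions and the Riesz representation\<close>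

lemma borel_measurable_cnj [measurable]:
  "f \<in> borel_measurable M \<Longrightarrow> (\<lambda>x. cnj (f x)) \<in> borel_measurable M"
  by (rule borel_measurable_continuous_on) (intro continuous_intros)

text \<open>Square integrable functions stay honest functions instead of almost-everywhere classes,
  so that holomorphic representatives can be evaluated at points.\<close>

definition sqi :: "'a measure \<Rightarrow> ('a \<Rightarrow> complex) \<Rightarrow> bool"
  where "sqi M f \<longleftrightarrow> f \<in> borel_measurable M \<and> integrable M (\<lambda>x. (norm (f x))\<^sup>2)"

definition ip :: "'a measure \<Rightarrow> ('a \<Rightarrow> complex) \<Rightarrow> ('a \<Rightarrow> complex) \<Rightarrow> complex"
  where "ip M f g = (\<integral>x. f x * cnj (g x) \<partial>M)"

definition nrm :: "'a measure \<Rightarrow> ('a \<Rightarrow> complex) \<Rightarrow> real"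
  where "nrm M f = sqrt (\<integral>x. (norm (f x))\<^sup>2 \<partial>M)"

lemma sqi_dominated:
  assumes "sqi M g" "f \<in> borel_measurable M" "\<And>x. x \<in> space M \<Longrightarrow> norm (f x) \<le> norm (g x)"
  shows "sqi M f"
proof -
  have "integrable M (\<lambda>x. (norm (f x))\<^sup>2)"
  proof (rule Bochner_Integration.integrable_bound)
    show "integrable M (\<lambda>x. (norm (g x))\<^sup>2)" using assms(1) by (simp add: sqi_def)
    show "AE x in M. norm ((norm (f x))\<^sup>2) \<le> norm ((norm (g x))\<^sup>2)"
      using assms(3) by (auto intro!: AE_I2 power_mono)
  qed (use assms(2) in measurable)
  then show ?thesis using assms(2) by (simp add: sqi_def)
qed

lemma sqi_scale: "sqi M f \<Longrightarrow> sqi M (\<lambda>x. c * f x)"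
  by (auto simp: sqi_def norm_mult power_mult_distrib)

lemma sqi_add:
  assumes "sqi M f" "sqi M g"
  shows "sqi M (\<lambda>x. f x + g x)"
proof -
  have "integrable M (\<lambda>x. 2 * (norm (f x))\<^sup>2 + 2 * (norm (g x))\<^sup>2)"
    using assms by (auto simp: sqi_def)
  moreover have "(\<lambda>x. (norm (f x + g x))\<^sup>2) \<in> borel_measurable M"
    using assms by (auto simp: sqi_def)
  moreover have "norm ((norm (f x + g x))\<^sup>2) \<le> norm (2 * (norm (f x))\<^sup>2 + 2 * (norm (g x))\<^sup>2)" for x
  proof -
    have "(norm (f x + g x))\<^sup>2 \<le> (norm (f x) + norm (g x))\<^sup>2"
      by (intro power_mono norm_triangle_ineq) auto
    also have "\<dots> \<le> 2 * (norm (f x))\<^sup>2 + 2 * (norm (g x))\<^sup>2"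
      using sum_squares_bound[of "norm (f x)" "norm (g x)"] by (simp add: power2_sum)
    finally show ?thesis by simp
  qed
  ultimately have "integrable M (\<lambda>x. (norm (f x + g x))\<^sup>2)"
    by (rule Bochner_Integration.integrable_bound[OF _ _ AE_I2])
  then show ?thesis using assms by (auto simp: sqi_def)
qed

lemma sqi_minus: "sqi M f \<Longrightarrow> sqi M (\<lambda>x. - f x)"
  by (auto simp: sqi_def)

lemma sqi_diff: "sqi M f \<Longrightarrow> sqi M g \<Longrightarrow> sqi M (\<lambda>x. f x - g x)"
  using sqi_add[OF _ sqi_minus] by fastforce

lemma nrm_nonneg: "0 \<le> nrm M f"
  by (simp add: nrm_def)

lemma nrm_sq: "(nrm M f)\<^sup>2 = (\<integral>x. (norm (f x))\<^sup>2 \<partial>M)"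
  by (simp add: nrm_def)

lemma nrm_scale: "nrm M (\<lambda>x. c * f x) = norm c * nrm M f"
  by (simp add: nrm_def norm_mult power_mult_distrib real_sqrt_mult)

lemma nrm_mono:
  assumes "sqi M f" "sqi M g" "\<And>x. x \<in> space M \<Longrightarrow> norm (f x) \<le> norm (g x)"
  shows "nrm M f \<le> nrm M g"
  unfolding nrm_def using assms by (intro real_sqrt_le_mono integral_mono) (auto simp: sqi_def power_mono)

lemma integrable_norm_mult:
  assumes "sqi M f" "sqi M g"
  shows "integrable M (\<lambda>x. norm (f x) * norm (g x))"
proof (rule Bochner_Integration.integrable_bound)
  show "integrable M (\<lambda>x. (norm (f x))\<^sup>2 + (norm (g x))\<^sup>2)"
    using assms by (auto simp: sqi_def)
  show "(\<lambda>x. norm (f x) * norm (g x)) \<in> borel_measurable M"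
    using assms by (auto simp: sqi_def)
  show "AE x in M. norm (norm (f x) * norm (g x)) \<le> norm ((norm (f x))\<^sup>2 + (norm (g x))\<^sup>2)"
  proof (rule AE_I2)
    fix x
    show "norm (norm (f x) * norm (g x)) \<le> norm ((norm (f x))\<^sup>2 + (norm (g x))\<^sup>2)"
      using sum_squares_bound[of "norm (f x)" "norm (g x)"]
      by (auto simp: mult.assoc) (smt (verit) mult_nonneg_nonneg norm_ge_zero)
  qed
qed

lemma integrable_ip:
  assumes "sqi M f" "sqi M g"
  shows "integrable M (\<lambda>x. f x * cnj (g x))"
  by (rule Bochner_Integration.integrable_bound[OF integrable_norm_mult[OF assms]])
     (use assms in \<open>auto simp: sqi_def norm_mult\<close>)

text \<open>Integrate \<open>2 x y <= t x^2 + y^2 / t\<close> and optimise the parameter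
  \<open>t\<close>.\<close>

lemma cauchy_schwarz_norm:
  assumes "sqi M f" "sqi M g"
  shows "(\<integral>x. norm (f x) * norm (g x) \<partial>M) \<le> nrm M f * nrm M g"
proof -
  let ?I = "\<integral>x. norm (f x) * norm (g x) \<partial>M"
  have *: "2 * ?I \<le> t * (nrm M f)\<^sup>2 + (nrm M g)\<^sup>2 / t" if "t > 0" for t
  proof -
    have "(\<integral>x. 2 * (norm (f x) * norm (g x)) \<partial>M) \<le> (\<integral>x. t * (norm (f x))\<^sup>2 + (norm (g x))\<^sup>2 / t \<partial>M)"
    proof (rule integral_mono)
      show "integrable M (\<lambda>x. 2 * (norm (f x) * norm (g x)))"
        using integrable_norm_mult[OF assms] by simp
      show "integrable M (\<lambda>x. t * (norm (f x))\<^sup>2 + (norm (g x))\<^sup>2 / t)"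
        using assms by (auto simp: sqi_def)
      fix x
      have "0 \<le> (sqrt t * norm (f x) - norm (g x) / sqrt t)\<^sup>2" by simp
      also have "\<dots> = t * (norm (f x))\<^sup>2 - 2 * (norm (f x) * norm (g x)) + (norm (g x))\<^sup>2 / t"
        using that by (simp add: power2_diff power_mult_distrib power_divide)
      finally show "2 * (norm (f x) * norm (g x)) \<le> t * (norm (f x))\<^sup>2 + (norm (g x))\<^sup>2 / t" by simp
    qed
    also have "\<dots> = t * (nrm M f)\<^sup>2 + (nrm M g)\<^sup>2 / t"
      using assms by (simp add: nrm_sq sqi_def)
    finally show ?thesis by simp
  qed
  let ?a = "nrm M f" and ?b = "nrm M g"
  have nn: "0 \<le> ?a" "0 \<le> ?b" by (auto simp: nrm_nonneg)
  \<comment> \<open>The optimal \<open>t\<close> is the quotient of the norms; adding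
    \<open>e\<close> to both keeps it defined and positive when a norm vanishes.\<close>
  have "?I \<le> (?a + e) * (?b + e)" if "e > 0" for e
  proof -
    have "2 * ?I \<le> (?b + e) / (?a + e) * ?a\<^sup>2 + ?b\<^sup>2 / ((?b + e) / (?a + e))"
      using nn that by (intro *) auto
    also have "\<dots> \<le> (?b + e) / (?a + e) * (?a + e)\<^sup>2 + (?b + e)\<^sup>2 / ((?b + e) / (?a + e))"
      using nn that by (intro add_mono mult_left_mono divide_right_mono power_mono) auto
    also have "\<dots> = 2 * ((?a + e) * (?b + e))"
      using nn that by (simp add: power2_eq_square)
    finally show ?thesis by simp
  qed
  then have "\<forall>\<^sub>F e in at_right 0. ?I \<le> (?a + e) * (?b + e)"
    by (auto simp: eventually_at_right_field)
       (metis linordered_field_no_ub)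
  moreover have "((\<lambda>e. (?a + e) * (?b + e)) \<longlongrightarrow> (?a + 0) * (?b + 0)) (at_right 0)"
    by (intro tendsto_intros)
  ultimately show ?thesis
    using tendsto_lowerbound[of "\<lambda>e. (?a + e) * (?b + e)" _ "at_right 0" ?I] by simp
qed

lemma ip_bound:
  assumes "sqi M f" "sqi M g"
  shows "norm (ip M f g) \<le> nrm M f * nrm M g"
proof -
  have "norm (ip M f g) \<le> (\<integral>x. norm (f x * cnj (g x)) \<partial>M)"
    unfolding ip_def by (rule integral_norm_bound)
  also have "\<dots> \<le> nrm M f * nrm M g"
    using cauchy_schwarz_norm[OF assms] by (simp add: norm_mult)
  finally show ?thesis .
qed

lemma nrm_triangle:
  assumes "sqi M f" "sqi M g"
  shows "nrm M (\<lambda>x. f x + g x) \<le> nrm M f + nrm M g"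
proof (rule power2_le_imp_le)
  have i: "integrable M (\<lambda>x. (norm (f x))\<^sup>2)" "integrable M (\<lambda>x. (norm (g x))\<^sup>2)"
    "integrable M (\<lambda>x. norm (f x) * norm (g x))"
    using assms integrable_norm_mult[OF assms] by (auto simp: sqi_def)
  have "(nrm M (\<lambda>x. f x + g x))\<^sup>2 \<le> (\<integral>x. (norm (f x))\<^sup>2 + (norm (g x))\<^sup>2 + 2 * (norm (f x) * norm (g x)) \<partial>M)"
    unfolding nrm_sq
  proof (rule integral_mono)
    show "integrable M (\<lambda>x. (norm (f x + g x))\<^sup>2)"
      using sqi_add[OF assms] by (simp add: sqi_def)
    show "integrable M (\<lambda>x. (norm (f x))\<^sup>2 + (norm (g x))\<^sup>2 + 2 * (norm (f x) * norm (g x)))"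
      using i by auto
    fix x
    have "(norm (f x + g x))\<^sup>2 \<le> (norm (f x) + norm (g x))\<^sup>2"
      by (intro power_mono norm_triangle_ineq) auto
    then show "(norm (f x + g x))\<^sup>2 \<le> (norm (f x))\<^sup>2 + (norm (g x))\<^sup>2 + 2 * (norm (f x) * norm (g x))"
      by (simp add: power2_sum mult.assoc)
  qed
  also have "\<dots> = (nrm M f)\<^sup>2 + (nrm M g)\<^sup>2 + 2 * (\<integral>x. norm (f x) * norm (g x) \<partial>M)"
    using i by (simp add: nrm_sq)
  also have "\<dots> \<le> (nrm M f + nrm M g)\<^sup>2"
    using cauchy_schwarz_norm[OF assms] by (simp add: power2_sum mult.assoc)
  finally show "(nrm M (\<lambda>x. f x + g x))\<^sup>2 \<le> (nrm M f + nrm M g)\<^sup>2" .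
qed (simp add: nrm_nonneg)

lemma nrm_triangle_diff:
  assumes "sqi M f" "sqi M g" "sqi M h"
  shows "nrm M (\<lambda>x. f x - h x) \<le> nrm M (\<lambda>x. f x - g x) + nrm M (\<lambda>x. g x - h x)"
  using nrm_triangle[OF sqi_diff[OF assms(1,2)] sqi_diff[OF assms(2,3)]] by simp

lemma ip_add_left: "sqi M f \<Longrightarrow> sqi M g \<Longrightarrow> sqi M h \<Longrightarrow> ip M (\<lambda>x. f x + g x) h = ip M f h + ip M g h"
  using integrable_ip[of M f h] integrable_ip[of M g h] by (simp add: ip_def distrib_right)

lemma ip_diff_left: "sqi M f \<Longrightarrow> sqi M g \<Longrightarrow> sqi M h \<Longrightarrow> ip M (\<lambda>x. f x - g x) h = ip M f h - ip M g h"
  using integrable_ip[of M f h] integrable_ip[of M g h] by (simp add: ip_def left_diff_distrib)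

lemma ip_diff_right: "sqi M f \<Longrightarrow> sqi M g \<Longrightarrow> sqi M h \<Longrightarrow> ip M h (\<lambda>x. f x - g x) = ip M h f - ip M h g"
  using integrable_ip[of M h f] integrable_ip[of M h g] by (simp add: ip_def right_diff_distrib)

lemma ip_scale_left: "ip M (\<lambda>x. c * f x) h = c * ip M f h"
  by (simp add: ip_def mult.assoc)

lemma ip_commute: "ip M f g = cnj (ip M g f)"
proof -
  have "cnj (ip M g f) = (\<integral>x. cnj (g x * cnj (f x)) \<partial>M)"
    unfolding ip_def by (rule Bochner_Integration.integral_cnj[symmetric])
  then show ?thesis
    by (simp add: ip_def mult.commute)
qed

lemma ip_self: "ip M f f = of_real ((nrm M f)\<^sup>2)"
proof -
  have "f x * cnj (f x) = of_real ((norm (f x))\<^sup>2)" for x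
    by (simp only: complex_norm_square)
  then show ?thesis
    by (simp only: ip_def nrm_sq integral_complex_of_real)
qed

lemma tendsto_ip_right:
  assumes "sqi M f" "\<And>n. sqi M (s n)" "sqi M G" "(\<lambda>n. nrm M (\<lambda>x. s n x - G x)) \<longlonglongrightarrow> 0"
  shows "(\<lambda>n. ip M f (s n)) \<longlonglongrightarrow> ip M f G"
proof -
  have "norm (ip M f (s n) - ip M f G) \<le> nrm M f * nrm M (\<lambda>x. s n x - G x)" for n
    using ip_bound[OF assms(1) sqi_diff[OF assms(2)[of n] assms(3)]] ip_diff_right[OF assms(2)[of n] assms(3,1)]
    by simp
  moreover have "(\<lambda>n. nrm M f * nrm M (\<lambda>x. s n x - G x)) \<longlonglongrightarrow> 0"
    using assms(4) by (rule tendsto_mult_right_zero)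
  ultimately have "(\<lambda>n. ip M f (s n) - ip M f G) \<longlonglongrightarrow> 0"
    by (rule Lim_null_comparison[OF always_eventually[OF allI]])
  then show ?thesis by (rule LIM_zero_cancel)
qed

lemma integral_norm_le_nrm:
  assumes "finite_measure M" "sqi M f"
  shows "integrable M f" "(\<integral>x. norm (f x) \<partial>M) \<le> nrm M f * sqrt (measure M (space M))"
proof -
  interpret finite_measure M by fact
  have 1: "sqi M (\<lambda>x. 1)" by (simp add: sqi_def)
  show "integrable M f"
    using integrable_ip[OF assms(2) 1] by simp
  show "(\<integral>x. norm (f x) \<partial>M) \<le> nrm M f * sqrt (measure M (space M))"
    using cauchy_schwarz_norm[OF assms(2) 1] by (simp add: nrm_def)
qed

text \<open>Finiteness of the measure turns the \<open>L\<^sup>2\<close> rate into an \<open>L\<^sup>1\<close> rate, hence into almost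
  everywhere convergence.\<close>

lemma L2_complete:
  assumes fin: "finite_measure M" and s: "\<And>n. sqi M (s n)"
    and rate: "\<And>n. nrm M (\<lambda>x. s (Suc n) x - s n x) \<le> D * (1/2)^n"
  obtains G where "sqi M G" "(\<lambda>n. nrm M (\<lambda>x. s n x - G x)) \<longlonglongrightarrow> 0"
proof -
  interpret finite_measure M by fact
  have [measurable]: "s n \<in> borel_measurable M" for n
    using s by (simp add: sqi_def)
  define d where "d n x = norm (s (Suc n) x - s n x)" for n x
  have [measurable]: "d n \<in> borel_measurable M" for n
    unfolding d_def by measurable
  have D: "0 \<le> D"
    using order_trans[OF nrm_nonneg rate[of 0]] by simp
  let ?c = "sqrt (measure M (space M))"
  have id: "integrable M (d n)" "(\<integral>x. d n x \<partial>M) \<le> D * ?c * (1/2)^n" for n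
  proof -
    note l = integral_norm_le_nrm[OF fin sqi_diff[OF s s], of "Suc n" n]
    show "integrable M (d n)"
      unfolding d_def by (rule integrable_norm[OF l(1)])
    have "(\<integral>x. d n x \<partial>M) \<le> nrm M (\<lambda>x. s (Suc n) x - s n x) * ?c"
      unfolding d_def by (rule l(2))
    also have "\<dots> \<le> (D * (1/2)^n) * ?c"
      by (intro mult_right_mono rate) simp
    finally show "(\<integral>x. d n x \<partial>M) \<le> D * ?c * (1/2)^n" by (simp add: ac_simps)
  qed
  have "(\<integral>\<^sup>+x. (\<Sum>n. ennreal (d n x)) \<partial>M) = (\<Sum>n. \<integral>\<^sup>+x. ennreal (d n x) \<partial>M)"
    by (rule nn_integral_suminf) simp
  also have "\<dots> \<le> (\<Sum>n. ennreal (D * ?c * (1/2)^n))"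
  proof (intro suminf_le allI)
    fix n
    have "(\<integral>\<^sup>+x. ennreal (d n x) \<partial>M) = ennreal (\<integral>x. d n x \<partial>M)"
      by (intro nn_integral_eq_integral id AE_I2) (simp add: d_def)
    then show "(\<integral>\<^sup>+x. ennreal (d n x) \<partial>M) \<le> ennreal (D * ?c * (1/2)^n)"
      using id(2)[of n] by (simp add: ennreal_leI)
  qed auto
  also have "\<dots> = ennreal (\<Sum>n. D * ?c * (1/2)^n)"
    using D by (intro suminf_ennreal2 summable_mult summable_geometric) auto
  finally have "(\<integral>\<^sup>+x. (\<Sum>n. ennreal (d n x)) \<partial>M) \<noteq> \<infinity>"
    by (auto simp: top_unique)
  then have "AE x in M. (\<Sum>n. ennreal (d n x)) \<noteq> \<infinity>"
    by (intro nn_integral_noteq_infinite) auto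
  then have conv: "AE x in M. convergent (\<lambda>n. s n x)"
  proof eventually_elim
    case (elim x)
    then have "summable (\<lambda>n. d n x)"
      by (intro summable_suminf_not_top) (auto simp: d_def)
    then have "summable (\<lambda>n. s (Suc n) x - s n x)"
      unfolding d_def by (rule summable_norm_cancel)
    then have "convergent (\<lambda>n. \<Sum>k<n. s (Suc k) x - s k x)"
      by (simp add: summable_iff_convergent)
    then have "convergent (\<lambda>n. s n x - s 0 x)"
      using sum_lessThan_telescope[of "\<lambda>k. s k x"] by simp
    then have "convergent (\<lambda>n. (s n x - s 0 x) + s 0 x)"
      by (intro convergent_add convergent_const)
    then show ?case by simp
  qed
  \<comment> \<open>Where the sequence diverges, \<open>lim\<close> has an unspecified value; by
    \<open>conv\<close> this concerns a null set only.\<close>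
  define G where "G x = lim (\<lambda>n. s n x)" for x
  have [measurable]: "G \<in> borel_measurable M"
    unfolding G_def by measurable
  have lim: "AE x in M. (\<lambda>n. s n x) \<longlonglongrightarrow> G x"
    using conv by eventually_elim (simp add: G_def convergent_LIMSEQ_iff)
  have far: "nrm M (\<lambda>x. s (n + k) x - s n x) \<le> 2 * D * (1/2)^n" for n k
  proof -
    have "nrm M (\<lambda>x. s (n + k) x - s n x) \<le> 2 * D * (1/2)^n * (1 - (1/2)^k)"
    proof (induction k)
      case 0
      then show ?case by (simp add: nrm_def)
    next
      case (Suc k)
      have "nrm M (\<lambda>x. s (n + Suc k) x - s n x) \<le>
          nrm M (\<lambda>x. s (Suc (n + k)) x - s (n + k) x) + nrm M (\<lambda>x. s (n + k) x - s n x)"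
        using nrm_triangle_diff[OF s[of "Suc (n + k)"] s[of "n + k"] s[of n]] by simp
      also have "\<dots> \<le> D * (1/2)^(n + k) + 2 * D * (1/2)^n * (1 - (1/2)^k)"
        by (intro add_mono rate Suc.IH)
      also have "\<dots> = 2 * D * (1/2)^n * (1 - (1/2)^Suc k)"
        by (simp add: power_add algebra_simps)
      finally show ?case .
    qed
    also have "\<dots> \<le> 2 * D * (1/2)^n * 1"
      using D by (intro mult_left_mono) auto
    finally show ?thesis by simp
  qed
  \<comment> \<open>Fatou's lemma lets \<open>k\<close> tend to infinity in
    \<open>far\<close>.\<close>
  have le: "(\<integral>\<^sup>+x. ennreal ((norm (s n x - G x))\<^sup>2) \<partial>M) \<le> ennreal ((2 * D * (1/2)^n)\<^sup>2)" for n
  proof -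
    have "(\<integral>\<^sup>+x. ennreal ((norm (s n x - G x))\<^sup>2) \<partial>M) =
        (\<integral>\<^sup>+x. liminf (\<lambda>k. ennreal ((norm (s (n + k) x - s n x))\<^sup>2)) \<partial>M)"
    proof (rule nn_integral_cong_AE)
      show "AE x in M. ennreal ((norm (s n x - G x))\<^sup>2) =
          liminf (\<lambda>k. ennreal ((norm (s (n + k) x - s n x))\<^sup>2))"
        using lim
      proof eventually_elim
        case (elim x)
        have "(\<lambda>k. s (n + k) x) \<longlonglongrightarrow> G x"
          using LIMSEQ_ignore_initial_segment[OF elim, of n] by (simp add: add.commute)
        then have "(\<lambda>k. ennreal ((norm (s (n + k) x - s n x))\<^sup>2)) \<longlonglongrightarrow> ennreal ((norm (G x - s n x))\<^sup>2)"
          by (intro tendsto_intros)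
        then show ?case
          by (subst lim_imp_Liminf) (simp_all add: norm_minus_commute[of "s n x"])
      qed
    qed
    also have "\<dots> \<le> liminf (\<lambda>k. \<integral>\<^sup>+x. ennreal ((norm (s (n + k) x - s n x))\<^sup>2) \<partial>M)"
      by (rule nn_integral_liminf) measurable
    also have "\<dots> \<le> liminf (\<lambda>k. ennreal ((2 * D * (1/2)^n)\<^sup>2))"
    proof (intro Liminf_mono always_eventually allI)
      fix k
      have "(\<integral>\<^sup>+x. ennreal ((norm (s (n + k) x - s n x))\<^sup>2) \<partial>M) =
          ennreal ((nrm M (\<lambda>x. s (n + k) x - s n x))\<^sup>2)"
        unfolding nrm_sq using sqi_diff[OF s s, of "n + k" n]
        by (intro nn_integral_eq_integral) (auto simp: sqi_def)
      also have "\<dots> \<le> ennreal ((2 * D * (1/2)^n)\<^sup>2)"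
        by (intro ennreal_leI power_mono far nrm_nonneg)
      finally show "(\<integral>\<^sup>+x. ennreal ((norm (s (n + k) x - s n x))\<^sup>2) \<partial>M) \<le> ennreal ((2 * D * (1/2)^n)\<^sup>2)" .
    qed
    also have "\<dots> = ennreal ((2 * D * (1/2)^n)\<^sup>2)"
      by (simp add: Liminf_const)
    finally show ?thesis .
  qed
  have sd: "sqi M (\<lambda>x. s n x - G x)" for n
  proof -
    have "(\<integral>\<^sup>+x. ennreal ((norm (s n x - G x))\<^sup>2) \<partial>M) < \<infinity>"
      using le[of n] by (auto simp: less_top[symmetric] top_unique)
    then show ?thesis
      unfolding sqi_def by (auto intro!: integrableI_bounded)
  qed
  have nd: "nrm M (\<lambda>x. s n x - G x) \<le> 2 * D * (1/2)^n" for n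
  proof (rule power2_le_imp_le)
    have "ennreal ((nrm M (\<lambda>x. s n x - G x))\<^sup>2) = (\<integral>\<^sup>+x. ennreal ((norm (s n x - G x))\<^sup>2) \<partial>M)"
      unfolding nrm_sq using sd[of n]
      by (intro nn_integral_eq_integral[symmetric]) (auto simp: sqi_def)
    also note le[of n]
    finally show "(nrm M (\<lambda>x. s n x - G x))\<^sup>2 \<le> (2 * D * (1/2)^n)\<^sup>2"
      by (simp add: ennreal_le_iff)
  qed (use D in simp)
  show thesis
  proof
    show "sqi M G"
      using sqi_diff[OF s[of 0] sd[of 0]] by simp
    have "(\<lambda>n. 2 * D * (1/2)^n) \<longlonglongrightarrow> 2 * D * 0"
      by (rule tendsto_mult[OF tendsto_const LIMSEQ_power_zero]) simp
    then have lim0: "(\<lambda>n. 2 * D * (1/2)^n) \<longlonglongrightarrow> 0"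
      by simp
    show "(\<lambda>n. nrm M (\<lambda>x. s n x - G x)) \<longlonglongrightarrow> 0"
      by (rule Lim_null_comparison[OF always_eventually[OF allI] lim0])
         (simp only: real_norm_def abs_of_nonneg[OF nrm_nonneg] nd)
  qed
qed

lemma nrm_expand:
  assumes "sqi M f" "sqi M g"
  shows "(nrm M (\<lambda>x. f x + c * g x))\<^sup>2 = (nrm M f)\<^sup>2 + 2 * Re (c * ip M g f) + (norm c)\<^sup>2 * (nrm M g)\<^sup>2"
proof -
  note sc = sqi_scale[OF assms(2), of c]
  have "complex_of_real ((nrm M (\<lambda>x. f x + c * g x))\<^sup>2) = ip M (\<lambda>x. f x + c * g x) (\<lambda>x. f x + c * g x)"
    by (simp only: ip_self)
  also have "\<dots> = ip M f (\<lambda>x. f x + c * g x) + ip M (\<lambda>x. c * g x) (\<lambda>x. f x + c * g x)"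
    by (intro ip_add_left assms sc sqi_add)
  also have "ip M f (\<lambda>x. f x + c * g x) = cnj (ip M f f + ip M (\<lambda>x. c * g x) f)"
    by (subst ip_commute) (simp only: ip_add_left[OF assms(1) sc assms(1)])
  also have "ip M (\<lambda>x. c * g x) (\<lambda>x. f x + c * g x) = cnj (ip M f (\<lambda>x. c * g x) + ip M (\<lambda>x. c * g x) (\<lambda>x. c * g x))"
    by (subst ip_commute) (simp only: ip_add_left[OF assms(1) sc sc])
  also have "ip M f (\<lambda>x. c * g x) = cnj (c * ip M g f)"
    by (subst ip_commute) (simp only: ip_scale_left)
  finally have "complex_of_real ((nrm M (\<lambda>x. f x + c * g x))\<^sup>2) =
      cnj (of_real ((nrm M f)\<^sup>2) + c * ip M g f) + cnj (cnj (c * ip M g f) + of_real ((norm c * nrm M g)\<^sup>2))"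
    by (simp only: ip_self ip_scale_left nrm_scale)
  from arg_cong[OF this, of Re] show ?thesis
    by (simp add: power_mult_distrib)
qed

text \<open>The representing element is found by the direct method. \<open>S\<close> is merely a
  subspace, so the minimiser may lie outside of it; this is why an approximating sequence from
  \<open>S\<close> is returned together with \<open>G\<close>.\<close>

theorem riesz_L2:
  assumes fin: "finite_measure M" and S: "\<And>s. s \<in> S \<Longrightarrow> sqi M s"
    "\<And>s t. s \<in> S \<Longrightarrow> t \<in> S \<Longrightarrow> (\<lambda>x. s x + t x) \<in> S" "\<And>c s. s \<in> S \<Longrightarrow> (\<lambda>x. c * s x) \<in> S" "S \<noteq> {}"
    and L: "\<And>s t. s \<in> S \<Longrightarrow> t \<in> S \<Longrightarrow> L (\<lambda>x. s x + t x) = L s + L t"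
    "\<And>c s. s \<in> S \<Longrightarrow> L (\<lambda>x. c * s x) = c * L s"
    and bd: "\<And>s. s \<in> S \<Longrightarrow> norm (L s) \<le> C * nrm M s"
  obtains s G where "\<And>n. s n \<in> S" "sqi M G" "(\<lambda>n. nrm M (\<lambda>x. s n x - G x)) \<longlonglongrightarrow> 0"
    "\<And>t. t \<in> S \<Longrightarrow> ip M t G = L t"
proof -
  \<comment> \<open>If \<open>G\<close> represents \<open>L\<close>, then \<open>J s\<close> is the
    squared distance from \<open>s\<close> to \<open>G\<close> minus the squared norm of
    \<open>G\<close>; minimising \<open>J\<close> approximates the unknown \<open>G\<close> from
    \<open>S\<close>.\<close>
  define J where "J s = (nrm M s)\<^sup>2 - 2 * Re (L s)" for s
  have Jlow: "- C\<^sup>2 \<le> J s" if "s \<in> S" for s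
  proof -
    have "Re (L s) \<le> C * nrm M s"
      using complex_Re_le_cmod[of "L s"] bd[OF that] by linarith
    moreover have "0 \<le> (nrm M s - C)\<^sup>2" by simp
    ultimately show ?thesis
      unfolding J_def by (simp add: power2_diff algebra_simps)
  qed
  define m where "m = (INF s\<in>S. J s)"
  have bdd: "bdd_below (J ` S)"
    using Jlow by (intro bdd_belowI2)
  have m: "m \<le> J s" if "s \<in> S" for s
    unfolding m_def by (rule cINF_lower[OF bdd that])
  \<comment> \<open>An excess of 4^-n over the infimum turns, after a square root, into the
    geometric rate expected by \<open>L2_complete\<close>.\<close>
  have "\<exists>s\<in>S. J s < m + (1/4)^n" for n :: nat
    using cINF_less_iff[OF S(4) bdd, of "m + (1/4)^n"] by (simp add: m_def)
  then obtain s where s: "\<And>n. s n \<in> S" "\<And>n. J (s n) < m + (1/4)^n"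
    by metis
  have J_shift: "J (\<lambda>x. u x + c * t x) = J u + 2 * Re (c * (ip M t u - L t)) + (norm c)\<^sup>2 * (nrm M t)\<^sup>2"
    if "u \<in> S" "t \<in> S" for u t c
    unfolding J_def nrm_expand[OF S(1) S(1), OF that] L(1)[OF that(1) S(3)[OF that(2)]] L(2)[OF that(2)]
    by (simp add: algebra_simps)
  have rate: "nrm M (\<lambda>x. s (Suc n) x - s n x) \<le> 2 * (1/2)^n" for n
  proof (rule power2_le_imp_le)
    let ?u = "s n" and ?w = "\<lambda>x. s (Suc n) x + (-1) * s n x"
    have w: "?w \<in> S" by (intro S s)
    \<comment> \<open>Comparing \<open>J\<close> at two consecutive terms with \<open>J\<close> at
      their midpoint is the parallelogram identity; the linear terms cancel.\<close>
    have half: "J (\<lambda>x. ?u x + (1/2) * ?w x) = J ?u + Re (ip M ?w ?u - L ?w) + (1/4) * (nrm M ?w)\<^sup>2"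
      using J_shift[OF s(1)[of n] w, of "1/2"] by (simp add: power_divide)
    have one: "J (\<lambda>x. ?u x + 1 * ?w x) = J ?u + 2 * Re (ip M ?w ?u - L ?w) + (nrm M ?w)\<^sup>2"
      using J_shift[OF s(1)[of n] w, of 1] by simp
    have "(\<lambda>x. ?u x + 1 * ?w x) = s (Suc n)" by auto
    with one have one: "J (s (Suc n)) = J ?u + 2 * Re (ip M ?w ?u - L ?w) + (nrm M ?w)\<^sup>2"
      by simp
    have "(1/2) * (nrm M ?w)\<^sup>2 = J (s (Suc n)) + J ?u - 2 * J (\<lambda>x. ?u x + (1/2) * ?w x)"
      unfolding one half by (simp add: algebra_simps)
    also have "\<dots> \<le> (m + (1/4)^Suc n) + (m + (1/4)^n) - 2 * m"
      using s(2)[of n] s(2)[of "Suc n"] m[OF S(2)[OF s(1) S(3)[OF w]], of n "1/2"] by linarith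
    also have "\<dots> \<le> 2 * (1/4)^n" by simp
    finally have "(nrm M ?w)\<^sup>2 \<le> 4 * (1/4)^n" by simp
    also have "\<dots> = (2 * (1/2)^n)\<^sup>2"
    proof -
      have "(1/4::real)^n = ((1/2)^n)\<^sup>2"
        by (simp add: power2_eq_square power_mult_distrib[symmetric] power_one_over[symmetric])
      then show ?thesis
        by (simp add: power_mult_distrib)
    qed
    finally show "(nrm M (\<lambda>x. s (Suc n) x - s n x))\<^sup>2 \<le> (2 * (1/2)^n)\<^sup>2"
      by simp
  qed simp
  obtain G where G: "sqi M G" "(\<lambda>n. nrm M (\<lambda>x. s n x - G x)) \<longlonglongrightarrow> 0"
    using L2_complete[OF fin S(1)[OF s(1)] rate] by blast
  have "ip M t G = L t" if t: "t \<in> S" for t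
  proof -
    define a where "a = ip M t G - L t"
    define b where "b = (nrm M t)\<^sup>2"
    \<comment> \<open>First variation: \<open>s n\<close> is minimal up to 4^-n, so a shift by
      \<open>c * t\<close> lowers \<open>J\<close> by less than that. The limit in \<open>n\<close>
      replaces \<open>s n\<close> by \<open>G\<close>.\<close>
    have "0 \<le> 2 * Re (c * a) + (norm c)\<^sup>2 * b" for c
    proof -
      have "- ((1/4)^n) \<le> 2 * Re (c * (ip M t (s n) - L t)) + (norm c)\<^sup>2 * b" for n :: nat
        using m[OF S(2)[OF s(1) S(3)[OF t]], of n c] s(2)[of n] J_shift[OF s(1) t, of n c]
        unfolding b_def by linarith
      moreover have "(\<lambda>n. - ((1/4)^n)) \<longlonglongrightarrow> - (0::real)"
        by (intro tendsto_minus LIMSEQ_power_zero) simp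
      moreover have "(\<lambda>n. 2 * Re (c * (ip M t (s n) - L t)) + (norm c)\<^sup>2 * b) \<longlonglongrightarrow>
          2 * Re (c * (ip M t G - L t)) + (norm c)\<^sup>2 * b"
        by (intro tendsto_intros tendsto_ip_right S s G t)
      ultimately have "- 0 \<le> 2 * Re (c * (ip M t G - L t)) + (norm c)\<^sup>2 * b"
        by (intro LIMSEQ_le) auto
      then show ?thesis by (simp add: a_def)
    qed
    note pos = this
    \<comment> \<open>The shift \<open>c = - e * cnj a\<close> goes against \<open>a\<close>. With
      \<open>e = 1 / (b + 1)\<close>, defined also for \<open>b = 0\<close>, the linear term
      outweighs the quadratic one unless \<open>a = 0\<close>.\<close>
    have "0 \<le> - (2 * e * (norm a)\<^sup>2) + e\<^sup>2 * (norm a)\<^sup>2 * b" for e :: real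
    proof -
      have 1: "Re (- of_real e * cnj a * a) = - e * (norm a)\<^sup>2"
      proof -
        have "- of_real e * cnj a * a = of_real (- e * (norm a)\<^sup>2)"
          unfolding of_real_mult complex_norm_square of_real_minus by (simp add: ac_simps)
        then show ?thesis by (simp only: Re_complex_of_real)
      qed
      have 2: "(norm (- of_real e * cnj a))\<^sup>2 = e\<^sup>2 * (norm a)\<^sup>2"
        by (simp add: norm_mult power_mult_distrib)
      show ?thesis
        using pos[of "- of_real e * cnj a"] unfolding 1 2 by simp
    qed
    from this[of "1 / (b + 1)"] have "0 \<le> (norm a)\<^sup>2 * (b / (b + 1)\<^sup>2 - 2 / (b + 1))"
      by (simp add: algebra_simps power_divide)
    moreover have "b / (b + 1)\<^sup>2 - 2 / (b + 1) < 0"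
    proof -
      have "0 \<le> b" by (simp add: b_def)
      then show ?thesis by (simp add: power2_eq_square divide_simps)
    qed
    ultimately have "(norm a)\<^sup>2 \<le> 0"
      by (simp add: zero_le_mult_iff)
    then show ?thesis by (simp add: a_def)
  qed
  with that s(1) G show thesis by blast
qed

section \<open>Sub-mean value property\<close>

text \<open>Truncated powers are the building blocks of all cutoffs: the power \<open>Suc n\<close>
  has \<open>n\<close> continuous derivatives given by explicit formulas. At 0 the difference
  quotient is at most \<open>\<bar>h\<bar> ^ n\<close>.\<close>

lemma DERIV_max_power:
  fixes x :: real
  assumes n: "n \<ge> 1"
  shows "((\<lambda>x. max 0 x ^ Suc n) has_real_derivative (real (Suc n) * max 0 x ^ n)) (at x)"
proof -
  consider "x > 0" | "x < 0" | "x = 0" by linarith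
  then show ?thesis
  proof cases
    case 1
    have "((\<lambda>x. x ^ Suc n) has_real_derivative (real (Suc n) * x ^ n)) (at x)"
      by (rule derivative_eq_intros refl | simp)+
    then have "((\<lambda>x. max 0 x ^ Suc n) has_real_derivative (real (Suc n) * x ^ n)) (at x)"
      by (rule DERIV_cong_ev[THEN iffD1, rotated -1])
         (use 1 in \<open>auto simp: eventually_nhds intro!: exI[of _ "{0<..}"]\<close>)
    then show ?thesis using 1 by simp
  next
    case 2
    have "((\<lambda>x. 0) has_real_derivative 0) (at x)"
      by simp
    then have "((\<lambda>x. max 0 x ^ Suc n) has_real_derivative 0) (at x)"
      by (rule DERIV_cong_ev[THEN iffD1, rotated -1])
         (use 2 in \<open>auto simp: eventually_nhds intro!: exI[of _ "{..<0}"]\<close>)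
    then show ?thesis using 2 n by (simp add: power_0_left)
  next
    case 3
    have "((\<lambda>h::real. (max 0 (0 + h) ^ Suc n - max 0 0 ^ Suc n) / h) \<longlongrightarrow> 0) (at 0)"
    proof (rule Lim_null_comparison)
      show "\<forall>\<^sub>F h in at (0::real). norm ((max 0 (0 + h) ^ Suc n - max 0 0 ^ Suc n) / h) \<le> \<bar>h\<bar> ^ n"
      proof (intro always_eventually allI)
        fix h :: real
        show "norm ((max 0 (0 + h) ^ Suc n - max 0 0 ^ Suc n) / h) \<le> \<bar>h\<bar> ^ n"
          by (cases "h > 0") (simp_all add: max_def)
      qed
      have "((\<lambda>h::real. \<bar>h\<bar> ^ n) \<longlongrightarrow> \<bar>0\<bar> ^ n) (at 0)"
        by (intro tendsto_intros)
      moreover have "\<bar>0::real\<bar> ^ n = 0"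
        using n by (simp add: power_0_left)
      ultimately show "((\<lambda>h::real. \<bar>h\<bar> ^ n) \<longlongrightarrow> 0) (at 0)"
        by (simp only:)
    qed
    then show ?thesis using 3 n by (simp add: DERIV_def power_0_left)
  qed
qed

text \<open>Differentiation under the integral is carried out over a box, while the integrand lives
  on a disk. Vanishing on the bounding circle lets the two closed pieces be glued.\<close>

lemma continuous_on_bump_ext:
  fixes D :: "'a::topological_space \<Rightarrow> complex \<Rightarrow> real"
  assumes "continuous_on (T \<times> cball 0 R) (\<lambda>(t, w). D t w)" and "\<And>t w. norm w = R \<Longrightarrow> t \<in> T \<Longrightarrow> D t w = 0"
    and "closed T"
  shows "continuous_on (T \<times> UNIV) (\<lambda>(t, w). if w \<in> cball 0 R then D t w else 0)"
proof -
  have eq: "T \<times> UNIV = T \<times> cball 0 R \<union> T \<times> - ball (0::complex) R" by auto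
  have "continuous_on (T \<times> cball 0 R \<union> T \<times> - ball (0::complex) R)
      (\<lambda>x. if snd x \<in> cball 0 R then (\<lambda>(t, w). D t w) x else 0)"
  proof (rule continuous_on_cases)
    show "closed (T \<times> cball (0::complex) R)" "closed (T \<times> - ball (0::complex) R)"
      using assms(3) by (auto intro!: closed_Times)
    show "continuous_on (T \<times> - ball 0 R) (\<lambda>x. 0)" by simp
  qed (use assms(1,2) in \<open>auto\<close>)
  then show ?thesis
    unfolding eq by (rule continuous_on_cong[THEN iffD1, rotated 2]) auto
qed

lemma integrable_cball:
  fixes f :: "complex \<Rightarrow> 'b::{banach, second_countable_topology}"
  assumes "continuous_on (cball a R) f"
  shows "integrable lborel (\<lambda>w. if w \<in> cball a R then f w else 0)"
proof -
  have "integrable lborel (\<lambda>z. indicator (cball a R) z *\<^sub>R f z)"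
    by (rule borel_integrable_compact[OF compact_cball assms])
  also have "(\<lambda>z. indicator (cball a R) z *\<^sub>R f z) = (\<lambda>w. if w \<in> cball a R then f w else 0)"
    by (auto simp: indicator_def)
  finally show ?thesis .
qed

text \<open>The mean of \<open>\<psi> (a + t w)\<close> against the radial bump \<open>R\<^sup>2 - |w|\<^sup>2\<close> is nondecreasing in \<open>t\<close>: after
  an integration by parts its derivative becomes an integral of the Laplacian.\<close>

context
  fixes \<psi> :: "complex \<Rightarrow> real" and p q m :: "complex \<Rightarrow> complex" and U :: "complex set"
    and a :: complex and R :: real
  assumes C2: "C2w U (\<lambda>z. of_real (\<psi> z)) p q m" and U: "open U" and sub: "cball a R \<subseteq> U" and R: "0 < R"
    and pos: "\<And>z. z \<in> cball a R \<Longrightarrow> 0 \<le> Re (m z)"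
begin

private definition k :: "complex \<Rightarrow> real" where "k w = max 0 (R\<^sup>2 - (norm w)\<^sup>2)"

text \<open>A potential of the radial field \<open>k w\<close>: its Wirtinger derivatives are
  \<open>- k / 2\<close> times \<open>cnj w\<close> and \<open>w\<close>. It vanishes on the circle
  of radius \<open>R\<close>, so integration by parts leaves no boundary term.\<close>

private definition \<kappa> :: "complex \<Rightarrow> real" where "\<kappa> w = (max 0 (R\<^sup>2 - (norm w)\<^sup>2))\<^sup>2 / 4"

private lemma in_cball: "t \<in> {0..1} \<Longrightarrow> norm w \<le> R \<Longrightarrow> a + of_real t * w \<in> cball a R"
proof -
  assume t: "t \<in> {0..1}" "norm w \<le> R"
  then have "\<bar>t\<bar> * norm w \<le> 1 * R"
    by (intro mult_mono) auto
  then show ?thesis by (simp add: dist_norm norm_mult)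
qed

private lemma k_cont: "continuous_on S k"
  unfolding k_def by (intro continuous_intros)

private lemma kappa_C1: "C1w S (\<lambda>w. of_real (\<kappa> w)) (\<lambda>w. of_real (- k w / 2) * cnj w) (\<lambda>w. of_real (- k w / 2) * w)"
proof -
  have 1: "C1w UNIV (\<lambda>w. of_real ((norm w)\<^sup>2)) (\<lambda>w. cnj w) (\<lambda>w. w)"
    using C2w_norm_sq[of UNIV 0] by (simp add: C2w_def)
  have "((\<lambda>s. (max 0 (R\<^sup>2 - s))\<^sup>2 / 4) has_real_derivative (- max 0 (R\<^sup>2 - s) / 2)) (at s)" for s
  proof -
    have "((\<lambda>s. max 0 (R\<^sup>2 - s) ^ Suc 1) has_real_derivative (real (Suc 1) * max 0 (R\<^sup>2 - s) ^ 1) * (0 - 1)) (at s)"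
      by (rule DERIV_chain'[OF DERIV_diff[OF DERIV_const DERIV_ident] DERIV_max_power]) simp
    from DERIV_cdivide[OF this, of 4] show ?thesis
      by (simp add: numeral_2_eq_2)
  qed
  from C1w_real_chain[OF 1 this] have
    "C1w UNIV (\<lambda>w. of_real (\<kappa> w)) (\<lambda>w. of_real (- k w / 2) * cnj w) (\<lambda>w. of_real (- k w / 2) * w)"
    unfolding k_def \<kappa>_def by (simp add: continuous_intros)
  then show ?thesis by (rule C1w_subset) simp
qed

text \<open>Here \<open>k w\<close> is -2 times the conjugate derivative of \<open>\<kappa>\<close>,
  and \<open>k * cnj w\<close> is -2 times the other one. The derivative moves onto \<open>f\<close>
  and \<open>g\<close>, where the chain rule for \<open>a + t w\<close> produces the factor
  \<open>t\<close>.\<close>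

private lemma ibp:
  assumes t: "t \<in> {0..1}" and C1: "C1w U f r s" "C1w U g r' s'"
  shows "(\<integral>w. (if w \<in> cball 0 R then of_real (k w) * (f (a + of_real t * w) * w + g (a + of_real t * w) * cnj w) else 0) \<partial>lborel) =
    2 * of_real t * (\<integral>w. (if w \<in> cball 0 R then of_real (\<kappa> w) * (s (a + of_real t * w) + r' (a + of_real t * w)) else 0) \<partial>lborel)"
proof -
  define T where "T = (\<lambda>w. a + of_real t * w) -` U"
  have T: "open T" "cball 0 R \<subseteq> T"
  proof -
    show "open T" unfolding T_def by (intro open_vimage U continuous_intros)
    show "cball 0 R \<subseteq> T"
    proof
      fix w :: complex assume "w \<in> cball 0 R"
      then have "norm w \<le> R" by simp
      from in_cball[OF t this] sub show "w \<in> T" unfolding T_def by blast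
    qed
  qed
  have slc: "continuous_on T (\<lambda>w. h (a + of_real t * w))" if "continuous_on U h" for h :: "complex \<Rightarrow> complex"
    by (rule continuous_on_compose2[OF that]) (auto simp: T_def intro!: continuous_intros)
  have comp: "C1w T (\<lambda>w. h (a + of_real t * w)) (\<lambda>w. of_real t * u (a + of_real t * w)) (\<lambda>w. of_real t * v (a + of_real t * w))"
    if "C1w U h u v" for h u v
  proof (rule C1wI)
    fix w assume "w \<in> T"
    then have "has_wirt h (u (a + of_real t * w)) (v (a + of_real t * w)) (of_real t * w + a)"
      using C1w_D[OF that] by (auto simp: T_def add.commute)
    from has_wirt_scale[OF has_wirt_shift[OF this]]
    show "has_wirt (\<lambda>w. h (a + of_real t * w)) (of_real t * u (a + of_real t * w)) (of_real t * v (a + of_real t * w)) w"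
      by (simp add: add.commute)
  next
    show "continuous_on T (\<lambda>w. of_real t * u (a + of_real t * w))" "continuous_on T (\<lambda>w. of_real t * v (a + of_real t * w))"
      using C1w_continuous(2,3)[OF that] by (auto intro!: continuous_intros slc)
  qed
  have z: "of_real (\<kappa> w) * x = 0" if "w \<notin> cball 0 R" for w x
    using that R by (simp add: \<kappa>_def max_def power2_eq_square) (smt (verit) mult_strict_mono norm_ge_zero)
  note V1 = C1w_mult[OF kappa_C1 comp[OF C1(1)]]
  note V2 = C1w_mult[OF kappa_C1 comp[OF C1(2)]]
  note e1 = integral_wirt_eq_0(2)[OF V1 compact_cball T(2) T(1) z]
    and e2 = integral_wirt_eq_0(1)[OF V2 compact_cball T(2) T(1) z]
  note s1 = integrable_restrict_compact_support(2)[OF compact_cball T(2) T(1) C1w_continuous(3)[OF V1]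
      C1w_compact_support(2)[OF V1 compact_cball T(2) T(1) z]]
  note s2 = integrable_restrict_compact_support(2)[OF compact_cball T(2) T(1) C1w_continuous(2)[OF V2]
      C1w_compact_support(1)[OF V2 compact_cball T(2) T(1) z]]
  let ?I = "\<lambda>h. \<integral>w. (if w \<in> cball 0 R then h w else (0::complex)) \<partial>lborel"
  have ii: "integrable lborel (\<lambda>w. if w \<in> cball 0 R then h w else 0)" if "continuous_on T h" for h :: "complex \<Rightarrow> complex"
    by (rule integrable_cball[OF continuous_on_subset[OF that T(2)]])
  have lin: "?I (\<lambda>w. h w + h' w) = ?I h + ?I h'" if "continuous_on T h" "continuous_on T h'" for h h'
    by (subst Bochner_Integration.integral_add[symmetric, OF ii[OF that(1)] ii[OF that(2)]])
       (rule Bochner_Integration.integral_cong, auto)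
  have lin': "?I (\<lambda>w. c * h w) = c * ?I h" for h c
    by (subst integral_mult_right_zero[symmetric]) (rule Bochner_Integration.integral_cong, auto)
  have c: "continuous_on T (\<lambda>w. f (a + of_real t * w))" "continuous_on T (\<lambda>w. g (a + of_real t * w))"
    using comp[OF C1(1)] comp[OF C1(2)] C1w_continuous by blast+
  have c': "continuous_on T (\<lambda>w. s (a + of_real t * w))" "continuous_on T (\<lambda>w. r' (a + of_real t * w))"
    using C1w_continuous(3)[OF C1(1)] C1w_continuous(2)[OF C1(2)] by (auto intro!: slc)
  have ck: "continuous_on T (\<lambda>w. complex_of_real (k w))" "continuous_on T (\<lambda>w. complex_of_real (\<kappa> w))"
    using C1w_continuous[OF kappa_C1[of T]] by (auto intro!: continuous_intros k_cont)
  have AB: "?I (\<lambda>w. of_real (k w) * (F w * e w)) = 2 * of_real t * ?I (\<lambda>w. of_real (\<kappa> w) * G w)"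
    if "continuous_on T F" "continuous_on T G" "continuous_on T e"
      "?I (\<lambda>w. of_real (- k w / 2) * e w * F w + of_real (\<kappa> w) * (of_real t * G w)) = 0" for F G e
  proof -
    have c1: "continuous_on T (\<lambda>w. (-1/2) * (of_real (k w) * (F w * e w)))"
      and c2: "continuous_on T (\<lambda>w. of_real t * (of_real (\<kappa> w) * G w))"
      by (intro continuous_intros that ck)+
    have eq: "of_real (- k w / 2) * e w * F w + of_real (\<kappa> w) * (of_real t * G w) =
       (-1/2) * (of_real (k w) * (F w * e w)) + of_real t * (of_real (\<kappa> w) * G w)" for w
      by (simp add: algebra_simps)
    from that(4) have "?I (\<lambda>w. (-1/2) * (of_real (k w) * (F w * e w)) + of_real t * (of_real (\<kappa> w) * G w)) = 0"
      by (simp only: eq)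
    then have "(-1/2) * ?I (\<lambda>w. of_real (k w) * (F w * e w)) + of_real t * ?I (\<lambda>w. of_real (\<kappa> w) * G w) = 0"
      by (simp only: lin[OF c1 c2] lin')
    then show ?thesis by (simp add: algebra_simps eq_neg_iff_add_eq_0)
  qed
  have A: "?I (\<lambda>w. of_real (k w) * (f (a + of_real t * w) * w)) = 2 * of_real t * ?I (\<lambda>w. of_real (\<kappa> w) * s (a + of_real t * w))"
    by (rule AB[OF c(1) c'(1) continuous_on_id]) (use e1 s1 in simp)
  have B: "?I (\<lambda>w. of_real (k w) * (g (a + of_real t * w) * cnj w)) = 2 * of_real t * ?I (\<lambda>w. of_real (\<kappa> w) * r' (a + of_real t * w))"
    by (rule AB[OF c(2) c'(2)]) (use e2 s2 in \<open>simp_all add: continuous_intros\<close>)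
  have "?I (\<lambda>w. of_real (k w) * (f (a + of_real t * w) * w + g (a + of_real t * w) * cnj w)) =
      ?I (\<lambda>w. of_real (k w) * (f (a + of_real t * w) * w)) + ?I (\<lambda>w. of_real (k w) * (g (a + of_real t * w) * cnj w))"
    unfolding distrib_left by (rule lin) (intro continuous_intros c ck)+
  also have "\<dots> = 2 * of_real t * (?I (\<lambda>w. of_real (\<kappa> w) * s (a + of_real t * w)) + ?I (\<lambda>w. of_real (\<kappa> w) * r' (a + of_real t * w)))"
    unfolding A B by (simp add: distrib_left)
  also have "?I (\<lambda>w. of_real (\<kappa> w) * s (a + of_real t * w)) + ?I (\<lambda>w. of_real (\<kappa> w) * r' (a + of_real t * w)) =
      ?I (\<lambda>w. of_real (\<kappa> w) * (s (a + of_real t * w) + r' (a + of_real t * w)))"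
    unfolding distrib_left by (rule lin[symmetric]) (intro continuous_intros c' ck)+
  finally show ?thesis .
qed

private lemma line_deriv:
  assumes "t \<in> {0..1}" "norm w \<le> R"
  shows "((\<lambda>t. \<psi> (a + of_real t * w)) has_real_derivative
    Re (p (a + of_real t * w) * w + q (a + of_real t * w) * cnj w)) (at t within S)"
proof -
  let ?z = "a + of_real t * w"
  have "?z \<in> U" using in_cball[OF assms] sub by blast
  then have "((\<lambda>z. complex_of_real (\<psi> z)) has_derivative (\<lambda>h. p ?z * h + q ?z * cnj h)) (at ?z)"
    using C2 unfolding C2w_def C1w_def has_wirt_def by blast
  then have 1: "((\<lambda>z. Re (complex_of_real (\<psi> z))) has_derivative (\<lambda>h. Re (p ?z * h + q ?z * cnj h))) (at ?z)"
    by (rule has_derivative_Re)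
  have 2: "((\<lambda>t. a + complex_of_real t * w) has_derivative (\<lambda>h. of_real h * w)) (at t within S)"
    by (auto intro!: derivative_eq_intros)
  from has_derivative_compose[OF 2 1]
  have "((\<lambda>t. \<psi> (a + of_real t * w)) has_derivative (\<lambda>h. Re (p ?z * (of_real h * w) + q ?z * cnj (of_real h * w)))) (at t within S)"
    by simp
  moreover have "Re (p ?z * (of_real h * w) + q ?z * cnj (of_real h * w)) = Re (p ?z * w + q ?z * cnj w) * h" for h
  proof -
    have "p ?z * (of_real h * w) + q ?z * cnj (of_real h * w) = (p ?z * w + q ?z * cnj w) * of_real h"
      by (simp add: algebra_simps)
    moreover have "Re (x * complex_of_real h) = Re x * h" for x by simp
    ultimately show ?thesis by (simp only:)
  qed
  ultimately show ?thesis
    unfolding has_field_derivative_def by (simp add: fun_eq_iff)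
qed

private lemma cont_line:
  assumes "continuous_on U (h :: complex \<Rightarrow> complex)"
  shows "continuous_on ({0..1} \<times> cball 0 R) (\<lambda>x. h (a + of_real (fst x) * snd x))"
proof (rule continuous_on_compose2[OF assms])
  show "(\<lambda>x. a + of_real (fst x) * snd x) ` ({0..1} \<times> cball 0 R) \<subseteq> U"
  proof (rule image_subsetI)
    fix x :: "real \<times> complex" assume "x \<in> {0..1} \<times> cball 0 R"
    then have "fst x \<in> {0..1}" "norm (snd x) \<le> R" by auto
    from in_cball[OF this] sub show "a + of_real (fst x) * snd x \<in> U" by blast
  qed
qed (intro continuous_intros)

private lemma cont_slice:
  assumes "continuous_on U (h :: complex \<Rightarrow> complex)" "t \<in> {0..1}"
  shows "continuous_on (cball 0 R) (\<lambda>w. h (a + of_real t * w))"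
proof (rule continuous_on_compose2[OF assms(1)])
  show "(\<lambda>w. a + of_real t * w) ` cball 0 R \<subseteq> U"
  proof (rule image_subsetI)
    fix w :: complex assume "w \<in> cball 0 R"
    then have "norm w \<le> R" by auto
    from in_cball[OF assms(2) this] sub show "a + of_real t * w \<in> U" by blast
  qed
qed (intro continuous_intros)

private lemma psi_slice:
  assumes "t \<in> {0..1}"
  shows "continuous_on (cball 0 R) (\<lambda>w. \<psi> (a + of_real t * w))"
proof -
  have "continuous_on U (\<lambda>z. complex_of_real (\<psi> z))"
    using C2 C1w_continuous(1) unfolding C2w_def by blast
  from continuous_on_Re[OF cont_slice[OF this assms]] show ?thesis by simp
qed

private definition mean :: "real \<Rightarrow> real"
  where "mean t = (\<integral>w. (if w \<in> cball 0 R then k w * \<psi> (a + of_real t * w) else 0) \<partial>lborel)"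

private lemma mean_deriv:
  assumes t: "t \<in> {0..1}"
  shows "(mean has_real_derivative
    (\<integral>w. (if w \<in> cball 0 R then k w * Re (p (a + of_real t * w) * w + q (a + of_real t * w) * cnj w) else 0) \<partial>lborel)) (at t within {0..1})"
proof -
  \<comment> \<open>Any box around the disk will do: the integrands are zero outside the
    disk.\<close>
  obtain c where c: "cball (0::complex) R \<subseteq> cbox (- c) c"
    using bounded_subset_cbox_symmetric[OF bounded_cball] by blast
  define F where "F t w = (if w \<in> cball 0 R then k w * \<psi> (a + of_real t * w) else 0)" for t w
  define D where "D t w = (if w \<in> cball 0 R then k w * Re (p (a + of_real t * w) * w + q (a + of_real t * w) * cnj w) else 0)" for t w
  have conv: "integral (cbox (- c) c) h = (\<integral>w. h w \<partial>lborel) \<and> h integrable_on cbox (- c) c"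
    if "h = (\<lambda>w. if w \<in> cball 0 R then h' w else 0)" "continuous_on (cball 0 R) h'" for h h' :: "complex \<Rightarrow> real"
  proof -
    have i: "integrable lborel h" unfolding that(1) by (rule integrable_cball[OF that(2)])
    have z: "h w = 0" if "w \<notin> cbox (- c) c" for w
      using that c \<open>h = _\<close> by auto
    have "h = (\<lambda>w. if w \<in> cbox (- c) c then h w else 0)"
      using z by auto
    with has_integral_integral_lborel[OF i] have "(h has_integral (\<integral>w. h w \<partial>lborel)) (cbox (- c) c)"
      using has_integral_restrict_UNIV[of "cbox (- c) c" h] by (simp only:)
    then show ?thesis by (simp add: has_integral_iff)
  qed
  have pq: "continuous_on U p" "continuous_on U q"
    using C2 C1w_continuous unfolding C2w_def by blast+
  have "((\<lambda>t. integral (cbox (- c) c) (F t)) has_field_derivative integral (cbox (- c) c) (D t)) (at t within {0..1})"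
  proof (rule leibniz_rule_field_derivative)
    fix t w assume "t \<in> {0..1::real}"
    then show "((\<lambda>t. F t w) has_real_derivative D t w) (at t within {0..1})"
      unfolding F_def D_def by (cases "w \<in> cball 0 R") (auto intro!: derivative_eq_intros line_deriv)
  next
    fix t assume "t \<in> {0..1::real}"
    from conv[OF _ continuous_on_mult[OF k_cont psi_slice[OF this]]] show "F t integrable_on cbox (- c) c"
      unfolding F_def by blast
  next
    have "continuous_on ({0..1} \<times> UNIV) (\<lambda>(t, w). D t w)"
      unfolding D_def
    proof (rule continuous_on_bump_ext)
      show "continuous_on ({0..1} \<times> cball 0 R) (\<lambda>(t, w). k w * Re (p (a + of_real t * w) * w + q (a + of_real t * w) * cnj w))"
        unfolding split_beta
        by (intro continuous_intros cont_line pq continuous_on_compose2[OF k_cont[of UNIV]]) auto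
    qed (auto simp: k_def)
    then show "continuous_on ({0..1} \<times> cbox (- c) c) (\<lambda>(t, w). D t w)"
      by (rule continuous_on_subset) auto
  qed (use t in auto)
  moreover have "integral (cbox (- c) c) (F t) = mean t" if "t \<in> {0..1}" for t
    using conv[OF _ continuous_on_mult[OF k_cont psi_slice[OF that]]]
    unfolding F_def mean_def by blast
  moreover have "integral (cbox (- c) c) (D t) = (\<integral>w. D t w \<partial>lborel)"
  proof -
    have "continuous_on (cball 0 R) (\<lambda>w. k w * Re (p (a + of_real t * w) * w + q (a + of_real t * w) * cnj w))"
      by (intro continuous_intros k_cont cont_slice pq t)
    from conv[OF _ this] show ?thesis unfolding D_def by blast
  qed
  ultimately show ?thesis
    using has_field_derivative_transform_within[of _ _ t "{0..1}" 1 mean] t unfolding D_def by auto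
qed

private lemma mean_deriv_nonneg:
  assumes t: "t \<in> {0..1}"
  shows "0 \<le> (\<integral>w. (if w \<in> cball 0 R then k w * Re (p (a + of_real t * w) * w + q (a + of_real t * w) * cnj w) else 0) \<partial>lborel)"
proof -
  obtain r r' where 1: "C1w U p r m" "C1w U q m r'"
    using C2 unfolding C2w_def by blast
  have pq: "continuous_on U p" "continuous_on U q" "continuous_on U m"
    using 1 C1w_continuous by blast+
  have "(\<integral>w. (if w \<in> cball 0 R then k w * Re (p (a + of_real t * w) * w + q (a + of_real t * w) * cnj w) else 0) \<partial>lborel)
      = (\<integral>w. Re (if w \<in> cball 0 R then of_real (k w) * (p (a + of_real t * w) * w + q (a + of_real t * w) * cnj w) else 0) \<partial>lborel)"
    by (rule Bochner_Integration.integral_cong) auto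
  also have "\<dots> = Re (\<integral>w. (if w \<in> cball 0 R then of_real (k w) * (p (a + of_real t * w) * w + q (a + of_real t * w) * cnj w) else 0) \<partial>lborel)"
    by (rule integral_Re[OF integrable_cball]) (intro continuous_intros k_cont cont_slice pq t)
  also have "\<dots> = 2 * t * Re (\<integral>w. (if w \<in> cball 0 R then of_real (\<kappa> w) * (m (a + of_real t * w) + m (a + of_real t * w)) else 0) \<partial>lborel)"
    unfolding ibp[OF t 1] by simp
  also have "Re (\<integral>w. (if w \<in> cball 0 R then of_real (\<kappa> w) * (m (a + of_real t * w) + m (a + of_real t * w)) else 0) \<partial>lborel)
      = (\<integral>w. Re (if w \<in> cball 0 R then of_real (\<kappa> w) * (m (a + of_real t * w) + m (a + of_real t * w)) else 0) \<partial>lborel)"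
    by (rule integral_Re[OF integrable_cball, symmetric])
       (intro continuous_intros C1w_continuous(1)[OF kappa_C1] cont_slice pq t)
  also have "2 * t * \<dots> \<ge> 0"
  proof (intro mult_nonneg_nonneg Bochner_Integration.integral_nonneg)
    fix w
    show "0 \<le> Re (if w \<in> cball 0 R then of_real (\<kappa> w) * (m (a + of_real t * w) + m (a + of_real t * w)) else 0)"
      using pos[OF in_cball[OF t, of w]] by (auto simp: \<kappa>_def)
  qed (use t in auto)
  finally show ?thesis .
qed

private lemma mean_mono: "mean 0 \<le> mean 1"
proof (rule DERIV_nonneg_imp_increasing_open[of 0 1 mean])
  show "\<exists>y. (mean has_real_derivative y) (at x) \<and> 0 \<le> y" if "0 < x" "x < 1" for x
    using mean_deriv[of x] mean_deriv_nonneg[of x] that at_within_Icc_at[of 0 x 1] by auto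
  show "continuous_on {0..1} mean"
    unfolding continuous_on_eq_continuous_within
    using mean_deriv DERIV_continuous by blast
qed simp

text \<open>Convexity enters through the tangent line \<open>exp x * (1 + (y - x)) <= exp y\<close>,
  integrated against \<open>k\<close>. The constant arises from \<open>k <= R^2\<close> on one side
  and total mass \<open>K >= R^4 / 2\<close> on the other.\<close>

lemma exp_submean:
  "exp (\<psi> a) \<le> 2 / R\<^sup>2 * (\<integral>w. (if w \<in> cball a R then exp (\<psi> w) else 0) \<partial>lborel)"
proof -
  let ?I = "\<lambda>h. \<integral>w. (if w \<in> cball (0::complex) R then h w else (0::real)) \<partial>lborel"
  have ps: "continuous_on (cball 0 R) (\<lambda>w. \<psi> (a + w))"
    using psi_slice[of 1] by simp
  have mono: "?I h \<le> ?I h'" if "continuous_on (cball 0 R) h" "continuous_on (cball 0 R) h'" "\<And>w. norm w \<le> R \<Longrightarrow> h w \<le> h' w" for h h'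
    by (rule integral_mono[OF integrable_cball[OF that(1)] integrable_cball[OF that(2)]]) (use that(3) in auto)
  have lin: "?I (\<lambda>w. c * h w + d * h' w) = c * ?I h + d * ?I h'"
    if "continuous_on (cball 0 R) h" "continuous_on (cball 0 R) h'" for h h' c d
  proof -
    have "?I (\<lambda>w. c * h w + d * h' w) = (\<integral>w. c * (if w \<in> cball 0 R then h w else 0) + d * (if w \<in> cball 0 R then h' w else 0) \<partial>lborel)"
      by (rule Bochner_Integration.integral_cong) auto
    also have "\<dots> = c * ?I h + d * ?I h'"
      using integrable_cball[OF that(1)] integrable_cball[OF that(2)]
      by (subst Bochner_Integration.integral_add) auto
    finally show ?thesis .
  qed
  define K where "K = ?I k"
  \<comment> \<open>On the disk of half the radius, of area \<open>pi * R^2 / 4\<close>, the bump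
    \<open>k\<close> is at least \<open>3/4 * R^2\<close>.\<close>
  have K: "3/16 * pi * R^4 \<le> K"
  proof -
    have "3/16 * pi * R^4 = 3/4 * R\<^sup>2 * measure lborel (ball (0::complex) (R/2))"
      using R by (simp add: content_ball unit_ball_vol_2 power_divide)
    also have "\<dots> = (\<integral>w. 3/4 * R\<^sup>2 * indicator (ball (0::complex) (R/2)) w \<partial>lborel)"
      by simp
    also have "\<dots> \<le> K"
      unfolding K_def
    proof (rule integral_mono)
      show "integrable lborel (\<lambda>w. 3/4 * R\<^sup>2 * indicator (ball (0::complex) (R/2)) w)"
        by (intro integrable_mult_right integrable_real_indicator) (auto intro: emeasure_bounded_finite[OF bounded_ball, unfolded infinity_ennreal_def])
      show "integrable lborel (\<lambda>w. if w \<in> cball 0 R then k w else 0)"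
        by (rule integrable_cball[OF k_cont])
      fix w :: complex
      have "(norm w)\<^sup>2 \<le> (R/2)\<^sup>2" if "norm w < R/2"
        using that by (intro power_mono) auto
      moreover have "R\<^sup>2 - (norm w)\<^sup>2 \<le> k w" by (simp add: k_def)
      ultimately have "3/4 * R\<^sup>2 \<le> k w" if "norm w < R/2"
        using that by (simp add: power_divide)
      moreover have "0 \<le> k w" by (simp add: k_def)
      ultimately show "3/4 * R\<^sup>2 * indicator (ball 0 (R/2)) w \<le> (if w \<in> cball 0 R then k w else 0)"
        using R by (auto simp: indicator_def)
    qed
    finally show ?thesis .
  qed
  have "\<psi> a * K = ?I (\<lambda>w. \<psi> a * k w + 0 * k w)"
    using lin[OF k_cont k_cont, of "\<psi> a" 0] by (simp only: K_def)
  also have "\<dots> = mean 0"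
    unfolding mean_def by (rule Bochner_Integration.integral_cong) (auto simp: mult.commute)
  finally have "\<psi> a * K = mean 0" .
  also have "mean 0 \<le> mean 1" by (rule mean_mono)
  also have "mean 1 = ?I (\<lambda>w. k w * \<psi> (a + w))"
    unfolding mean_def by (rule Bochner_Integration.integral_cong) auto
  finally have ge: "\<psi> a * K \<le> ?I (\<lambda>w. k w * \<psi> (a + w))" .
  have "exp (\<psi> a) * K \<le> exp (\<psi> a) * (1 - \<psi> a) * K + exp (\<psi> a) * ?I (\<lambda>w. k w * \<psi> (a + w))"
    using mult_left_mono[OF ge, of "exp (\<psi> a)"] by (simp add: algebra_simps)
  also have "\<dots> = ?I (\<lambda>w. exp (\<psi> a) * (1 - \<psi> a) * k w + exp (\<psi> a) * (k w * \<psi> (a + w)))"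
    unfolding K_def by (rule lin[symmetric]) (intro continuous_intros k_cont ps)+
  also have "\<dots> \<le> ?I (\<lambda>w. R\<^sup>2 * exp (\<psi> (a + w)))"
  proof (rule mono)
    fix w :: complex assume "norm w \<le> R"
    have "exp (\<psi> a) * (1 + (\<psi> (a + w) - \<psi> a)) \<le> exp (\<psi> a) * exp (\<psi> (a + w) - \<psi> a)"
      by (intro mult_left_mono exp_ge_add_one_self) auto
    also have "\<dots> = exp (\<psi> (a + w))" by (simp add: mult_exp_exp)
    finally have 1: "exp (\<psi> a) * (1 + (\<psi> (a + w) - \<psi> a)) \<le> exp (\<psi> (a + w))" .
    have k: "0 \<le> k w" "k w \<le> R\<^sup>2" by (auto simp: k_def)
    have "exp (\<psi> a) * (1 - \<psi> a) * k w + exp (\<psi> a) * (k w * \<psi> (a + w)) = k w * (exp (\<psi> a) * (1 + (\<psi> (a + w) - \<psi> a)))"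
      by (simp add: algebra_simps)
    also have "\<dots> \<le> k w * exp (\<psi> (a + w))"
      by (rule mult_left_mono[OF 1 k(1)])
    also have "\<dots> \<le> R\<^sup>2 * exp (\<psi> (a + w))"
      by (rule mult_right_mono[OF k(2)]) simp
    finally show "exp (\<psi> a) * (1 - \<psi> a) * k w + exp (\<psi> a) * (k w * \<psi> (a + w)) \<le> R\<^sup>2 * exp (\<psi> (a + w))" .
  qed (intro continuous_intros k_cont ps)+
  also have "\<dots> = R\<^sup>2 * ?I (\<lambda>w. exp (\<psi> (a + w)))"
  proof -
    have c: "continuous_on (cball 0 R) (\<lambda>w. exp (\<psi> (a + w)))"
      by (intro continuous_intros ps)
    have "?I (\<lambda>w. R\<^sup>2 * exp (\<psi> (a + w))) = ?I (\<lambda>w. R\<^sup>2 * exp (\<psi> (a + w)) + 0 * exp (\<psi> (a + w)))"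
      by (rule Bochner_Integration.integral_cong) auto
    also have "\<dots> = R\<^sup>2 * ?I (\<lambda>w. exp (\<psi> (a + w)))"
      unfolding lin[OF c c] by simp
    finally show ?thesis .
  qed
  also have "?I (\<lambda>w. exp (\<psi> (a + w))) = (\<integral>w. (if w \<in> cball a R then exp (\<psi> w) else 0) \<partial>lborel)"
  proof -
    have "continuous_on (cball a R) \<psi>"
    proof -
      have "continuous_on (cball a R) (\<lambda>z. complex_of_real (\<psi> z))"
        using C2 C1w_continuous(1) sub unfolding C2w_def by (blast intro: continuous_on_subset)
      from continuous_on_Re[OF this] show ?thesis by simp
    qed
    then have "integrable lborel (\<lambda>w. if w \<in> cball a R then exp (\<psi> w) else 0)"
      by (intro integrable_cball continuous_intros)
    from lborel_integral_shift[of "\<lambda>w. if w \<in> cball a R then exp (\<psi> w) else 0" a] borel_measurable_integrable[OF this]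
    show ?thesis by (simp add: add.commute[of _ a] dist_norm cong: if_cong)
  qed
  finally have "exp (\<psi> a) * K \<le> R\<^sup>2 * (\<integral>w. (if w \<in> cball a R then exp (\<psi> w) else 0) \<partial>lborel)" .
  moreover have "R^4 / 2 \<le> K"
  proof -
    have "R^4 / 2 \<le> 3/16 * 3 * R^4" by simp
    also have "\<dots> \<le> 3/16 * pi * R^4"
      using pi_gt3 by (intro mult_right_mono mult_left_mono) auto
    finally show ?thesis using K by simp
  qed
  then have "exp (\<psi> a) * (R^4 / 2) \<le> exp (\<psi> a) * K"
    by (intro mult_left_mono) auto
  ultimately have "exp (\<psi> a) * (R^4 / 2) \<le> R\<^sup>2 * (\<integral>w. (if w \<in> cball a R then exp (\<psi> w) else 0) \<partial>lborel)"
    by linarith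
  then show ?thesis
    using R by (simp add: field_simps power4_eq_xxxx power2_eq_square)
qed

end

text \<open>\<open>ln (norm g) - \<phi>\<close> fails to be subharmonic by at most \<open>B\<close>.
  Adding \<open>B * (norm (w - a))^2\<close> repairs this and costs the factor
  \<open>exp (B * R^2)\<close>. Zeros of \<open>g\<close> are avoided by the regularisation
  \<open>ln ((norm g)^2 + e) / 2\<close>, which is removed at the end.\<close>

lemma submean_holomorphic:
  assumes g: "g holomorphic_on U" and U: "open U" and C2: "C2w U (\<lambda>z. of_real (\<phi> z)) f fb m"
    and sub: "cball a R \<subseteq> U" and R: "0 < R" and B: "\<And>z. z \<in> cball a R \<Longrightarrow> Re (m z) \<le> B" and B0: "0 \<le> B"
  shows "norm (g a) * exp (- \<phi> a) \<le>
    2 * exp (B * R\<^sup>2) / R\<^sup>2 * (\<integral>w. (if w \<in> cball a R then norm (g w) * exp (- \<phi> w) else 0) \<partial>lborel)"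
proof -
  let ?g' = "deriv g"
  have gg: "C2w U (\<lambda>z. of_real ((norm (g z))\<^sup>2)) (\<lambda>z. ?g' z * cnj (g z)) (\<lambda>z. g z * cnj (?g' z)) (\<lambda>z. ?g' z * cnj (?g' z))"
    using C2w_mult[OF C2w_holomorphic[OF g U] C2w_cnj[OF C2w_holomorphic[OF g U]]]
    by (simp add: complex_norm_square del: of_real_power)
  let ?J = "\<lambda>h. \<integral>w. (if w \<in> cball a R then h w else (0::real)) \<partial>lborel"
  have cphi: "continuous_on (cball a R) \<phi>"
  proof -
    have "continuous_on (cball a R) (\<lambda>z. complex_of_real (\<phi> z))"
      using C2 C1w_continuous(1) sub unfolding C2w_def by (blast intro: continuous_on_subset)
    from continuous_on_Re[OF this] show ?thesis by simp
  qed
  have cg: "continuous_on (cball a R) g"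
    using holomorphic_on_imp_continuous_on[OF g] sub continuous_on_subset by blast
  have main: "norm (g a) * exp (- \<phi> a) \<le>
      2 * exp (B * R\<^sup>2) / R\<^sup>2 * (?J (\<lambda>w. norm (g w) * exp (- \<phi> w)) + d * ?J (\<lambda>w. exp (- \<phi> w)))" if d: "0 < d" for d
  proof -
    \<comment> \<open>With this choice \<open>sqrt ((norm g)^2 + e) <= norm g + d\<close>, so the
      error is linear in \<open>d\<close>.\<close>
    define e where "e = d\<^sup>2"
    have e: "0 < e" using d by (simp add: e_def)
    define \<psi> where "\<psi> w = ln ((norm (g w))\<^sup>2 + e) / 2 + (-1) * \<phi> w + B * (norm (w - a))\<^sup>2" for w
    have pos: "0 < x\<^sup>2 + e" for x :: real using e by (simp add: add_nonneg_pos)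
    have 1: "C2w U (\<lambda>z. of_real (ln ((norm (g z))\<^sup>2 + e) / 2))
        (\<lambda>z. of_real (1 / (2 * ((norm (g z))\<^sup>2 + e))) * (?g' z * cnj (g z)))
        (\<lambda>z. of_real (1 / (2 * ((norm (g z))\<^sup>2 + e))) * (g z * cnj (?g' z)))
        (\<lambda>z. of_real (- 1 / (2 * ((norm (g z))\<^sup>2 + e)\<^sup>2)) * (?g' z * cnj (g z)) * (g z * cnj (?g' z))
           + of_real (1 / (2 * ((norm (g z))\<^sup>2 + e))) * (?g' z * cnj (?g' z)))"
    proof (rule C2w_real_chain[OF gg, where g = "\<lambda>s. ln (s + e) / 2" and g' = "\<lambda>s. 1 / (2 * (s + e))" and g'' = "\<lambda>s. - 1 / (2 * (s + e)\<^sup>2)"])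
      fix z
      let ?x = "(norm (g z))\<^sup>2"
      show "((\<lambda>s. ln (s + e) / 2) has_real_derivative 1 / (2 * (?x + e))) (at ?x)"
        using pos[of "norm (g z)"] by (auto intro!: derivative_eq_intros simp: field_simps)
      show "((\<lambda>s. 1 / (2 * (s + e))) has_real_derivative - 1 / (2 * (?x + e)\<^sup>2)) (at ?x)"
      proof -
        have "((\<lambda>s. s + e) has_real_derivative 1) (at ?x)"
          by (auto intro!: derivative_eq_intros)
        from DERIV_cmult[OF DERIV_inverse'[OF this], of "1/2"] pos[of "norm (g z)"]
        have "((\<lambda>s. (1/2) * inverse (s + e)) has_real_derivative (1/2) * (- (inverse (?x + e) * 1 * inverse (?x + e)))) (at ?x)"
          by (simp only: less_imp_neq[symmetric] not_False_eq_True)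
        then show ?thesis
          by (simp add: inverse_eq_divide power2_eq_square mult.assoc)
      qed
      show "continuous_on ((\<lambda>z. (norm (g z))\<^sup>2) ` U) (\<lambda>s. - 1 / (2 * (s + e)\<^sup>2))"
      proof (intro continuous_intros ballI)
        fix s assume "s \<in> (\<lambda>z. (norm (g z))\<^sup>2) ` U"
        then obtain z where "s = (norm (g z))\<^sup>2" by blast
        then have "0 < s + e" using pos[of "norm (g z)"] by simp
        then show "2 * (s + e)\<^sup>2 \<noteq> 0" by simp
      qed
    qed
    note 2 = C2w_add[OF C2w_add[OF 1 C2w_mult[OF C2w_const[of U "-1"] C2]] C2w_mult[OF C2w_const[of U "of_real B"] C2w_norm_sq[of U a]]]
    let ?m = "\<lambda>z. of_real (- 1 / (2 * ((norm (g z))\<^sup>2 + e)\<^sup>2)) * (?g' z * cnj (g z)) * (g z * cnj (?g' z))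
           + of_real (1 / (2 * ((norm (g z))\<^sup>2 + e))) * (?g' z * cnj (?g' z)) + (0 * of_real (\<phi> z) + 0 * fb z + (0 * f z + (-1) * m z))
           + (0 * of_real ((norm (z - a))\<^sup>2) + 0 * (z - a) + (0 * cnj (z - a) + of_real B * 1))"
    have "of_real (ln ((norm (g z))\<^sup>2 + e) / 2) + (-1) * of_real (\<phi> z) + of_real B * of_real ((norm (z - a))\<^sup>2) = complex_of_real (\<psi> z)" for z
      by (simp add: \<psi>_def)
    note psi = C2w_transform[OF 2 U this refl refl refl]
    have "0 \<le> Re (?m z)" if z: "z \<in> cball a R" for z
    proof -
      define x where "x = (norm (g z))\<^sup>2"
      define y where "y = (norm (?g' z))\<^sup>2"
      have x: "0 \<le> x" "0 \<le> y" by (auto simp: x_def y_def)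
      have "?m z = of_real (- 1 / (2 * (x + e)\<^sup>2)) * ((g z * cnj (g z)) * (?g' z * cnj (?g' z))) + of_real (1 / (2 * (x + e))) * (?g' z * cnj (?g' z)) - m z + of_real B"
        unfolding x_def by (simp add: algebra_simps)
      also have "\<dots> = of_real (- 1 / (2 * (x + e)\<^sup>2) * (x * y) + 1 / (2 * (x + e)) * y + B) - m z"
        unfolding x_def y_def by (simp only: complex_norm_square[symmetric] of_real_add of_real_mult) simp
      finally have "Re (?m z) = - 1 / (2 * (x + e)\<^sup>2) * (x * y) + 1 / (2 * (x + e)) * y + B - Re (m z)"
        by (simp only: minus_complex.sel Re_complex_of_real)
      \<comment> \<open>The regularised logarithm is subharmonic: its mixed derivative collapses to
        a nonnegative quotient.\<close>
      also have "- 1 / (2 * (x + e)\<^sup>2) * (x * y) + 1 / (2 * (x + e)) * y = e * y / (2 * (x + e)\<^sup>2)"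
      proof -
        have "1 / (2 * (x + e)) * y = (x + e) * y / (2 * (x + e)\<^sup>2)"
          using x e by (simp add: power2_eq_square)
        then have "- 1 / (2 * (x + e)\<^sup>2) * (x * y) + 1 / (2 * (x + e)) * y = ((x + e) * y - x * y) / (2 * (x + e)\<^sup>2)"
          by (simp add: diff_divide_distrib)
        then show ?thesis by (simp add: algebra_simps)
      qed
      finally have fin: "Re (?m z) = e * y / (2 * (x + e)\<^sup>2) + B - Re (m z)" .
      have "0 \<le> e * y / (2 * (x + e)\<^sup>2)"
        using x e by simp
      then show ?thesis
        unfolding fin using B[OF z] by linarith
    qed
    from exp_submean[OF psi U sub R this]
    have *: "exp (\<psi> a) \<le> 2 / R\<^sup>2 * ?J (\<lambda>w. exp (\<psi> w))" .
    have ex: "exp (\<psi> w) = sqrt ((norm (g w))\<^sup>2 + e) * exp (- \<phi> w) * exp (B * (norm (w - a))\<^sup>2)" for w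
    proof -
      have "exp (ln ((norm (g w))\<^sup>2 + e) / 2) = sqrt ((norm (g w))\<^sup>2 + e)"
        unfolding ln_sqrt[OF less_imp_le[OF pos], symmetric] using pos[of "norm (g w)"] by (intro exp_ln) simp
      then show ?thesis by (simp only: \<psi>_def exp_add mult_minus1)
    qed
    have "norm (g a) * exp (- \<phi> a) \<le> exp (\<psi> a)"
    proof -
      have "norm (g a) = sqrt ((norm (g a))\<^sup>2)" by simp
      also have "\<dots> \<le> sqrt ((norm (g a))\<^sup>2 + e)" using e by (intro real_sqrt_le_mono) simp
      finally show ?thesis unfolding ex by simp
    qed
    also note *
    also have "2 / R\<^sup>2 * ?J (\<lambda>w. exp (\<psi> w)) \<le> 2 / R\<^sup>2 * (exp (B * R\<^sup>2) * (?J (\<lambda>w. norm (g w) * exp (- \<phi> w)) + d * ?J (\<lambda>w. exp (- \<phi> w))))"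
    proof (rule mult_left_mono)
      have i: "integrable lborel (\<lambda>w. if w \<in> cball a R then norm (g w) * exp (- \<phi> w) else 0)"
        "integrable lborel (\<lambda>w. if w \<in> cball a R then exp (- \<phi> w) else 0)"
        by (rule integrable_cball, intro continuous_intros cphi cg)+
      have "continuous_on (cball a R) \<psi>"
        unfolding \<psi>_def using pos by (intro continuous_intros cg cphi) (auto simp: less_le)
      then have ip: "integrable lborel (\<lambda>w. if w \<in> cball a R then exp (\<psi> w) else 0)"
        by (intro integrable_cball continuous_intros)
      have "?J (\<lambda>w. exp (\<psi> w)) \<le> (\<integral>w. exp (B * R\<^sup>2) * ((if w \<in> cball a R then norm (g w) * exp (- \<phi> w) else 0) + d * (if w \<in> cball a R then exp (- \<phi> w) else 0)) \<partial>lborel)"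
      proof (rule integral_mono[OF ip])
        show "integrable lborel (\<lambda>w. exp (B * R\<^sup>2) * ((if w \<in> cball a R then norm (g w) * exp (- \<phi> w) else 0) + d * (if w \<in> cball a R then exp (- \<phi> w) else 0)))"
          by (intro integrable_mult_right Bochner_Integration.integrable_add i)
        fix w
        have "exp (\<psi> w) \<le> exp (B * R\<^sup>2) * (norm (g w) * exp (- \<phi> w) + d * exp (- \<phi> w))" if w: "w \<in> cball a R"
        proof -
          have "sqrt ((norm (g w))\<^sup>2 + e) \<le> norm (g w) + d"
            using d by (intro real_le_lsqrt) (auto simp: e_def power2_sum)
          moreover have "norm (w - a) \<le> R"
            using w by (simp add: dist_norm norm_minus_commute)
          then have "exp (B * (norm (w - a))\<^sup>2) \<le> exp (B * R\<^sup>2)"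
            using B0 by (simp add: mult_left_mono power_mono)
          ultimately have "exp (\<psi> w) \<le> ((norm (g w) + d) * exp (- \<phi> w)) * exp (B * R\<^sup>2)"
            unfolding ex using d by (intro mult_mono) auto
          then show ?thesis by (simp add: algebra_simps)
        qed
        then show "(if w \<in> cball a R then exp (\<psi> w) else 0) \<le> exp (B * R\<^sup>2) * ((if w \<in> cball a R then norm (g w) * exp (- \<phi> w) else 0) + d * (if w \<in> cball a R then exp (- \<phi> w) else 0))"
          by auto
      qed
      also have "\<dots> = exp (B * R\<^sup>2) * (?J (\<lambda>w. norm (g w) * exp (- \<phi> w)) + d * ?J (\<lambda>w. exp (- \<phi> w)))"
        using i by (simp add: Bochner_Integration.integral_add)
      finally show "?J (\<lambda>w. exp (\<psi> w)) \<le> exp (B * R\<^sup>2) * (?J (\<lambda>w. norm (g w) * exp (- \<phi> w)) + d * ?J (\<lambda>w. exp (- \<phi> w)))" .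
    qed (use R in simp)
    finally show ?thesis by (simp add: mult.assoc)
  qed
  have "((\<lambda>d. 2 * exp (B * R\<^sup>2) / R\<^sup>2 * (?J (\<lambda>w. norm (g w) * exp (- \<phi> w)) + d * ?J (\<lambda>w. exp (- \<phi> w)))) \<longlongrightarrow>
     2 * exp (B * R\<^sup>2) / R\<^sup>2 * (?J (\<lambda>w. norm (g w) * exp (- \<phi> w)) + 0 * ?J (\<lambda>w. exp (- \<phi> w)))) (at_right 0)"
    by (intro tendsto_intros)
  moreover have "\<forall>\<^sub>F d in at_right 0. norm (g a) * exp (- \<phi> a) \<le>
      2 * exp (B * R\<^sup>2) / R\<^sup>2 * (?J (\<lambda>w. norm (g w) * exp (- \<phi> w)) + d * ?J (\<lambda>w. exp (- \<phi> w)))"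
    using eventually_at_right_less[of 0] by eventually_elim (rule main)
  ultimately show ?thesis
    using tendsto_lowerbound[of _ _ "at_right (0::real)"] by fastforce
qed

section \<open>Weyl's lemma\<close>

text \<open>The exponent starts at 3, the least one for which a truncated power is twice
  continuously differentiable.\<close>

lemma C2w_max_power:
  assumes "C2w U (\<lambda>z. of_real (r z)) p q m"
  obtains m' where "C2w U (\<lambda>z. of_real (max 0 (r z) ^ (n + 3)))
    (\<lambda>z. of_real (real (n + 3) * max 0 (r z) ^ (n + 2)) * p z)
    (\<lambda>z. of_real (real (n + 3) * max 0 (r z) ^ (n + 2)) * q z) m'"
proof -
  have 1: "((\<lambda>x::real. max 0 x ^ (n + 3)) has_real_derivative real (n + 3) * max 0 x ^ (n + 2)) (at x)" for x
    using DERIV_max_power[of "n + 2" x] by (simp add: eval_nat_numeral)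
  have 2: "((\<lambda>x::real. real (n + 3) * max 0 x ^ (n + 2)) has_real_derivative real (n + 3) * (real (n + 2) * max 0 x ^ (n + 1))) (at x)" for x
    using DERIV_cmult[OF DERIV_max_power[of "n + 1" x], of "real (n + 3)"] by (simp add: eval_nat_numeral)
  have 3: "continuous_on (r ` U) (\<lambda>x::real. real (n + 3) * (real (n + 2) * max 0 x ^ (n + 1)))"
    by (intro continuous_intros)
  show thesis
    by (rule that, rule C2w_real_chain[OF assms 1 2 3])
qed

lemma C2w_affine:
  assumes "C2w U (\<lambda>z. of_real (r z)) p q m" "open U"
  shows "C2w U (\<lambda>z. of_real (\<alpha> * r z + \<beta>)) (\<lambda>z. of_real \<alpha> * p z) (\<lambda>z. of_real \<alpha> * q z) (\<lambda>z. of_real \<alpha> * m z)"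
  by (rule C2w_transform[OF C2w_add[OF C2w_mult[OF C2w_const[of U "of_real \<alpha>"] assms(1)] C2w_const[of U "of_real \<beta>"]] assms(2)])
     simp_all

text \<open>The cutoff is \<open>(1 - y_+^3)_+^3\<close>, where \<open>y\<close> is affine in the
  squared norm, 0 at \<open>r1\<close> and 1 at \<open>r2\<close>. The inner truncation flattens it
  at 1, the outer one at 0.\<close>

lemma smooth_cutoff:
  assumes "0 < r1" "r1 < r2"
  obtains \<eta> :: "complex \<Rightarrow> real" and p q m where "C2w UNIV (\<lambda>z. of_real (\<eta> z)) p q m"
    "\<And>z. (norm z)\<^sup>2 \<le> r1 \<Longrightarrow> \<eta> z = 1" "\<And>z. r2 \<le> (norm z)\<^sup>2 \<Longrightarrow> \<eta> z = 0"
proof -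
  have 1: "C2w UNIV (\<lambda>z. of_real ((norm z)\<^sup>2)) (\<lambda>z. cnj z) (\<lambda>z. z) (\<lambda>z. 1)"
    using C2w_norm_sq[of UNIV 0] by simp
  let ?y = "\<lambda>z::complex. 1 / (r2 - r1) * (norm z)\<^sup>2 + - r1 / (r2 - r1)"
  note 2 = C2w_affine[OF 1 open_UNIV, of "1 / (r2 - r1)" "- r1 / (r2 - r1)"]
  obtain m' where 3: "C2w UNIV (\<lambda>z. of_real (max 0 (?y z) ^ (0 + 3)))
    (\<lambda>z. of_real (real (0 + 3) * max 0 (?y z) ^ (0 + 2)) * (of_real (1 / (r2 - r1)) * cnj z))
    (\<lambda>z. of_real (real (0 + 3) * max 0 (?y z) ^ (0 + 2)) * (of_real (1 / (r2 - r1)) * z)) m'"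
    by (rule C2w_max_power[OF 2])
  note 4 = C2w_affine[OF 3 open_UNIV, of "-1" 1]
  define \<eta> where "\<eta> z = max 0 (-1 * max 0 (?y z) ^ (0 + 3) + 1) ^ (0 + 3)" for z :: complex
  have y: "?y z = ((norm z)\<^sup>2 - r1) / (r2 - r1)" for z :: complex
    by (simp add: diff_divide_distrib)
  show thesis
  proof (rule C2w_max_power[OF 4, of 0])
    fix m assume "C2w UNIV (\<lambda>z. of_real (max 0 (-1 * max 0 (?y z) ^ (0 + 3) + 1) ^ (0 + 3)))
      (\<lambda>z. of_real (real (0 + 3) * max 0 (-1 * max 0 (?y z) ^ (0 + 3) + 1) ^ (0 + 2)) * (of_real (-1) * (of_real (real (0 + 3) * max 0 (?y z) ^ (0 + 2)) * (of_real (1 / (r2 - r1)) * cnj z))))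
      (\<lambda>z. of_real (real (0 + 3) * max 0 (-1 * max 0 (?y z) ^ (0 + 3) + 1) ^ (0 + 2)) * (of_real (-1) * (of_real (real (0 + 3) * max 0 (?y z) ^ (0 + 2)) * (of_real (1 / (r2 - r1)) * z)))) m"
    from this[folded \<eta>_def] show thesis
    proof (rule that)
      fix z :: complex
      show "\<eta> z = 1" if "(norm z)\<^sup>2 \<le> r1"
      proof -
        have "?y z \<le> 0" unfolding y using that assms by (simp add: divide_nonpos_pos)
        then show ?thesis by (simp only: \<eta>_def max_absorb1) simp
      qed
      show "\<eta> z = 0" if "r2 \<le> (norm z)\<^sup>2"
      proof -
        have "1 \<le> ?y z" unfolding y using that assms by (simp add: le_divide_eq)
        then have "1 \<le> max 0 (?y z) ^ (0 + 3)" by (intro one_le_power) linarith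
        then have "-1 * max 0 (?y z) ^ (0 + 3) + 1 \<le> 0" by linarith
        then show ?thesis by (simp only: \<eta>_def max_absorb1) simp
      qed
    qed
  qed
qed

text \<open>On the overlap uniqueness of Wirtinger derivatives forces both sets of derivatives to
  agree, so the piecewise definition is consistent. Only \<open>q\<close> is tracked by name, since
  \<open>cauchy_bump\<close> prescribes just the conjugate derivative.\<close>

lemma C2w_Un:
  assumes 1: "C2w U f p q m" and 2: "C2w V f p' q' m'" and o: "open U" "open V"
    and q: "\<And>z. z \<in> V \<Longrightarrow> q z = q' z"
  obtains p'' m'' where "C2w (U \<union> V) f p'' q m''"
proof -
  define p'' where "p'' z = (if z \<in> U then p z else p' z)" for z
  define m'' where "m'' z = (if z \<in> U then m z else m' z)" for z
  from 1 obtain r s where a: "C1w U f p q" "C1w U p r m" "C1w U q m s" unfolding C2w_def by blast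
  from 2 obtain r' s' where b: "C1w V f p' q'" "C1w V p' r' m'" "C1w V q' m' s'" unfolding C2w_def by blast
  define r'' where "r'' z = (if z \<in> U then r z else r' z)" for z
  define s'' where "s'' z = (if z \<in> U then s z else s' z)" for z
  have oi: "open (U \<inter> V)" using o by auto
  have pe: "p z = p' z" if "z \<in> U \<inter> V" for z
    using has_wirt_unique(1)[of f] C1w_D[OF a(1)] C1w_D[OF b(1)] that by blast
  have rm: "r z = r' z" "m z = m' z" if "z \<in> U \<inter> V" for z
  proof -
    have "has_wirt p' (r z) (m z) z"
      by (rule has_wirt_transform[OF C1w_D[OF a(2)] oi that]) (use that pe in auto)
    moreover have "has_wirt p' (r' z) (m' z) z" using C1w_D[OF b(2)] that by auto
    ultimately show "r z = r' z" "m z = m' z" using has_wirt_unique by blast+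
  qed
  have se: "s z = s' z" if "z \<in> U \<inter> V" for z
  proof -
    have "has_wirt q' (m z) (s z) z"
      by (rule has_wirt_transform[OF C1w_D[OF a(3)] oi that]) (use that q in auto)
    moreover have "has_wirt q' (m' z) (s' z) z" using C1w_D[OF b(3)] that by auto
    ultimately show ?thesis using has_wirt_unique by blast
  qed
  have A: "C1w U f p'' q" "C1w U p'' r'' m''" "C1w U q m'' s''"
    by (rule C1w_transform[OF a(1) o(1)], simp_all add: p''_def)
       (rule C1w_transform[OF a(2) o(1)] C1w_transform[OF a(3) o(1)], simp_all add: p''_def r''_def m''_def s''_def)+
  have B: "C1w V f p'' q"
    by (rule C1w_transform[OF b(1) o(2)]) (use pe q in \<open>auto simp: p''_def\<close>)
  have B': "C1w V p'' r'' m''"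
    by (rule C1w_transform[OF b(2) o(2)]) (use pe rm in \<open>auto simp: p''_def r''_def m''_def\<close>)
  have B'': "C1w V q m'' s''"
    by (rule C1w_transform[OF b(3) o(2)]) (use rm se q in \<open>auto simp: m''_def s''_def\<close>)
  have "C2w (U \<union> V) f p'' q m''"
    unfolding C2w_def using C1w_Un[OF A(1) B o] C1w_Un[OF A(2) B' o] C1w_Un[OF A(3) B'' o] by blast
  then show thesis by (rule that)
qed

text \<open>A mollifier up to a constant. The scaling is the one for which it becomes the conjugate
  derivative of \<open>(1 - (1 - (norm z)^2 / \<epsilon>^2)_+^4) / z\<close>.\<close>

definition bump :: "real \<Rightarrow> complex \<Rightarrow> real"
  where "bump \<epsilon> z = 4 / \<epsilon>\<^sup>2 * max 0 (1 - (norm z)\<^sup>2 / \<epsilon>\<^sup>2) ^ 3"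

text \<open>A solution of \<open>\<partial>c/\<partial>\<zz> = bump \<epsilon>\<close> that coincides with the Cauchy kernel \<open>1/z\<close> off the disk
  of radius \<open>\<epsilon>\<close>.\<close>

lemma cauchy_bump:
  assumes e: "0 < \<epsilon>"
  obtains c p m where "C2w UNIV c p (\<lambda>z. of_real (bump \<epsilon> z)) m" "\<And>z. \<epsilon> \<le> norm z \<Longrightarrow> c z = inverse z"
proof -
  define d where "d = \<epsilon>\<^sup>2"
  have d: "0 < d" using e by (simp add: d_def)
  define c where "c z = of_real (1 - max 0 (1 - (norm z)\<^sup>2 / d) ^ 4) * inverse z" for z :: complex
  have nsq: "C2w U (\<lambda>z. of_real ((norm z)\<^sup>2)) (\<lambda>z. cnj z) (\<lambda>z. z) (\<lambda>z. 1)" for U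
    using C2w_norm_sq[of U 0] by simp
  \<comment> \<open>\<open>P\<close> solves \<open>x * P x = 1 - (1 - x / d)^4\<close>. Hence near 0
    the quotient \<open>c z\<close> is \<open>cnj z * P ((norm z)^2)\<close>, which shows that the
    singularity is removable.\<close>
  define P where "P x = (4 - 6 * (x / d) + 4 * (x / d)^2 - (x / d)^3) / d" for x :: real
  define P' where "P' x = (- 6 / d + 8 * x / d^2 - 3 * x^2 / d^3) / d" for x :: real
  define P'' where "P'' x = (8 / d^2 - 6 * x / d^3) / d" for x :: real
  have dP: "(P has_real_derivative P' x) (at x)" "(P' has_real_derivative P'' x) (at x)" for x
    unfolding P_def P'_def P''_def using d
    by (auto intro!: derivative_eq_intros simp: field_simps eval_nat_numeral)
  have in_ball: "(norm z)\<^sup>2 \<le> d" if "norm z \<le> \<epsilon>" for z :: complex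
    unfolding d_def using that by (intro power_mono) auto
  have cP: "C2w (ball 0 \<epsilon>) (\<lambda>z. of_real (P ((norm z)\<^sup>2)))
      (\<lambda>z. of_real (P' ((norm z)\<^sup>2)) * cnj z) (\<lambda>z. of_real (P' ((norm z)\<^sup>2)) * z)
      (\<lambda>z. of_real (P'' ((norm z)\<^sup>2)) * cnj z * z + of_real (P' ((norm z)\<^sup>2)) * 1)"
    by (rule C2w_real_chain[OF nsq dP]) (use d in \<open>auto simp: P''_def intro!: continuous_intros\<close>)
  have ccnj: "C2w U (\<lambda>z. cnj z) (\<lambda>z. 0) (\<lambda>z. 1) (\<lambda>z. 0)" if "open U" for U
  proof -
    have "C2w U (\<lambda>z. z) (deriv (\<lambda>z. z)) (\<lambda>z. 0) (\<lambda>z. 0)"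
      by (rule C2w_holomorphic[OF holomorphic_on_ident that])
    from C2w_cnj[OF this] show ?thesis by simp
  qed
  have FP: "x * P x = 1 - (1 - x / d) ^ 4" for x
    using d unfolding P_def by (simp add: field_simps eval_nat_numeral)
  have FP': "P x + x * P' x = 4 / d * (1 - x / d) ^ 3" for x
    using d unfolding P_def P'_def by (simp add: field_simps eval_nat_numeral)
  note m1 = C2w_mult[OF ccnj[OF open_ball] cP]
  have 1: "\<exists>p m. C2w (ball 0 \<epsilon>) c p (\<lambda>z. of_real (bump \<epsilon> z)) m"
  proof (intro exI, rule C2w_transform[OF m1 open_ball _ refl _ refl])
    fix z assume z: "z \<in> ball (0::complex) \<epsilon>"
    then have le: "(norm z)\<^sup>2 / d \<le> 1" using in_ball[of z] d by simp
    show "cnj z * of_real (P ((norm z)\<^sup>2)) = c z"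
    proof (cases "z = 0")
      case False
      have "c z = of_real ((norm z)\<^sup>2 * P ((norm z)\<^sup>2)) * inverse z"
        unfolding c_def FP using le by simp
      also have "\<dots> = (z * cnj z) * of_real (P ((norm z)\<^sup>2)) * inverse z"
        by (simp only: of_real_mult complex_norm_square)
      finally show ?thesis using False by simp
    qed (simp add: c_def)
    have "1 * complex_of_real (P ((norm z)\<^sup>2)) + cnj z * (of_real (P' ((norm z)\<^sup>2)) * z) =
        of_real (P ((norm z)\<^sup>2)) + (z * cnj z) * of_real (P' ((norm z)\<^sup>2))"
      by (simp add: algebra_simps)
    also have "\<dots> = of_real (P ((norm z)\<^sup>2) + (norm z)\<^sup>2 * P' ((norm z)\<^sup>2))"
      by (simp only: of_real_add of_real_mult complex_norm_square)
    also have "\<dots> = of_real (bump \<epsilon> z)"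
      unfolding FP' bump_def d_def[symmetric] using le by simp
    finally show "1 * complex_of_real (P ((norm z)\<^sup>2)) + cnj z * (of_real (P' ((norm z)\<^sup>2)) * z) = of_real (bump \<epsilon> z)" .
  qed
  have 2: "\<exists>p m. C2w (- {0}) c p (\<lambda>z. of_real (bump \<epsilon> z)) m"
  proof -
    have o: "open (- {0::complex})" by auto
    obtain m' where a: "C2w (- {0}) (\<lambda>z. of_real (max 0 (- 1 / d * (norm z)\<^sup>2 + 1) ^ (1 + 3)))
       (\<lambda>z. of_real (real (1 + 3) * max 0 (- 1 / d * (norm z)\<^sup>2 + 1) ^ (1 + 2)) * (of_real (- 1 / d) * cnj z))
       (\<lambda>z. of_real (real (1 + 3) * max 0 (- 1 / d * (norm z)\<^sup>2 + 1) ^ (1 + 2)) * (of_real (- 1 / d) * z)) m'"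
      by (rule C2w_max_power[OF C2w_affine[OF nsq o]])
    have i: "C2w (- {0}) inverse (deriv inverse) (\<lambda>z. 0) (\<lambda>z. 0)"
      by (rule C2w_holomorphic[OF _ o]) (auto intro!: holomorphic_intros)
    note b = C2w_mult[OF C2w_affine[OF a o, of "-1" 1] i]
    show ?thesis
    proof (intro exI, rule C2w_transform[OF b o _ refl _ refl])
      fix z :: complex assume z: "z \<in> - {0}"
      have y: "- 1 / d * (norm z)\<^sup>2 + 1 = 1 - (norm z)\<^sup>2 / d" by simp
      show "of_real (- 1 * max 0 (- 1 / d * (norm z)\<^sup>2 + 1) ^ (1 + 3) + 1) * inverse z = c z"
        unfolding y c_def by (simp add: eval_nat_numeral)
      show "of_real (- 1) * (of_real (real (1 + 3) * max 0 (- 1 / d * (norm z)\<^sup>2 + 1) ^ (1 + 2)) * (of_real (- 1 / d) * z)) * inverse z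
        + of_real (- 1 * max 0 (- 1 / d * (norm z)\<^sup>2 + 1) ^ (1 + 3) + 1) * 0 = complex_of_real (bump \<epsilon> z)"
        unfolding y bump_def d_def[symmetric] using z by (simp add: eval_nat_numeral)
    qed
  qed
  from 1 2 obtain p m p' m' where
    "C2w (ball 0 \<epsilon>) c p (\<lambda>z. of_real (bump \<epsilon> z)) m" "C2w (- {0}) c p' (\<lambda>z. of_real (bump \<epsilon> z)) m'" by blast
  then obtain p'' m'' where "C2w (ball 0 \<epsilon> \<union> - {0}) c p'' (\<lambda>z. of_real (bump \<epsilon> z)) m''"
    by (rule C2w_Un) auto
  moreover have "ball 0 \<epsilon> \<union> - {0} = (UNIV :: complex set)" using e by auto
  ultimately have C: "C2w UNIV c p'' (\<lambda>z. of_real (bump \<epsilon> z)) m''" by simp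
  have "c z = inverse z" if "\<epsilon> \<le> norm z" for z
  proof -
    have "d \<le> (norm z)\<^sup>2" unfolding d_def using that e by (intro power_mono) auto
    then have "1 - (norm z)\<^sup>2 / d \<le> 0" using d by simp
    then show ?thesis by (simp add: c_def max_absorb1)
  qed
  with C show thesis by (rule that)
qed

lemma C2w_shift:
  assumes "C2w UNIV f p q m"
  shows "C2w UNIV (\<lambda>z. f (z - w)) (\<lambda>z. p (z - w)) (\<lambda>z. q (z - w)) (\<lambda>z. m (z - w))"
proof -
  have 1: "C1w UNIV (\<lambda>z. f (z - w)) (\<lambda>z. p (z - w)) (\<lambda>z. q (z - w))" if "C1w UNIV f p q" for f p q
  proof (rule C1wI)
    fix z
    have "has_wirt f (p (z - w)) (q (z - w)) (z + - w)"
      using C1w_D[OF that, of "z - w"] by simp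
    from has_wirt_shift[OF this] show "has_wirt (\<lambda>z. f (z - w)) (p (z - w)) (q (z - w)) z" by simp
  next
    have d: "continuous_on UNIV (\<lambda>z. z - w)" by (intro continuous_intros)
    show "continuous_on UNIV (\<lambda>z. p (z - w))" "continuous_on UNIV (\<lambda>z. q (z - w))"
      by (rule continuous_on_compose2[OF C1w_continuous(2)[OF that] d] continuous_on_compose2[OF C1w_continuous(3)[OF that] d], simp)+
  qed
  then show ?thesis using assms unfolding C2w_def by blast
qed

text \<open>\<open>p\<close>, \<open>q\<close> and \<open>m\<close> are the first and mixed
  derivatives of \<open>b\<close>. Values of \<open>b\<close> off the disk are left free, as the
  weight has no meaning there.\<close>

definition test_fun :: "(complex \<Rightarrow> complex) \<Rightarrow> (complex \<Rightarrow> complex) \<Rightarrow> (complex \<Rightarrow> complex) \<Rightarrow> (complex \<Rightarrow> complex) \<Rightarrow> bool"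
  where "test_fun b p q m \<longleftrightarrow> C2w disk b p q m \<and> (\<exists>K. compact K \<and> K \<subseteq> disk \<and> (\<forall>z\<in>disk. z \<notin> K \<longrightarrow> b z = 0))"

text \<open>Borel measure without the factor 1/pi; the passage to \<open>disk_area\<close> happens
  once, in \<open>disk_area_conversion\<close>.\<close>

abbreviation diskm :: "complex measure"
  where "diskm \<equiv> restrict_space lborel disk"

section \<open>Measure on the disk and criteria for vanishing almost everywhere\<close>

lemma finite_measure_diskm: "finite_measure diskm"
proof
  have "emeasure lborel (disk :: complex set) < \<infinity>"
    by (rule emeasure_bounded_finite) simp
  then show "emeasure diskm (space diskm) \<noteq> \<infinity>"
    by (subst emeasure_restrict_space) (auto simp: space_restrict_space)
qed

lemma measurable_diskm_continuous:
  fixes f :: "complex \<Rightarrow> 'b::{second_countable_topology, real_normed_vector}"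
  assumes "continuous_on disk f"
  shows "f \<in> borel_measurable diskm"
proof -
  have "f \<in> borel_measurable (restrict_space borel disk)"
    by (rule borel_measurable_continuous_on_restrict[OF assms])
  then show ?thesis
    by (simp cong: measurable_cong_sets sets_restrict_space_cong add: measurable_cong_sets[OF sets_restrict_space_cong[OF sets_lborel]])
qed

lemma space_diskm [simp]: "space diskm = disk"
  by (simp add: space_restrict_space)

text \<open>Dynkin's argument: the sets over which \<open>v\<close> integrates to zero include the
  open sets, which generate the Borel sets and are stable under intersection, and they are closed
  under complements and countable disjoint unions.\<close>

lemma AE_lborel_open_zero:
  fixes v :: "complex \<Rightarrow> complex"
  assumes v: "integrable lborel v" and z: "\<And>O'. open O' \<Longrightarrow> (\<integral>z. indicator O' z *\<^sub>R v z \<partial>lborel) = 0"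
  shows "AE z in lborel. v z = 0"
proof -
  have "(\<integral>z. indicator A z *\<^sub>R v z \<partial>lborel) = 0" if "A \<in> sets borel" for A
  proof -
    have 1: "Int_stable {S :: complex set. open S}" "{S :: complex set. open S} \<subseteq> Pow UNIV"
      by (auto simp: Int_stable_def)
    from that have 2: "A \<in> sigma_sets UNIV {S. open S}"
      by (simp add: borel_def)
    from 1 2 show ?thesis
    proof (induction rule: sigma_sets_induct_disjoint)
      case (basic A)
      then show ?case using z by auto
    next
      case empty
      then show ?case by simp
    next
      case (compl A)
      then have A: "A \<in> sets borel" by (simp add: borel_def)
      have "(\<integral>z. indicator (UNIV - A) z *\<^sub>R v z \<partial>lborel) = (\<integral>z. v z - indicator A z *\<^sub>R v z \<partial>lborel)"
        by (rule Bochner_Integration.integral_cong) (auto simp: indicator_def)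
      also have "\<dots> = (\<integral>z. v z \<partial>lborel) - (\<integral>z. indicator A z *\<^sub>R v z \<partial>lborel)"
        using A v by (intro Bochner_Integration.integral_diff integrable_mult_indicator) auto
      also have "(\<integral>z. v z \<partial>lborel) = 0" using z[of UNIV] by simp
      finally show ?case using compl by simp
    next
      case (union A)
      then have A: "\<And>i. A i \<in> sets lborel" by (auto simp: borel_def)
      have "set_lebesgue_integral lborel (\<Union>i. A i) v = (\<Sum>i. set_lebesgue_integral lborel (A i) v)"
      proof (rule lebesgue_integral_countable_add)
        show "set_integrable lborel (\<Union>i. A i) v"
          unfolding set_integrable_def using A v by (intro integrable_mult_indicator) auto
        show "A i \<inter> A j = {}" if "i \<noteq> j" for i j
          using union that by (auto simp: disjoint_family_on_def)
      qed (use A in auto)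
      then show ?case using union by (simp add: set_lebesgue_integral_def)
    qed
  qed
  then have "AE z in lborel. v z = (\<lambda>z. 0) z"
    using v by (intro sigma_finite_measure.density_unique_banach[OF sigma_finite_lborel]) (auto simp: set_lebesgue_integral_def)
  then show ?thesis by simp
qed

text \<open>It suffices to test against Lipschitz functions: they approximate indicators of open sets
  from below.\<close>

lemma AE_lborel_lipschitz_zero:
  fixes v :: "complex \<Rightarrow> complex"
  assumes v: "integrable lborel v" and U: "open U" "\<And>z. z \<notin> U \<Longrightarrow> v z = 0"
    and z: "\<And>\<psi> L. (\<And>x y. \<bar>\<psi> x - \<psi> y\<bar> \<le> L * norm (x - y)) \<Longrightarrow> (\<And>x. x \<notin> U \<Longrightarrow> \<psi> x = 0) \<Longrightarrow>
      (\<And>x. 0 \<le> \<psi> x \<and> \<psi> x \<le> 1) \<Longrightarrow> (\<integral>z. of_real (\<psi> z) * v z \<partial>lborel) = 0"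
  shows "AE z in lborel. v z = 0"
proof (rule AE_lborel_open_zero[OF v])
  fix O' :: "complex set" assume "open O'"
  define S where "S = - (O' \<inter> U)"
  have S: "closed S" using \<open>open O'\<close> U(1) by (auto simp: S_def)
  show "(\<integral>z. indicator O' z *\<^sub>R v z \<partial>lborel) = 0"
  proof (cases "S = {}")
    case True
    then have "O' = UNIV" "U = UNIV" by (auto simp: S_def)
    then show ?thesis using z[of "\<lambda>_. 1" 0] by simp
  next
    case False
    \<comment> \<open>These increase to the indicator of the intersection of \<open>O'\<close> and
      \<open>U\<close>. Intersecting with \<open>U\<close> makes them admissible and loses nothing,
      because \<open>v\<close> vanishes off \<open>U\<close>.\<close>
    define \<psi> where "\<psi> n x = min 1 (real n * infdist x S)" for n x
    have inf: "\<bar>infdist x S - infdist y S\<bar> \<le> norm (x - y)" for x y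
      using infdist_triangle_abs[of x S y] by (simp add: dist_norm)
    have lip: "\<bar>\<psi> n x - \<psi> n y\<bar> \<le> real n * norm (x - y)" for n x y
    proof -
      have "\<bar>\<psi> n x - \<psi> n y\<bar> \<le> \<bar>real n * infdist x S - real n * infdist y S\<bar>"
        unfolding \<psi>_def by linarith
      also have "\<dots> = real n * \<bar>infdist x S - infdist y S\<bar>"
        by (simp add: abs_mult flip: right_diff_distrib)
      also have "\<dots> \<le> real n * norm (x - y)"
        by (intro mult_left_mono inf) auto
      finally show ?thesis .
    qed
    have r: "0 \<le> \<psi> n x \<and> \<psi> n x \<le> 1" for n x
      unfolding \<psi>_def by (simp add: infdist_nonneg)
    have zero: "\<psi> n x = 0" if "x \<in> S" for n x
      unfolding \<psi>_def using that by simp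
    have 0: "(\<integral>z. of_real (\<psi> n z) * v z \<partial>lborel) = 0" for n
      by (rule z[OF lip _ r]) (use zero in \<open>auto simp: S_def\<close>)
    have "(\<lambda>n. \<integral>z. of_real (\<psi> n z) * v z \<partial>lborel) \<longlonglongrightarrow> (\<integral>z. indicator O' z *\<^sub>R v z \<partial>lborel)"
    proof (rule integral_dominated_convergence[where w = "\<lambda>z. norm (v z)"])
      show "(\<lambda>z. indicator O' z *\<^sub>R v z) \<in> borel_measurable lborel"
        using \<open>open O'\<close> by (intro borel_measurable_integrable[OF integrable_mult_indicator[OF _ v]]) auto
      show "(\<lambda>z. of_real (\<psi> n z) * v z) \<in> borel_measurable lborel" for n
      proof (rule borel_measurable_times[OF _ borel_measurable_integrable[OF v]])
        have "continuous_on UNIV (\<lambda>z. complex_of_real (\<psi> n z))"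
          unfolding \<psi>_def by (intro continuous_intros)
        then show "(\<lambda>z. complex_of_real (\<psi> n z)) \<in> borel_measurable lborel"
          by (simp add: borel_measurable_continuous_onI)
      qed
      show "AE x in lborel. norm (of_real (\<psi> n x) * v x) \<le> norm (v x)" for n
        using r[of n] by (auto simp: norm_mult intro!: AE_I2 mult_left_le_one_le)
      show "AE x in lborel. (\<lambda>n. of_real (\<psi> n x) * v x) \<longlonglongrightarrow> indicator O' x *\<^sub>R v x"
      proof (rule AE_I2)
        fix x
        show "(\<lambda>n. of_real (\<psi> n x) * v x) \<longlonglongrightarrow> indicator O' x *\<^sub>R v x"
        proof (cases "x \<in> S")
          case True
          then have "indicator O' x *\<^sub>R v x = 0" using U(2) by (auto simp: S_def indicator_def)
          then have "(\<lambda>n. of_real (\<psi> n x) * v x) = (\<lambda>n. indicator O' x *\<^sub>R v x)"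
            using zero[OF True] by (simp only: of_real_0 mult_zero_left)
          then show ?thesis by (simp only: tendsto_const)
        next
          case x: False
          then have "0 < infdist x S"
            using S False infdist_nonneg[of x S] in_closed_iff_infdist_zero[OF S False, of x] by linarith
          then obtain N where N: "1 < real N * infdist x S"
            using reals_Archimedean3 by blast
          have "\<psi> n x = 1" if "n \<ge> N" for n
          proof -
            have "real N * infdist x S \<le> real n * infdist x S"
              using that by (intro mult_right_mono) (auto simp: infdist_nonneg)
            then show ?thesis using N unfolding \<psi>_def by linarith
          qed
          then have "\<forall>\<^sub>F n in sequentially. of_real (\<psi> n x) * v x = indicator O' x *\<^sub>R v x"
            using x by (auto simp: eventually_sequentially S_def)
          then show ?thesis by (rule tendsto_eventually)
        qed
      qed
    qed (use v in auto)
    then show ?thesis unfolding 0 by (simp add: LIMSEQ_const_iff)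
  qed
qed

section \<open>Mollification of weak solutions of the Cauchy-Riemann equation\<close>

lemma bump_cont: "continuous_on S (\<lambda>z. bump \<epsilon> (z - w))"
  by (cases "\<epsilon> = 0") (auto simp: bump_def intro!: continuous_intros)

lemma bump_zero: "0 < \<epsilon> \<Longrightarrow> \<epsilon> \<le> norm z \<Longrightarrow> bump \<epsilon> z = 0"
proof -
  assume "0 < \<epsilon>" "\<epsilon> \<le> norm z"
  then have "\<epsilon>\<^sup>2 \<le> (norm z)\<^sup>2" "0 < \<epsilon>\<^sup>2" by (auto intro: power_mono)
  then have "1 - (norm z)\<^sup>2 / \<epsilon>\<^sup>2 \<le> 0" by simp
  then show ?thesis by (simp add: bump_def max_absorb1)
qed

text \<open>Testing against \<open>\<eta>(\<zeta>) c(\<zeta> - w)\<close>, with \<open>c\<close> as in \<open>cauchy_bump\<close> and a cutoff \<open>\<eta>\<close>, shows that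
  the mollification of \<open>u\<close> at \<open>w\<close> is a Cauchy-type integral, independent of the radius.\<close>

context
  fixes u :: "complex \<Rightarrow> complex"
  assumes um: "u \<in> borel_measurable diskm"
    and ui: "\<And>K. compact K \<Longrightarrow> K \<subseteq> disk \<Longrightarrow> integrable diskm (\<lambda>z. indicator K z *\<^sub>R u z)"
    and weak: "\<And>b p q m. test_fun b p q m \<Longrightarrow> (\<integral>z. u z * q z \<partial>diskm) = 0"
begin

private lemma int_mult:
  assumes K: "compact K" "K \<subseteq> disk" and h: "continuous_on disk h" and 0: "\<And>z. z \<in> disk \<Longrightarrow> z \<notin> K \<Longrightarrow> h z = 0"
  shows "integrable diskm (\<lambda>z. u z * h z)"
proof -
  have "bounded (h ` K)"
    using K h by (intro compact_imp_bounded compact_continuous_image) (auto intro: continuous_on_subset)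
  then obtain B where B: "\<And>z. z \<in> K \<Longrightarrow> norm (h z) \<le> B" by (auto simp: bounded_iff)
  show ?thesis
  proof (rule Bochner_Integration.integrable_bound)
    show "integrable diskm (\<lambda>z. B *\<^sub>R (indicator K z *\<^sub>R u z))"
      by (intro integrable_scaleR_right ui K)
    show "(\<lambda>z. u z * h z) \<in> borel_measurable diskm"
      using um measurable_diskm_continuous[OF h] by measurable
    show "AE z in diskm. norm (u z * h z) \<le> norm (B *\<^sub>R (indicator K z *\<^sub>R u z))"
    proof (rule AE_I2)
      fix z assume "z \<in> space diskm"
      then show "norm (u z * h z) \<le> norm (B *\<^sub>R (indicator K z *\<^sub>R u z))"
        using 0[of z] B[of z] norm_ge_zero[of "h z"]
        by (cases "z \<in> K") (auto simp: norm_mult mult.commute[of "norm (u z)"] intro!: mult_right_mono)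
    qed
  qed
qed

lemma mollify:
  assumes r: "0 < r" "r < 1"
  obtains h where "integrable diskm h" "\<And>z. z \<in> disk \<Longrightarrow> norm z < r \<Longrightarrow> h z = 0"
    "\<And>w \<epsilon>. 0 < \<epsilon> \<Longrightarrow> norm w + \<epsilon> < r \<Longrightarrow> (\<integral>z. u z * of_real (bump \<epsilon> (z - w)) \<partial>diskm) = (\<integral>z. h z * inverse (z - w) \<partial>diskm)"
proof -
  define r2 where "r2 = ((1 + r) / 2)\<^sup>2"
  have r2: "r\<^sup>2 < r2" "0 < r\<^sup>2" using r by (auto simp: r2_def intro!: power_strict_mono)
  obtain \<eta> :: "complex \<Rightarrow> real" and p q m where \<eta>: "C2w UNIV (\<lambda>z. of_real (\<eta> z)) p q m"
    "\<And>z. (norm z)\<^sup>2 \<le> r\<^sup>2 \<Longrightarrow> \<eta> z = 1" "\<And>z. r2 \<le> (norm z)\<^sup>2 \<Longrightarrow> \<eta> z = 0"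
    using smooth_cutoff[OF r2(2,1)] by blast
  have eta0: "of_real (\<eta> z) = (0::complex)" if "z \<notin> cball 0 ((1 + r) / 2)" for z
  proof -
    have "(1 + r) / 2 \<le> norm z" using that by simp
    then have "r2 \<le> (norm z)\<^sup>2" unfolding r2_def using r by (intro power_mono) auto
    then show ?thesis using \<eta>(3) by simp
  qed
  have K: "compact (cball (0::complex) ((1 + r) / 2))" "cball 0 ((1 + r) / 2) \<subseteq> (disk :: complex set)"
    using r by auto
  have C1: "C1w UNIV (\<lambda>z. of_real (\<eta> z)) p q" using \<eta>(1) by (simp add: C2w_def)
  have q0: "q z = 0" if "z \<notin> cball 0 ((1 + r) / 2)" for z
    using C1w_compact_support(2)[OF C1 K(1) subset_UNIV open_UNIV eta0 UNIV_I that] .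
  have q1: "q z = 0" if "norm z < r" for z
  proof -
    have "has_wirt (\<lambda>z. 1) (p z) (q z) z"
    proof (rule has_wirt_transform[OF C1w_D[OF C1 UNIV_I] open_ball[of 0 r]])
      show "of_real (\<eta> w) = 1" if "w \<in> ball 0 r" for w
      proof -
        have "(norm w)\<^sup>2 \<le> r\<^sup>2" using that by (intro power_mono) auto
        then show ?thesis using \<eta>(2) by simp
      qed
    qed (use that in simp)
    then show ?thesis using has_wirt_unique(2)[OF _ has_wirt_const] by blast
  qed
  have qc: "continuous_on disk q" using C1w_continuous(3)[OF C1] continuous_on_subset by blast
  \<comment> \<open>\<open>h\<close> lives on the annulus from radius \<open>r\<close> to
    \<open>(1 + r) / 2\<close>, where \<open>\<eta>\<close> drops from 1 to 0. It involves neither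
    \<open>w\<close> nor \<open>\<epsilon>\<close>.\<close>
  define h where "h z = - (u z * q z)" for z
  have "integrable diskm h"
    unfolding h_def by (intro Bochner_Integration.integrable_minus int_mult[OF K qc]) (use q0 in auto)
  moreover have "h z = 0" if "norm z < r" for z
    using q1[OF that] by (simp add: h_def)
  moreover have "(\<integral>z. u z * of_real (bump \<epsilon> (z - w)) \<partial>diskm) = (\<integral>z. h z * inverse (z - w) \<partial>diskm)"
    if e: "0 < \<epsilon>" "norm w + \<epsilon> < r" for w \<epsilon>
  proof -
    obtain c pc mc where c: "C2w UNIV c pc (\<lambda>z. of_real (bump \<epsilon> z)) mc" "\<And>z. \<epsilon> \<le> norm z \<Longrightarrow> c z = inverse z"
      using cauchy_bump[OF e(1)] by blast
    note b = C2w_mult[OF \<eta>(1) C2w_shift[OF c(1), of w]]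
    \<comment> \<open>For \<open>norm z < r\<close> the derivative \<open>q\<close> is 0 and
      \<open>\<eta>\<close> is 1. Otherwise \<open>z\<close> is at least \<open>\<epsilon>\<close>
      away from \<open>w\<close>, so \<open>c\<close> is the Cauchy kernel and the bump is
      0.\<close>
    have eq: "q z * c (z - w) + of_real (\<eta> z) * of_real (bump \<epsilon> (z - w)) = q z * inverse (z - w) + of_real (bump \<epsilon> (z - w))" for z
    proof (cases "norm z < r")
      case True
      then have "(norm z)\<^sup>2 \<le> r\<^sup>2" by (intro power_mono) auto
      then show ?thesis using q1[OF True] \<eta>(2) by simp
    next
      case False
      then have "\<epsilon> \<le> norm (z - w)" using e norm_triangle_ineq2[of z w] by linarith
      then show ?thesis using c(2) bump_zero[OF e(1)] by simp
    qed
    have "test_fun (\<lambda>z. of_real (\<eta> z) * c (z - w)) (\<lambda>z. p z * c (z - w) + of_real (\<eta> z) * pc (z - w))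
        (\<lambda>z. q z * inverse (z - w) + of_real (bump \<epsilon> (z - w)))
        (\<lambda>z. m z * c (z - w) + p z * of_real (bump \<epsilon> (z - w)) + (q z * pc (z - w) + of_real (\<eta> z) * mc (z - w)))"
      unfolding test_fun_def
    proof (intro conjI exI[of _ "cball 0 ((1 + r) / 2)"] K ballI impI)
      show "C2w disk (\<lambda>z. of_real (\<eta> z) * c (z - w)) (\<lambda>z. p z * c (z - w) + of_real (\<eta> z) * pc (z - w))
        (\<lambda>z. q z * inverse (z - w) + of_real (bump \<epsilon> (z - w)))
        (\<lambda>z. m z * c (z - w) + p z * of_real (bump \<epsilon> (z - w)) + (q z * pc (z - w) + of_real (\<eta> z) * mc (z - w)))"
        unfolding eq[symmetric] by (rule C2w_subset[OF b]) simp
      show "of_real (\<eta> z) * c (z - w) = 0" if "z \<notin> cball 0 ((1 + r) / 2)" for z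
        using eta0[OF that] by simp
    qed
    from weak[OF this] have "(\<integral>z. u z * of_real (bump \<epsilon> (z - w)) - h z * inverse (z - w) \<partial>diskm) = 0"
      by (simp add: h_def algebra_simps)
    moreover have "integrable diskm (\<lambda>z. u z * of_real (bump \<epsilon> (z - w)))"
    proof (rule int_mult[of "cball w \<epsilon>"])
      show "cball w \<epsilon> \<subseteq> disk"
        using e r norm_triangle_ineq[of w] by (auto simp: subset_iff dist_norm) (smt (verit) norm_minus_commute norm_triangle_sub)
      show "continuous_on disk (\<lambda>z. complex_of_real (bump \<epsilon> (z - w)))"
        by (intro continuous_intros bump_cont)
      show "complex_of_real (bump \<epsilon> (z - w)) = 0" if "z \<notin> cball w \<epsilon>" for z
        using bump_zero[OF e(1), of "z - w"] that by (simp add: dist_norm norm_minus_commute)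
    qed simp
    moreover have "integrable diskm (\<lambda>z. h z * inverse (z - w))"
    proof -
      have 1: "continuous_on disk (\<lambda>z. q z * inverse (z - w))"
      proof -
        have "continuous_on disk (\<lambda>z. q z * c (z - w))"
          using C1w_continuous(1) C2w_shift[OF c(1), of w] qc unfolding C2w_def
          by (intro continuous_intros) (blast intro: continuous_on_subset)+
        moreover have "q z * c (z - w) = q z * inverse (z - w)" for z
        proof (cases "norm z < r")
          case False
          then have "\<epsilon> \<le> norm (z - w)" using e norm_triangle_ineq2[of z w] by linarith
          then show ?thesis by (simp add: c(2))
        qed (simp add: q1)
        ultimately show ?thesis by simp
      qed
      have "integrable diskm (\<lambda>z. u z * (q z * inverse (z - w)))"
        by (rule int_mult[OF K 1]) (use q0 in auto)
      from Bochner_Integration.integrable_minus[OF this] show ?thesis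
        by (simp add: h_def mult.assoc)
    qed
    ultimately show ?thesis by simp
  qed
  ultimately show thesis using that by blast
qed

end

text \<open>The density sits at distance at least \<open>r - \<rho>\<close> from every admissible
  \<open>w\<close>. There the second-order Taylor remainder of the kernel is uniformly bounded, so
  the integral can be differentiated directly.\<close>

lemma cauchy_type_holomorphic:
  assumes h: "integrable diskm h" "\<And>z. z \<in> disk \<Longrightarrow> norm z < r \<Longrightarrow> h z = 0" and \<rho>: "\<rho> < r"
  shows "(\<lambda>w. \<integral>z. h z * inverse (z - w) \<partial>diskm) holomorphic_on ball 0 \<rho>"
proof -
  define \<delta> where "\<delta> = r - \<rho>"
  have \<delta>: "0 < \<delta>" using \<rho> by (simp add: \<delta>_def)
  have hm [measurable]: "h \<in> borel_measurable diskm" using h by auto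
  have mi: "(\<lambda>z. inverse (z - w)) \<in> borel_measurable diskm" for w :: complex
    by (rule measurable_restrict_space1) simp
  have far: "\<delta> \<le> norm (z - w)" if "z \<in> disk" "h z \<noteq> 0" "w \<in> ball 0 \<rho>" for z w
    using h(2)[OF that(1)] that norm_triangle_ineq2[of z w] by (force simp: \<delta>_def)
  have inv: "norm (inverse (z - w)) \<le> inverse \<delta>" if "z \<in> disk" "h z \<noteq> 0" "w \<in> ball 0 \<rho>" for z w
    using far[OF that] \<delta> by (simp add: norm_inverse le_imp_inverse_le)
  have i1: "integrable diskm (\<lambda>z. h z * inverse (z - w))" if "w \<in> ball 0 \<rho>" for w
  proof (rule Bochner_Integration.integrable_bound)
    show "integrable diskm (\<lambda>z. inverse \<delta> *\<^sub>R h z)" using h by simp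
    show "(\<lambda>z. h z * inverse (z - w)) \<in> borel_measurable diskm" using mi by measurable
    show "AE z in diskm. norm (h z * inverse (z - w)) \<le> norm (inverse \<delta> *\<^sub>R h z)"
    proof (rule AE_I2)
      fix z assume "z \<in> space diskm"
      then show "norm (h z * inverse (z - w)) \<le> norm (inverse \<delta> *\<^sub>R h z)"
        using inv[of z w] that \<delta> by (cases "h z = 0") (auto simp: norm_mult mult.commute[of "inverse \<delta>"] intro!: mult_left_mono)
    qed
  qed
  have i2: "integrable diskm (\<lambda>z. h z * (inverse (z - w))\<^sup>2)" if "w \<in> ball 0 \<rho>" for w
  proof (rule Bochner_Integration.integrable_bound)
    show "integrable diskm (\<lambda>z. (inverse \<delta>)\<^sup>2 *\<^sub>R h z)" using h by simp
    show "(\<lambda>z. h z * (inverse (z - w))\<^sup>2) \<in> borel_measurable diskm" using mi by measurable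
    show "AE z in diskm. norm (h z * (inverse (z - w))\<^sup>2) \<le> norm ((inverse \<delta>)\<^sup>2 *\<^sub>R h z)"
    proof (rule AE_I2)
      fix z assume "z \<in> space diskm"
      then show "norm (h z * (inverse (z - w))\<^sup>2) \<le> norm ((inverse \<delta>)\<^sup>2 *\<^sub>R h z)"
        using inv[of z w] that \<delta>
        by (cases "h z = 0") (auto simp: norm_mult norm_power mult.commute[of "(inverse \<delta>)\<^sup>2"] intro!: mult_left_mono power_mono)
    qed
  qed
  let ?f = "\<lambda>w. \<integral>z. h z * inverse (z - w) \<partial>diskm" and ?D = "\<lambda>w. \<integral>z. h z * (inverse (z - w))\<^sup>2 \<partial>diskm"
  define C where "C = inverse \<delta> ^ 3 * (\<integral>z. norm (h z) \<partial>diskm)"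
  have bound: "norm (?f w' - ?f w - (w' - w) * ?D w) \<le> C * (norm (w' - w))\<^sup>2" if w: "w \<in> ball 0 \<rho>" "w' \<in> ball 0 \<rho>" for w w'
  proof -
    let ?R = "\<lambda>z. h z * inverse (z - w') - h z * inverse (z - w) - (w' - w) * (h z * (inverse (z - w))\<^sup>2)"
    have iR: "integrable diskm ?R"
      by (intro Bochner_Integration.integrable_diff integrable_mult_right i1 i2 w)
    have "(\<integral>z. ?R z \<partial>diskm) = (\<integral>z. h z * inverse (z - w') - h z * inverse (z - w) \<partial>diskm) - (\<integral>z. (w' - w) * (h z * (inverse (z - w))\<^sup>2) \<partial>diskm)"
      by (intro Bochner_Integration.integral_diff Bochner_Integration.integrable_diff integrable_mult_right i1 i2 w)
    also have "(\<integral>z. h z * inverse (z - w') - h z * inverse (z - w) \<partial>diskm) = ?f w' - ?f w"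
      by (intro Bochner_Integration.integral_diff i1 w)
    finally have "norm (?f w' - ?f w - (w' - w) * ?D w) = norm (\<integral>z. ?R z \<partial>diskm)"
      by (simp only: integral_mult_right_zero)
    also have "norm (\<integral>z. ?R z \<partial>diskm) \<le> (\<integral>z. norm (?R z) \<partial>diskm)"
      by (rule integral_norm_bound)
    also have "\<dots> \<le> (\<integral>z. ((norm (w' - w))\<^sup>2 * inverse \<delta> ^ 3) * norm (h z) \<partial>diskm)"
    proof (rule integral_mono)
      show "integrable diskm (\<lambda>z. norm (?R z))" using iR by (rule integrable_norm)
      show "integrable diskm (\<lambda>z. ((norm (w' - w))\<^sup>2 * inverse \<delta> ^ 3) * norm (h z))" using h by simp
      fix z assume z: "z \<in> space diskm"
      show "norm (?R z) \<le> ((norm (w' - w))\<^sup>2 * inverse \<delta> ^ 3) * norm (h z)"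
      proof (cases "h z = 0")
        case False
        have nz: "z - w \<noteq> 0" "z - w' \<noteq> 0"
          using far[of z w] far[of z w'] False z w \<delta> by auto
        have "?R z = (w' - w)\<^sup>2 * (inverse (z - w') * (inverse (z - w))\<^sup>2) * h z"
        proof -
          have "inverse a - inverse b - (b - a) * (inverse b)\<^sup>2 = (b - a)\<^sup>2 * (inverse a * (inverse b)\<^sup>2)"
            if "a \<noteq> 0" "b \<noteq> 0" for a b :: complex
            using that by (simp add: divide_simps power2_eq_square) (simp add: algebra_simps)
          from this[OF nz(2,1)] have "h z * (inverse (z - w') - inverse (z - w) - (w' - w) * (inverse (z - w))\<^sup>2) =
              h z * ((w' - w)\<^sup>2 * (inverse (z - w') * (inverse (z - w))\<^sup>2))"
            by simp
          then show ?thesis by (simp only: right_diff_distrib mult.assoc mult.commute mult.left_commute)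
        qed
        then have "norm (?R z) = (norm (w' - w))\<^sup>2 * (norm (inverse (z - w')) * (norm (inverse (z - w)))\<^sup>2) * norm (h z)"
          by (simp only: norm_mult norm_power)
        also have "\<dots> \<le> (norm (w' - w))\<^sup>2 * (inverse \<delta> * (inverse \<delta>)\<^sup>2) * norm (h z)"
          using inv[of z w] inv[of z w'] False z w \<delta>
          by (intro mult_right_mono mult_left_mono mult_mono power_mono) auto
        finally show ?thesis by (simp add: power2_eq_square power3_eq_cube mult.assoc)
      qed simp
    qed
    also have "\<dots> = C * (norm (w' - w))\<^sup>2" by (simp add: C_def)
    finally show ?thesis .
  qed
  have "(?f has_field_derivative ?D w) (at w)" if w: "w \<in> ball 0 \<rho>" for w
  proof -
    have "((\<lambda>w'. (?f w' - ?f w) / (w' - w) - ?D w) \<longlongrightarrow> 0) (at w)"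
    proof (rule Lim_null_comparison)
      have "\<forall>\<^sub>F w' in at w. w' \<in> ball 0 \<rho>"
        using w by (intro eventually_at_in_open') auto
      moreover have "\<forall>\<^sub>F w' in at w. w' \<noteq> w" by (simp add: eventually_at_filter)
      ultimately show "\<forall>\<^sub>F w' in at w. norm ((?f w' - ?f w) / (w' - w) - ?D w) \<le> C * norm (w' - w)"
      proof eventually_elim
        case (elim w')
        have "(?f w' - ?f w) / (w' - w) - ?D w = (?f w' - ?f w - (w' - w) * ?D w) / (w' - w)"
          using elim by (simp add: diff_divide_distrib)
        then have "norm ((?f w' - ?f w) / (w' - w) - ?D w) = norm (?f w' - ?f w - (w' - w) * ?D w) / norm (w' - w)"
          by (simp only: norm_divide)
        also have "\<dots> \<le> C * (norm (w' - w))\<^sup>2 / norm (w' - w)"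
          by (intro divide_right_mono bound w elim) auto
        finally show ?case using elim by (simp add: power2_eq_square)
      qed
      have "((\<lambda>w'. C * norm (w' - w)) \<longlongrightarrow> C * norm (w - w)) (at w)"
        by (intro tendsto_intros)
      then show "((\<lambda>w'. C * norm (w' - w)) \<longlongrightarrow> 0) (at w)" by simp
    qed
    then have "((\<lambda>w'. (?f w' - ?f w) / (w' - w)) \<longlongrightarrow> ?D w) (at w)"
      by (rule LIM_zero_cancel)
    then show ?thesis by (simp add: has_field_derivative_iff)
  qed
  then show ?thesis
    unfolding holomorphic_on_def field_differentiable_def by (blast intro: has_field_derivative_at_within)
qed

lemma bump_nonneg: "0 \<le> bump \<epsilon> z"
  by (simp add: bump_def)

lemma bump_le: "bump \<epsilon> z \<le> 4 / \<epsilon>\<^sup>2"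
proof -
  have "max 0 (1 - (norm z)\<^sup>2 / \<epsilon>\<^sup>2) ^ 3 \<le> 1 ^ 3"
    by (intro power_mono) auto
  then show ?thesis
    unfolding bump_def by (intro mult_left_le) auto
qed

lemma bump_integrable: "0 < \<epsilon> \<Longrightarrow> integrable lborel (\<lambda>z. bump \<epsilon> (z - w))"
  by (rule integrable_compact_support[of "cball w \<epsilon>"])
     (auto intro: bump_cont bump_zero simp: dist_norm norm_minus_commute)

lemma integral_restrict_lborel:
  fixes f :: "complex \<Rightarrow> 'b::{banach, second_countable_topology}"
  assumes "\<And>z. z \<notin> disk \<Longrightarrow> f z = 0"
  shows "integral\<^sup>L diskm f = (\<integral>z. f z \<partial>lborel)"
proof -
  have "(\<lambda>z. indicator disk z *\<^sub>R f z) = f" using assms by (auto simp: indicator_def fun_eq_iff)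
  then show ?thesis by (subst integral_restrict_space) auto
qed

text \<open>\<open>mollify\<close> for the constant function 1 expresses the mass by an integral in
  which \<open>\<epsilon>\<close> no longer occurs. The bound 1/2 keeps the bump inside the range of
  \<open>mollify\<close>; the value \<open>M\<close> stays anonymous, since only its positivity
  matters.\<close>

lemma bump_mass:
  obtains M where "0 < M" "\<And>\<epsilon> w. 0 < \<epsilon> \<Longrightarrow> \<epsilon> < 1/2 \<Longrightarrow> (\<integral>z. bump \<epsilon> (z - w) \<partial>lborel) = M"
proof -
  have w: "(\<integral>z. 1 * q z \<partial>diskm) = 0" if "test_fun b p q m" for b p q m
    using that integral_wirt_eq_0(2)[of disk b p q] unfolding test_fun_def C2w_def by auto
  have i: "integrable diskm (\<lambda>z. indicator K z *\<^sub>R (1::complex))" if "compact K" for K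
  proof -
    have "integrable lborel (\<lambda>z. indicator disk z *\<^sub>R (indicator K z *\<^sub>R (1::complex)))"
      by (rule integrable_mult_indicator[OF _ borel_integrable_compact[OF that]]) auto
    then show ?thesis by (subst integrable_restrict_space) auto
  qed
  obtain h where h: "\<And>w \<epsilon>. 0 < \<epsilon> \<Longrightarrow> norm w + \<epsilon> < 1/2 \<Longrightarrow>
      (\<integral>z. 1 * complex_of_real (bump \<epsilon> (z - w)) \<partial>diskm) = (\<integral>z. h z * inverse (z - w) \<partial>diskm)"
    by (rule mollify[of "\<lambda>_. 1" "1/2"]) (use w i in auto)
  have eq: "complex_of_real (\<integral>z. bump \<epsilon> (z - w) \<partial>lborel) = (\<integral>z. h z * inverse (z - 0) \<partial>diskm)"
    if e: "0 < \<epsilon>" "\<epsilon> < 1/2" for \<epsilon> w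
  proof -
    have "(\<integral>z. bump \<epsilon> (z - w) \<partial>lborel) = (\<integral>z. bump \<epsilon> z \<partial>lborel)"
      using lborel_integral_shift[of "bump \<epsilon>" "- w"] borel_measurable_integrable[OF bump_integrable[OF e(1), of 0]] by simp
    also have "complex_of_real \<dots> = (\<integral>z. complex_of_real (bump \<epsilon> z) \<partial>lborel)"
      by simp
    also have "\<dots> = (\<integral>z. complex_of_real (bump \<epsilon> z) \<partial>diskm)"
      by (rule integral_restrict_lborel[symmetric]) (use bump_zero[OF e(1)] e in auto)
    finally show ?thesis using h[of \<epsilon> 0] e by simp
  qed
  define M where "M = (\<integral>z. bump (1/4) (z - 0) \<partial>lborel)"
  have "(\<integral>z. bump \<epsilon> (z - w) \<partial>lborel) = M" if e: "0 < \<epsilon>" "\<epsilon> < 1/2" for \<epsilon> w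
  proof -
    have "complex_of_real M = (\<integral>z. h z * inverse (z - 0) \<partial>diskm)"
      unfolding M_def by (rule eq) auto
    with eq[OF e, of w] show ?thesis
      by (simp only: of_real_eq_iff[symmetric, where 'a = complex])
  qed
  moreover have "0 < M"
  proof -
    \<comment> \<open>On the disk of half its radius \<open>bump (1/4)\<close> is at least
      \<open>64 * (3/4)^3 = 27\<close>.\<close>
    have "0 < 27 * measure lborel (ball (0::complex) (1/8))"
      by (simp add: content_ball)
    also have "\<dots> = (\<integral>z. 27 * indicator (ball (0::complex) (1/8)) z \<partial>lborel)"
      by simp
    also have "\<dots> \<le> M"
      unfolding M_def
    proof (rule integral_mono[OF _ bump_integrable])
      show "integrable lborel (\<lambda>z. 27 * indicator (ball (0::complex) (1/8)) z :: real)"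
        by (intro integrable_mult_right integrable_real_indicator) (auto intro: emeasure_bounded_finite[OF bounded_ball, unfolded infinity_ennreal_def])
      fix z :: complex
      have "27 \<le> bump (1/4) z" if "norm z < 1/8"
      proof -
        have "(norm z)\<^sup>2 \<le> (1/8)\<^sup>2" using that by (intro power_mono) auto
        then have "(3/4) ^ 3 \<le> max 0 (1 - (norm z)\<^sup>2 / (1/4)\<^sup>2) ^ 3"
          by (intro power_mono) (auto simp: power2_eq_square)
        then have "4 / (1/4)\<^sup>2 * (3/4) ^ 3 \<le> bump (1/4) z"
          unfolding bump_def by (intro mult_left_mono) auto
        then show ?thesis by (simp add: power2_eq_square power3_eq_cube)
      qed
      then show "27 * indicator (ball 0 (1/8)) z \<le> bump (1/4) (z - 0)"
        using bump_nonneg[of "1/4" z] by (auto simp: indicator_def)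
    qed simp
    finally show ?thesis .
  qed
  ultimately show thesis using that by blast
qed

text \<open>The mollification of \<open>u\<close> is holomorphic and independent of the radius;
  letting the radius shrink identifies it with \<open>M * u\<close> almost everywhere. The
  identification is done weakly, against Lipschitz functions.\<close>

theorem weyl_lemma:
  fixes u :: "complex \<Rightarrow> complex"
  assumes um: "u \<in> borel_measurable diskm"
    and ui: "\<And>K. compact K \<Longrightarrow> K \<subseteq> disk \<Longrightarrow> integrable diskm (\<lambda>z. indicator K z *\<^sub>R u z)"
    and weak: "\<And>b p q m. test_fun b p q m \<Longrightarrow> (\<integral>z. u z * q z \<partial>diskm) = 0"
  obtains g where "g holomorphic_on disk" "AE z in diskm. u z = g z"
proof -
  obtain M where M: "0 < M" "\<And>\<epsilon> w. 0 < \<epsilon> \<Longrightarrow> \<epsilon> < 1/2 \<Longrightarrow> (\<integral>z. bump \<epsilon> (z - w) \<partial>lborel) = M"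
    using bump_mass by blast
  \<comment> \<open>The radius \<open>(1 - norm w) / 4\<close> is merely one admissible choice that
    works on the whole disk; by \<open>mollify\<close> smaller ones give the same value.\<close>
  define G where "G w = (\<integral>z. u z * of_real (bump ((1 - norm w) / 4) (z - w)) \<partial>diskm)" for w
  have main: "G holomorphic_on ball 0 \<rho> \<and> (AE w in lborel. w \<in> ball 0 \<rho> \<longrightarrow> u w = G w / of_real M)"
    if \<rho>: "0 < \<rho>" "\<rho> < 1" for \<rho>
  proof -
    define r where "r = (1 + \<rho>) / 2"
    have r: "0 < r" "r < 1" "\<rho> < r" using \<rho> by (auto simp: r_def)
    obtain h where h: "integrable diskm h" "\<And>z. z \<in> disk \<Longrightarrow> norm z < r \<Longrightarrow> h z = 0"
      "\<And>w \<epsilon>. 0 < \<epsilon> \<Longrightarrow> norm w + \<epsilon> < r \<Longrightarrow> (\<integral>z. u z * of_real (bump \<epsilon> (z - w)) \<partial>diskm) = (\<integral>z. h z * inverse (z - w) \<partial>diskm)"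
      by (rule mollify[OF um ui weak r(1,2)]) blast+
    have Gh: "G w = (\<integral>z. h z * inverse (z - w) \<partial>diskm)" if "w \<in> ball 0 \<rho>" for w
      unfolding G_def by (rule h(3)) (use that \<rho> in \<open>auto simp: r_def field_simps\<close>)
    have Ghol: "G holomorphic_on ball 0 \<rho>"
      by (rule holomorphic_transform[OF cauchy_type_holomorphic[OF h(1,2) r(3)]]) (use Gh in auto)
    define K where "K = cball (0::complex) r"
    have K: "compact K" "K \<subseteq> disk" using r by (auto simp: K_def)
    \<comment> \<open>\<open>u\<close> is only locally integrable. Its restriction to
      \<open>K\<close> is integrable, and \<open>K\<close> contains every bump of radius below
      \<open>r - \<rho>\<close> centred in the ball of radius \<open>\<rho>\<close>.\<close>
    define u' where "u' z = indicator K z *\<^sub>R u z" for z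
    have u'i: "integrable lborel u'"
    proof -
      have "integrable lborel (\<lambda>z. indicator disk z *\<^sub>R (indicator K z *\<^sub>R u z))"
        using ui[OF K] by (subst (asm) integrable_restrict_space) auto
      also have "(\<lambda>z. indicator disk z *\<^sub>R (indicator K z *\<^sub>R u z)) = u'"
        using K(2) by (auto simp: u'_def indicator_def fun_eq_iff)
      finally show ?thesis .
    qed
    have [measurable]: "u' \<in> borel_measurable borel" using borel_measurable_integrable[OF u'i] by simp
    define v where "v w = (if w \<in> ball 0 \<rho> then G w - of_real M * u w else 0)" for w
    have vi: "integrable lborel v"
    proof -
      have gc: "continuous_on (cball 0 \<rho>) (\<lambda>w. \<integral>z. h z * inverse (z - w) \<partial>diskm)"
        by (rule continuous_on_subset[OF holomorphic_on_imp_continuous_on[OF cauchy_type_holomorphic[OF h(1,2), where \<rho> = "(\<rho> + r) / 2"]]])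
           (use r in auto)
      have "integrable lborel (\<lambda>w. indicator (ball 0 \<rho>) w *\<^sub>R ((if w \<in> cball 0 \<rho> then (\<integral>z. h z * inverse (z - w) \<partial>diskm) else 0) - of_real M * u' w))"
        by (intro integrable_mult_indicator Bochner_Integration.integrable_diff integrable_mult_right u'i integrable_cball gc) simp
      also have "(\<lambda>w. indicator (ball 0 \<rho>) w *\<^sub>R ((if w \<in> cball 0 \<rho> then (\<integral>z. h z * inverse (z - w) \<partial>diskm) else 0) - of_real M * u' w)) = v"
        using r Gh by (auto simp: v_def u'_def K_def indicator_def fun_eq_iff)
      finally show ?thesis .
    qed
    have "AE z in lborel. v z = 0"
    proof (rule AE_lborel_lipschitz_zero[OF vi open_ball[of 0 \<rho>]])
      show "v z = 0" if "z \<notin> ball 0 \<rho>" for z using that by (simp add: v_def)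
      fix \<psi> :: "complex \<Rightarrow> real" and L
      assume lip: "\<And>x y. \<bar>\<psi> x - \<psi> y\<bar> \<le> L * norm (x - y)" and \<psi>0: "\<And>x. x \<notin> ball 0 \<rho> \<Longrightarrow> \<psi> x = 0"
        and \<psi>1: "\<And>x. 0 \<le> \<psi> x \<and> \<psi> x \<le> 1"
      have L: "0 \<le> L" using lip[of 1 0] by simp
      have "L-lipschitz_on UNIV \<psi>"
        using lip L by (intro lipschitz_onI) (auto simp: dist_norm)
      then have \<psi>c: "continuous_on UNIV \<psi>" by (rule lipschitz_on_continuous_on)
      then have [measurable]: "\<psi> \<in> borel_measurable borel" by (rule borel_measurable_continuous_onI)
      have \<psi>mult: "integrable lborel (\<lambda>z. of_real (\<psi> z) * f z)" if "integrable lborel f" for f :: "complex \<Rightarrow> complex"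
      proof (rule Bochner_Integration.integrable_bound[OF that])
        show "(\<lambda>z. of_real (\<psi> z) * f z) \<in> borel_measurable lborel"
          using borel_measurable_integrable[OF that] by measurable
        show "AE z in lborel. norm (of_real (\<psi> z) * f z) \<le> norm (f z)"
          using \<psi>1 by (intro AE_I2) (auto simp: norm_mult intro!: mult_left_le_one_le)
      qed
      have \<psi>i: "integrable lborel \<psi>"
        by (rule integrable_compact_support[of "cball 0 \<rho>"]) (use \<psi>0 \<psi>c in \<open>auto intro: continuous_on_subset\<close>)
      let ?X = "\<integral>z. of_real (\<psi> z) * v z \<partial>lborel" and ?I = "\<integral>z. norm (u' z) \<partial>lborel"
      \<comment> \<open>Fubini moves the mollifier from \<open>u'\<close> to \<open>\<psi>\<close>,
        and the Lipschitz bound makes \<open>A\<close> differ from \<open>M * \<psi>\<close> by at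
        most \<open>L * \<epsilon> * M\<close>.\<close>
      have small: "norm ?X \<le> L * \<epsilon> * M * ?I" if e: "0 < \<epsilon>" "\<epsilon> < min (1/2) (r - \<rho>)" for \<epsilon>
      proof -
        define T where "T w = (\<integral>z. of_real (bump \<epsilon> (z - w)) * u' z \<partial>lborel)" for w
        define F where "F w z = of_real (\<psi> w * bump \<epsilon> (z - w)) * u' z" for w z
        define A where "A z = (\<integral>w. \<psi> w * bump \<epsilon> (z - w) \<partial>lborel)" for z
        have bm [measurable]: "(\<lambda>(w, z). bump \<epsilon> (z - w)) \<in> borel_measurable (lborel \<Otimes>\<^sub>M lborel)"
          unfolding bump_def by measurable
        have TG: "T w = G w" if w: "w \<in> ball 0 \<rho>" for w
        proof -
          have "T w = (\<integral>z. of_real (bump \<epsilon> (z - w)) * u' z \<partial>diskm)"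
            unfolding T_def using K(2) by (intro integral_restrict_lborel[symmetric]) (auto simp: u'_def indicator_def)
          also have "\<dots> = (\<integral>z. u z * of_real (bump \<epsilon> (z - w)) \<partial>diskm)"
          proof (rule Bochner_Integration.integral_cong[OF refl])
            fix z
            show "of_real (bump \<epsilon> (z - w)) * u' z = u z * of_real (bump \<epsilon> (z - w))"
            proof (cases "z \<in> K")
              case False
              then have "\<epsilon> \<le> norm (z - w)"
                using w e norm_triangle_ineq2[of z w] by (auto simp: K_def)
              then show ?thesis using bump_zero[OF e(1)] by simp
            qed (simp add: u'_def)
          qed
          also have "\<dots> = G w"
            unfolding Gh[OF w] by (rule h(3)) (use e w in auto)
          finally show ?thesis .
        qed
        have v_eq: "of_real (\<psi> w) * v w = of_real (\<psi> w) * T w - of_real M * (of_real (\<psi> w) * u' w)" for w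
        proof (cases "w \<in> ball 0 \<rho>")
          case True
          then have "u' w = u w" using r by (auto simp: u'_def K_def)
          then show ?thesis using True TG by (simp add: v_def algebra_simps)
        qed (simp add: \<psi>0)
        have iu: "integrable lborel (\<lambda>w. of_real M * (of_real (\<psi> w) * u' w))"
          by (intro integrable_mult_right \<psi>mult u'i)
        have Fi: "integrable (lborel \<Otimes>\<^sub>M lborel) (\<lambda>(w, z). F w z)"
        proof (rule lborel_pair.Fubini_integrable)
          show Fm: "(\<lambda>(w, z). F w z) \<in> borel_measurable (lborel \<Otimes>\<^sub>M lborel)"
            unfolding F_def by measurable
          have Fb: "norm (F w z) \<le> (\<psi> w * (4 / \<epsilon>\<^sup>2)) * norm (u' z)" for w z
          proof -
            have "\<bar>\<psi> w * bump \<epsilon> (z - w)\<bar> \<le> \<psi> w * (4 / \<epsilon>\<^sup>2)"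
              using \<psi>1[of w] bump_nonneg[of \<epsilon> "z - w"] mult_left_mono[OF bump_le[of \<epsilon> "z - w"], of "\<psi> w"]
              by (simp only: abs_of_nonneg mult_nonneg_nonneg)
            then show ?thesis
              unfolding F_def norm_mult norm_of_real by (rule mult_right_mono) simp
          qed
          have Fw: "integrable lborel (\<lambda>z. F w z)" for w
          proof (rule Bochner_Integration.integrable_bound)
            show "integrable lborel (\<lambda>z. (\<psi> w * (4 / \<epsilon>\<^sup>2)) * norm (u' z))" using u'i by simp
            have "(\<lambda>z. bump \<epsilon> (z - w)) \<in> borel_measurable lborel"
              using bump_integrable[OF e(1)] by auto
            then show "(\<lambda>z. F w z) \<in> borel_measurable lborel" unfolding F_def by measurable
            show "AE z in lborel. norm (F w z) \<le> norm ((\<psi> w * (4 / \<epsilon>\<^sup>2)) * norm (u' z))"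
              using Fb by (intro AE_I2) (metis abs_ge_self order_trans real_norm_def)
          qed
          then show "AE w in lborel. integrable lborel (\<lambda>z. (\<lambda>(w, z). F w z) (w, z))" by simp
          show "integrable lborel (\<lambda>w. \<integral>z. norm ((\<lambda>(w, z). F w z) (w, z)) \<partial>lborel)"
          proof (rule Bochner_Integration.integrable_bound)
            show "integrable lborel (\<lambda>w. \<psi> w * (4 / \<epsilon>\<^sup>2) * ?I)" using \<psi>i by simp
            show "(\<lambda>w. \<integral>z. norm ((\<lambda>(w, z). F w z) (w, z)) \<partial>lborel) \<in> borel_measurable lborel"
            proof -
              have "(\<lambda>(w, z). norm (F w z)) \<in> borel_measurable (lborel \<Otimes>\<^sub>M lborel)"
                using measurable_compose[OF Fm borel_measurable_norm] by (simp add: split_beta')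
              from lborel.borel_measurable_lebesgue_integral[OF this] show ?thesis by simp
            qed
            show "AE w in lborel. norm (\<integral>z. norm ((\<lambda>(w, z). F w z) (w, z)) \<partial>lborel) \<le> norm (\<psi> w * (4 / \<epsilon>\<^sup>2) * ?I)"
            proof (rule AE_I2)
              fix w
              have "(\<integral>z. norm (F w z) \<partial>lborel) \<le> (\<integral>z. (\<psi> w * (4 / \<epsilon>\<^sup>2)) * norm (u' z) \<partial>lborel)"
                using u'i by (intro integral_mono Fb integrable_norm Fw) simp
              then have le: "(\<integral>z. norm (F w z) \<partial>lborel) \<le> \<psi> w * (4 / \<epsilon>\<^sup>2) * ?I"
                by (simp only: integral_mult_right_zero)
              have nn: "0 \<le> (\<integral>z. norm (F w z) \<partial>lborel)" by simp
              show "norm (\<integral>z. norm ((\<lambda>(w, z). F w z) (w, z)) \<partial>lborel) \<le> norm (\<psi> w * (4 / \<epsilon>\<^sup>2) * ?I)"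
                unfolding prod.case real_norm_def abs_of_nonneg[OF nn] abs_of_nonneg[OF order_trans[OF nn le]] by (rule le)
            qed
          qed
        qed
        have Fz: "(\<integral>w. F w z \<partial>lborel) = of_real (A z) * u' z" for z
          unfolding F_def A_def by (simp only: integral_mult_left_zero integral_complex_of_real)
        have iA: "integrable lborel (\<lambda>z. of_real (A z) * u' z)"
          using lborel_pair.integrable_snd[OF Fi] unfolding Fz .
        have iT: "integrable lborel (\<lambda>w. of_real (\<psi> w) * T w)"
          using Bochner_Integration.integrable_add[OF \<psi>mult[OF vi] iu] by (simp add: v_eq)
        have "?X = (\<integral>w. of_real (\<psi> w) * T w \<partial>lborel) - (\<integral>w. of_real M * (of_real (\<psi> w) * u' w) \<partial>lborel)"
          unfolding v_eq by (rule Bochner_Integration.integral_diff[OF iT iu])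
        also have "(\<integral>w. of_real (\<psi> w) * T w \<partial>lborel) = (\<integral>w. (\<integral>z. F w z \<partial>lborel) \<partial>lborel)"
          unfolding F_def T_def by (simp add: mult.assoc)
        also have "\<dots> = (\<integral>z. (\<integral>w. F w z \<partial>lborel) \<partial>lborel)"
          by (rule lborel_pair.Fubini_integral[OF Fi, symmetric])
        also have "\<dots> = (\<integral>z. of_real (A z) * u' z \<partial>lborel)" unfolding Fz ..
        also have "\<dots> - (\<integral>w. of_real M * (of_real (\<psi> w) * u' w) \<partial>lborel) = (\<integral>z. of_real (A z) * u' z - of_real M * (of_real (\<psi> z) * u' z) \<partial>lborel)"
          by (rule Bochner_Integration.integral_diff[OF iA iu, symmetric])
        finally have "norm ?X = norm (\<integral>z. of_real (A z) * u' z - of_real M * (of_real (\<psi> z) * u' z) \<partial>lborel)"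
          by (simp only:)
        also have "norm (\<integral>z. of_real (A z) * u' z - of_real M * (of_real (\<psi> z) * u' z) \<partial>lborel) \<le> (\<integral>z. norm (of_real (A z) * u' z - of_real M * (of_real (\<psi> z) * u' z)) \<partial>lborel)"
          by (rule integral_norm_bound)
        also have "\<dots> \<le> (\<integral>z. L * \<epsilon> * M * norm (u' z) \<partial>lborel)"
        proof (rule integral_mono)
          show "integrable lborel (\<lambda>z. norm (of_real (A z) * u' z - of_real M * (of_real (\<psi> z) * u' z)))"
            by (intro integrable_norm Bochner_Integration.integrable_diff iA iu)
          show "integrable lborel (\<lambda>z. L * \<epsilon> * M * norm (u' z))" using u'i by simp
          fix z
          have sym: "bump \<epsilon> (z - w) = bump \<epsilon> (w - z)" for w
            by (simp add: bump_def norm_minus_commute)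
          have bi: "integrable lborel (\<lambda>w. bump \<epsilon> (z - w))"
            unfolding sym by (rule bump_integrable[OF e(1)])
          have Mz: "M = (\<integral>w. bump \<epsilon> (z - w) \<partial>lborel)"
            unfolding sym using M(2)[of \<epsilon> z] e by simp
          have pbi: "integrable lborel (\<lambda>w. \<psi> w * bump \<epsilon> (z - w))"
          proof (rule Bochner_Integration.integrable_bound[OF bi])
            show "(\<lambda>w. \<psi> w * bump \<epsilon> (z - w)) \<in> borel_measurable lborel"
              using borel_measurable_integrable[OF bi] by measurable
            show "AE w in lborel. norm (\<psi> w * bump \<epsilon> (z - w)) \<le> norm (bump \<epsilon> (z - w))"
              using \<psi>1 by (intro AE_I2) (auto simp: abs_mult intro!: mult_left_le_one_le)
          qed
          have "A z - M * \<psi> z = (\<integral>w. \<psi> w * bump \<epsilon> (z - w) - bump \<epsilon> (z - w) * \<psi> z \<partial>lborel)"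
            unfolding A_def Mz using pbi bi by (subst Bochner_Integration.integral_diff) auto
          then have "\<bar>A z - M * \<psi> z\<bar> = \<bar>\<integral>w. \<psi> w * bump \<epsilon> (z - w) - bump \<epsilon> (z - w) * \<psi> z \<partial>lborel\<bar>"
            by (simp only:)
          also have "\<bar>\<integral>w. \<psi> w * bump \<epsilon> (z - w) - bump \<epsilon> (z - w) * \<psi> z \<partial>lborel\<bar> \<le> (\<integral>w. \<bar>\<psi> w * bump \<epsilon> (z - w) - bump \<epsilon> (z - w) * \<psi> z\<bar> \<partial>lborel)"
            by (rule integral_abs_bound)
          also have "\<dots> \<le> (\<integral>w. L * \<epsilon> * bump \<epsilon> (z - w) \<partial>lborel)"
          proof (rule integral_mono)
            show "integrable lborel (\<lambda>w. \<bar>\<psi> w * bump \<epsilon> (z - w) - bump \<epsilon> (z - w) * \<psi> z\<bar>)"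
              using pbi bi by auto
            show "integrable lborel (\<lambda>w. L * \<epsilon> * bump \<epsilon> (z - w))" using bi by simp
            fix w
            have "\<psi> w * bump \<epsilon> (z - w) - bump \<epsilon> (z - w) * \<psi> z = (\<psi> w - \<psi> z) * bump \<epsilon> (z - w)"
              by (simp add: algebra_simps)
            then have "\<bar>\<psi> w * bump \<epsilon> (z - w) - bump \<epsilon> (z - w) * \<psi> z\<bar> = \<bar>\<psi> w - \<psi> z\<bar> * bump \<epsilon> (z - w)"
              by (simp add: abs_mult bump_nonneg)
            also have "\<dots> \<le> L * \<epsilon> * bump \<epsilon> (z - w)"
            proof (cases "norm (z - w) < \<epsilon>")
              case True
              have "\<bar>\<psi> w - \<psi> z\<bar> \<le> L * norm (w - z)" by (rule lip)
              also have "\<dots> \<le> L * \<epsilon>" using True L by (intro mult_left_mono) (auto simp: norm_minus_commute)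
              finally show ?thesis by (intro mult_right_mono bump_nonneg)
            next
              case False
              then show ?thesis using bump_zero[OF e(1)] by simp
            qed
            finally show "\<bar>\<psi> w * bump \<epsilon> (z - w) - bump \<epsilon> (z - w) * \<psi> z\<bar> \<le> L * \<epsilon> * bump \<epsilon> (z - w)" .
          qed
          also have "\<dots> = L * \<epsilon> * M" by (simp add: Mz)
          finally have le: "\<bar>A z - M * \<psi> z\<bar> \<le> L * \<epsilon> * M" .
          have "of_real (A z) * u' z - of_real M * (of_real (\<psi> z) * u' z) = of_real (A z - M * \<psi> z) * u' z"
            by (simp add: algebra_simps)
          then have "norm (of_real (A z) * u' z - of_real M * (of_real (\<psi> z) * u' z)) = \<bar>A z - M * \<psi> z\<bar> * norm (u' z)"
            by (simp only: norm_mult norm_of_real)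
          also have "\<dots> \<le> L * \<epsilon> * M * norm (u' z)"
            by (intro mult_right_mono le) simp
          finally show "norm (of_real (A z) * u' z - of_real M * (of_real (\<psi> z) * u' z)) \<le> L * \<epsilon> * M * norm (u' z)" .
        qed
        also have "\<dots> = L * \<epsilon> * M * ?I" by simp
        finally show ?thesis .
      qed
      have "((\<lambda>\<epsilon>. L * \<epsilon> * M * ?I) \<longlongrightarrow> L * 0 * M * ?I) (at_right 0)"
        by (intro tendsto_intros)
      moreover have "\<forall>\<^sub>F \<epsilon> in at_right 0. norm ?X \<le> L * \<epsilon> * M * ?I"
      proof -
        have "0 < min (1/2) (r - \<rho>)" using r by simp
        from eventually_at_right_real[OF this] show ?thesis
          by eventually_elim (use small in auto)
      qed
      ultimately have "norm ?X \<le> L * 0 * M * ?I"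
        by (rule tendsto_lowerbound) simp
      then show "?X = 0" by simp
    qed
    then have "AE w in lborel. w \<in> ball 0 \<rho> \<longrightarrow> u w = G w / of_real M"
      by eventually_elim (use M(1) in \<open>auto simp: v_def field_simps split: if_splits\<close>)
    with Ghol show ?thesis by blast
  qed
  show thesis
  proof
    \<comment> \<open>The null set in \<open>main\<close> depends on the radius, so the disk is
      exhausted by countably many balls.\<close>
    have "G holomorphic_on (\<Union>n::nat. ball 0 (1 - 1 / (real n + 2)))"
      using main by (intro holomorphic_on_UN_open) auto
    also have un: "(\<Union>n::nat. ball (0::complex) (1 - 1 / (real n + 2))) = disk"
    proof (intro equalityI subsetI)
      fix z :: complex assume "z \<in> disk"
      then have "0 < 1 - norm z" by simp
      then obtain n where "inverse (real (Suc n)) < 1 - norm z"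
        using reals_Archimedean by blast
      moreover have "1 / (real n + 2) \<le> inverse (real (Suc n))"
        by (simp add: inverse_eq_divide field_simps)
      ultimately show "z \<in> (\<Union>n::nat. ball 0 (1 - 1 / (real n + 2)))"
        by (auto intro!: exI[of _ n])
    next
      fix z :: complex assume "z \<in> (\<Union>n::nat. ball 0 (1 - 1 / (real n + 2)))"
      then obtain n :: nat where "norm z < 1 - 1 / (real n + 2)" by auto
      moreover have "0 < 1 / (real n + 2)" by simp
      ultimately have "norm z < 1" by linarith
      then show "z \<in> disk" by simp
    qed
    finally show "(\<lambda>w. G w / of_real M) holomorphic_on disk"
      using M(1) by (intro holomorphic_intros) auto
    have "AE w in lborel. \<forall>n::nat. w \<in> ball 0 (1 - 1 / (real n + 2)) \<longrightarrow> u w = G w / of_real M"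
      using main by (intro AE_all_countable[THEN iffD2] allI) auto
    then have "AE w in lborel. w \<in> disk \<longrightarrow> u w = G w / of_real M"
      by eventually_elim (use un in blast)
    then show "AE z in diskm. u z = G z / of_real M"
      by (subst AE_restrict_space_iff) auto
  qed
qed

section \<open>Orthogonal decomposition and basic inequality\<close>

lemma nrm_cong_AE:
  assumes "AE x in M. f x = g x" "f \<in> borel_measurable M" "g \<in> borel_measurable M"
  shows "nrm M f = nrm M g"
  unfolding nrm_def using assms by (intro arg_cong[where f = sqrt] integral_cong_AE) auto

lemma ip_cong_AE:
  assumes "AE x in M. f x = g x" "f \<in> borel_measurable M" "g \<in> borel_measurable M" "h \<in> borel_measurable M"
  shows "ip M h f = ip M h g"
  unfolding ip_def using assms by (intro integral_cong_AE) auto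

lemma sqi_cong_AE:
  assumes "AE x in M. f x = g x" "g \<in> borel_measurable M" "sqi M f"
  shows "sqi M g"
proof -
  have "integrable M (\<lambda>x. (norm (f x))\<^sup>2) \<longleftrightarrow> integrable M (\<lambda>x. (norm (g x))\<^sup>2)"
    using assms by (intro integrable_cong_AE) (auto simp: sqi_def)
  then show ?thesis using assms by (simp add: sqi_def)
qed

lemma sqi_compact_support:
  assumes "compact K" "K \<subseteq> disk" "continuous_on disk h" "\<And>z. z \<in> disk \<Longrightarrow> z \<notin> K \<Longrightarrow> h z = 0"
  shows "sqi diskm h"
  unfolding sqi_def
proof
  show "h \<in> borel_measurable diskm" by (rule measurable_diskm_continuous[OF assms(3)])
  have c: "continuous_on disk (\<lambda>z. (norm (h z))\<^sup>2)"
    by (rule continuous_on_power[OF continuous_on_norm[OF assms(3)]])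
  have z: "(norm (h z))\<^sup>2 = 0" if "z \<in> disk" "z \<notin> K" for z
    unfolding assms(4)[OF that] by simp
  show "integrable diskm (\<lambda>z. (norm (h z))\<^sup>2)"
    by (rule integrable_restrict_compact_support(1)[of K disk "\<lambda>z. (norm (h z))\<^sup>2", OF assms(1,2) open_ball c z])
qed

section \<open>Calculus of test functions\<close>

lemma test_funI:
  assumes "C2w disk b p q m" "compact K" "K \<subseteq> disk" "\<And>z. z \<in> disk \<Longrightarrow> z \<notin> K \<Longrightarrow> b z = 0"
  shows "test_fun b p q m"
  unfolding test_fun_def using assms by (intro conjI exI[of _ K] ballI impI)

lemma test_funE:
  assumes "test_fun b p q m"
  obtains K where "C2w disk b p q m" "compact K" "K \<subseteq> disk" "\<And>z. z \<in> disk \<Longrightarrow> z \<notin> K \<Longrightarrow> b z = 0"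
proof -
  from assms obtain K where K: "C2w disk b p q m" "compact K" "K \<subseteq> disk" "\<forall>z\<in>disk. z \<notin> K \<longrightarrow> b z = 0"
    unfolding test_fun_def by (elim conjE exE)
  show thesis
    by (rule that[OF K(1,2,3)]) (rule K(4)[rule_format])
qed

lemma test_fun_add:
  assumes "test_fun b p q m" "test_fun b' p' q' m'"
  shows "test_fun (\<lambda>z. b z + b' z) (\<lambda>z. p z + p' z) (\<lambda>z. q z + q' z) (\<lambda>z. m z + m' z)"
proof (rule test_funE[OF assms(1)], rule test_funE[OF assms(2)])
  fix K K' assume K: "C2w disk b p q m" "compact K" "K \<subseteq> disk" "\<And>z. z \<in> disk \<Longrightarrow> z \<notin> K \<Longrightarrow> b z = 0"
    and K': "C2w disk b' p' q' m'" "compact K'" "K' \<subseteq> disk" "\<And>z. z \<in> disk \<Longrightarrow> z \<notin> K' \<Longrightarrow> b' z = 0"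
  show ?thesis
    by (rule test_funI[OF C2w_add[OF K(1) K'(1)] compact_Un[OF K(2) K'(2)] Un_least[OF K(3) K'(3)]])
       (simp add: K(4) K'(4))
qed

lemma test_fun_mult:
  assumes "test_fun b p q m" "C2w disk g p' q' m'"
  shows "test_fun (\<lambda>z. g z * b z) (\<lambda>z. p' z * b z + g z * p z) (\<lambda>z. q' z * b z + g z * q z)
    (\<lambda>z. m' z * b z + p' z * q z + (q' z * p z + g z * m z))"
proof (rule test_funE[OF assms(1)])
  fix K assume K: "C2w disk b p q m" "compact K" "K \<subseteq> disk" "\<And>z. z \<in> disk \<Longrightarrow> z \<notin> K \<Longrightarrow> b z = 0"
  show ?thesis
    by (rule test_funI[OF C2w_mult[OF assms(2) K(1)] K(2,3)]) (simp add: K(4))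
qed

lemma test_fun_scale:
  assumes "test_fun b p q m"
  shows "test_fun (\<lambda>z. c * b z) (\<lambda>z. c * p z) (\<lambda>z. c * q z) (\<lambda>z. c * m z)"
  using test_fun_mult[OF assms C2w_const[of disk c]] by simp

lemma test_fun_cnj:
  assumes "test_fun b p q m"
  shows "test_fun (\<lambda>z. cnj (b z)) (\<lambda>z. cnj (q z)) (\<lambda>z. cnj (p z)) (\<lambda>z. cnj (m z))"
proof (rule test_funE[OF assms(1)])
  fix K assume K: "C2w disk b p q m" "compact K" "K \<subseteq> disk" "\<And>z. z \<in> disk \<Longrightarrow> z \<notin> K \<Longrightarrow> b z = 0"
  show ?thesis
    by (rule test_funI[OF C2w_cnj[OF K(1)] K(2,3)]) (simp add: K(4))
qed

lemma test_fun_support: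
  assumes "test_fun b p q m"
  obtains K where "compact K" "K \<subseteq> disk" "\<And>z. z \<in> disk \<Longrightarrow> z \<notin> K \<Longrightarrow> b z = 0"
    "\<And>z. z \<in> disk \<Longrightarrow> z \<notin> K \<Longrightarrow> p z = 0" "\<And>z. z \<in> disk \<Longrightarrow> z \<notin> K \<Longrightarrow> q z = 0"
    "continuous_on disk b" "continuous_on disk p" "continuous_on disk q"
proof (rule test_funE[OF assms(1)])
  fix K assume K: "C2w disk b p q m" "compact K" "K \<subseteq> disk" "\<And>z. z \<in> disk \<Longrightarrow> z \<notin> K \<Longrightarrow> b z = 0"
  have C: "C1w disk b p q" using K(1) unfolding C2w_def by (rule conjunct1)
  show thesis
    by (rule that[OF K(2,3,4) C1w_compact_support(1,2)[OF C K(2,3) open_ball K(4)] C1w_continuous[OF C]])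
qed

text \<open>The parameter \<open>c\<close> measures the ellipticity of \<open>\<phi>\<close> at the scale \<open>\<tau>\<close>; the slope \<open>c/32\<close> in the
  growth condition on \<open>\<tau>\<close> is what class \<open>\<E>\<close> provides.\<close>

locale slow_weight =
  fixes \<phi> \<tau> :: "complex \<Rightarrow> real" and df lap :: "complex \<Rightarrow> complex" and c c1 c2 B \<beta> :: real
  assumes C2: "C2w disk (\<lambda>z. of_real (\<phi> z)) df (\<lambda>z. cnj (df z)) lap"
    and tau_pos: "\<And>z. z \<in> disk \<Longrightarrow> 0 < \<tau> z"
    and tau_bd: "\<And>z. z \<in> disk \<Longrightarrow> \<tau> z \<le> c1 * (1 - norm z)"
    and tau_lip: "\<And>z w. z \<in> disk \<Longrightarrow> w \<in> disk \<Longrightarrow> \<bar>\<tau> z - \<tau> w\<bar> \<le> c2 * norm (z - w)"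
    and lap_low: "\<And>z. z \<in> disk \<Longrightarrow> c\<^sup>2 / (\<tau> z)\<^sup>2 \<le> 2 * Re (lap z)"
    and lap_up: "\<And>z. z \<in> disk \<Longrightarrow> Re (lap z) \<le> B / (\<tau> z)\<^sup>2"
    and growth: "\<And>z w. z \<in> disk \<Longrightarrow> w \<in> disk \<Longrightarrow> \<tau> z \<le> \<beta> * \<tau> w + c / 32 * norm (z - w)"
    and pos_consts: "0 < c" "0 < c1" "0 < c2" "0 < B" "0 < \<beta>"
begin

definition ex :: "complex \<Rightarrow> complex" where "ex z = of_real (exp (\<phi> z))"

lemma phi_cont: "continuous_on disk \<phi>"
proof -
  have "continuous_on disk (\<lambda>z. complex_of_real (\<phi> z))"
    using C2 C1w_continuous(1) unfolding C2w_def by blast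
  from continuous_on_Re[OF this] show ?thesis by simp
qed

lemma ex_cont: "continuous_on disk ex"
  unfolding ex_def by (intro continuous_intros phi_cont)

lemma tau_cont: "continuous_on disk \<tau>"
proof -
  have "c2-lipschitz_on disk \<tau>"
    using tau_lip pos_consts by (intro lipschitz_onI) (auto simp: dist_norm)
  then show ?thesis by (rule lipschitz_on_continuous_on)
qed

lemma ex_nonzero [simp]: "ex z \<noteq> 0"
  by (simp add: ex_def)

lemma sqi_test:
  assumes "test_fun b p q mm" "continuous_on disk h"
  shows "sqi diskm (\<lambda>z. h z * b z)" "sqi diskm (\<lambda>z. h z * p z)"
proof -
  obtain K where K: "compact K" "K \<subseteq> disk" "\<And>z. z \<in> disk \<Longrightarrow> z \<notin> K \<Longrightarrow> b z = 0"
    "\<And>z. z \<in> disk \<Longrightarrow> z \<notin> K \<Longrightarrow> p z = 0" "continuous_on disk b" "continuous_on disk p"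
    by (rule test_fun_support[OF assms(1)]) blast
  show "sqi diskm (\<lambda>z. h z * b z)"
    by (rule sqi_compact_support[OF K(1,2) continuous_on_mult[OF assms(2) K(5)]]) (simp add: K(3))
  show "sqi diskm (\<lambda>z. h z * p z)"
    by (rule sqi_compact_support[OF K(1,2) continuous_on_mult[OF assms(2) K(6)]]) (simp add: K(4))
qed

definition itau :: "complex \<Rightarrow> complex" where "itau z = of_real (1 / \<tau> z)"

lemma itau_cont: "continuous_on disk itau"
  unfolding itau_def using tau_pos by (intro continuous_intros tau_cont) (auto simp: less_imp_neq[symmetric])

text \<open>Commuting \<open>\<partial>\<close> with its weighted adjoint produces the Laplacian of \<open>\<phi>\<close>.\<close>

lemma basic_inequality:
  assumes t: "test_fun b p q mm"
  shows "c * nrm diskm (\<lambda>z. ex z * itau z * b z) \<le> nrm diskm (\<lambda>z. ex z * p z)"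
proof -
  obtain K where K: "compact K" "K \<subseteq> disk" "\<And>z. z \<in> disk \<Longrightarrow> z \<notin> K \<Longrightarrow> b z = 0"
    "\<And>z. z \<in> disk \<Longrightarrow> z \<notin> K \<Longrightarrow> p z = 0" "\<And>z. z \<in> disk \<Longrightarrow> z \<notin> K \<Longrightarrow> q z = 0"
    "continuous_on disk b" "continuous_on disk p" "continuous_on disk q"
    by (rule test_fun_support[OF t]) blast
  from C2 obtain fr fs where F: "C1w disk (\<lambda>z. of_real (\<phi> z)) df (\<lambda>z. cnj (df z))" "C1w disk df fr lap"
    "C1w disk (\<lambda>z. cnj (df z)) lap fs" unfolding C2w_def by blast
  from t obtain r s where T: "C1w disk b p q" "C1w disk p r mm" "C1w disk q mm s"
    unfolding test_fun_def C2w_def by blast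
  have E: "C1w disk (\<lambda>z. of_real (exp (2 * \<phi> z))) (\<lambda>z. of_real (2 * exp (2 * \<phi> z)) * df z) (\<lambda>z. of_real (2 * exp (2 * \<phi> z)) * cnj (df z))"
    by (rule C1w_real_chain[OF F(1), where g = "\<lambda>x. exp (2 * x)" and g' = "\<lambda>x. 2 * exp (2 * x)"])
       (auto intro!: derivative_eq_intros continuous_intros)
  \<comment> \<open>This is \<open>e^(-2 \<phi>)\<close> times the conjugate derivative of
    \<open>e^(2 \<phi>) b\<close>, since \<open>cnj (df z)\<close> is the conjugate derivative of
    the real function \<open>\<phi>\<close>.\<close>
  define q' where "q' z = q z + 2 * (cnj (df z) * b z)" for z
  have Q: "C1w disk q' (\<lambda>z. mm z + 2 * (lap z * b z + cnj (df z) * p z)) (\<lambda>z. s z + 2 * (fs z * b z + cnj (df z) * q z))"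
    using C1w_add[OF T(3) C1w_mult[OF C1w_const[of disk 2] C1w_mult[OF F(3) T(1)]]] unfolding q'_def by simp
  note EB = C1w_mult[OF E T(1)]
  note V1 = C1w_mult[OF EB C1w_cnj[OF T(2)]]
  note V2 = C1w_mult[OF EB C1w_cnj[OF Q]]
  let ?E = "\<lambda>z. exp (2 * \<phi> z)"
  let ?A1 = "\<lambda>z. (of_real (2 * ?E z) * df z * b z + of_real (?E z) * p z) * cnj (p z) + of_real (?E z) * b z * cnj (mm z)"
  let ?A2 = "\<lambda>z. (of_real (2 * ?E z) * cnj (df z) * b z + of_real (?E z) * q z) * cnj (q' z) + of_real (?E z) * b z * cnj (mm z + 2 * (lap z * b z + cnj (df z) * p z))"
  have z1: "of_real (?E z) * b z * x = 0" if "z \<in> disk" "z \<notin> K" for z x using K(3)[OF that] by simp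
  have I1: "integral\<^sup>L diskm ?A1 = 0"
    by (rule integral_wirt_eq_0(1)[OF V1 K(1,2) open_ball z1])
  have I2: "integral\<^sup>L diskm ?A2 = 0"
    by (rule integral_wirt_eq_0(2)[OF V2 K(1,2) open_ball z1])
  have i1: "integrable diskm ?A1"
    by (rule integrable_restrict_compact_support(1)[OF K(1,2) open_ball C1w_continuous(2)[OF V1]
          C1w_compact_support(1)[OF V1 K(1,2) open_ball z1]])
  have i2: "integrable diskm ?A2"
    by (rule integrable_restrict_compact_support(1)[OF K(1,2) open_ball C1w_continuous(3)[OF V2]
          C1w_compact_support(2)[OF V2 K(1,2) open_ball z1]])
  \<comment> \<open>The second derivatives of \<open>b\<close> cancel in the difference of the two
    exact integrands. The square of \<open>q'\<close> has a favourable sign and is dropped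
    afterwards; the term with \<open>lap\<close> is the gain.\<close>
  have pt: "Re (?A1 z - ?A2 z) = ?E z * (norm (p z))\<^sup>2 - ?E z * (norm (q' z))\<^sup>2 - 2 * ?E z * Re (lap z) * (norm (b z))\<^sup>2" for z
  proof -
    have "?A1 z - ?A2 z = of_real (?E z) * (p z * cnj (p z)) - of_real (?E z) * (q' z * cnj (q' z)) - 2 * of_real (?E z) * cnj (lap z) * (b z * cnj (b z))"
      unfolding q'_def by (simp add: algebra_simps)
    also have "\<dots> = of_real (?E z * (norm (p z))\<^sup>2) - of_real (?E z * (norm (q' z))\<^sup>2) - cnj (lap z) * of_real (2 * ?E z * (norm (b z))\<^sup>2)"
      by (simp only: of_real_mult complex_norm_square) simp
    finally have eq: "?A1 z - ?A2 z = of_real (?E z * (norm (p z))\<^sup>2) - of_real (?E z * (norm (q' z))\<^sup>2) - cnj (lap z) * of_real (2 * ?E z * (norm (b z))\<^sup>2)" .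
    have "Re (x * complex_of_real y) = Re x * y" for x y by simp
    then show ?thesis
      unfolding eq minus_complex.sel Re_complex_of_real by (simp add: mult_ac)
  qed
  have "(\<integral>z. Re (?A1 z - ?A2 z) \<partial>diskm) = Re (integral\<^sup>L diskm ?A1 - integral\<^sup>L diskm ?A2)"
    using i1 i2 by (subst integral_Re) (auto intro!: arg_cong[where f = Re] Bochner_Integration.integral_diff)
  then have zero: "(\<integral>z. Re (?A1 z - ?A2 z) \<partial>diskm) = 0" by (simp only: I1 I2) simp
  have sp: "sqi diskm (\<lambda>z. ex z * p z)" and sb: "sqi diskm (\<lambda>z. ex z * itau z * b z)"
    by (rule sqi_test(2)[OF t ex_cont], rule sqi_test(1)[OF t continuous_on_mult[OF ex_cont itau_cont]])
  have "(c * nrm diskm (\<lambda>z. ex z * itau z * b z))\<^sup>2 = (\<integral>z. c\<^sup>2 * (norm (ex z * itau z * b z))\<^sup>2 \<partial>diskm)"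
    by (simp add: power_mult_distrib nrm_sq)
  also have "\<dots> \<le> (\<integral>z. (norm (ex z * p z))\<^sup>2 - Re (?A1 z - ?A2 z) \<partial>diskm)"
  proof (rule integral_mono)
    show "integrable diskm (\<lambda>z. c\<^sup>2 * (norm (ex z * itau z * b z))\<^sup>2)" using sb by (simp add: sqi_def)
    show "integrable diskm (\<lambda>z. (norm (ex z * p z))\<^sup>2 - Re (?A1 z - ?A2 z))"
      using sp i1 i2 by (intro Bochner_Integration.integrable_diff integrable_Re) (auto simp: sqi_def)
    fix z assume "z \<in> space diskm"
    then have z: "z \<in> disk" by simp
    have n: "(norm (ex z))\<^sup>2 = ?E z"
      by (simp add: ex_def power2_eq_square mult_exp_exp)
    have "c\<^sup>2 * (norm (ex z * itau z * b z))\<^sup>2 = ?E z * (norm (b z))\<^sup>2 * (c\<^sup>2 / (\<tau> z)\<^sup>2)"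
      unfolding norm_mult power_mult_distrib n by (simp add: itau_def power_divide norm_divide)
    also have "\<dots> \<le> ?E z * (norm (b z))\<^sup>2 * (2 * Re (lap z))"
      by (intro mult_left_mono lap_low z) simp
    also have "\<dots> \<le> (norm (ex z * p z))\<^sup>2 - Re (?A1 z - ?A2 z)"
      unfolding pt norm_mult power_mult_distrib n by simp
    finally show "c\<^sup>2 * (norm (ex z * itau z * b z))\<^sup>2 \<le> (norm (ex z * p z))\<^sup>2 - Re (?A1 z - ?A2 z)" .
  qed
  also have "\<dots> = (nrm diskm (\<lambda>z. ex z * p z))\<^sup>2 - (\<integral>z. Re (?A1 z - ?A2 z) \<partial>diskm)"
    unfolding nrm_sq using sp i1 i2 by (intro Bochner_Integration.integral_diff integrable_Re Bochner_Integration.integrable_diff) (auto simp: sqi_def)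
  finally have "(c * nrm diskm (\<lambda>z. ex z * itau z * b z))\<^sup>2 \<le> (nrm diskm (\<lambda>z. ex z * p z))\<^sup>2"
    unfolding zero by simp
  then show ?thesis by (rule power2_le_imp_le) (simp add: nrm_nonneg)
qed

definition gex :: "(complex \<Rightarrow> complex) \<Rightarrow> complex \<Rightarrow> complex" where "gex g z = g z * of_real (exp (- \<phi> z))"

text \<open>Riesz, applied to the pairing with \<open>H\<close>, projects \<open>H\<close> to the
  closure of the functions \<open>ex * p\<close>. Orthogonality of the remainder says that
  \<open>e^\<phi>\<close> times it solves the Cauchy-Riemann equation weakly.\<close>

lemma decomposition:
  assumes H: "sqi diskm H"
  obtains g bb pp qq mm where "g holomorphic_on disk" "sqi diskm (gex g)"
    "\<And>n::nat. test_fun (bb n) (pp n) (qq n) (mm n)"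
    "(\<lambda>n. nrm diskm (\<lambda>z. ex z * pp n z - (H z - gex g z))) \<longlonglongrightarrow> 0"
    "\<And>b p q m. test_fun b p q m \<Longrightarrow> ip diskm (\<lambda>z. ex z * p z) (gex g) = 0"
proof -
  define S where "S = {s. \<exists>b p q m. test_fun b p q m \<and> s = (\<lambda>z. ex z * p z)}"
  have "test_fun (\<lambda>z. 0) (\<lambda>z. 0) (\<lambda>z. 0) (\<lambda>z. 0)"
    unfolding test_fun_def using C2w_const[of disk 0] by (auto intro!: exI[of _ "{}"])
  then have ne: "S \<noteq> {}" unfolding S_def by blast
  have Ssq: "sqi diskm s" if "s \<in> S" for s
    using that sqi_test(2)[OF _ ex_cont] unfolding S_def by blast
  have Sadd: "(\<lambda>x. s x + t x) \<in> S" if "s \<in> S" "t \<in> S" for s t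
  proof -
    from that obtain b p q m b' p' q' m' where 1: "test_fun b p q m" "s = (\<lambda>z. ex z * p z)" "test_fun b' p' q' m'" "t = (\<lambda>z. ex z * p' z)"
      unfolding S_def by blast
    have "(\<lambda>x. s x + t x) = (\<lambda>z. ex z * (p z + p' z))" by (simp add: 1 distrib_left)
    then show ?thesis using test_fun_add[OF 1(1,3)] unfolding S_def by blast
  qed
  have Sscale: "(\<lambda>x. a * s x) \<in> S" if "s \<in> S" for a s
  proof -
    from that obtain b p q m where 1: "test_fun b p q m" "s = (\<lambda>z. ex z * p z)"
      unfolding S_def by blast
    have "(\<lambda>x. a * s x) = (\<lambda>z. ex z * (a * p z))" by (simp add: 1 mult_ac)
    then show ?thesis using test_fun_scale[OF 1(1), of a] unfolding S_def by blast
  qed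
  have bd: "norm (ip diskm s H) \<le> nrm diskm H * nrm diskm s" if "s \<in> S" for s
    using ip_bound[OF Ssq[OF that] H] by (simp add: mult.commute)
  obtain s Q where s: "\<And>n::nat. s n \<in> S" "sqi diskm Q" "(\<lambda>n. nrm diskm (\<lambda>x. s n x - Q x)) \<longlonglongrightarrow> 0"
    "\<And>t. t \<in> S \<Longrightarrow> ip diskm t Q = ip diskm t H"
    by (rule riesz_L2[OF finite_measure_diskm Ssq Sadd Sscale ne ip_add_left[OF Ssq Ssq H] ip_scale_left bd]) (assumption | rule that)+
  define G where "G z = H z - Q z" for z
  have G: "sqi diskm G" unfolding G_def by (rule sqi_diff[OF H s(2)])
  have orth: "ip diskm t G = 0" if "t \<in> S" for t
    unfolding G_def using ip_diff_right[OF H s(2) Ssq[OF that]] s(4)[OF that] by simp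
  have Gm: "G \<in> borel_measurable diskm" using G by (simp add: sqi_def)
  have exm: "ex \<in> borel_measurable diskm" by (rule measurable_diskm_continuous[OF ex_cont])
  have um: "(\<lambda>z. G z * ex z) \<in> borel_measurable diskm" using Gm exm by measurable
  have ui: "integrable diskm (\<lambda>z. indicator K z *\<^sub>R (G z * ex z))" if K: "compact K" "K \<subseteq> disk" for K
  proof -
    have "bounded (ex ` K)"
      using K ex_cont by (intro compact_imp_bounded compact_continuous_image) (auto intro: continuous_on_subset)
    then obtain D where D: "\<And>z. z \<in> K \<Longrightarrow> norm (ex z) \<le> D" by (auto simp: bounded_iff)
    have "K \<in> sets borel" using K(1) by (intro borel_closed compact_imp_closed)
    then have km: "(\<lambda>z. indicat_real K z) \<in> borel_measurable diskm"
      by (intro measurable_restrict_space1 borel_measurable_indicator) simp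
    show ?thesis
    proof (rule Bochner_Integration.integrable_bound)
      show "integrable diskm (\<lambda>z. D *\<^sub>R G z)"
        using integral_norm_le_nrm(1)[OF finite_measure_diskm G] by simp
      show "(\<lambda>z. indicator K z *\<^sub>R (G z * ex z)) \<in> borel_measurable diskm"
        by (rule borel_measurable_scaleR[OF km um])
      show "AE z in diskm. norm (indicator K z *\<^sub>R (G z * ex z)) \<le> norm (D *\<^sub>R G z)"
      proof (rule AE_I2)
        fix z
        show "norm (indicator K z *\<^sub>R (G z * ex z)) \<le> norm (D *\<^sub>R G z)"
          using D[of z] norm_ge_zero[of "ex z"]
          by (cases "z \<in> K") (auto simp: norm_mult mult.commute[of "norm (G z)"] intro!: mult_right_mono)
      qed
    qed
  qed
  have weak: "(\<integral>z. (G z * ex z) * q z \<partial>diskm) = 0" if t: "test_fun b p q m" for b p q m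
  proof -
    \<comment> \<open>The conjugate of a test function is a test function, and its holomorphic
      derivative is \<open>cnj q\<close>; thus orthogonality to \<open>S\<close> also tests
      conjugate derivatives.\<close>
    have "(\<lambda>z. ex z * cnj (q z)) \<in> S"
      unfolding S_def using test_fun_cnj[OF t] by blast
    from orth[OF this] have "cnj (ip diskm (\<lambda>z. ex z * cnj (q z)) G) = 0" by simp
    then have "ip diskm G (\<lambda>z. ex z * cnj (q z)) = 0" by (simp only: ip_commute[of _ G])
    then show ?thesis by (simp add: ip_def ex_def mult_ac)
  qed
  obtain g where g: "g holomorphic_on disk" "AE z in diskm. G z * ex z = g z"
    by (rule weyl_lemma[OF um ui weak])
  have gm: "gex g \<in> borel_measurable diskm"
    unfolding gex_def by (intro measurable_diskm_continuous continuous_intros holomorphic_on_imp_continuous_on g phi_cont)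
  have ae: "AE z in diskm. G z = gex g z"
    using g(2) by eventually_elim (simp add: gex_def ex_def exp_minus field_simps)
  have sg: "sqi diskm (gex g)" by (rule sqi_cong_AE[OF ae gm G])
  have "\<exists>b p q m. test_fun b p q m \<and> s n = (\<lambda>z. ex z * p z)" for n
    using s(1)[of n] unfolding S_def by blast
  then obtain bb pp qq mm where T: "\<And>n. test_fun (bb n) (pp n) (qq n) (mm n)" "\<And>n. s n = (\<lambda>z. ex z * pp n z)"
    by metis
  show thesis
  proof (rule that[OF g(1) sg T(1)])
    have "nrm diskm (\<lambda>z. ex z * pp n z - (H z - gex g z)) = nrm diskm (\<lambda>z. s n z - Q z)" for n
    proof (rule nrm_cong_AE)
      show "AE z in diskm. ex z * pp n z - (H z - gex g z) = s n z - Q z"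
        using ae
      proof eventually_elim
        case (elim z)
        then have "gex g z = H z - Q z" by (simp add: G_def)
        then show ?case by (simp add: T(2))
      qed
      have "sqi diskm (\<lambda>z. s n z - (H z - gex g z))"
        by (intro sqi_diff H sg Ssq s)
      then show "(\<lambda>z. ex z * pp n z - (H z - gex g z)) \<in> borel_measurable diskm"
        unfolding T(2) by (simp add: sqi_def)
      show "(\<lambda>z. s n z - Q z) \<in> borel_measurable diskm"
        using sqi_diff[OF Ssq[OF s(1)] s(2), of n] by (simp add: sqi_def)
    qed
    then show "(\<lambda>n. nrm diskm (\<lambda>z. ex z * pp n z - (H z - gex g z))) \<longlonglongrightarrow> 0" using s(3) by simp
    show "ip diskm (\<lambda>z. ex z * p z) (gex g) = 0" if "test_fun b p q m" for b p q m
    proof -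
      have "(\<lambda>z. ex z * p z) \<in> S" using that unfolding S_def by blast
      note o = orth[OF this] and sq = Ssq[OF this]
      have "ip diskm (\<lambda>z. ex z * p z) G = ip diskm (\<lambda>z. ex z * p z) (gex g)"
        by (rule ip_cong_AE[OF ae Gm gm]) (use sq in \<open>simp add: sqi_def\<close>)
      then show ?thesis using o by simp
    qed
  qed
qed

text \<open>Chosen so that the term \<open>\<beta> * \<tau> z0\<close> of the growth condition is \<open>c/16\<close> times the radius
  \<open>sc * \<tau> z0\<close> of the twist.\<close>

definition sc :: real where "sc = 16 * \<beta> / c"

text \<open>A profile of width \<open>sc * \<tau> z0\<close>. Quadratic decay makes its square
  integrable over the plane, while its logarithmic derivative stays of order 1 / |z - z0| far away,
  which slow growth of \<open>\<tau>\<close> can match.\<close>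

definition rho :: "complex \<Rightarrow> complex \<Rightarrow> complex"
  where "rho z0 z = of_real ((sc * \<tau> z0)\<^sup>2 / ((sc * \<tau> z0)\<^sup>2 + (norm (z - z0))\<^sup>2))"

definition drho :: "complex \<Rightarrow> complex \<Rightarrow> complex"
  where "drho z0 z = of_real (- (sc * \<tau> z0)\<^sup>2 / ((sc * \<tau> z0)\<^sup>2 + (norm (z - z0))\<^sup>2)\<^sup>2) * cnj (z - z0)"

lemma sc_pos: "0 < sc"
  using pos_consts by (simp add: sc_def)

section \<open>The twist and the localised estimate\<close>

lemma rho_C2:
  assumes "z0 \<in> disk"
  obtains q m where "C2w disk (rho z0) (drho z0) q m"
proof -
  define A where "A = (sc * \<tau> z0)\<^sup>2"
  have A: "0 < A" using sc_pos tau_pos[OF assms] by (simp add: A_def)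
  have nz: "A + (norm (z - z0))\<^sup>2 \<noteq> 0" for z
    using A by (simp add: add_pos_nonneg less_imp_neq[symmetric])
  have d1: "((\<lambda>x. A / (A + x)) has_real_derivative - A / (A + (norm (z - z0))\<^sup>2)\<^sup>2) (at ((norm (z - z0))\<^sup>2))" for z
    using nz by (auto intro!: derivative_eq_intros simp: power2_eq_square)
  have d2: "((\<lambda>x. - A / (A + x)\<^sup>2) has_real_derivative 2 * A / (A + (norm (z - z0))\<^sup>2) ^ 3) (at ((norm (z - z0))\<^sup>2))" for z
    using nz[of z] by (auto intro!: derivative_eq_intros simp: divide_simps) (simp add: eval_nat_numeral algebra_simps)
  have d3: "continuous_on ((\<lambda>z. (norm (z - z0))\<^sup>2) ` disk) (\<lambda>x. 2 * A / (A + x) ^ 3)"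
    using nz by (intro continuous_intros) auto
  from C2w_real_chain[OF C2w_norm_sq[of disk z0] d1 d2 d3]
  show thesis
    unfolding A_def by (intro that) (simp add: rho_def[abs_def] drho_def[abs_def])
qed

lemma rho_bounds:
  assumes "z0 \<in> disk"
  shows "norm (rho z0 z) \<le> 1" "cnj (rho z0 z) = rho z0 z"
proof -
  have "0 < (sc * \<tau> z0)\<^sup>2" using sc_pos tau_pos[OF assms] by simp
  then show "norm (rho z0 z) \<le> 1"
    unfolding rho_def norm_of_real by (simp add: divide_le_eq_1 add_pos_nonneg)
  show "cnj (rho z0 z) = rho z0 z" by (simp add: rho_def)
qed

text \<open>The twist is flat at scale \<open>\<tau>\<close> even far from \<open>z0\<close>, because \<open>\<tau>\<close> grows slowly; this is what class
  \<open>\<E>\<close> is needed for.\<close>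

lemma drho_bound:
  assumes z0: "z0 \<in> disk" and z: "z \<in> disk"
  shows "norm (drho z0 z) \<le> c / 16 * norm (rho z0 z * itau z)"
proof -
  define R where "R = sc * \<tau> z0"
  define d where "d = norm (z - z0)"
  have pos: "0 < R" "0 \<le> d" "0 < \<tau> z" using sc_pos tau_pos z z0 by (auto simp: R_def d_def)
  have S: "0 < R\<^sup>2 + d\<^sup>2" using pos by (simp add: add_pos_nonneg)
  have n1: "norm (drho z0 z) = R\<^sup>2 / (R\<^sup>2 + d\<^sup>2)\<^sup>2 * d"
    unfolding drho_def norm_mult complex_mod_cnj norm_of_real R_def[symmetric] d_def[symmetric] by simp
  have n2: "norm (rho z0 z * itau z) = R\<^sup>2 / (R\<^sup>2 + d\<^sup>2) / \<tau> z"
    unfolding rho_def itau_def norm_mult norm_of_real R_def[symmetric] d_def[symmetric] using S pos by simp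
  have "\<beta> * \<tau> z0 * d = c / 16 * (R * d)"
    using pos_consts by (simp add: R_def sc_def)
  also have "\<dots> \<le> c / 16 * ((R\<^sup>2 + d\<^sup>2) / 2)"
    using pos_consts sum_squares_bound[of R d] by (intro mult_left_mono) auto
  finally have 1: "\<beta> * \<tau> z0 * d \<le> c / 32 * (R\<^sup>2 + d\<^sup>2)" by simp
  have "\<tau> z * d \<le> (\<beta> * \<tau> z0 + c / 32 * d) * d"
    using growth[OF z z0] pos unfolding d_def by (intro mult_right_mono) auto
  also have "\<dots> = \<beta> * \<tau> z0 * d + c / 32 * d\<^sup>2"
    by (simp add: algebra_simps power2_eq_square)
  also have "\<dots> \<le> c / 32 * (R\<^sup>2 + d\<^sup>2) + c / 32 * (R\<^sup>2 + d\<^sup>2)"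
    using pos_consts by (intro add_mono 1 mult_left_mono) auto
  finally have "\<tau> z * d \<le> c / 16 * (R\<^sup>2 + d\<^sup>2)" by simp
  then have "d \<le> c / 16 * (R\<^sup>2 + d\<^sup>2) / \<tau> z"
    using pos by (simp add: le_divide_eq mult.commute)
  then have "R\<^sup>2 / (R\<^sup>2 + d\<^sup>2)\<^sup>2 * d \<le> R\<^sup>2 / (R\<^sup>2 + d\<^sup>2)\<^sup>2 * (c / 16 * (R\<^sup>2 + d\<^sup>2) / \<tau> z)"
    using S by (intro mult_left_mono) auto
  also have "\<dots> = c / 16 * (R\<^sup>2 / (R\<^sup>2 + d\<^sup>2) / \<tau> z)"
    using S by (simp add: power2_eq_square mult_ac)
  finally show ?thesis unfolding n1 n2 .
qed

lemma rho_cont: "z0 \<in> disk \<Longrightarrow> continuous_on disk (rho z0)"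
  by (rule rho_C2[of z0]) (auto simp: C2w_def dest: C1w_continuous(1))

lemma drho_cont: "z0 \<in> disk \<Longrightarrow> continuous_on disk (drho z0)"
  by (rule rho_C2[of z0]) (auto simp: C2w_def dest: C1w_continuous(2))

lemma sqi_rho: "z0 \<in> disk \<Longrightarrow> sqi diskm h \<Longrightarrow> sqi diskm (\<lambda>z. rho z0 z * h z)"
proof (rule sqi_dominated)
  assume z0: "z0 \<in> disk" and h: "sqi diskm h"
  show "(\<lambda>z. rho z0 z * h z) \<in> borel_measurable diskm"
    using h measurable_diskm_continuous[OF rho_cont[OF z0]] by (auto simp: sqi_def)
  show "norm (rho z0 z * h z) \<le> norm (h z)" for z
    using rho_bounds(1)[OF z0] by (simp add: norm_mult mult_left_le_one_le)
qed

lemma nrm_rho_le: "z0 \<in> disk \<Longrightarrow> sqi diskm h \<Longrightarrow> nrm diskm (\<lambda>z. rho z0 z * h z) \<le> nrm diskm h"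
  using rho_bounds(1) by (intro nrm_mono sqi_rho) (auto simp: norm_mult mult_left_le_one_le)

text \<open>Three inequalities for the twisted norms \<open>X\<close>, \<open>y\<close> and
  \<open>G\<close> close up on themselves. Orthogonality survives the twist because
  \<open>rho^2 * p\<close> is the derivative of the test function \<open>rho^2 * b\<close> up to the
  term \<open>2 * rho * drho * b\<close>, which \<open>drho_bound\<close> makes small.
  \<open>e\<close> is the defect of the approximation by \<open>ex * p\<close>.\<close>

theorem twisted_estimate:
  assumes z0: "z0 \<in> disk" and H: "sqi diskm H" and sg: "sqi diskm (gex g)" and t: "test_fun b p q m"
    and orth: "\<And>b p q m. test_fun b p q m \<Longrightarrow> ip diskm (\<lambda>z. ex z * p z) (gex g) = 0"
  defines "e \<equiv> nrm diskm (\<lambda>z. ex z * p z - (H z - gex g z))" and "h \<equiv> nrm diskm (\<lambda>z. rho z0 z * H z)"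
  shows "nrm diskm (\<lambda>z. rho z0 z * gex g z) \<le> 3 * (h + e)"
    and "nrm diskm (\<lambda>z. rho z0 z * (ex z * itau z * b z)) \<le> 4 / c * (h + e)"
proof -
  obtain rq rm where R: "C2w disk (rho z0) (drho z0) rq rm" by (rule rho_C2[OF z0])
  define D where "D z = ex z * p z - (H z - gex g z)" for z
  have sp: "sqi diskm (\<lambda>z. ex z * p z)" by (rule sqi_test(2)[OF t ex_cont])
  have sD: "sqi diskm D" unfolding D_def by (intro sqi_diff sp H sg)
  define X where "X = nrm diskm (\<lambda>z. rho z0 z * (ex z * p z))"
  define y where "y = nrm diskm (\<lambda>z. rho z0 z * (ex z * itau z * b z))"
  define G where "G = nrm diskm (\<lambda>z. rho z0 z * gex g z)"
  have sX: "sqi diskm (\<lambda>z. rho z0 z * (ex z * p z))" by (rule sqi_rho[OF z0 sp])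
  have sb: "sqi diskm (\<lambda>z. ex z * itau z * b z)"
    by (rule sqi_test(1)[OF t continuous_on_mult[OF ex_cont itau_cont]])
  have sy: "sqi diskm (\<lambda>z. rho z0 z * (ex z * itau z * b z))" by (rule sqi_rho[OF z0 sb])
  have sG: "sqi diskm (\<lambda>z. rho z0 z * gex g z)" by (rule sqi_rho[OF z0 sg])
  have sH: "sqi diskm (\<lambda>z. rho z0 z * H z)" by (rule sqi_rho[OF z0 H])
  have srD: "sqi diskm (\<lambda>z. rho z0 z * D z)" by (rule sqi_rho[OF z0 sD])
  have sdr: "sqi diskm (\<lambda>z. ex z * (drho z0 z * b z))"
    using sqi_test(1)[OF t continuous_on_mult[OF ex_cont drho_cont[OF z0]]] by (simp add: mult.assoc)
  have e: "e = nrm diskm D" unfolding e_def D_def ..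
  have nn: "0 \<le> X" "0 \<le> y" "0 \<le> G" "0 \<le> h" "0 \<le> e"
    by (auto simp: X_def y_def G_def h_def e_def nrm_nonneg)
  have c: "0 < c" using pos_consts by simp
  have rD: "nrm diskm (\<lambda>z. rho z0 z * D z) \<le> e"
    unfolding e by (rule nrm_rho_le[OF z0 sD])
  \<comment> \<open>The basic inequality for \<open>rho * b\<close>; the term in which
    \<open>rho\<close> is differentiated costs a sixteenth of the left-hand side.\<close>
  have y1: "c * y \<le> X + c / 16 * y"
  proof -
    have t1: "test_fun (\<lambda>z. rho z0 z * b z) (\<lambda>z. drho z0 z * b z + rho z0 z * p z) (\<lambda>z. rq z * b z + rho z0 z * q z)
        (\<lambda>z. rm z * b z + drho z0 z * q z + (rq z * p z + rho z0 z * m z))"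
      by (rule test_fun_mult[OF t R])
    have "c * y = c * nrm diskm (\<lambda>z. ex z * itau z * (rho z0 z * b z))"
      by (simp add: y_def mult_ac)
    also have "\<dots> \<le> nrm diskm (\<lambda>z. ex z * (drho z0 z * b z + rho z0 z * p z))"
      by (rule basic_inequality[OF t1])
    also have "(\<lambda>z. ex z * (drho z0 z * b z + rho z0 z * p z)) = (\<lambda>z. ex z * (drho z0 z * b z) + rho z0 z * (ex z * p z))"
      by (simp add: algebra_simps)
    also have "nrm diskm \<dots> \<le> nrm diskm (\<lambda>z. ex z * (drho z0 z * b z)) + X"
      unfolding X_def by (rule nrm_triangle[OF sdr sX])
    also have "nrm diskm (\<lambda>z. ex z * (drho z0 z * b z)) \<le> nrm diskm (\<lambda>z. of_real (c / 16) * (rho z0 z * (ex z * itau z * b z)))"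
    proof (rule nrm_mono[OF sdr sqi_scale[OF sy]])
      fix z assume "z \<in> space diskm"
      then have z: "z \<in> disk" by simp
      have "norm (ex z * (drho z0 z * b z)) = norm (drho z0 z) * norm (ex z * b z)"
        by (simp add: norm_mult)
      also have "\<dots> \<le> (c / 16 * norm (rho z0 z * itau z)) * norm (ex z * b z)"
        by (intro mult_right_mono drho_bound z0 z) simp
      also have "\<dots> = norm (of_real (c / 16) * (rho z0 z * (ex z * itau z * b z)))"
        using c by (simp add: norm_mult)
      finally show "norm (ex z * (drho z0 z * b z)) \<le> norm (of_real (c / 16) * (rho z0 z * (ex z * itau z * b z)))" .
    qed
    also have "nrm diskm (\<lambda>z. of_real (c / 16) * (rho z0 z * (ex z * itau z * b z))) = c / 16 * y"
      unfolding nrm_scale y_def norm_of_real using c by simp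
    finally show ?thesis by simp
  qed
  have y2: "c * y \<le> 2 * X"
  proof -
    have "c / 16 * y = (c * y) / 16" by simp
    then show ?thesis using y1 nn(1) by linarith
  qed
  have G1: "G \<le> h + X + e"
  proof -
    have "(\<lambda>z. rho z0 z * gex g z) = (\<lambda>z. (rho z0 z * H z - rho z0 z * (ex z * p z)) + rho z0 z * D z)"
      by (simp add: D_def algebra_simps)
    then have "G = nrm diskm (\<lambda>z. (rho z0 z * H z - rho z0 z * (ex z * p z)) + rho z0 z * D z)"
      by (simp only: G_def)
    also have "\<dots> \<le> nrm diskm (\<lambda>z. rho z0 z * H z - rho z0 z * (ex z * p z)) + nrm diskm (\<lambda>z. rho z0 z * D z)"
      by (rule nrm_triangle[OF sqi_diff[OF sH sX] srD])
    also have "nrm diskm (\<lambda>z. rho z0 z * H z - rho z0 z * (ex z * p z)) \<le> h + X"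
      using nrm_triangle[OF sH sqi_minus[OF sX]] by (simp add: h_def X_def nrm_def)
    finally show ?thesis using rD by simp
  qed
  \<comment> \<open>Expand one factor of \<open>X^2\<close> by the definition of \<open>D\<close>.
    As \<open>rho\<close> is real, it can be shifted between the two arguments of the inner product,
    which brings in \<open>rho^2 * b\<close>.\<close>
  have X1: "X\<^sup>2 \<le> X * h + c / 8 * y * G + X * e"
  proof -
    have t2: "test_fun (\<lambda>z. (rho z0 z * rho z0 z) * b z)
        (\<lambda>z. (drho z0 z * rho z0 z + rho z0 z * drho z0 z) * b z + (rho z0 z * rho z0 z) * p z)
        (\<lambda>z. (rq z * rho z0 z + rho z0 z * rq z) * b z + (rho z0 z * rho z0 z) * q z)
        (\<lambda>z. (rm z * rho z0 z + drho z0 z * rq z + (rq z * drho z0 z + rho z0 z * rm z)) * b z + (drho z0 z * rho z0 z + rho z0 z * drho z0 z) * q z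
          + ((rq z * rho z0 z + rho z0 z * rq z) * p z + (rho z0 z * rho z0 z) * m z))"
      by (rule test_fun_mult[OF t C2w_mult[OF R R]])
    let ?P = "\<lambda>z. rho z0 z * (ex z * p z)"
    have "ip diskm ?P ?P = ip diskm ?P (\<lambda>z. (rho z0 z * H z - rho z0 z * gex g z) - - (rho z0 z * D z))"
      by (rule arg_cong[where f = "ip diskm ?P"]) (simp add: D_def algebra_simps)
    also have "\<dots> = (ip diskm ?P (\<lambda>z. rho z0 z * H z) - ip diskm ?P (\<lambda>z. rho z0 z * gex g z)) - ip diskm ?P (\<lambda>z. - (rho z0 z * D z))"
      unfolding ip_diff_right[OF sqi_diff[OF sH sG] sqi_minus[OF srD] sX] ip_diff_right[OF sH sG sX] ..
    finally have split: "ip diskm ?P ?P = (ip diskm ?P (\<lambda>z. rho z0 z * H z) - ip diskm ?P (\<lambda>z. rho z0 z * gex g z)) - ip diskm ?P (\<lambda>z. - (rho z0 z * D z))" .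
    have a: "norm (ip diskm ?P (\<lambda>z. rho z0 z * H z)) \<le> X * h"
      unfolding X_def h_def by (rule ip_bound[OF sX sH])
    have b: "norm (ip diskm ?P (\<lambda>z. - (rho z0 z * D z))) \<le> X * e"
    proof -
      have "norm (ip diskm ?P (\<lambda>z. - (rho z0 z * D z))) \<le> X * nrm diskm (\<lambda>z. - (rho z0 z * D z))"
        unfolding X_def by (rule ip_bound[OF sX sqi_minus[OF srD]])
      also have "nrm diskm (\<lambda>z. - (rho z0 z * D z)) = nrm diskm (\<lambda>z. rho z0 z * D z)"
        by (simp add: nrm_def)
      also have "X * \<dots> \<le> X * e" by (intro mult_left_mono rD nn)
      finally show ?thesis .
    qed
    have d: "norm (ip diskm ?P (\<lambda>z. rho z0 z * gex g z)) \<le> c / 8 * y * G"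
    proof -
      let ?T = "\<lambda>z. ex z * ((drho z0 z * rho z0 z + rho z0 z * drho z0 z) * b z + (rho z0 z * rho z0 z) * p z)"
      let ?W = "\<lambda>z. 2 * (ex z * (drho z0 z * b z))"
      have "ip diskm ?P (\<lambda>z. rho z0 z * gex g z) = ip diskm (\<lambda>z. ?T z - rho z0 z * ?W z) (gex g)"
        unfolding ip_def complex_cnj_mult rho_bounds(2)[OF z0]
        by (rule Bochner_Integration.integral_cong[OF refl]) (simp add: algebra_simps)
      also have "\<dots> = ip diskm ?T (gex g) - ip diskm (\<lambda>z. rho z0 z * ?W z) (gex g)"
        by (rule ip_diff_left[OF sqi_test(2)[OF t2 ex_cont] sqi_rho[OF z0 sqi_scale[OF sdr]] sg])
      also have "ip diskm ?T (gex g) = 0" by (rule orth[OF t2])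
      also have "ip diskm (\<lambda>z. rho z0 z * ?W z) (gex g) = ip diskm ?W (\<lambda>z. rho z0 z * gex g z)"
        unfolding ip_def complex_cnj_mult rho_bounds(2)[OF z0] by (simp add: mult_ac)
      finally have "norm (ip diskm ?P (\<lambda>z. rho z0 z * gex g z)) = norm (ip diskm ?W (\<lambda>z. rho z0 z * gex g z))"
        by simp
      also have "\<dots> \<le> nrm diskm ?W * G"
        unfolding G_def by (rule ip_bound[OF sqi_scale[OF sdr] sG])
      also have "nrm diskm ?W \<le> nrm diskm (\<lambda>z. of_real (c / 8) * (rho z0 z * (ex z * itau z * b z)))"
      proof (rule nrm_mono[OF sqi_scale[OF sdr] sqi_scale[OF sy]])
        fix z assume "z \<in> space diskm"
        then have z: "z \<in> disk" by simp
        have "norm (?W z) = 2 * norm (drho z0 z) * norm (ex z * b z)"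
          by (simp add: norm_mult)
        also have "\<dots> \<le> 2 * (c / 16 * norm (rho z0 z * itau z)) * norm (ex z * b z)"
          by (intro mult_right_mono mult_left_mono drho_bound z0 z) auto
        also have "\<dots> = norm (of_real (c / 8) * (rho z0 z * (ex z * itau z * b z)))"
          using c by (simp add: norm_mult)
        finally show "norm (?W z) \<le> norm (of_real (c / 8) * (rho z0 z * (ex z * itau z * b z)))" .
      qed
      also have "nrm diskm (\<lambda>z. of_real (c / 8) * (rho z0 z * (ex z * itau z * b z))) = c / 8 * y"
        unfolding nrm_scale y_def norm_of_real using c by simp
      finally show ?thesis using nn by (simp add: mult_right_mono)
    qed
    have "X\<^sup>2 = norm (ip diskm ?P ?P)"
      unfolding ip_self X_def norm_of_real by simp
    also have "\<dots> \<le> (X * h + c / 8 * y * G) + X * e"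
      unfolding split by (intro order_trans[OF norm_triangle_ineq4] add_mono a b d)
    finally show ?thesis by simp
  qed
  \<comment> \<open>By \<open>y2\<close> and \<open>G1\<close> the cross term is at most
    \<open>X * (h + X + e) / 4\<close>. After division by \<open>X\<close> a quarter of
    \<open>X\<close> is absorbed on the left.\<close>
  have X2: "X \<le> 2 * (h + e)"
  proof (cases "X = 0")
    case True
    then show ?thesis using nn by simp
  next
    case False
    have "c / 8 * y * G = (c * y) * G / 8" by simp
    also have "\<dots> \<le> (2 * X) * (h + X + e) / 8"
      by (intro divide_right_mono mult_mono[OF y2 G1]) (use nn in auto)
    finally have "X\<^sup>2 \<le> X * h + (2 * X) * (h + X + e) / 8 + X * e"
      using X1 by linarith
    also have "\<dots> = X * (h + (h + X + e) / 4 + e)" by (simp add: algebra_simps)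
    finally have "X * X \<le> X * (h + (h + X + e) / 4 + e)" by (simp add: power2_eq_square)
    moreover have "0 < X" using False nn by simp
    ultimately have *: "X \<le> h + (h + X + e) / 4 + e"
      by (rule mult_left_le_imp_le)
    have "4 * X \<le> 4 * (h + (h + X + e) / 4 + e)"
      using * by (rule mult_left_mono) simp
    also have "\<dots> = 5 * h + 5 * e + X" by (simp add: algebra_simps)
    finally have "3 * X \<le> 5 * h + 5 * e" by simp
    moreover have "5 * h + 5 * e \<le> 6 * h + 6 * e" using nn(4,5) by simp
    ultimately have "3 * X \<le> 6 * h + 6 * e" by (rule order_trans)
    then show ?thesis by simp
  qed
  show "nrm diskm (\<lambda>z. rho z0 z * gex g z) \<le> 3 * (h + e)"
    using G1 X2 nn unfolding G_def by simp
  have "c * y \<le> 4 * (h + e)" using y2 X2 by linarith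
  then have "y \<le> 4 * (h + e) / c" using c by (simp add: le_divide_eq mult.commute)
  then show "nrm diskm (\<lambda>z. rho z0 z * (ex z * itau z * b z)) \<le> 4 / c * (h + e)"
    unfolding y_def by simp
qed

end

section \<open>Local averages and pointwise bounds\<close>

lemma nrm_indicator_cball:
  assumes "0 \<le> r"
  shows "sqi diskm (\<lambda>z. of_real (indicator (cball a r) z))" "nrm diskm (\<lambda>z. of_real (indicator (cball a r) z)) \<le> 2 * r"
proof -
  let ?i = "\<lambda>z. indicator (cball a r) z :: real"
  have im: "?i \<in> borel_measurable diskm"
    by (rule measurable_restrict_space1[OF borel_measurable_indicator]) simp
  have eq: "(norm (complex_of_real (?i z)))\<^sup>2 = ?i z" for z
    by (simp add: indicator_def)
  interpret finite_measure diskm by (rule finite_measure_diskm)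
  have i: "integrable diskm ?i"
    by (rule integrable_const_bound[of _ 1]) (use im in auto)
  then show sq: "sqi diskm (\<lambda>z. of_real (?i z))"
    unfolding sqi_def eq using im by auto
  have il: "integrable lborel ?i"
    by (rule integrable_real_indicator) (use emeasure_bounded_finite[OF bounded_cball] in auto)
  show "nrm diskm (\<lambda>z. of_real (?i z)) \<le> 2 * r"
  proof (rule power2_le_imp_le)
    have "(nrm diskm (\<lambda>z. of_real (?i z)))\<^sup>2 = (\<integral>z. ?i z \<partial>diskm)"
      unfolding nrm_sq eq ..
    also have "\<dots> = (\<integral>z. indicator disk z *\<^sub>R ?i z \<partial>lborel)"
      by (rule integral_restrict_space) simp
    also have "\<dots> \<le> (\<integral>z. ?i z \<partial>lborel)"
      by (rule integral_mono[OF integrable_mult_indicator[OF _ il] il]) (auto simp: indicator_def)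
    also have "\<dots> = pi * r\<^sup>2"
      using assms by (simp add: content_cball unit_ball_vol_2)
    also have "\<dots> \<le> 4 * r\<^sup>2"
      using pi_less_4 by (intro mult_right_mono) auto
    finally show "(nrm diskm (\<lambda>z. of_real (?i z)))\<^sup>2 \<le> (2 * r)\<^sup>2"
      by (simp add: power_mult_distrib)
  qed (use assms in simp)
qed

context slow_weight
begin

text \<open>Dyadic summation: \<open>rho^2\<close> is at most \<open>16 / 16^k\<close> on the k-th
  dyadic annulus, while the area of the enclosing disk grows like \<open>4^k\<close>, so the series
  has ratio 1/4. The sum \<open>64/3 * pi * R^2\<close> is below \<open>(10 * R)^2\<close>.\<close>

lemma nrm_rho:
  assumes z0: "z0 \<in> disk"
  shows "sqi diskm (rho z0)" "nrm diskm (rho z0) \<le> 10 * sc * \<tau> z0"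
proof -
  define R where "R = sc * \<tau> z0"
  have R: "0 < R" using sc_pos tau_pos[OF z0] by (simp add: R_def)
  define r where "r z = R\<^sup>2 / (R\<^sup>2 + (norm (z - z0))\<^sup>2)" for z
  have rho: "rho z0 z = of_real (r z)" for z by (simp add: rho_def r_def R_def)
  have r0: "0 \<le> r z" for z unfolding r_def by simp
  have pt: "ennreal ((r z)\<^sup>2) \<le> (\<Sum>k. ennreal (16 / 16 ^ k) * indicator (ball z0 (2 ^ k * R)) z)" for z
  proof -
    define d where "d = norm (z - z0)"
    have ex: "\<exists>k. d < 2 ^ k * R"
    proof -
      obtain k where "d / R < 2 ^ k" using real_arch_pow[of 2 "d / R"] by auto
      then show ?thesis using R by (auto simp: divide_less_eq)
    qed
    \<comment> \<open>Minimality places \<open>z\<close> outside the previous disk, which is the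
      lower bound on its distance from \<open>z0\<close>.\<close>
    define k where "k = (LEAST k. d < 2 ^ k * R)"
    have k: "d < 2 ^ k * R" unfolding k_def using ex by (rule LeastI_ex)
    have "(r z)\<^sup>2 \<le> 16 / 16 ^ k"
    proof (cases k)
      case 0
      have "r z \<le> 1" unfolding r_def using R by (simp add: divide_le_eq_1 add_pos_nonneg)
      then have "(r z)\<^sup>2 \<le> 1" using r0 by (simp add: power_le_one)
      then show ?thesis using 0 by simp
    next
      case (Suc j)
      then have "\<not> d < 2 ^ j * R" using not_less_Least[of j "\<lambda>k. d < 2 ^ k * R"] by (simp add: k_def)
      then have dj: "2 ^ j * R \<le> d" by simp
      have "4 ^ j * R\<^sup>2 = (2 ^ j * R)\<^sup>2"
        by (simp add: power_mult_distrib power2_eq_square flip: power_mult_distrib)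
      also have "\<dots> \<le> d\<^sup>2" using dj R by (intro power_mono) auto
      finally have "4 ^ j * R\<^sup>2 \<le> R\<^sup>2 + d\<^sup>2" using zero_le_power2[of R] by linarith
      then have "r z \<le> 1 / 4 ^ j"
        unfolding r_def d_def[symmetric] using R by (simp add: field_simps add_pos_nonneg)
      then have "(r z)\<^sup>2 \<le> (1 / 4 ^ j)\<^sup>2" by (intro power_mono r0)
      also have "\<dots> = 16 / 16 ^ k"
        by (simp add: Suc power2_eq_square power_one_over flip: power_mult_distrib)
      finally show ?thesis .
    qed
    then have "ennreal ((r z)\<^sup>2) \<le> ennreal (16 / 16 ^ k) * indicator (ball z0 (2 ^ k * R)) z"
      using k by (simp add: d_def dist_norm norm_minus_commute ennreal_leI)
    also have "\<dots> \<le> (\<Sum>k. ennreal (16 / 16 ^ k) * indicator (ball z0 (2 ^ k * R)) z)"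
    proof -
      have "F k \<le> suminf F" for F :: "nat \<Rightarrow> ennreal"
        using sum_le_suminf[of F "{k}"] by simp
      then show ?thesis .
    qed
    finally show ?thesis .
  qed
  have rm: "r \<in> borel_measurable diskm"
    unfolding r_def using R by (intro measurable_diskm_continuous continuous_intros) (auto simp: add_pos_nonneg less_imp_neq[symmetric])
  have "(\<integral>\<^sup>+z. ennreal ((r z)\<^sup>2) \<partial>diskm) = (\<integral>\<^sup>+z. ennreal ((r z)\<^sup>2) * indicator disk z \<partial>lborel)"
    by (rule nn_integral_restrict_space) simp
  also have "\<dots> \<le> (\<integral>\<^sup>+z. (\<Sum>k. ennreal (16 / 16 ^ k) * indicator (ball z0 (2 ^ k * R)) z) \<partial>lborel)"
    using pt by (intro nn_integral_mono) (auto simp: indicator_def)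
  also have "\<dots> = (\<Sum>k. \<integral>\<^sup>+z. ennreal (16 / 16 ^ k) * indicator (ball z0 (2 ^ k * R)) z \<partial>lborel)"
    by (intro nn_integral_suminf borel_measurable_times_ennreal borel_measurable_const borel_measurable_indicator) simp
  also have "\<dots> = (\<Sum>k. ennreal (16 * pi * R\<^sup>2 * (1/4) ^ k))"
  proof (rule suminf_cong)
    fix k
    have "(\<integral>\<^sup>+z. ennreal (16 / 16 ^ k) * indicator (ball z0 (2 ^ k * R)) z \<partial>lborel) = ennreal (16 / 16 ^ k) * emeasure lborel (ball z0 (2 ^ k * R))"
      by (rule nn_integral_cmult_indicator) simp
    also have "emeasure lborel (ball z0 (2 ^ k * R)) = ennreal (pi * (2 ^ k * R)\<^sup>2)"
      using R by (simp add: emeasure_ball unit_ball_vol_2)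
    also have "ennreal (16 / 16 ^ k) * \<dots> = ennreal (16 / 16 ^ k * (pi * (2 ^ k * R)\<^sup>2))"
      by (rule ennreal_mult'[symmetric]) simp
    also have "16 / 16 ^ k * (pi * (2 ^ k * R)\<^sup>2) = 16 * pi * R\<^sup>2 * (1/4) ^ k"
    proof -
      have "(2 ^ k)\<^sup>2 / 16 ^ k = (1/4::real) ^ k"
        by (simp add: power2_eq_square flip: power_mult_distrib power_divide)
      then show ?thesis by (simp add: power_mult_distrib field_simps)
    qed
    finally show "(\<integral>\<^sup>+z. ennreal (16 / 16 ^ k) * indicator (ball z0 (2 ^ k * R)) z \<partial>lborel) = ennreal (16 * pi * R\<^sup>2 * (1/4) ^ k)" .
  qed
  also have "\<dots> = ennreal (\<Sum>k. 16 * pi * R\<^sup>2 * (1/4) ^ k)"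
    by (intro suminf_ennreal2 summable_mult summable_geometric) auto
  also have "(\<Sum>k. 16 * pi * R\<^sup>2 * (1/4) ^ k) = 16 * pi * R\<^sup>2 * (4/3)"
    by (subst suminf_mult) (auto simp: suminf_geometric)
  finally have le: "(\<integral>\<^sup>+z. ennreal ((r z)\<^sup>2) \<partial>diskm) \<le> ennreal (16 * pi * R\<^sup>2 * (4/3))" .
  then have "(\<integral>\<^sup>+z. ennreal ((r z)\<^sup>2) \<partial>diskm) < \<infinity>" by (rule order_le_less_trans) simp
  then have i: "integrable diskm (\<lambda>z. (r z)\<^sup>2)"
    using rm by (intro integrableI_nonneg) auto
  then show sq: "sqi diskm (rho z0)"
    using rm unfolding sqi_def rho by (auto simp: rho[abs_def])
  show "nrm diskm (rho z0) \<le> 10 * sc * \<tau> z0"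
  proof (rule power2_le_imp_le)
    have "(nrm diskm (rho z0))\<^sup>2 = (\<integral>z. (r z)\<^sup>2 \<partial>diskm)"
      unfolding nrm_sq rho by simp
    also have "\<dots> \<le> 16 * pi * R\<^sup>2 * (4/3)"
    proof -
      have "ennreal (\<integral>z. (r z)\<^sup>2 \<partial>diskm) \<le> ennreal (16 * pi * R\<^sup>2 * (4/3))"
        using le nn_integral_eq_integral[OF i] by simp
      then show ?thesis by (subst (asm) ennreal_le_iff) auto
    qed
    also have "\<dots> = (64 / 3 * pi) * R\<^sup>2" by simp
    also have "\<dots> \<le> 100 * R\<^sup>2"
      using pi_less_4 by (intro mult_right_mono) auto
    also have "\<dots> = (10 * sc * \<tau> z0)\<^sup>2" by (simp add: R_def power_mult_distrib)
    finally show "(nrm diskm (rho z0))\<^sup>2 \<le> (10 * sc * \<tau> z0)\<^sup>2" .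
  qed (use sc_pos tau_pos[OF z0] in simp)
qed

text \<open>On the ball of radius \<open>del * \<tau> z\<close> about \<open>z\<close>, which stays in the disk, \<open>\<tau>\<close> is comparable to \<open>\<tau> z\<close>.\<close>

definition del :: real where "del = min sc (min (1 / (2 * c1)) (1 / (2 * c2)))"

lemma del_pos: "0 < del" "del \<le> sc" "del * c1 \<le> 1/2" "del * c2 \<le> 1/2"
proof -
  have "del \<le> 1 / (2 * c1)" "del \<le> 1 / (2 * c2)" by (auto simp: del_def)
  then show "del * c1 \<le> 1/2" "del * c2 \<le> 1/2"
    using pos_consts by (simp_all add: le_divide_eq)
qed (use sc_pos pos_consts in \<open>auto simp: del_def\<close>)

lemma cball_sub:
  assumes z: "z \<in> disk"
  shows "cball z (del * \<tau> z) \<subseteq> disk"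
proof
  fix w assume "w \<in> cball z (del * \<tau> z)"
  then have "norm (w - z) \<le> del * \<tau> z" by (simp add: dist_norm norm_minus_commute)
  also have "\<dots> \<le> del * (c1 * (1 - norm z))"
    using del_pos tau_bd[OF z] by (intro mult_left_mono) auto
  also have "\<dots> = (del * c1) * (1 - norm z)" by simp
  also have "\<dots> \<le> 1/2 * (1 - norm z)"
    using z del_pos by (intro mult_right_mono) auto
  also have "\<dots> < 1 - norm z" using z by simp
  finally show "w \<in> disk" using norm_triangle_ineq2[of w z] by simp
qed

lemma tau_compare:
  assumes "z \<in> disk" "w \<in> disk" "norm (w - z) \<le> del * \<tau> z"
  shows "\<tau> z \<le> 2 * \<tau> w" "\<tau> w \<le> 3/2 * \<tau> z"
proof -
  have "\<bar>\<tau> w - \<tau> z\<bar> \<le> c2 * norm (w - z)" by (rule tau_lip[OF assms(2,1)])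
  also have "\<dots> \<le> c2 * (del * \<tau> z)" using pos_consts assms by (intro mult_left_mono) auto
  also have "\<dots> = (del * c2) * \<tau> z" by simp
  also have "\<dots> \<le> 1/2 * \<tau> z" using tau_pos[OF assms(1)] del_pos by (intro mult_right_mono) auto
  finally show "\<tau> z \<le> 2 * \<tau> w" "\<tau> w \<le> 3/2 * \<tau> z" by linarith+
qed

definition K1 :: real where "K1 = 2 * exp (4 * B * del\<^sup>2) / del\<^sup>2"

lemma K1_pos: "0 < K1"
  using del_pos by (simp add: K1_def)

text \<open>On the disk of radius \<open>del * \<tau> z\<close> the Laplacian bound is
  \<open>4 * B / (\<tau> z)^2\<close>. Its product with the squared radius is scale invariant, so
  \<open>K1\<close> does not depend on \<open>z\<close>.\<close>

lemma submean:
  assumes g: "g holomorphic_on disk" and z: "z \<in> disk"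
  shows "norm (gex g z) \<le> K1 / (\<tau> z)\<^sup>2 * (\<integral>w. indicator (cball z (del * \<tau> z)) w * norm (gex g w) \<partial>diskm)"
proof -
  let ?R = "del * \<tau> z"
  have R: "0 < ?R" using del_pos tau_pos[OF z] by simp
  have n: "norm (gex g w) = norm (g w) * exp (- \<phi> w)" for w
    by (simp add: gex_def norm_mult)
  have "Re (lap w) \<le> 4 * B / (\<tau> z)\<^sup>2" if "w \<in> cball z ?R" for w
  proof -
    have w: "w \<in> disk" using that cball_sub[OF z] by blast
    have t: "\<tau> z / 2 \<le> \<tau> w"
      using tau_compare(1)[OF z w] that by (simp add: dist_norm norm_minus_commute)
    have "Re (lap w) \<le> B / (\<tau> w)\<^sup>2" by (rule lap_up[OF w])
    also have "\<dots> \<le> B / (\<tau> z / 2)\<^sup>2"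
      using pos_consts t tau_pos[OF z] tau_pos[OF w] by (intro divide_left_mono power_mono) auto
    finally show ?thesis by (simp add: power_divide mult.commute)
  qed
  from submean_holomorphic[OF g open_ball C2 cball_sub[OF z] R this]
  have "norm (gex g z) \<le> 2 * exp (4 * B / (\<tau> z)\<^sup>2 * ?R\<^sup>2) / ?R\<^sup>2 *
      (\<integral>w. (if w \<in> cball z ?R then norm (g w) * exp (- \<phi> w) else 0) \<partial>lborel)"
    using pos_consts by (simp add: n)
  also have "(\<integral>w. (if w \<in> cball z ?R then norm (g w) * exp (- \<phi> w) else 0) \<partial>lborel)
      = (\<integral>w. indicator disk w *\<^sub>R (indicator (cball z ?R) w * norm (gex g w)) \<partial>lborel)"
    using cball_sub[OF z] by (intro Bochner_Integration.integral_cong) (auto simp: indicator_def n)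
  also have "\<dots> = (\<integral>w. indicator (cball z ?R) w * norm (gex g w) \<partial>diskm)"
    by (rule integral_restrict_space[symmetric]) simp
  also have "2 * exp (4 * B / (\<tau> z)\<^sup>2 * ?R\<^sup>2) / ?R\<^sup>2 = K1 / (\<tau> z)\<^sup>2"
    using tau_pos[OF z] by (simp add: K1_def power_mult_distrib)
  finally show ?thesis .
qed

lemma rho_lower:
  assumes z0: "z0 \<in> disk" and d: "norm (z - z0) \<le> a * sc * \<tau> z0" "0 \<le> a"
  shows "1 \<le> (1 + a\<^sup>2) * norm (rho z0 z)"
proof -
  define R where "R = sc * \<tau> z0"
  have R: "0 < R" using sc_pos tau_pos[OF z0] by (simp add: R_def)
  have n: "norm (rho z0 z) = R\<^sup>2 / (R\<^sup>2 + (norm (z - z0))\<^sup>2)"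
    unfolding rho_def norm_of_real R_def[symmetric] using R by simp
  have "(norm (z - z0))\<^sup>2 \<le> (a * R)\<^sup>2"
    using d by (intro power_mono) (auto simp: R_def mult.assoc)
  then have "R\<^sup>2 + (norm (z - z0))\<^sup>2 \<le> (1 + a\<^sup>2) * R\<^sup>2"
    by (simp add: power_mult_distrib algebra_simps)
  moreover have "0 < R\<^sup>2 + (norm (z - z0))\<^sup>2" using R by (simp add: add_pos_nonneg)
  ultimately show ?thesis unfolding n by (simp add: le_divide_eq)
qed

text \<open>Cauchy-Schwarz against the indicator of the disk, on which \<open>rho z0\<close> is at
  least \<open>1 / (1 + a^2)\<close>. The dilation \<open>a\<close> is 1 for averages about the
  centre itself and 2 where the centre varies.\<close>

lemma local_average:
  assumes z0: "z0 \<in> disk" and h: "sqi diskm h" and a: "0 \<le> a"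
  shows "integrable diskm (\<lambda>w. indicator (cball z0 (a * del * \<tau> z0)) w * norm (h w))"
    "(\<integral>w. indicator (cball z0 (a * del * \<tau> z0)) w * norm (h w) \<partial>diskm) \<le> 2 * a * del * \<tau> z0 * ((1 + a\<^sup>2) * nrm diskm (\<lambda>z. rho z0 z * h z))"
proof -
  let ?i = "\<lambda>z. of_real (indicator (cball z0 (a * del * \<tau> z0)) z) :: complex"
  have r: "0 \<le> a * del * \<tau> z0" using a del_pos tau_pos[OF z0] by simp
  note i = nrm_indicator_cball[OF r, of z0]
  have ih: "sqi diskm (\<lambda>z. ?i z * h z)"
  proof (rule sqi_dominated[OF h])
    show "(\<lambda>z. ?i z * h z) \<in> borel_measurable diskm" using i(1) h by (auto simp: sqi_def)
  qed (auto simp: norm_mult indicator_def)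
  have eq: "indicator (cball z0 (a * del * \<tau> z0)) w * norm (h w) = norm (?i w) * norm (?i w * h w)" for w
    by (auto simp: indicator_def)
  show "integrable diskm (\<lambda>w. indicator (cball z0 (a * del * \<tau> z0)) w * norm (h w))"
    unfolding eq by (rule integrable_norm_mult[OF i(1) ih])
  have "(\<integral>w. indicator (cball z0 (a * del * \<tau> z0)) w * norm (h w) \<partial>diskm) \<le> nrm diskm ?i * nrm diskm (\<lambda>z. ?i z * h z)"
    unfolding eq by (rule cauchy_schwarz_norm[OF i(1) ih])
  also have "\<dots> \<le> (2 * (a * del * \<tau> z0)) * ((1 + a\<^sup>2) * nrm diskm (\<lambda>z. rho z0 z * h z))"
  proof (rule mult_mono[OF i(2)])
    have "nrm diskm (\<lambda>z. ?i z * h z) \<le> nrm diskm (\<lambda>z. of_real (1 + a\<^sup>2) * (rho z0 z * h z))"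
    proof (rule nrm_mono[OF ih sqi_scale[OF sqi_rho[OF z0 h]]])
      fix z
      have p: "0 \<le> 1 + a\<^sup>2" by simp
      show "norm (?i z * h z) \<le> norm (of_real (1 + a\<^sup>2) * (rho z0 z * h z))"
      proof (cases "z \<in> cball z0 (a * del * \<tau> z0)")
        case True
        then have "norm (z - z0) \<le> a * del * \<tau> z0" by (simp add: dist_norm norm_minus_commute)
        also have "\<dots> \<le> a * sc * \<tau> z0"
          using a del_pos tau_pos[OF z0] by (intro mult_right_mono mult_left_mono) auto
        finally have "1 \<le> (1 + a\<^sup>2) * norm (rho z0 z)" using rho_lower[OF z0] a by blast
        then have "1 * norm (h z) \<le> ((1 + a\<^sup>2) * norm (rho z0 z)) * norm (h z)"
          by (intro mult_right_mono) auto
        also have "\<dots> = norm (of_real (1 + a\<^sup>2) * (rho z0 z * h z))"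
          unfolding norm_mult norm_of_real abs_of_nonneg[OF p] by simp
        finally show ?thesis using True by simp
      qed simp
    qed
    also have "\<dots> = (1 + a\<^sup>2) * nrm diskm (\<lambda>z. rho z0 z * h z)"
      unfolding nrm_scale norm_of_real by (simp add: abs_of_nonneg)
    finally show "nrm diskm (\<lambda>z. ?i z * h z) \<le> (1 + a\<^sup>2) * nrm diskm (\<lambda>z. rho z0 z * h z)" .
  qed (use r in \<open>auto simp: nrm_nonneg\<close>)
  finally show "(\<integral>w. indicator (cball z0 (a * del * \<tau> z0)) w * norm (h w) \<partial>diskm) \<le> 2 * a * del * \<tau> z0 * ((1 + a\<^sup>2) * nrm diskm (\<lambda>z. rho z0 z * h z))"
    by (simp add: mult.assoc)
qed

lemma bounded_sqi:
  assumes "H \<in> borel_measurable diskm" "\<And>z. z \<in> disk \<Longrightarrow> norm (H z) \<le> 1"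
  shows "sqi diskm H" "z0 \<in> disk \<Longrightarrow> nrm diskm (\<lambda>z. rho z0 z * H z) \<le> 10 * sc * \<tau> z0"
proof -
  interpret finite_measure diskm by (rule finite_measure_diskm)
  have 1: "sqi diskm (\<lambda>z. 1)" by (simp add: sqi_def)
  show H: "sqi diskm H"
    by (rule sqi_dominated[OF 1 assms(1)]) (use assms(2) in simp)
  assume z0: "z0 \<in> disk"
  have "nrm diskm (\<lambda>z. rho z0 z * H z) \<le> nrm diskm (rho z0)"
    by (rule nrm_mono[OF sqi_rho[OF z0 H] nrm_rho(1)[OF z0]])
       (use assms(2) in \<open>auto simp: norm_mult intro!: mult_right_le_one_le\<close>)
  also note nrm_rho(2)[OF z0]
  finally show "nrm diskm (\<lambda>z. rho z0 z * H z) \<le> 10 * sc * \<tau> z0" .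
qed

text \<open>The factor 120 is 4 from \<open>local_average\<close> with \<open>a = 1\<close>, 3 from
  \<open>twisted_estimate\<close> and 10 from \<open>nrm_rho\<close>.\<close>

definition Kinf :: real where "Kinf = 120 * K1 * del * sc"

text \<open>The powers of \<open>\<tau> z\<close> cancel: \<open>submean\<close> contributes -2, the
  radius of the averaging disk 1, and the twisted norm of \<open>H\<close> the remaining 1.\<close>

theorem projection_sup_bound:
  assumes H: "H \<in> borel_measurable diskm" "\<And>z. z \<in> disk \<Longrightarrow> norm (H z) \<le> 1"
    and g: "g holomorphic_on disk" "sqi diskm (gex g)"
    and t: "\<And>n::nat. test_fun (bb n) (pp n) (qq n) (mm n)"
    and lim: "(\<lambda>n. nrm diskm (\<lambda>z. ex z * pp n z - (H z - gex g z))) \<longlonglongrightarrow> 0"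
    and orth: "\<And>b p q m. test_fun b p q m \<Longrightarrow> ip diskm (\<lambda>z. ex z * p z) (gex g) = 0"
    and z: "z \<in> disk"
  shows "norm (gex g z) \<le> Kinf"
proof -
  note sH = bounded_sqi(1)[OF H] and rH = bounded_sqi(2)[OF H z]
  have "nrm diskm (\<lambda>w. rho z w * gex g w) \<le> 3 * (nrm diskm (\<lambda>w. rho z w * H w) + nrm diskm (\<lambda>w. ex w * pp n w - (H w - gex g w)))" for n
    by (rule twisted_estimate(1)[OF z sH g(2) t orth])
  moreover have "(\<lambda>n. 3 * (nrm diskm (\<lambda>w. rho z w * H w) + nrm diskm (\<lambda>w. ex w * pp n w - (H w - gex g w)))) \<longlonglongrightarrow> 3 * (nrm diskm (\<lambda>w. rho z w * H w) + 0)"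
    by (intro tendsto_intros lim)
  ultimately have "nrm diskm (\<lambda>w. rho z w * gex g w) \<le> 3 * (nrm diskm (\<lambda>w. rho z w * H w) + 0)"
    by (intro LIMSEQ_le_const) auto
  then have G: "nrm diskm (\<lambda>w. rho z w * gex g w) \<le> 30 * sc * \<tau> z"
    using rH by simp
  have tz: "0 < \<tau> z" by (rule tau_pos[OF z])
  have "norm (gex g z) \<le> K1 / (\<tau> z)\<^sup>2 * (\<integral>w. indicator (cball z (1 * del * \<tau> z)) w * norm (gex g w) \<partial>diskm)"
    using submean[OF g(1) z] by simp
  also have "\<dots> \<le> K1 / (\<tau> z)\<^sup>2 * (2 * 1 * del * \<tau> z * ((1 + 1\<^sup>2) * nrm diskm (\<lambda>w. rho z w * gex g w)))"
    using K1_pos by (intro mult_left_mono local_average(2)[OF z g(2)]) auto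
  also have "\<dots> \<le> K1 / (\<tau> z)\<^sup>2 * (2 * 1 * del * \<tau> z * ((1 + 1\<^sup>2) * (30 * sc * \<tau> z)))"
    using K1_pos del_pos tz by (intro mult_left_mono G) auto
  also have "\<dots> = Kinf"
    using tz by (simp add: Kinf_def power2_eq_square field_simps)
  finally show ?thesis .
qed

text \<open>The factor 180 is the product of 9/4 from comparing \<open>\<tau>\<close> at
  neighbouring points, 4 and 5 from \<open>local_average\<close> with \<open>a = 2\<close>, and 4
  from \<open>twisted_estimate\<close>.\<close>

definition K2 :: real where "K2 = 180 * del * K1 / c"

text \<open>The sub-mean value property moves the average from \<open>f0\<close> to the potential \<open>bb\<close>, which is
  controlled locally by the twisted estimate.\<close>

lemma potential_pairing:
  assumes f0: "f0 holomorphic_on disk" "integrable diskm (\<lambda>z. norm (gex f0 z))"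
    and H: "H \<in> borel_measurable diskm" "\<And>z. z \<in> disk \<Longrightarrow> norm (H z) \<le> 1"
    and sg: "sqi diskm (gex g)" and t: "test_fun bb pp qq mm"
    and orth: "\<And>b p q m. test_fun b p q m \<Longrightarrow> ip diskm (\<lambda>z. ex z * p z) (gex g) = 0"
    and K: "K \<in> sets borel" "K \<subseteq> disk" and a: "0 < a" "\<And>w. w \<in> K \<Longrightarrow> a \<le> \<tau> w"
    and e: "nrm diskm (\<lambda>z. ex z * pp z - (H z - gex g z)) \<le> e"
  shows "(\<integral>\<^sup>+w. ennreal (indicator K w * norm (gex f0 w) * norm (ex w * itau w * bb w)) \<partial>diskm)
    \<le> ennreal (K2 * (10 * sc + 2 * e / a) * (\<integral>z. norm (gex f0 z) \<partial>diskm))"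
proof -
  have e0: "0 \<le> e" using e nrm_nonneg order_trans by blast
  have K2: "0 < K2" using del_pos K1_pos pos_consts by (simp add: K2_def)
  define F where "F z = norm (gex f0 z)" for z
  define A where "A w = norm (ex w * itau w * bb w)" for w
  have sb: "sqi diskm (\<lambda>z. ex z * itau z * bb z)"
    by (rule sqi_test(1)[OF t continuous_on_mult[OF ex_cont itau_cont]])
  have idm: "(\<lambda>z. z) \<in> borel_measurable diskm" by (rule measurable_restrict_space1) simp
  have Fm: "F \<in> borel_measurable diskm" using f0(2) unfolding F_def[abs_def] by (rule borel_measurable_integrable)
  have Am: "A \<in> borel_measurable diskm" using sb unfolding A_def[abs_def] sqi_def by auto
  have tm: "\<tau> \<in> borel_measurable diskm" by (rule measurable_diskm_continuous[OF tau_cont])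
  have Km: "(\<lambda>w. indicat_real K w) \<in> borel_measurable diskm"
    by (rule measurable_restrict_space1[OF borel_measurable_indicator]) (simp add: K)
  define N where "N w z = (if norm (z - w) \<le> del * \<tau> w then 1 else 0 :: real)" for w z
  note f1 [measurable] = measurable_compose[OF measurable_fst idm] and f2 [measurable] = measurable_compose[OF measurable_snd idm]
    and f3 [measurable] = measurable_compose[OF measurable_fst tm] and f4 [measurable] = measurable_compose[OF measurable_snd Fm]
    and f5 [measurable] = measurable_compose[OF measurable_fst Am] and f6 [measurable] = measurable_compose[OF measurable_fst Km]
  have Nm: "(\<lambda>x. N (fst x) (snd x)) \<in> borel_measurable (diskm \<Otimes>\<^sub>M diskm)"
    unfolding N_def by measurable
  \<comment> \<open>Integrated over \<open>z\<close> this dominates the pointwise product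
    (\<open>step1\<close>); after Fubini it is integrated over \<open>w\<close> with
    \<open>z\<close> fixed, where the factor \<open>F z\<close> comes out
    (\<open>step2\<close>).\<close>
  define P where "P w z = indicator K w * A w * (K1 / (\<tau> w)\<^sup>2) * (N w z * F z)" for w z
  have Pm: "(\<lambda>(w, z). ennreal (P w z)) \<in> borel_measurable (diskm \<Otimes>\<^sub>M diskm)"
    unfolding P_def split_beta using Nm by measurable
  have sf: "sigma_finite_measure diskm"
    using finite_measure_diskm by (simp add: finite_measure_def)
  then interpret pair_sigma_finite diskm diskm
    by (simp add: pair_sigma_finite_def)
  have nonneg: "0 \<le> F z" "0 \<le> A w" "0 \<le> N w z" for z w by (auto simp: F_def A_def N_def)
  have step1: "ennreal (indicator K w * F w * A w) \<le> (\<integral>\<^sup>+z. ennreal (P w z) \<partial>diskm)" for w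
  proof (cases "w \<in> K")
    case True
    then have w: "w \<in> disk" using K by blast
    have eq: "indicator (cball w (del * \<tau> w)) z * F z = N w z * F z" for z
      by (auto simp: N_def F_def indicator_def dist_norm norm_minus_commute)
    have i: "integrable diskm (\<lambda>z. N w z * F z)"
    proof -
      have "integrable diskm (\<lambda>z. indicator (cball w (del * \<tau> w) \<inter> disk) z *\<^sub>R F z)"
        using f0(2) unfolding F_def
        by (intro integrable_mult_indicator) (auto simp: sets_restrict_space)
      also have "?this \<longleftrightarrow> integrable diskm (\<lambda>z. N w z * F z)"
        by (rule Bochner_Integration.integrable_cong[OF refl]) (auto simp: N_def indicator_def dist_norm norm_minus_commute)
      finally show ?thesis .
    qed
    have "F w \<le> K1 / (\<tau> w)\<^sup>2 * (\<integral>z. N w z * F z \<partial>diskm)"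
      using submean[OF f0(1) w] by (simp only: F_def[symmetric] eq)
    then have "F w * A w \<le> (K1 / (\<tau> w)\<^sup>2 * (\<integral>z. N w z * F z \<partial>diskm)) * A w"
      by (intro mult_right_mono nonneg)
    moreover have "(\<integral>z. P w z \<partial>diskm) = indicator K w * A w * (K1 / (\<tau> w)\<^sup>2) * (\<integral>z. N w z * F z \<partial>diskm)"
      unfolding P_def by (rule integral_mult_right_zero)
    ultimately have "indicator K w * F w * A w \<le> (\<integral>z. P w z \<partial>diskm)"
      using True by (simp add: mult_ac)
    also have "ennreal (\<integral>z. P w z \<partial>diskm) = (\<integral>\<^sup>+z. ennreal (P w z) \<partial>diskm)"
    proof (rule nn_integral_eq_integral[symmetric])
      show "integrable diskm (P w)" using i unfolding P_def by simp
      show "AE z in diskm. 0 \<le> P w z" unfolding P_def using nonneg K1_pos by (intro AE_I2 mult_nonneg_nonneg) auto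
    qed
    finally show ?thesis by (simp add: ennreal_leI)
  qed simp
  have step2: "(\<integral>\<^sup>+w. ennreal (P w z) \<partial>diskm) \<le> ennreal (K2 * (10 * sc + 2 * e / a) * F z)" if z: "z \<in> disk" for z
  proof (cases "\<exists>w\<in>K. norm (z - w) \<le> del * \<tau> w")
    case False
    then have "P w z = 0" for w unfolding P_def N_def by (cases "w \<in> K") auto
    then show ?thesis by simp
  next
    case True
    have tz: "0 < \<tau> z" by (rule tau_pos[OF z])
    \<comment> \<open>The error \<open>e\<close> enters divided by \<open>\<tau> z\<close>; a lower
      bound for \<open>\<tau>\<close> on the support makes it uniform. The bound may be poor, since
      \<open>e\<close> tends to 0 while \<open>K\<close> is fixed.\<close>
    have az: "a / 2 \<le> \<tau> z"
    proof -
      from True obtain w where w: "w \<in> K" "norm (z - w) \<le> del * \<tau> w" by blast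
      then have "\<tau> w \<le> 2 * \<tau> z" using tau_compare(1)[of w z] K z by blast
      with a(2)[OF w(1)] show ?thesis by simp
    qed
    let ?c = "K1 * (9 / (4 * (\<tau> z)\<^sup>2)) * F z"
    have c0: "0 \<le> ?c" using K1_pos nonneg by simp
    note la = local_average[OF z sb, of 2]
    \<comment> \<open>Only \<open>w\<close> with \<open>norm (z - w) <= del * \<tau> w\<close>
      contribute. There \<open>\<tau> w\<close> and \<open>\<tau> z\<close> are comparable, so
      \<open>w\<close> ranges over a disk of twice the standard radius about
      \<open>z\<close>.\<close>
    have Ple: "P w z \<le> ?c * (indicator (cball z (2 * del * \<tau> z)) w * A w)" if w: "w \<in> disk" for w
    proof (cases "w \<in> K \<and> norm (z - w) \<le> del * \<tau> w")
      case True
      note tc = tau_compare[OF w z conjunct2[OF True]]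
      have tw: "0 < \<tau> w" by (rule tau_pos[OF w])
      have "norm (z - w) \<le> del * (2 * \<tau> z)"
        using True tc(1) del_pos by (meson less_imp_le mult_left_mono order_trans)
      then have i: "indicator (cball z (2 * del * \<tau> z)) w = (1::real)"
        by (simp add: dist_norm mult_ac)
      have "K1 / (\<tau> w)\<^sup>2 \<le> K1 / (2/3 * \<tau> z)\<^sup>2"
        using K1_pos tc(2) tz tw by (intro divide_left_mono power_mono) auto
      also have "\<dots> = K1 * (9 / (4 * (\<tau> z)\<^sup>2))" by (simp add: power_mult_distrib power2_eq_square)
      finally have "(K1 / (\<tau> w)\<^sup>2) * (A w * F z) \<le> K1 * (9 / (4 * (\<tau> z)\<^sup>2)) * (A w * F z)"
        using nonneg by (intro mult_right_mono) auto
      then show ?thesis using True i by (simp add: P_def N_def mult_ac)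
    next
      case False
      then have "P w z = 0" unfolding P_def N_def by (cases "w \<in> K") auto
      moreover have "0 \<le> ?c * (indicator (cball z (2 * del * \<tau> z)) w * A w)"
        by (intro mult_nonneg_nonneg[OF c0] mult_nonneg_nonneg nonneg) simp
      ultimately show ?thesis by (simp only:)
    qed
    have "(\<integral>\<^sup>+w. ennreal (P w z) \<partial>diskm) \<le> (\<integral>\<^sup>+w. ennreal (?c * (indicator (cball z (2 * del * \<tau> z)) w * A w)) \<partial>diskm)"
      using Ple by (intro nn_integral_mono ennreal_leI) simp
    also have "\<dots> = ennreal (\<integral>w. ?c * (indicator (cball z (2 * del * \<tau> z)) w * A w) \<partial>diskm)"
    proof (rule nn_integral_eq_integral)
      show "integrable diskm (\<lambda>w. ?c * (indicator (cball z (2 * del * \<tau> z)) w * A w))"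
        using la(1) unfolding A_def by (intro integrable_mult_right) simp
      show "AE w in diskm. 0 \<le> ?c * (indicator (cball z (2 * del * \<tau> z)) w * A w)"
        by (intro AE_I2 mult_nonneg_nonneg[OF c0] mult_nonneg_nonneg nonneg) simp
    qed
    also have "\<dots> \<le> ennreal (K2 * (10 * sc + 2 * e / a) * F z)"
    proof (rule ennreal_leI)
      have r: "nrm diskm (\<lambda>w. rho z w * (ex w * itau w * bb w)) \<le> 4 / c * (10 * sc * \<tau> z + e)"
      proof -
        have "nrm diskm (\<lambda>w. rho z w * (ex w * itau w * bb w)) \<le> 4 / c * (nrm diskm (\<lambda>w. rho z w * H w) + nrm diskm (\<lambda>z. ex z * pp z - (H z - gex g z)))"
          by (rule twisted_estimate(2)[OF z bounded_sqi(1)[OF H] sg t orth])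
        also have "\<dots> \<le> 4 / c * (10 * sc * \<tau> z + e)"
          using pos_consts by (intro mult_left_mono add_mono bounded_sqi(2)[OF H z] e) auto
        finally show ?thesis .
      qed
      have "(\<integral>w. ?c * (indicator (cball z (2 * del * \<tau> z)) w * A w) \<partial>diskm) = ?c * (\<integral>w. indicator (cball z (2 * del * \<tau> z)) w * A w \<partial>diskm)"
        by (rule integral_mult_right_zero)
      also have "\<dots> \<le> ?c * (2 * 2 * del * \<tau> z * ((1 + 2\<^sup>2) * (4 / c * (10 * sc * \<tau> z + e))))"
      proof (rule mult_left_mono[OF _ c0])
        have "(\<integral>w. indicator (cball z (2 * del * \<tau> z)) w * A w \<partial>diskm) \<le> 2 * 2 * del * \<tau> z * ((1 + 2\<^sup>2) * nrm diskm (\<lambda>w. rho z w * (ex w * itau w * bb w)))"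
          unfolding A_def by (rule la(2)) simp
        also have "\<dots> \<le> 2 * 2 * del * \<tau> z * ((1 + 2\<^sup>2) * (4 / c * (10 * sc * \<tau> z + e)))"
          using del_pos tz by (intro mult_left_mono r) auto
        finally show "(\<integral>w. indicator (cball z (2 * del * \<tau> z)) w * A w \<partial>diskm) \<le> 2 * 2 * del * \<tau> z * ((1 + 2\<^sup>2) * (4 / c * (10 * sc * \<tau> z + e)))" .
      qed
      also have "\<dots> = K2 * (10 * sc + e / \<tau> z) * F z"
        using tz pos_consts by (simp add: K2_def field_simps power2_eq_square)
      also have "\<dots> \<le> K2 * (10 * sc + 2 * e / a) * F z"
      proof -
        have "e / \<tau> z \<le> e / (a / 2)"
          using az a(1) e0 by (intro divide_left_mono) auto
        then have "10 * sc + e / \<tau> z \<le> 10 * sc + 2 * e / a" by (simp add: mult.commute)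
        then show ?thesis using K2 nonneg by (intro mult_right_mono mult_left_mono) auto
      qed
      finally show "(\<integral>w. ?c * (indicator (cball z (2 * del * \<tau> z)) w * A w) \<partial>diskm) \<le> K2 * (10 * sc + 2 * e / a) * F z" .
    qed
    finally show ?thesis .
  qed
  have "(\<integral>\<^sup>+w. ennreal (indicator K w * F w * A w) \<partial>diskm) \<le> (\<integral>\<^sup>+w. (\<integral>\<^sup>+z. ennreal (P w z) \<partial>diskm) \<partial>diskm)"
    by (intro nn_integral_mono step1)
  also have "\<dots> = (\<integral>\<^sup>+z. (\<integral>\<^sup>+w. ennreal (P w z) \<partial>diskm) \<partial>diskm)"
    by (rule Fubini'[OF Pm, symmetric])
  also have "\<dots> \<le> (\<integral>\<^sup>+z. ennreal (K2 * (10 * sc + 2 * e / a) * F z) \<partial>diskm)"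
    by (intro nn_integral_mono step2) simp
  also have "\<dots> = ennreal (\<integral>z. K2 * (10 * sc + 2 * e / a) * F z \<partial>diskm)"
    using f0(2) K2 e0 a(1) sc_pos nonneg unfolding F_def
    by (intro nn_integral_eq_integral AE_I2 mult_nonneg_nonneg) auto
  also have "\<dots> = ennreal (K2 * (10 * sc + 2 * e / a) * (\<integral>z. norm (gex f0 z) \<partial>diskm))"
    unfolding F_def by simp
  finally show ?thesis unfolding F_def A_def .
qed

text \<open>Integration by parts against \<open>ex * pp n\<close> leaves only the derivative of the
  cutoff, whose size \<open>d / \<tau>\<close> supplies both the small factor and the weight needed
  for \<open>potential_pairing\<close>.\<close>

theorem pairing_cutoff:
  assumes f0: "f0 holomorphic_on disk" "integrable diskm (\<lambda>z. norm (gex f0 z))"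
    and H: "H \<in> borel_measurable diskm" "\<And>z. z \<in> disk \<Longrightarrow> norm (H z) \<le> 1"
    and sg: "sqi diskm (gex g)" and t: "\<And>n::nat. test_fun (bb n) (pp n) (qq n) (mm n)"
    and lim: "(\<lambda>n. nrm diskm (\<lambda>z. ex z * pp n z - (H z - gex g z))) \<longlonglongrightarrow> 0"
    and orth: "\<And>b p q m. test_fun b p q m \<Longrightarrow> ip diskm (\<lambda>z. ex z * p z) (gex g) = 0"
    and \<eta>: "C1w disk (\<lambda>z. of_real (\<eta> z)) pe qe" "compact K" "K \<subseteq> disk" "\<And>z. z \<in> disk \<Longrightarrow> z \<notin> K \<Longrightarrow> \<eta> z = 0"
    and d: "0 \<le> d" "\<And>z. z \<in> disk \<Longrightarrow> norm (qe z) \<le> d / \<tau> z"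
  shows "norm (ip diskm (\<lambda>z. of_real (\<eta> z) * gex f0 z) (\<lambda>z. H z - gex g z)) \<le> d * (K2 * (10 * sc) * (\<integral>z. norm (gex f0 z) \<partial>diskm))"
proof -
  let ?V = "\<lambda>z. of_real (\<eta> z) * gex f0 z" and ?I = "\<integral>z. norm (gex f0 z) \<partial>diskm"
  define e where "e n = nrm diskm (\<lambda>z. ex z * pp n z - (H z - gex g z))" for n
  have f0c: "continuous_on disk f0" by (rule holomorphic_on_imp_continuous_on[OF f0(1)])
  have gc: "continuous_on disk (gex f0)"
    unfolding gex_def[abs_def] by (intro continuous_intros f0c phi_cont)
  have e0: "complex_of_real (\<eta> z) = 0" if "z \<in> disk" "z \<notin> K" for z using \<eta>(4)[OF that] by simp
  have q0: "qe z = 0" if "z \<in> disk" "z \<notin> K" for z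
    by (rule C1w_compact_support(2)[OF \<eta>(1-3) open_ball e0 that])
  have sV: "sqi diskm ?V"
    by (rule sqi_compact_support[OF \<eta>(2,3) continuous_on_mult[OF C1w_continuous(1)[OF \<eta>(1)] gc]]) (simp add: \<eta>(4))
  have sQ: "sqi diskm (\<lambda>z. H z - gex g z)" by (rule sqi_diff[OF bounded_sqi(1)[OF H] sg])
  \<comment> \<open>The minimum of \<open>\<tau>\<close> on the support of the cutoff, with 1 as
    default when the support is empty.\<close>
  obtain a where a: "0 < a" "\<And>w. w \<in> K \<Longrightarrow> a \<le> \<tau> w"
  proof (cases "K = {}")
    case True
    then show ?thesis using that[of 1] by simp
  next
    case False
    have "continuous_on K \<tau>" using tau_cont \<eta>(3) continuous_on_subset by blast
    then obtain x where "x \<in> K" "\<And>w. w \<in> K \<Longrightarrow> \<tau> x \<le> \<tau> w"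
      using continuous_attains_inf[OF \<eta>(2) False] by blast
    then show ?thesis using that[of "\<tau> x"] tau_pos \<eta>(3) by blast
  qed
  have Kb: "K \<in> sets borel" using \<eta>(2) by (intro borel_closed compact_imp_closed)
  have I0: "0 \<le> ?I" by simp
  have K20: "0 < K2" using del_pos K1_pos pos_consts by (simp add: K2_def)
  have bound: "norm (ip diskm ?V (\<lambda>z. ex z * pp n z)) \<le> d * (K2 * (10 * sc + 2 * e n / a) * ?I)" for n
  proof -
    have T: "C1w disk (bb n) (pp n) (qq n)" using t[of n] unfolding test_fun_def C2w_def by blast
    note V = C1w_mult[OF C1w_mult[OF \<eta>(1) C1w_holomorphic[OF f0(1) open_ball]] C1w_cnj[OF T]]
    have V0: "of_real (\<eta> z) * f0 z * cnj (bb n z) = 0" if "z \<in> disk" "z \<notin> K" for z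
      using \<eta>(4)[OF that] by simp
    have c1: "continuous_on disk (\<lambda>z. qe z * f0 z * cnj (bb n z))"
      and c2: "continuous_on disk (\<lambda>z. of_real (\<eta> z) * f0 z * cnj (pp n z))"
      by (intro continuous_intros f0c C1w_continuous[OF \<eta>(1)] C1w_continuous[OF T])+
    have z1: "qe z * f0 z * cnj (bb n z) = 0" if "z \<in> disk" "z \<notin> K" for z using q0[OF that] by simp
    have z2: "of_real (\<eta> z) * f0 z * cnj (pp n z) = 0" if "z \<in> disk" "z \<notin> K" for z using \<eta>(4)[OF that] by simp
    have i1: "integrable diskm (\<lambda>z. qe z * f0 z * cnj (bb n z))"
      by (rule integrable_restrict_compact_support(1)[OF \<eta>(2,3) open_ball c1 z1])
    have i2: "integrable diskm (\<lambda>z. of_real (\<eta> z) * f0 z * cnj (pp n z))"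
      by (rule integrable_restrict_compact_support(1)[OF \<eta>(2,3) open_ball c2 z2])
    \<comment> \<open>The conjugate derivative of \<open>\<eta> * f0 * cnj (bb n)\<close>; the
      explicit 0 is the contribution of the holomorphic factor.\<close>
    have "(\<integral>z. (qe z * f0 z + of_real (\<eta> z) * 0) * cnj (bb n z) + of_real (\<eta> z) * f0 z * cnj (pp n z) \<partial>diskm) = 0"
      by (rule integral_wirt_eq_0(2)[OF V \<eta>(2,3) open_ball V0])
    then have "(\<integral>z. qe z * f0 z * cnj (bb n z) + of_real (\<eta> z) * f0 z * cnj (pp n z) \<partial>diskm) = 0"
      by simp
    then have "(\<integral>z. of_real (\<eta> z) * f0 z * cnj (pp n z) \<partial>diskm) = - (\<integral>z. qe z * f0 z * cnj (bb n z) \<partial>diskm)"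
      using Bochner_Integration.integral_add[OF i1 i2] by (simp add: eq_neg_iff_add_eq_0 add.commute)
    moreover have "ip diskm ?V (\<lambda>z. ex z * pp n z) = (\<integral>z. of_real (\<eta> z) * f0 z * cnj (pp n z) \<partial>diskm)"
    proof -
      have "exp (- \<phi> z) * exp (\<phi> z) = 1" for z by (simp add: mult_exp_exp)
      then have one: "complex_of_real (exp (- \<phi> z)) * of_real (exp (\<phi> z)) = 1" for z
        by (metis of_real_1 of_real_mult)
      have "?V z * cnj (ex z * pp n z) = of_real (\<eta> z) * f0 z * cnj (pp n z) * (complex_of_real (exp (- \<phi> z)) * of_real (exp (\<phi> z)))" for z
        by (simp add: gex_def ex_def mult_ac)
      then have "?V z * cnj (ex z * pp n z) = of_real (\<eta> z) * f0 z * cnj (pp n z)" for z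
        unfolding one by (simp only: mult_1_right)
      then show ?thesis by (simp only: ip_def)
    qed
    ultimately have eq: "norm (ip diskm ?V (\<lambda>z. ex z * pp n z)) = norm (\<integral>z. qe z * f0 z * cnj (bb n z) \<partial>diskm)"
      by simp
    have "ennreal (norm (\<integral>z. qe z * f0 z * cnj (bb n z) \<partial>diskm)) \<le> ennreal (\<integral>z. norm (qe z * f0 z * cnj (bb n z)) \<partial>diskm)"
      by (intro ennreal_leI integral_norm_bound)
    also have "\<dots> = (\<integral>\<^sup>+z. ennreal (norm (qe z * f0 z * cnj (bb n z))) \<partial>diskm)"
      by (rule nn_integral_eq_integral[symmetric, OF integrable_norm[OF i1]]) simp
    also have "\<dots> \<le> (\<integral>\<^sup>+z. ennreal d * ennreal (indicator K z * norm (gex f0 z) * norm (ex z * itau z * bb n z)) \<partial>diskm)"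
    proof (rule nn_integral_mono)
      fix z assume "z \<in> space diskm"
      then have z: "z \<in> disk" by simp
      have "norm (qe z * f0 z * cnj (bb n z)) \<le> d * (indicator K z * norm (gex f0 z) * norm (ex z * itau z * bb n z))"
      proof (cases "z \<in> K")
        case True
        have "norm (qe z * f0 z * cnj (bb n z)) = norm (qe z) * (norm (f0 z) * norm (bb n z))"
          by (simp add: norm_mult)
        also have "\<dots> \<le> d / \<tau> z * (norm (f0 z) * norm (bb n z))"
          by (intro mult_right_mono d(2) z) auto
        also have "\<dots> = d / \<tau> z * (norm (f0 z) * norm (bb n z)) * (exp (- \<phi> z) * exp (\<phi> z))"
          by (simp add: mult_exp_exp)
        also have "\<dots> = d * (indicator K z * norm (gex f0 z) * norm (ex z * itau z * bb n z))"
          using True tau_pos[OF z] by (simp add: norm_mult gex_def ex_def itau_def norm_divide)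
        finally show ?thesis .
      next
        case False
        then show ?thesis using q0[OF z] by simp
      qed
      then show "ennreal (norm (qe z * f0 z * cnj (bb n z))) \<le> ennreal d * ennreal (indicator K z * norm (gex f0 z) * norm (ex z * itau z * bb n z))"
        using d(1) by (simp add: ennreal_mult'[symmetric] ennreal_leI)
    qed
    also have "\<dots> = ennreal d * (\<integral>\<^sup>+z. ennreal (indicator K z * norm (gex f0 z) * norm (ex z * itau z * bb n z)) \<partial>diskm)"
    proof (rule nn_integral_cmult)
      have "sqi diskm (\<lambda>z. ex z * itau z * bb n z)"
        by (rule sqi_test(1)[OF t continuous_on_mult[OF ex_cont itau_cont]])
      then have [measurable]: "(\<lambda>z. ex z * itau z * bb n z) \<in> borel_measurable diskm" by (simp add: sqi_def)
      have [measurable]: "gex f0 \<in> borel_measurable diskm" by (rule measurable_diskm_continuous[OF gc])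
      have [measurable]: "(\<lambda>w. indicat_real K w) \<in> borel_measurable diskm"
        by (rule measurable_restrict_space1[OF borel_measurable_indicator]) (simp add: Kb)
      show "(\<lambda>z. ennreal (indicator K z * norm (gex f0 z) * norm (ex z * itau z * bb n z))) \<in> borel_measurable diskm"
        by measurable
    qed
    also have "\<dots> \<le> ennreal d * ennreal (K2 * (10 * sc + 2 * e n / a) * ?I)"
      by (intro mult_left_mono potential_pairing[OF f0 H sg t orth Kb \<eta>(3) a]) (auto simp: e_def)
    also have "\<dots> = ennreal (d * (K2 * (10 * sc + 2 * e n / a) * ?I))"
      by (rule ennreal_mult'[symmetric, OF d(1)])
    finally have "ennreal (norm (\<integral>z. qe z * f0 z * cnj (bb n z) \<partial>diskm)) \<le> ennreal (d * (K2 * (10 * sc + 2 * e n / a) * ?I))" .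
    moreover have "0 \<le> d * (K2 * (10 * sc + 2 * e n / a) * ?I)"
      using d(1) K20 sc_pos a(1) I0 by (auto intro!: mult_nonneg_nonneg add_nonneg_nonneg divide_nonneg_nonneg simp: e_def nrm_nonneg)
    ultimately show ?thesis
      unfolding eq by (subst (asm) ennreal_le_iff)
  qed
  have "(\<lambda>n. norm (ip diskm ?V (\<lambda>z. ex z * pp n z))) \<longlonglongrightarrow> norm (ip diskm ?V (\<lambda>z. H z - gex g z))"
    by (intro tendsto_norm tendsto_ip_right[OF sV _ sQ lim] sqi_test(2)[OF t ex_cont])
  moreover have "(\<lambda>n. d * (K2 * (10 * sc + 2 * e n / a) * ?I)) \<longlonglongrightarrow> d * (K2 * (10 * sc + 2 * 0 / a) * ?I)"
    using a(1) lim unfolding e_def[symmetric] by (intro tendsto_intros) auto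
  ultimately have "norm (ip diskm ?V (\<lambda>z. H z - gex g z)) \<le> d * (K2 * (10 * sc + 2 * 0 / a) * ?I)"
    using bound by (intro LIMSEQ_le) auto
  then show ?thesis by simp
qed

end

section \<open>Boundedness of the projection and density\<close>

text \<open>The logarithm makes \<open>(1 - |z|) |\<partial>\<eta>|\<close> uniformly of order \<open>1/n\<close>.\<close>

lemma log_cutoff:
  fixes n :: nat
  defines "\<eta> \<equiv> \<lambda>z. max 0 (1 + ln (1 - (norm z)\<^sup>2) / (real n + 1)) ^ 2"
  obtains p q K where "C1w disk (\<lambda>z. of_real (\<eta> z)) p q" "compact K" "K \<subseteq> disk"
    "\<And>z. z \<in> disk \<Longrightarrow> z \<notin> K \<Longrightarrow> \<eta> z = 0"
    "\<And>z. z \<in> disk \<Longrightarrow> norm (q z) \<le> 2 / (real n + 1) / (1 - norm z)"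
proof -
  have n: "0 < real n + 1" by simp
  have 1: "C1w disk (\<lambda>z. of_real ((norm z)\<^sup>2)) (\<lambda>z. cnj z) (\<lambda>z. z)"
    using C2w_norm_sq[of disk 0] by (simp add: C2w_def)
  have lt: "(norm z)\<^sup>2 < 1" if "z \<in> disk" for z :: complex
    using that by (simp add: power_less_one_iff)
  define r where "r z = 1 + ln (1 - (norm z)\<^sup>2) / (real n + 1)" for z :: complex
  have d1: "((\<lambda>s. 1 + ln (1 - s) / (real n + 1)) has_real_derivative - 1 / ((real n + 1) * (1 - (norm z)\<^sup>2))) (at ((norm z)\<^sup>2))" if "z \<in> disk" for z :: complex
  proof -
    have "((\<lambda>s. 1 - s) has_real_derivative (0 - 1)) (at ((norm z)\<^sup>2))"
      by (rule DERIV_diff[OF DERIV_const DERIV_ident])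
    moreover have "0 < 1 - (norm z)\<^sup>2" using lt[OF that] by simp
    ultimately have "((\<lambda>s. ln (1 - s)) has_real_derivative (1 / (1 - (norm z)\<^sup>2) * (0 - 1))) (at ((norm z)\<^sup>2))"
      by (intro DERIV_chain'[where g = ln] DERIV_ln_divide)
    from DERIV_add[OF DERIV_const DERIV_cdivide[OF this, of "real n + 1"]] show ?thesis
      by (simp add: mult.commute)
  qed
  have c1: "continuous_on ((\<lambda>z. (norm z)\<^sup>2) ` disk) (\<lambda>s. - 1 / ((real n + 1) * (1 - s)))"
  proof (intro continuous_intros ballI)
    fix s :: real assume "s \<in> (\<lambda>z::complex. (norm z)\<^sup>2) ` disk"
    then obtain z :: complex where "z \<in> disk" "s = (norm z)\<^sup>2" by blast
    then have "s < 1" using lt by simp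
    then show "(real n + 1) * (1 - s) \<noteq> 0" using n by simp
  qed
  have 2: "C1w disk (\<lambda>z. of_real (r z)) (\<lambda>z. of_real (- 1 / ((real n + 1) * (1 - (norm z)\<^sup>2))) * cnj z)
      (\<lambda>z. of_real (- 1 / ((real n + 1) * (1 - (norm z)\<^sup>2))) * z)"
    unfolding r_def by (rule C1w_real_chain[OF 1 d1 c1])
  \<comment> \<open>A truncated square is only once continuously differentiable; the cutoff is
    differentiated once.\<close>
  have d2: "((\<lambda>x::real. max 0 x ^ 2) has_real_derivative 2 * max 0 x) (at x)" for x
    using DERIV_max_power[of 1 x] by (simp add: numeral_2_eq_2)
  have c2: "continuous_on (r ` disk) (\<lambda>x. 2 * max 0 x)" by (intro continuous_intros)
  have 3: "C1w disk (\<lambda>z. of_real (\<eta> z)) (\<lambda>z. of_real (2 * max 0 (r z)) * (of_real (- 1 / ((real n + 1) * (1 - (norm z)\<^sup>2))) * cnj z))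
      (\<lambda>z. of_real (2 * max 0 (r z)) * (of_real (- 1 / ((real n + 1) * (1 - (norm z)\<^sup>2))) * z))"
    unfolding \<eta>_def r_def[symmetric] by (rule C1w_real_chain[OF 2 d2 c2])
  \<comment> \<open>The circle on which \<open>ln (1 - (norm z)^2)\<close> equals
    \<open>- (n + 1)\<close>; from there outwards the cutoff is 0.\<close>
  define R where "R = sqrt (1 - exp (- (real n + 1)))"
  have R: "R < 1" "0 \<le> R" by (auto simp: R_def real_sqrt_lt_1_iff)
  show thesis
  proof (rule that[OF 3 compact_cball[of 0 R]])
    show "cball 0 R \<subseteq> disk" using R by auto
    fix z :: complex assume z: "z \<in> disk"
    have r1: "r z \<le> 1"
    proof -
      have "ln (1 - (norm z)\<^sup>2) \<le> 0" using lt[OF z] by simp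
      then show ?thesis unfolding r_def using n by (simp add: divide_nonpos_pos)
    qed
    show "\<eta> z = 0" if "z \<notin> cball 0 R"
    proof -
      have "R < norm z" using that by simp
      then have "R\<^sup>2 < (norm z)\<^sup>2" using R by (intro power_strict_mono) auto
      then have "1 - (norm z)\<^sup>2 < exp (- (real n + 1))"
        unfolding R_def by simp
      then have "ln (1 - (norm z)\<^sup>2) < ln (exp (- (real n + 1)))"
        by (rule iffD2[OF ln_less_cancel_iff, rotated 2]) (use lt[OF z] in simp_all)
      then have "ln (1 - (norm z)\<^sup>2) < - (real n + 1)" by (simp only: ln_exp)
      then have "r z \<le> 0" unfolding r_def using n by (simp add: field_simps)
      then show ?thesis unfolding \<eta>_def r_def[symmetric] by (simp add: max_absorb1)
    qed
    have m: "0 \<le> max 0 (r z)" "max 0 (r z) \<le> 1" using max.bounded_iff[of 0 "r z" 1] r1 by simp_all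
    have a: "norm z < 1" using z by simp
    have b: "1 - norm z \<le> 1 - (norm z)\<^sup>2"
      using a power_decreasing[of 1 2 "norm z"] by simp
    have "norm (of_real (2 * max 0 (r z)) * (of_real (- 1 / ((real n + 1) * (1 - (norm z)\<^sup>2))) * z)) =
        2 * max 0 (r z) * (1 / ((real n + 1) * (1 - (norm z)\<^sup>2)) * norm z)"
      unfolding norm_mult norm_of_real using m lt[OF z] n by (simp add: abs_mult)
    also have "\<dots> \<le> 2 * 1 * (1 / ((real n + 1) * (1 - norm z)) * 1)"
      using m lt[OF z] n a b by (intro mult_mono divide_left_mono) auto
    finally show "norm (of_real (2 * max 0 (r z)) * (of_real (- 1 / ((real n + 1) * (1 - (norm z)\<^sup>2))) * z)) \<le> 2 / (real n + 1) / (1 - norm z)"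
      by simp
  qed
qed

context slow_weight
begin

section \<open>The weighted projection\<close>

lemma gex_cont: "f holomorphic_on disk \<Longrightarrow> continuous_on disk (gex f)"
  unfolding gex_def[abs_def] by (intro continuous_intros holomorphic_on_imp_continuous_on phi_cont)

lemma gex_measurable: "f holomorphic_on disk \<Longrightarrow> gex f \<in> borel_measurable diskm"
  by (intro measurable_diskm_continuous gex_cont)

lemma ex_gex: "ex z * gex f z = f z"
proof -
  have "complex_of_real (exp (\<phi> z)) * of_real (exp (- \<phi> z)) = of_real (exp (\<phi> z) * exp (- \<phi> z))" by simp
  also have "exp (\<phi> z) * exp (- \<phi> z) = 1" by (simp add: mult_exp_exp)
  finally show ?thesis by (simp add: ex_def gex_def)
qed

text \<open>\<open>f * cnj p\<close> is the conjugate derivative of the compactly supported function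
  \<open>f * cnj b\<close>.\<close>

lemma holomorphic_orth:
  assumes f: "f holomorphic_on disk" and t: "test_fun b p q m"
  shows "ip diskm (gex f) (\<lambda>z. ex z * p z) = 0"
proof -
  from t obtain K where K: "C2w disk b p q m" "compact K" "K \<subseteq> disk" "\<And>z. z \<in> disk \<Longrightarrow> z \<notin> K \<Longrightarrow> b z = 0"
    by (rule test_funE) blast
  have T: "C1w disk b p q" using K(1) by (simp add: C2w_def)
  have "integral\<^sup>L diskm (\<lambda>z. 0 * cnj (b z) + f z * cnj (p z)) = 0"
    by (rule integral_wirt_eq_0(2)[OF C1w_mult[OF C1w_holomorphic[OF f open_ball] C1w_cnj[OF T]] K(2,3) open_ball]) (simp add: K(4))
  moreover have "gex f z * cnj (ex z * p z) = 0 * cnj (b z) + f z * cnj (p z)" for z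
  proof -
    have "gex f z * cnj (ex z * p z) = (ex z * gex f z) * cnj (p z)" by (simp add: ex_def)
    then show ?thesis unfolding ex_gex by simp
  qed
  ultimately show ?thesis unfolding ip_def by (simp only:)
qed

text \<open>A relation and not a function: the values of \<open>g\<close> off the disk are
  undetermined.\<close>

definition proj_of :: "(complex \<Rightarrow> complex) \<Rightarrow> (complex \<Rightarrow> complex) \<Rightarrow> bool"
  where "proj_of H g \<longleftrightarrow> g holomorphic_on disk \<and> sqi diskm (gex g) \<and>
    (\<forall>f. f holomorphic_on disk \<longrightarrow> sqi diskm (gex f) \<longrightarrow> ip diskm (gex f) (\<lambda>z. H z - gex g z) = 0)"

lemma proj_ofD:
  assumes "proj_of H g"
  shows "g holomorphic_on disk" "sqi diskm (gex g)"
    "f holomorphic_on disk \<Longrightarrow> sqi diskm (gex f) \<Longrightarrow> ip diskm (gex f) (\<lambda>z. H z - gex g z) = 0"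
  using assms by (auto simp: proj_of_def)

lemma proj_ofD':
  assumes "proj_of H g" "sqi diskm H" "f holomorphic_on disk" "sqi diskm (gex f)"
  shows "ip diskm (gex f) H = ip diskm (gex f) (gex g)"
  using proj_ofD(3)[OF assms(1,3,4)] ip_diff_right[OF assms(2) proj_ofD(2)[OF assms(1)] assms(4)] by simp

text \<open>Holomorphic functions are orthogonal to every \<open>ex * pp n\<close>, hence to the
  limit. The approximating potentials remain in the conclusion because the twisted estimate acts on
  them.\<close>

lemma projection_exists:
  assumes H: "sqi diskm H"
  obtains g bb pp qq mm where "proj_of H g"
    "\<And>n::nat. test_fun (bb n) (pp n) (qq n) (mm n)"
    "(\<lambda>n. nrm diskm (\<lambda>z. ex z * pp n z - (H z - gex g z))) \<longlonglongrightarrow> 0"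
    "\<And>b p q m. test_fun b p q m \<Longrightarrow> ip diskm (\<lambda>z. ex z * p z) (gex g) = 0"
proof -
  obtain g bb pp qq mm where g: "g holomorphic_on disk" "sqi diskm (gex g)"
    "\<And>n::nat. test_fun (bb n) (pp n) (qq n) (mm n)"
    "(\<lambda>n. nrm diskm (\<lambda>z. ex z * pp n z - (H z - gex g z))) \<longlonglongrightarrow> 0"
    "\<And>b p q m. test_fun b p q m \<Longrightarrow> ip diskm (\<lambda>z. ex z * p z) (gex g) = 0"
    by (rule decomposition[OF H]) (assumption | rule that)+
  have "ip diskm (gex f) (\<lambda>z. H z - gex g z) = 0" if f: "f holomorphic_on disk" "sqi diskm (gex f)" for f
  proof -
    have "(\<lambda>n. ip diskm (gex f) (\<lambda>z. ex z * pp n z)) \<longlonglongrightarrow> ip diskm (gex f) (\<lambda>z. H z - gex g z)"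
      by (intro tendsto_ip_right[OF f(2) _ sqi_diff[OF H g(2)] g(4)] sqi_test(2)[OF g(3) ex_cont])
    then show ?thesis
      unfolding holomorphic_orth[OF f(1) g(3)] by (simp add: LIMSEQ_const_iff)
  qed
  then have "proj_of H g" using g(1,2) by (simp add: proj_of_def)
  then show thesis
    by (rule that[OF _ g(3,4)]) (rule g(5))
qed

text \<open>Since \<open>sgn 0 = 0\<close>, the last identity also covers the zeros of
  \<open>h\<close>.\<close>

lemma phase:
  assumes "h \<in> borel_measurable diskm"
  shows "(\<lambda>z. sgn (h z)) \<in> borel_measurable diskm" "norm (sgn (h z)) \<le> 1" "h z * cnj (sgn (h z)) = of_real (norm (h z))"
proof -
  have "(\<lambda>z. inverse (norm (h z)) *\<^sub>R h z) \<in> borel_measurable diskm"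
    using assms by measurable
  then show "(\<lambda>z. sgn (h z)) \<in> borel_measurable diskm" by (simp add: sgn_div_norm)
  show "norm (sgn (h z)) \<le> 1" by (simp add: norm_sgn)
  have "h z * cnj (sgn (h z)) = of_real (inverse (norm (h z))) * (h z * cnj (h z))"
    by (simp add: sgn_div_norm scaleR_conv_of_real)
  also have "\<dots> = of_real (inverse (norm (h z)) * (norm (h z))\<^sup>2)"
    by (simp only: of_real_mult complex_norm_square)
  also have "inverse (norm (h z)) * (norm (h z))\<^sup>2 = norm (h z)"
    by (cases "h z = 0") (simp_all add: power2_eq_square)
  finally show "h z * cnj (sgn (h z)) = of_real (norm (h z))" .
qed

lemma ip_phase:
  assumes "h \<in> borel_measurable diskm"
  shows "ip diskm h (\<lambda>z. sgn (h z)) = of_real (\<integral>z. norm (h z) \<partial>diskm)"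
  unfolding ip_def phase(3)[OF assms] by (rule integral_complex_of_real)

lemma sup_bound_phase:
  assumes h: "h \<in> borel_measurable diskm" and g: "proj_of (\<lambda>z. sgn (h z)) g'"
    and "\<And>n::nat. test_fun (bb n) (pp n) (qq n) (mm n)"
    "(\<lambda>n. nrm diskm (\<lambda>z. ex z * pp n z - (sgn (h z) - gex g' z))) \<longlonglongrightarrow> 0"
    "\<And>b p q m. test_fun b p q m \<Longrightarrow> ip diskm (\<lambda>z. ex z * p z) (gex g') = 0"
    and z: "z \<in> disk"
  shows "norm (gex g' z) \<le> Kinf"
  by (rule projection_sup_bound[OF phase(1,2)[OF h] proj_ofD(1,2)[OF g] assms(3,4,5) z])

text \<open>Self-adjointness of the projection, tested against the phase of \<open>gex g\<close>.\<close>

lemma projection_L1: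
  assumes \<psi>: "sqi diskm \<psi>" and p: "proj_of \<psi> g"
  shows "(\<integral>z. norm (gex g z) \<partial>diskm) \<le> Kinf * (\<integral>z. norm (\<psi> z) \<partial>diskm)"
proof -
  note g = proj_ofD(1,2)[OF p]
  have gm: "gex g \<in> borel_measurable diskm" by (rule gex_measurable[OF g(1)])
  let ?H = "\<lambda>z. sgn (gex g z)"
  have sH: "sqi diskm ?H" by (rule bounded_sqi(1)[OF phase(1,2)[OF gm]])
  obtain g' bb pp qq mm where g': "proj_of ?H g'"
    "\<And>n::nat. test_fun (bb n) (pp n) (qq n) (mm n)"
    "(\<lambda>n. nrm diskm (\<lambda>z. ex z * pp n z - (?H z - gex g' z))) \<longlonglongrightarrow> 0"
    "\<And>b p q m. test_fun b p q m \<Longrightarrow> ip diskm (\<lambda>z. ex z * p z) (gex g') = 0"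
    by (rule projection_exists[OF sH]) (assumption | rule that)+
  note h = proj_ofD(1,2)[OF g'(1)]
  have sup: "norm (gex g' z) \<le> Kinf" if "z \<in> disk" for z
    by (rule sup_bound_phase[OF gm g' that])
  have "complex_of_real (\<integral>z. norm (gex g z) \<partial>diskm) = ip diskm (gex g) ?H"
    by (rule ip_phase[OF gm, symmetric])
  also have "\<dots> = ip diskm (gex g) (gex g')"
    by (rule proj_ofD'[OF g'(1) sH g])
  also have "\<dots> = cnj (ip diskm (gex g') (gex g))" by (rule ip_commute)
  also have "ip diskm (gex g') (gex g) = ip diskm (gex g') \<psi>"
    by (rule proj_ofD'[OF p \<psi> h, symmetric])
  also have "cnj (ip diskm (gex g') \<psi>) = ip diskm \<psi> (gex g')" by (rule ip_commute[symmetric])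
  finally have eq: "complex_of_real (\<integral>z. norm (gex g z) \<partial>diskm) = ip diskm \<psi> (gex g')" .
  have "(\<integral>z. norm (gex g z) \<partial>diskm) = norm (complex_of_real (\<integral>z. norm (gex g z) \<partial>diskm))"
    by (simp add: abs_of_nonneg)
  also have "\<dots> = norm (ip diskm \<psi> (gex g'))" unfolding eq ..
  also have "\<dots> \<le> (\<integral>z. norm (\<psi> z * cnj (gex g' z)) \<partial>diskm)"
    unfolding ip_def by (rule integral_norm_bound)
  also have "\<dots> \<le> (\<integral>z. Kinf * norm (\<psi> z) \<partial>diskm)"
  proof (rule integral_mono)
    show "integrable diskm (\<lambda>z. norm (\<psi> z * cnj (gex g' z)))"
      by (rule integrable_norm[OF integrable_ip[OF \<psi> h(2)]])
    show "integrable diskm (\<lambda>z. Kinf * norm (\<psi> z))"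
      by (intro integrable_mult_right integrable_norm integral_norm_le_nrm(1)[OF finite_measure_diskm \<psi>])
    fix z assume "z \<in> space diskm"
    then show "norm (\<psi> z * cnj (gex g' z)) \<le> Kinf * norm (\<psi> z)"
      using sup[of z] by (simp add: norm_mult mult.commute[of "norm (\<psi> z)"] mult_right_mono)
  qed
  also have "\<dots> = Kinf * (\<integral>z. norm (\<psi> z) \<partial>diskm)" by simp
  finally show ?thesis .
qed

text \<open>The L1 norm of \<open>?D\<close> is its pairing with its own phase. As \<open>?D\<close>
  is orthogonal to holomorphic functions, the phase may be replaced by the phase minus its
  projection; the latter is itself orthogonal to \<open>gex g\<close>, so \<open>?D\<close> may be
  replaced by the cutoff function. This is the situation of \<open>pairing_cutoff\<close>.\<close>

lemma cutoff_projection: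
  assumes f0: "f0 holomorphic_on disk" "integrable diskm (\<lambda>z. norm (gex f0 z))"
    and \<eta>: "C1w disk (\<lambda>z. of_real (\<eta> z)) pe qe" "compact K" "K \<subseteq> disk" "\<And>z. z \<in> disk \<Longrightarrow> z \<notin> K \<Longrightarrow> \<eta> z = 0"
    and d: "0 \<le> d" "\<And>z. z \<in> disk \<Longrightarrow> norm (qe z) \<le> d / \<tau> z"
  obtains g where "g holomorphic_on disk" "sqi diskm (gex g)"
    "(\<integral>z. norm (of_real (\<eta> z) * gex f0 z - gex g z) \<partial>diskm) \<le> d * (K2 * (10 * sc) * (\<integral>z. norm (gex f0 z) \<partial>diskm))"
    "integrable diskm (\<lambda>z. norm (of_real (\<eta> z) * gex f0 z - gex g z))"
proof -
  let ?V = "\<lambda>z. of_real (\<eta> z) * gex f0 z"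
  have sV: "sqi diskm ?V"
    by (rule sqi_compact_support[OF \<eta>(2,3) continuous_on_mult[OF C1w_continuous(1)[OF \<eta>(1)] gex_cont[OF f0(1)]]]) (simp add: \<eta>(4))
  obtain g bb pp qq mm where p: "proj_of ?V g"
    "\<And>n::nat. test_fun (bb n) (pp n) (qq n) (mm n)"
    "(\<lambda>n. nrm diskm (\<lambda>z. ex z * pp n z - (?V z - gex g z))) \<longlonglongrightarrow> 0"
    "\<And>b p q m. test_fun b p q m \<Longrightarrow> ip diskm (\<lambda>z. ex z * p z) (gex g) = 0"
    by (rule projection_exists[OF sV]) (assumption | rule that)+
  note g = proj_ofD(1,2)[OF p(1)]
  let ?D = "\<lambda>z. ?V z - gex g z"
  have sD: "sqi diskm ?D" by (rule sqi_diff[OF sV g(2)])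
  then have Dm: "?D \<in> borel_measurable diskm" by (simp add: sqi_def)
  let ?H = "\<lambda>z. sgn (?D z)"
  have sH: "sqi diskm ?H" by (rule bounded_sqi(1)[OF phase(1,2)[OF Dm]])
  obtain g' bb' pp' qq' mm' where p': "proj_of ?H g'"
    "\<And>n::nat. test_fun (bb' n) (pp' n) (qq' n) (mm' n)"
    "(\<lambda>n. nrm diskm (\<lambda>z. ex z * pp' n z - (?H z - gex g' z))) \<longlonglongrightarrow> 0"
    "\<And>b p q m. test_fun b p q m \<Longrightarrow> ip diskm (\<lambda>z. ex z * p z) (gex g') = 0"
    by (rule projection_exists[OF sH]) (assumption | rule that)+
  note g' = proj_ofD(1,2)[OF p'(1)]
  have sQ: "sqi diskm (\<lambda>z. ?H z - gex g' z)" by (rule sqi_diff[OF sH g'(2)])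
  have "complex_of_real (\<integral>z. norm (?D z) \<partial>diskm) = ip diskm ?D ?H"
    by (rule ip_phase[OF Dm, symmetric])
  also have "\<dots> = ip diskm ?D (\<lambda>z. ?H z - gex g' z)"
  proof -
    have "ip diskm ?D (gex g') = cnj (ip diskm (gex g') ?D)" by (rule ip_commute)
    also have "ip diskm (gex g') ?D = 0" by (rule proj_ofD(3)[OF p(1) g'])
    finally show ?thesis using ip_diff_right[OF sH g'(2) sD] by simp
  qed
  also have "\<dots> = ip diskm ?V (\<lambda>z. ?H z - gex g' z) - ip diskm (gex g) (\<lambda>z. ?H z - gex g' z)"
    by (rule ip_diff_left[OF sV g(2) sQ])
  also have "ip diskm (gex g) (\<lambda>z. ?H z - gex g' z) = 0" by (rule proj_ofD(3)[OF p'(1) g])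
  finally have eq: "complex_of_real (\<integral>z. norm (?D z) \<partial>diskm) = ip diskm ?V (\<lambda>z. ?H z - gex g' z)" by simp
  have "(\<integral>z. norm (?D z) \<partial>diskm) = norm (complex_of_real (\<integral>z. norm (?D z) \<partial>diskm))"
    by (simp add: abs_of_nonneg)
  also have "\<dots> = norm (ip diskm ?V (\<lambda>z. ?H z - gex g' z))" unfolding eq ..
  also have "\<dots> \<le> d * (K2 * (10 * sc) * (\<integral>z. norm (gex f0 z) \<partial>diskm))"
    by (rule pairing_cutoff[OF f0 phase(1,2)[OF Dm] g'(2) p'(2,3,4) \<eta> d])
  finally show thesis
    using that[OF g] integrable_norm[OF integral_norm_le_nrm(1)[OF finite_measure_diskm sD]] by blast
qed

text \<open>The error splits into the part removed by the cutoff, which tends to 0 by dominated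
  convergence, and the part removed by the projection, which is at most
  \<open>C / (n + 1)\<close>.\<close>

lemma density:
  assumes f0: "f0 holomorphic_on disk" "integrable diskm (\<lambda>z. norm (gex f0 z))" and e: "0 < e"
  obtains g where "g holomorphic_on disk" "sqi diskm (gex g)" "(\<integral>z. norm (gex f0 z - gex g z) \<partial>diskm) < e"
proof -
  define \<eta> where "\<eta> n z = max 0 (1 + ln (1 - (norm z)\<^sup>2) / (real n + 1)) ^ 2" for n :: nat and z :: complex
  have fm: "gex f0 \<in> borel_measurable diskm" by (rule gex_measurable[OF f0(1)])
  have fi: "integrable diskm (gex f0)" using f0(2) fm by (simp add: integrable_norm_iff)
  define C where "C = 2 * c1 * (K2 * (10 * sc) * (\<integral>z. norm (gex f0 z) \<partial>diskm))"
  have \<eta>01: "0 \<le> \<eta> n z" "\<eta> n z \<le> 1" if "z \<in> disk" for n z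
  proof -
    have "(norm z)\<^sup>2 < 1" using that by (simp add: power_less_one_iff)
    then have "ln (1 - (norm z)\<^sup>2) \<le> 0" by simp
    then have "ln (1 - (norm z)\<^sup>2) / (real n + 1) \<le> 0" by (intro divide_nonpos_pos) auto
    then show "\<eta> n z \<le> 1" unfolding \<eta>_def by (intro power_le_one) auto
    show "0 \<le> \<eta> n z" by (simp add: \<eta>_def)
  qed
  have \<eta>lim: "(\<lambda>n. \<eta> n z) \<longlonglongrightarrow> 1" for z
  proof -
    have "(\<lambda>n. ln (1 - (norm z)\<^sup>2) * inverse (real (Suc n))) \<longlonglongrightarrow> ln (1 - (norm z)\<^sup>2) * 0"
      by (intro tendsto_mult tendsto_const LIMSEQ_inverse_real_of_nat)
    then have "(\<lambda>n. ln (1 - (norm z)\<^sup>2) / (real n + 1)) \<longlonglongrightarrow> 0"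
      by (simp add: inverse_eq_divide add.commute)
    then have "(\<lambda>n. \<eta> n z) \<longlonglongrightarrow> max 0 (1 + 0) ^ 2"
      unfolding \<eta>_def by (intro tendsto_power tendsto_max tendsto_add tendsto_const)
    then show ?thesis by simp
  qed
  have "\<forall>n. \<exists>g. g holomorphic_on disk \<and> sqi diskm (gex g) \<and>
      (\<integral>z. norm (of_real (\<eta> n z) * gex f0 z - gex g z) \<partial>diskm) \<le> C / (real n + 1) \<and>
      integrable diskm (\<lambda>z. norm (of_real (\<eta> n z) * gex f0 z - gex g z)) \<and> \<eta> n \<in> borel_measurable diskm"
  proof
    fix n
    obtain pe qe K where E: "C1w disk (\<lambda>z. of_real (\<eta> n z)) pe qe" "compact K" "K \<subseteq> disk"
      "\<And>z. z \<in> disk \<Longrightarrow> z \<notin> K \<Longrightarrow> \<eta> n z = 0"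
      "\<And>z. z \<in> disk \<Longrightarrow> norm (qe z) \<le> 2 / (real n + 1) / (1 - norm z)"
      by (rule log_cutoff[of n, folded \<eta>_def]) (assumption | rule that)+
    have d0: "0 \<le> 2 * c1 / (real n + 1)" using pos_consts by simp
    \<comment> \<open>The bound of \<open>\<tau>\<close> by the distance to the circle converts the
      logarithmic estimate into the scale of \<open>\<tau>\<close>.\<close>
    have d: "norm (qe z) \<le> (2 * c1 / (real n + 1)) / \<tau> z" if z: "z \<in> disk" for z
    proof -
      have "1 / (1 - norm z) \<le> c1 / \<tau> z"
        using tau_bd[OF z] tau_pos[OF z] z by (simp add: field_simps)
      then have "2 / (real n + 1) * (1 / (1 - norm z)) \<le> 2 / (real n + 1) * (c1 / \<tau> z)"
        by (intro mult_left_mono) auto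
      then show ?thesis using E(5)[OF z] by simp
    qed
    have "continuous_on disk (\<lambda>z. Re (complex_of_real (\<eta> n z)))"
      by (intro continuous_on_Re C1w_continuous(1)[OF E(1)])
    then have m: "\<eta> n \<in> borel_measurable diskm" by (intro measurable_diskm_continuous) simp
    obtain g where "g holomorphic_on disk" "sqi diskm (gex g)"
      "(\<integral>z. norm (of_real (\<eta> n z) * gex f0 z - gex g z) \<partial>diskm) \<le> 2 * c1 / (real n + 1) * (K2 * (10 * sc) * (\<integral>z. norm (gex f0 z) \<partial>diskm))"
      "integrable diskm (\<lambda>z. norm (of_real (\<eta> n z) * gex f0 z - gex g z))"
      by (rule cutoff_projection[OF f0 E(1-4) d0 d])
    then show "\<exists>g. g holomorphic_on disk \<and> sqi diskm (gex g) \<and>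
      (\<integral>z. norm (of_real (\<eta> n z) * gex f0 z - gex g z) \<partial>diskm) \<le> C / (real n + 1) \<and>
      integrable diskm (\<lambda>z. norm (of_real (\<eta> n z) * gex f0 z - gex g z)) \<and> \<eta> n \<in> borel_measurable diskm"
      using m by (intro exI[of _ g]) (simp add: C_def)
  qed
  from choice[OF this] obtain g where g: "\<And>n. g n holomorphic_on disk" "\<And>n. sqi diskm (gex (g n))"
      "\<And>n. (\<integral>z. norm (of_real (\<eta> n z) * gex f0 z - gex (g n) z) \<partial>diskm) \<le> C / (real n + 1)"
      "\<And>n. integrable diskm (\<lambda>z. norm (of_real (\<eta> n z) * gex f0 z - gex (g n) z))" "\<And>n. \<eta> n \<in> borel_measurable diskm"
    by blast
  have dm: "(\<lambda>z. gex f0 z - of_real (\<eta> n z) * gex f0 z) \<in> borel_measurable diskm" for n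
    using fm g(5)[of n] by measurable
  have dle: "norm (gex f0 z - of_real (\<eta> n z) * gex f0 z) \<le> norm (gex f0 z)" if "z \<in> disk" for n z
  proof -
    have "gex f0 z - of_real (\<eta> n z) * gex f0 z = of_real (1 - \<eta> n z) * gex f0 z" by (simp add: algebra_simps)
    then have "norm (gex f0 z - of_real (\<eta> n z) * gex f0 z) = \<bar>1 - \<eta> n z\<bar> * norm (gex f0 z)"
      by (simp only: norm_mult norm_of_real)
    also have "\<dots> \<le> norm (gex f0 z)"
      using \<eta>01[OF that, of n] by (intro mult_left_le_one_le) auto
    finally show ?thesis .
  qed
  have di: "integrable diskm (\<lambda>z. norm (gex f0 z - of_real (\<eta> n z) * gex f0 z))" for n
    by (rule Bochner_Integration.integrable_bound[OF f0(2)]) (use dm dle in auto)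
  have "(\<lambda>n. \<integral>z. norm (gex f0 z - of_real (\<eta> n z) * gex f0 z) \<partial>diskm) \<longlonglongrightarrow> (\<integral>z. 0 \<partial>diskm)"
  proof (rule integral_dominated_convergence[where w = "\<lambda>z. norm (gex f0 z)"])
    show "AE z in diskm. (\<lambda>n. norm (gex f0 z - of_real (\<eta> n z) * gex f0 z)) \<longlonglongrightarrow> 0"
    proof (rule AE_I2)
      fix z
      have "(\<lambda>n. norm (gex f0 z - of_real (\<eta> n z) * gex f0 z)) \<longlonglongrightarrow> norm (gex f0 z - of_real 1 * gex f0 z)"
        by (intro tendsto_intros \<eta>lim)
      then show "(\<lambda>n. norm (gex f0 z - of_real (\<eta> n z) * gex f0 z)) \<longlonglongrightarrow> 0" by simp
    qed
    show "AE z in diskm. norm (norm (gex f0 z - of_real (\<eta> n z) * gex f0 z)) \<le> norm (gex f0 z)" for n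
      using dle by (intro AE_I2) simp
  qed (use f0(2) dm in auto)
  moreover have "(\<lambda>n. C / (real n + 1)) \<longlonglongrightarrow> 0"
    using tendsto_mult_right_zero[OF LIMSEQ_inverse_real_of_nat, of C] by (simp add: divide_inverse add.commute)
  ultimately have "(\<lambda>n. (\<integral>z. norm (gex f0 z - of_real (\<eta> n z) * gex f0 z) \<partial>diskm) + C / (real n + 1)) \<longlonglongrightarrow> (\<integral>z. 0 \<partial>diskm) + 0"
    by (rule tendsto_add)
  then have "(\<lambda>n. (\<integral>z. norm (gex f0 z - of_real (\<eta> n z) * gex f0 z) \<partial>diskm) + C / (real n + 1)) \<longlonglongrightarrow> 0" by simp
  from order_tendstoD(2)[OF this e] obtain n where n: "(\<integral>z. norm (gex f0 z - of_real (\<eta> n z) * gex f0 z) \<partial>diskm) + C / (real n + 1) < e"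
    by (auto simp: eventually_sequentially)
  have "(\<integral>z. norm (gex f0 z - gex (g n) z) \<partial>diskm) \<le> (\<integral>z. norm (gex f0 z - of_real (\<eta> n z) * gex f0 z) + norm (of_real (\<eta> n z) * gex f0 z - gex (g n) z) \<partial>diskm)"
  proof (rule integral_mono)
    show "integrable diskm (\<lambda>z. norm (gex f0 z - gex (g n) z))"
      by (intro integrable_norm Bochner_Integration.integrable_diff fi integral_norm_le_nrm(1)[OF finite_measure_diskm g(2)])
    show "integrable diskm (\<lambda>z. norm (gex f0 z - of_real (\<eta> n z) * gex f0 z) + norm (of_real (\<eta> n z) * gex f0 z - gex (g n) z))"
      by (intro Bochner_Integration.integrable_add di g(4))
    fix z
    show "norm (gex f0 z - gex (g n) z) \<le> norm (gex f0 z - of_real (\<eta> n z) * gex f0 z) + norm (of_real (\<eta> n z) * gex f0 z - gex (g n) z)"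
      using norm_triangle_ineq[of "gex f0 z - of_real (\<eta> n z) * gex f0 z" "of_real (\<eta> n z) * gex f0 z - gex (g n) z"] by simp
  qed
  also have "\<dots> = (\<integral>z. norm (gex f0 z - of_real (\<eta> n z) * gex f0 z) \<partial>diskm) + (\<integral>z. norm (of_real (\<eta> n z) * gex f0 z - gex (g n) z) \<partial>diskm)"
    by (rule Bochner_Integration.integral_add[OF di g(4)])
  also have "\<dots> < e" using g(3)[of n] n by linarith
  finally show thesis using that[OF g(1,2)] by blast
qed

text \<open>\<open>A1 v\<close> in terms of \<open>\<phi>\<close> and Borel measure.\<close>

definition A1set :: "(complex \<Rightarrow> complex) set"
  where "A1set = {f \<in> analytic_disk. integrable diskm (\<lambda>z. norm (gex f z))}"

section \<open>Duality in terms of Borel measure\<close>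

lemma zero_extension:
  assumes "f holomorphic_on disk"
  obtains f0 where "f0 \<in> analytic_disk" "\<And>z. z \<in> disk \<Longrightarrow> f0 z = f z" "\<And>z. z \<in> disk \<Longrightarrow> gex f0 z = gex f z"
proof
  let ?f0 = "\<lambda>z. if z \<in> disk then f z else 0"
  show "?f0 \<in> analytic_disk"
    using holomorphic_cong[of disk disk ?f0 f] assms by (simp add: analytic_disk_def)
qed (simp_all add: gex_def)

text \<open>The sub-mean value property turns a vanishing norm into vanishing at each point.\<close>

lemma nrm_analytic_eq_0:
  assumes g: "g holomorphic_on disk" "sqi diskm (gex g)" "nrm diskm (gex g) = 0" and z: "z \<in> disk"
  shows "g z = 0"
proof -
  have "nrm diskm (\<lambda>w. rho z w * gex g w) \<le> 0"
    using nrm_rho_le[OF z g(2)] g(3) by simp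
  then have n: "nrm diskm (\<lambda>w. rho z w * gex g w) = 0"
    using nrm_nonneg[of diskm "\<lambda>w. rho z w * gex g w"] by linarith
  have "(\<integral>w. indicator (cball z (del * \<tau> z)) w * norm (gex g w) \<partial>diskm) \<le> 0"
    using local_average(2)[OF z g(2), of 1] n by simp
  then have "K1 / (\<tau> z)\<^sup>2 * (\<integral>w. indicator (cball z (del * \<tau> z)) w * norm (gex g w) \<partial>diskm) \<le> 0"
    using K1_pos by (intro mult_nonneg_nonpos) auto
  then have "norm (gex g z) \<le> 0" using submean[OF g(1) z] by linarith
  then show ?thesis by (simp add: gex_def)
qed

lemma bounded_pairing:
  assumes h: "integrable diskm h" and g: "g holomorphic_on disk" "\<And>z. z \<in> disk \<Longrightarrow> norm (gex g z) \<le> M"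
  shows "integrable diskm (\<lambda>z. h z * cnj (gex g z))"
    "norm (ip diskm h (gex g)) \<le> M * (\<integral>z. norm (h z) \<partial>diskm)"
proof -
  have hm: "h \<in> borel_measurable diskm" using h by simp
  have m: "(\<lambda>z. h z * cnj (gex g z)) \<in> borel_measurable diskm"
    using hm gex_measurable[OF g(1)] by measurable
  have i: "integrable diskm (\<lambda>z. M * norm (h z))"
    by (intro integrable_mult_right integrable_norm h)
  have le: "norm (h z * cnj (gex g z)) \<le> M * norm (h z)" if "z \<in> space diskm" for z
    using g(2)[of z] that by (simp add: norm_mult mult.commute[of "norm (h z)"] mult_right_mono)
  show I: "integrable diskm (\<lambda>z. h z * cnj (gex g z))"
  proof (rule Bochner_Integration.integrable_bound[OF i m])
    show "AE z in diskm. norm (h z * cnj (gex g z)) \<le> norm (M * norm (h z))"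
      by (rule AE_I2) (metis le abs_ge_self order_trans real_norm_def)
  qed
  have "norm (ip diskm h (gex g)) \<le> (\<integral>z. norm (h z * cnj (gex g z)) \<partial>diskm)"
    unfolding ip_def by (rule integral_norm_bound)
  also have "\<dots> \<le> (\<integral>z. M * norm (h z) \<partial>diskm)"
    by (rule integral_mono[OF integrable_norm[OF I] i le])
  finally show "norm (ip diskm h (gex g)) \<le> M * (\<integral>z. norm (h z) \<partial>diskm)" by simp
qed

lemma bounded_gex_sqi:
  assumes g: "g holomorphic_on disk" "\<And>z. z \<in> disk \<Longrightarrow> norm (gex g z) \<le> M"
  shows "sqi diskm (gex g)"
proof -
  interpret finite_measure diskm by (rule finite_measure_diskm)
  have 1: "sqi diskm (\<lambda>z. of_real M)" by (simp add: sqi_def)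
  show ?thesis
  proof (rule sqi_dominated[OF 1 gex_measurable[OF g(1)]])
    fix z assume "z \<in> space diskm"
    then have "norm (gex g z) \<le> M" using g(2)[of z] by simp
    then show "norm (gex g z) \<le> norm (complex_of_real M)" by simp
  qed
qed

lemma sqi_A1set: "f \<in> analytic_disk \<Longrightarrow> sqi diskm (gex f) \<Longrightarrow> f \<in> A1set"
  using integral_norm_le_nrm(1)[OF finite_measure_diskm, of "gex f"]
  by (simp add: A1set_def integrable_norm)

lemma pairing_nondegenerate:
  assumes g: "g \<in> analytic_disk" "\<And>z. z \<in> disk \<Longrightarrow> norm (gex g z) \<le> M"
    and 0: "\<And>f. f \<in> A1set \<Longrightarrow> ip diskm (gex f) (gex g) = 0"
  shows "g z = 0"
proof -
  have gh: "g holomorphic_on disk" using g(1) by (simp add: analytic_disk_def)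
  have s: "sqi diskm (gex g)" by (rule bounded_gex_sqi[OF gh g(2)])
  have "complex_of_real ((nrm diskm (gex g))\<^sup>2) = 0"
    using 0[OF sqi_A1set[OF g(1) s]] unfolding ip_self .
  then have n: "nrm diskm (gex g) = 0" by simp
  show ?thesis
  proof (cases "z \<in> disk")
    case True
    then show ?thesis by (rule nrm_analytic_eq_0[OF gh s n])
  next
    case False
    then show ?thesis using g(1) by (simp add: analytic_disk_def)
  qed
qed

text \<open>Where \<open>|gex g|\<close> is too large, pair it with the projection of its phase on a small ball.\<close>

lemma sup_bound_by_duality:
  assumes g: "g holomorphic_on disk" "sqi diskm (gex g)" and C: "0 \<le> C"
    and bd: "\<And>p. p holomorphic_on disk \<Longrightarrow> sqi diskm (gex p) \<Longrightarrow>
      norm (ip diskm (gex p) (gex g)) \<le> C * (\<integral>z. norm (gex p z) \<partial>diskm)"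
    and z: "z \<in> disk"
  shows "norm (gex g z) \<le> C * Kinf"
proof (rule ccontr)
  assume "\<not> norm (gex g z) \<le> C * Kinf"
  then obtain M where M: "C * Kinf < M" "M < norm (gex g z)" using dense by (auto simp: not_le)
  have gm: "gex g \<in> borel_measurable diskm" by (rule gex_measurable[OF g(1)])
  have "continuous_on disk (\<lambda>w. norm (gex g w))" by (intro continuous_on_norm gex_cont g(1))
  from continuous_open_preimage[OF this, of "{M<..}"]
  have "open {w \<in> disk. norm (gex g w) \<in> {M<..}}"
    by (simp add: vimage_def Int_def)
  then obtain r where r: "0 < r" "ball z r \<subseteq> {w \<in> disk. norm (gex g w) \<in> {M<..}}"
    using z M(2) by (auto elim!: openE)
  let ?i = "indicator (ball z r) :: complex \<Rightarrow> real"
  let ?\<psi> = "\<lambda>w. of_real (?i w) * sgn (gex g w)"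
  have bs: "ball z r \<in> sets diskm"
    using r(2) by (auto simp: sets_restrict_space intro!: image_eqI[of _ _ "ball z r"])
  have im: "?i \<in> borel_measurable diskm" by (rule borel_measurable_indicator[OF bs])
  have ms: "(\<lambda>w. sgn (gex g w)) \<in> borel_measurable diskm" by (rule phase(1)[OF gm])
  have ii: "integrable diskm ?i"
  proof -
    interpret finite_measure diskm by (rule finite_measure_diskm)
    show ?thesis by (rule integrable_const_bound[of _ 1]) (use im in \<open>auto simp: indicator_def\<close>)
  qed
  have n\<psi>: "norm (?\<psi> w) \<le> ?i w" for w
    using phase(2)[OF gm, of w] by (auto simp: norm_mult indicator_def)
  have s\<psi>: "sqi diskm ?\<psi>"
  proof (rule bounded_sqi(1))
    show "?\<psi> \<in> borel_measurable diskm" using im ms by measurable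
    show "norm (?\<psi> w) \<le> 1" if "w \<in> disk" for w
      using n\<psi>[of w] by (auto simp: indicator_def split: if_splits intro: order_trans)
  qed
  obtain p bb pp qq mm where p: "proj_of ?\<psi> p"
    "\<And>n::nat. test_fun (bb n) (pp n) (qq n) (mm n)"
    "(\<lambda>n. nrm diskm (\<lambda>z. ex z * pp n z - (?\<psi> z - gex p z))) \<longlonglongrightarrow> 0"
    "\<And>b p' q m. test_fun b p' q m \<Longrightarrow> ip diskm (\<lambda>z. ex z * p' z) (gex p) = 0"
    by (rule projection_exists[OF s\<psi>]) (assumption | rule that)+
  note p' = proj_ofD(1,2)[OF p(1)]
  have pt: "gex g w * cnj (?\<psi> w) = of_real (?i w * norm (gex g w))" for w
    using phase(3)[OF gm, of w] by (simp add: indicator_def)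
  have "ip diskm (gex p) (gex g) = cnj (ip diskm (gex g) (gex p))" by (rule ip_commute)
  also have "ip diskm (gex g) (gex p) = ip diskm (gex g) ?\<psi>"
    by (rule proj_ofD'[OF p(1) s\<psi> g, symmetric])
  also have "\<dots> = of_real (\<integral>w. ?i w * norm (gex g w) \<partial>diskm)"
    unfolding ip_def pt by (rule integral_complex_of_real)
  finally have eq: "norm (ip diskm (gex p) (gex g)) = \<bar>\<integral>w. ?i w * norm (gex g w) \<partial>diskm\<bar>"
    by simp
  \<comment> \<open>The pairing is squeezed between \<open>M\<close> and \<open>C * Kinf\<close>
    times the area of the ball. The area is positive, which contradicts the choice of
    \<open>M\<close>.\<close>
  have "M * (\<integral>w. ?i w \<partial>diskm) = (\<integral>w. M * ?i w \<partial>diskm)" by simp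
  also have "\<dots> \<le> (\<integral>w. ?i w * norm (gex g w) \<partial>diskm)"
  proof (rule integral_mono)
    show "integrable diskm (\<lambda>w. M * ?i w)" by (intro integrable_mult_right ii)
    have gi: "integrable diskm (\<lambda>w. norm (gex g w))"
      by (intro integrable_norm integral_norm_le_nrm(1)[OF finite_measure_diskm g(2)])
    show "integrable diskm (\<lambda>w. ?i w * norm (gex g w))"
    proof (rule Bochner_Integration.integrable_bound[OF gi])
      have "(\<lambda>w. norm (gex g w)) \<in> borel_measurable diskm" using gm by measurable
      then show "(\<lambda>w. ?i w * norm (gex g w)) \<in> borel_measurable diskm"
        by (rule borel_measurable_times[OF im])
    qed (auto simp: indicator_def)
    fix w
    show "M * ?i w \<le> ?i w * norm (gex g w)" using r(2) by (auto simp: indicator_def)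
  qed
  also have "\<dots> \<le> norm (ip diskm (gex p) (gex g))" unfolding eq by (rule abs_ge_self)
  also have "\<dots> \<le> C * (\<integral>z. norm (gex p z) \<partial>diskm)" by (rule bd[OF p'])
  also have "\<dots> \<le> C * (Kinf * (\<integral>z. norm (?\<psi> z) \<partial>diskm))"
    by (rule mult_left_mono[OF projection_L1[OF s\<psi> p(1)] C])
  also have "\<dots> \<le> C * (Kinf * (\<integral>w. ?i w \<partial>diskm))"
  proof -
    have "(\<integral>z. norm (?\<psi> z) \<partial>diskm) \<le> (\<integral>w. ?i w \<partial>diskm)"
      by (rule integral_mono[OF integrable_norm[OF integral_norm_le_nrm(1)[OF finite_measure_diskm s\<psi>]] ii n\<psi>])
    then show ?thesis using C K1_pos del_pos sc_pos by (intro mult_left_mono) (auto simp: Kinf_def)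
  qed
  finally have 1: "M * (\<integral>w. ?i w \<partial>diskm) \<le> (C * Kinf) * (\<integral>w. ?i w \<partial>diskm)" by (simp add: mult.assoc)
  have sub: "ball z r \<subseteq> disk" using r(2) by auto
  have "(\<integral>w. ?i w \<partial>diskm) = measure diskm (ball z r)"
    using sub by (simp add: sets_restrict_space Int_absorb2)
  also have "\<dots> = measure lborel (ball z r)"
    using sub by (subst measure_restrict_space) auto
  also have "\<dots> > 0" using r(1) by (simp add: content_ball_pos)
  finally show False using 1 M(1) by (simp add: mult_le_cancel_right)
qed

text \<open>On a space of finite measure the L1 bound for the functional implies an L2 bound, so
  Riesz applies on the square integrable functions; the sup bound on the representative is what
  permits passing to the limit in L1.\<close>

theorem duality:
  assumes add: "\<And>f g. f \<in> A1set \<Longrightarrow> g \<in> A1set \<Longrightarrow> \<Lambda> (\<lambda>z. f z + g z) = \<Lambda> f + \<Lambda> g"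
    and scale: "\<And>a f. f \<in> A1set \<Longrightarrow> \<Lambda> (\<lambda>z. a * f z) = a * \<Lambda> f"
    and bound: "\<And>f. f \<in> A1set \<Longrightarrow> norm (\<Lambda> f) \<le> C * (\<integral>z. norm (gex f z) \<partial>diskm)" and C: "0 \<le> C"
  obtains g where "g \<in> analytic_disk" "\<And>z. z \<in> disk \<Longrightarrow> norm (gex g z) \<le> C * Kinf"
    "\<And>f. f \<in> A1set \<Longrightarrow> \<Lambda> f = ip diskm (gex f) (gex g)"
proof -
  define S where "S = {gex f | f. f \<in> analytic_disk \<and> sqi diskm (gex f)}"
  define L where "L s = \<Lambda> (\<lambda>z. ex z * s z)" for s
  have L: "L (gex f) = \<Lambda> f" for f unfolding L_def ex_gex ..
  have an_add: "(\<lambda>z. f z + g z) \<in> analytic_disk" if "f \<in> analytic_disk" "g \<in> analytic_disk" for f g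
    using that by (auto simp: analytic_disk_def intro: holomorphic_intros)
  have an_scale: "(\<lambda>z. a * f z) \<in> analytic_disk" if "f \<in> analytic_disk" for f a
    using that by (auto simp: analytic_disk_def intro: holomorphic_intros)
  have gadd: "(\<lambda>z. gex f z + gex g z) = gex (\<lambda>z. f z + g z)" for f g
    by (simp add: gex_def fun_eq_iff distrib_right)
  have gscale: "(\<lambda>z. a * gex f z) = gex (\<lambda>z. a * f z)" for f a
    by (simp add: gex_def fun_eq_iff mult.assoc)
  have gz: "gex (\<lambda>z. 0) = (\<lambda>z. 0)" by (simp add: gex_def fun_eq_iff)
  let ?m = "sqrt (measure diskm (space diskm))"
  obtain s G where G: "\<And>n::nat. s n \<in> S" "sqi diskm G"
      "(\<lambda>n. nrm diskm (\<lambda>x. s n x - G x)) \<longlonglongrightarrow> 0" "\<And>t. t \<in> S \<Longrightarrow> ip diskm t G = L t"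
  proof (rule riesz_L2[of diskm S L "C * ?m"])
    show "finite_measure diskm" by (rule finite_measure_diskm)
    show "sqi diskm t" if "t \<in> S" for t using that by (auto simp: S_def)
    show "(\<lambda>x. t x + u x) \<in> S" if "t \<in> S" "u \<in> S" for t u
    proof -
      from that obtain f g where f: "t = gex f" "f \<in> analytic_disk" "sqi diskm (gex f)"
        and g: "u = gex g" "g \<in> analytic_disk" "sqi diskm (gex g)" by (auto simp: S_def)
      have "sqi diskm (gex (\<lambda>z. f z + g z))" using sqi_add[OF f(3) g(3)] unfolding gadd .
      then show ?thesis unfolding f(1) g(1) gadd S_def using an_add[OF f(2) g(2)] by blast
    qed
    show "(\<lambda>x. a * t x) \<in> S" if "t \<in> S" for t a
    proof -
      from that obtain f where f: "t = gex f" "f \<in> analytic_disk" "sqi diskm (gex f)" by (auto simp: S_def)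
      have "sqi diskm (gex (\<lambda>z. a * f z))" using sqi_scale[OF f(3)] unfolding gscale .
      then show ?thesis unfolding f(1) gscale S_def using an_scale[OF f(2)] by blast
    qed
    have "(\<lambda>z. 0) \<in> analytic_disk" by (simp add: analytic_disk_def)
    moreover have "sqi diskm (gex (\<lambda>z. 0))" unfolding gz by (simp add: sqi_def)
    ultimately show "S \<noteq> {}" unfolding S_def by blast
    show "L (\<lambda>x. t x + u x) = L t + L u" if "t \<in> S" "u \<in> S" for t u
    proof -
      from that obtain f g where f: "t = gex f" "f \<in> analytic_disk" "sqi diskm (gex f)"
        and g: "u = gex g" "g \<in> analytic_disk" "sqi diskm (gex g)" by (auto simp: S_def)
      show ?thesis unfolding f(1) g(1) gadd L by (rule add[OF sqi_A1set[OF f(2,3)] sqi_A1set[OF g(2,3)]])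
    qed
    show "L (\<lambda>x. a * t x) = a * L t" if "t \<in> S" for t a
    proof -
      from that obtain f where f: "t = gex f" "f \<in> analytic_disk" "sqi diskm (gex f)" by (auto simp: S_def)
      show ?thesis unfolding f(1) gscale L by (rule scale[OF sqi_A1set[OF f(2,3)]])
    qed
    show "norm (L t) \<le> C * ?m * nrm diskm t" if "t \<in> S" for t
    proof -
      from that obtain f where f: "t = gex f" "f \<in> analytic_disk" "sqi diskm (gex f)" by (auto simp: S_def)
      have "norm (\<Lambda> f) \<le> C * (\<integral>z. norm (gex f z) \<partial>diskm)" by (rule bound[OF sqi_A1set[OF f(2,3)]])
      also have "\<dots> \<le> C * (nrm diskm (gex f) * ?m)"
        by (rule mult_left_mono[OF integral_norm_le_nrm(2)[OF finite_measure_diskm f(3)] C])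
      also have "\<dots> = C * ?m * nrm diskm (gex f)" by (simp add: mult.commute[of _ ?m] mult.assoc)
      finally show ?thesis unfolding f(1) L .
    qed
  qed (assumption | rule that)+
  \<comment> \<open>\<open>G\<close> is known only as an L2 limit. Projecting it gives a holomorphic
    representative with the same pairings.\<close>
  obtain g1 bb pp qq mm where p: "proj_of G g1"
    "\<And>n::nat. test_fun (bb n) (pp n) (qq n) (mm n)"
    "(\<lambda>n. nrm diskm (\<lambda>z. ex z * pp n z - (G z - gex g1 z))) \<longlonglongrightarrow> 0"
    "\<And>b p' q m. test_fun b p' q m \<Longrightarrow> ip diskm (\<lambda>z. ex z * p' z) (gex g1) = 0"
    by (rule projection_exists[OF G(2)]) (assumption | rule that)+
  note g1 = proj_ofD(1,2)[OF p(1)]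
  obtain g where g: "g \<in> analytic_disk" "\<And>z. z \<in> disk \<Longrightarrow> g z = g1 z" "\<And>z. z \<in> disk \<Longrightarrow> gex g z = gex g1 z"
    by (rule zero_extension[OF g1(1)]) (assumption | rule that)+
  have rep: "\<Lambda> f = ip diskm (gex f) (gex g1)" if "f \<in> analytic_disk" "sqi diskm (gex f)" for f
  proof -
    have fh: "f holomorphic_on disk" using that(1) by (simp add: analytic_disk_def)
    have "gex f \<in> S" using that by (auto simp: S_def)
    from G(4)[OF this] have "\<Lambda> f = ip diskm (gex f) G" unfolding L ..
    also have "\<dots> = ip diskm (gex f) (gex g1)" by (rule proj_ofD'[OF p(1) G(2) fh that(2)])
    finally show ?thesis .
  qed
  \<comment> \<open>The functional acts on functions that vanish off the disk, whereas projections
    have arbitrary values there.\<close>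
  have ext: "\<exists>u0. u0 \<in> analytic_disk \<and> sqi diskm (gex u0) \<and> (\<forall>z\<in>disk. gex u0 z = gex u z)"
    if u: "u holomorphic_on disk" "sqi diskm (gex u)" for u
  proof -
    obtain u0 where u0: "u0 \<in> analytic_disk" "\<And>z. z \<in> disk \<Longrightarrow> u0 z = u z" "\<And>z. z \<in> disk \<Longrightarrow> gex u0 z = gex u z"
      by (rule zero_extension[OF u(1)]) (assumption | rule that)+
    have "u0 holomorphic_on disk" using u0(1) by (simp add: analytic_disk_def)
    then have "sqi diskm (gex u0)"
      by (intro sqi_dominated[OF u(2) gex_measurable]) (simp_all add: u0(3))
    then show ?thesis using u0 by blast
  qed
  have sup: "norm (gex g1 z) \<le> C * Kinf" if z: "z \<in> disk" for z
  proof (rule sup_bound_by_duality[OF g1 C _ z])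
    fix u assume u: "u holomorphic_on disk" "sqi diskm (gex u)"
    obtain u0 where u0: "u0 \<in> analytic_disk" "sqi diskm (gex u0)" "\<And>z. z \<in> disk \<Longrightarrow> gex u0 z = gex u z"
      using ext[OF u] by blast
    have "ip diskm (gex u) (gex g1) = ip diskm (gex u0) (gex g1)"
      unfolding ip_def by (rule Bochner_Integration.integral_cong) (simp_all add: u0(3))
    moreover have "(\<integral>z. norm (gex u z) \<partial>diskm) = (\<integral>z. norm (gex u0 z) \<partial>diskm)"
      by (rule Bochner_Integration.integral_cong) (simp_all add: u0(3))
    ultimately show "norm (ip diskm (gex u) (gex g1)) \<le> C * (\<integral>z. norm (gex u z) \<partial>diskm)"
      using bound[OF sqi_A1set[OF u0(1,2)]] rep[OF u0(1,2)] by simp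
  qed
  show thesis
  proof (rule that[OF g(1)])
    show "norm (gex g z) \<le> C * Kinf" if "z \<in> disk" for z using sup[OF that] g(3)[OF that] by simp
    fix f assume f: "f \<in> A1set"
    then have fa: "f \<in> analytic_disk" and fh: "f holomorphic_on disk" and fi: "integrable diskm (\<lambda>z. norm (gex f z))"
      by (auto simp: A1set_def analytic_disk_def)
    have fi': "integrable diskm (gex f)" using fi gex_measurable[OF fh] by (simp add: integrable_norm_iff)
    have eq: "ip diskm (gex f) (gex g) = ip diskm (gex f) (gex g1)"
      unfolding ip_def by (rule Bochner_Integration.integral_cong) (simp_all add: g(3))
    \<comment> \<open>The combined bounds of the two functionals being compared; adding 1 below
      avoids a division by zero.\<close>
    let ?D = "C + C * Kinf"
    have "norm (\<Lambda> f - ip diskm (gex f) (gex g1)) \<le> 0 + e" if e: "0 < e" for e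
    proof -
      have K: "0 \<le> Kinf" using K1_pos del_pos sc_pos by (simp add: Kinf_def)
      have D: "0 < ?D + 1" using C K by (simp add: add_nonneg_pos)
      have e': "0 < e / (?D + 1)" using e D by simp
      obtain u where u: "u holomorphic_on disk" "sqi diskm (gex u)" "(\<integral>z. norm (gex f z - gex u z) \<partial>diskm) < e / (?D + 1)"
        by (rule density[OF fh fi e']) (assumption | rule that)+
      obtain u0 where u0: "u0 \<in> analytic_disk" "sqi diskm (gex u0)" "\<And>z. z \<in> disk \<Longrightarrow> gex u0 z = gex u z"
        using ext[OF u(1,2)] by blast
      have u0h: "u0 holomorphic_on disk" using u0(1) by (simp add: analytic_disk_def)
      have u0A: "u0 \<in> A1set" by (rule sqi_A1set[OF u0(1,2)])
      have u0i: "integrable diskm (gex u0)" by (rule integral_norm_le_nrm(1)[OF finite_measure_diskm u0(2)])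
      define h where "h = (\<lambda>z. f z + (-1) * u0 z)"
      have gh: "gex h z = gex f z - gex u0 z" for z by (simp add: h_def gex_def left_diff_distrib)
      have hi: "integrable diskm (gex h)"
        unfolding gh[abs_def] by (rule Bochner_Integration.integrable_diff[OF fi' u0i])
      have mu: "(\<lambda>z. (-1) * u0 z) \<in> A1set"
        using an_scale[OF u0(1), of "-1"] sqi_scale[OF u0(2), of "-1"] unfolding gscale by (intro sqi_A1set) auto
      have ha: "h \<in> analytic_disk"
        unfolding h_def by (rule an_add[OF fa an_scale[OF u0(1)]])
      have hA: "h \<in> A1set" using ha hi by (simp add: A1set_def integrable_norm)
      have hn: "(\<integral>z. norm (gex h z) \<partial>diskm) < e / (?D + 1)"
      proof -
        have "(\<integral>z. norm (gex h z) \<partial>diskm) = (\<integral>z. norm (gex f z - gex u z) \<partial>diskm)"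
          by (rule Bochner_Integration.integral_cong) (simp_all add: gh u0(3))
        then show ?thesis using u(3) by simp
      qed
      have L1: "\<Lambda> h = \<Lambda> f - \<Lambda> u0"
        unfolding h_def add[OF f mu] scale[OF u0A] by simp
      have L2: "ip diskm (gex h) (gex g1) = ip diskm (gex f) (gex g1) - ip diskm (gex u0) (gex g1)"
        unfolding ip_def gh left_diff_distrib
        by (rule Bochner_Integration.integral_diff[OF bounded_pairing(1)[OF fi' g1(1) sup] bounded_pairing(1)[OF u0i g1(1) sup]])
      have "\<Lambda> f - ip diskm (gex f) (gex g1) = \<Lambda> h - ip diskm (gex h) (gex g1)"
        unfolding L1 L2 rep[OF u0(1,2)] by simp
      then have "norm (\<Lambda> f - ip diskm (gex f) (gex g1)) \<le> norm (\<Lambda> h) + norm (ip diskm (gex h) (gex g1))"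
        by (metis norm_triangle_ineq4)
      also have "\<dots> \<le> C * (\<integral>z. norm (gex h z) \<partial>diskm) + C * Kinf * (\<integral>z. norm (gex h z) \<partial>diskm)"
        by (rule add_mono[OF bound[OF hA] bounded_pairing(2)[OF hi g1(1) sup]])
      also have "\<dots> = ?D * (\<integral>z. norm (gex h z) \<partial>diskm)" by (simp only: distrib_right)
      also have "\<dots> \<le> ?D * (e / (?D + 1))"
        using hn C K by (intro mult_left_mono) auto
      also have "\<dots> \<le> e" using e D by (simp add: field_simps)
      finally show ?thesis by simp
    qed
    then have "norm (\<Lambda> f - ip diskm (gex f) (gex g1)) \<le> 0" by (rule field_le_epsilon)
    then show "\<Lambda> f = ip diskm (gex f) (gex g)" unfolding eq by simp
  qed
qed

end

section \<open>Weights of class \<open>\<E>\<close>\<close>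

lemma has_real_derivative_along_line:
  fixes f :: "complex \<Rightarrow> real"
  assumes "(f has_derivative f') (at (w + of_real t * h))"
  shows "((\<lambda>s. f (w + of_real s * h)) has_real_derivative f' h) (at t)"
proof -
  have "((\<lambda>s::real. w + of_real s * h) has_derivative (\<lambda>s. of_real s * h)) (at t)"
    by (auto intro!: derivative_eq_intros)
  from has_derivative_compose[OF this assms]
  have "((\<lambda>s. f (w + of_real s * h)) has_derivative (\<lambda>s. f' (of_real s * h))) (at t)" .
  moreover have "f' (of_real s * h) = f' h * s" for s
    using linear_cmul[OF has_derivative_linear[OF assms], of s h] by (simp add: scaleR_conv_of_real mult.commute)
  ultimately show ?thesis by (simp add: has_field_derivative_def)
qed

lemma blinfun_partial_deriv:
  assumes "(f' has_derivative blinfun_apply f'') (at z)"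
  shows "((\<lambda>w. blinfun_apply (f' w) h) has_derivative (\<lambda>k. blinfun_apply (blinfun_apply f'' k) h)) (at z)"
  by (rule bounded_linear.has_derivative[OF blinfun.bounded_linear_left assms])

text \<open>Two applications of the mean value theorem: along \<open>h\<close> to the increment in
  direction \<open>k\<close>, and along \<open>k\<close> to the resulting derivative.\<close>

lemma second_difference:
  fixes f :: "complex \<Rightarrow> real" and f' :: "complex \<Rightarrow> complex \<Rightarrow>\<^sub>L real" and f'' :: "complex \<Rightarrow> complex \<Rightarrow>\<^sub>L complex \<Rightarrow>\<^sub>L real"
  assumes d1: "\<And>z. z \<in> U \<Longrightarrow> (f has_derivative blinfun_apply (f' z)) (at z)"
    and d2: "\<And>z. z \<in> U \<Longrightarrow> (f' has_derivative blinfun_apply (f'' z)) (at z)"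
    and s: "0 < s" "cball z (2 * s) \<subseteq> U" and h: "norm h = 1" and k: "norm k = 1"
  shows "\<exists>w \<in> cball z (2 * s). f (z + of_real s * h + of_real s * k) - f (z + of_real s * h) - f (z + of_real s * k) + f z
     = s * (s * f'' w k h)"
proof -
  have in_cb: "z + of_real a * h + of_real b * k \<in> cball z (2 * s)" if "0 \<le> a" "a \<le> s" "0 \<le> b" "b \<le> s" for a b
  proof -
    have "norm (of_real a * h + of_real b * k) \<le> norm (of_real a * h) + norm (of_real b * k)"
      by (rule norm_triangle_ineq)
    also have "\<dots> = a + b" using that h k by (simp add: norm_mult)
    also have "\<dots> \<le> 2 * s" using that by simp
    finally show ?thesis by (simp add: dist_norm norm_minus_commute add.assoc) (metis norm_minus_cancel add.commute minus_add_distrib uminus_add_conv_diff)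
  qed
  note inU = subsetD[OF s(2) in_cb]
  define g where "g t = f ((z + of_real s * k) + of_real t * h) - f (z + of_real t * h)" for t
  have "\<exists>t. 0 < t \<and> t < s \<and> g s - g 0 = (s - 0) * (f' ((z + of_real s * k) + of_real t * h) h - f' (z + of_real t * h) h)"
  proof (rule MVT2[OF s(1)])
    fix t assume t: "0 \<le> t" "t \<le> s"
    have 1: "(z + of_real s * k) + of_real t * h \<in> U" using inU[OF t, of s] s(1) by (simp add: ac_simps)
    have 2: "z + of_real t * h \<in> U" using inU[OF t, of 0] s(1) by simp
    show "(g has_real_derivative f' ((z + of_real s * k) + of_real t * h) h - f' (z + of_real t * h) h) (at t)"
      unfolding g_def[abs_def] by (rule DERIV_diff[OF has_real_derivative_along_line[OF d1[OF 1]] has_real_derivative_along_line[OF d1[OF 2]]])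
  qed
  then obtain t where t: "0 < t" "t < s" "g s - g 0 = s * (f' ((z + of_real s * k) + of_real t * h) h - f' (z + of_real t * h) h)"
    by auto
  have "\<exists>u. 0 < u \<and> u < s \<and> f' ((z + of_real t * h) + of_real s * k) h - f' ((z + of_real t * h) + of_real 0 * k) h
      = (s - 0) * f'' ((z + of_real t * h) + of_real u * k) k h"
  proof (rule MVT2[OF s(1)])
    fix u assume u: "0 \<le> u" "u \<le> s"
    have "(z + of_real t * h) + of_real u * k \<in> U" using inU[of t u] t u by simp
    from has_real_derivative_along_line[OF blinfun_partial_deriv[OF d2[OF this]]]
    show "((\<lambda>u. f' ((z + of_real t * h) + of_real u * k) h) has_real_derivative f'' ((z + of_real t * h) + of_real u * k) k h) (at u)" .
  qed
  then obtain u where u: "0 < u" "u < s" "f' ((z + of_real t * h) + of_real s * k) h - f' (z + of_real t * h) h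
      = s * f'' ((z + of_real t * h) + of_real u * k) k h" by auto
  have "f (z + of_real s * h + of_real s * k) - f (z + of_real s * h) - f (z + of_real s * k) + f z = g s - g 0"
    by (simp add: g_def ac_simps)
  also have "\<dots> = s * (s * f'' ((z + of_real t * h) + of_real u * k) k h)"
    unfolding t(3) u(3)[symmetric] by (simp add: ac_simps)
  finally show ?thesis using in_cb[of t u] t u by (intro bexI[of _ "z + of_real t * h + of_real u * k"]) simp_all
qed

text \<open>The second difference does not change when \<open>h\<close> and \<open>k\<close> are
  exchanged, and divided by \<open>s^2\<close> it is close to both mixed derivatives at
  \<open>z\<close>.\<close>

lemma second_derivative_symmetric:
  fixes f :: "complex \<Rightarrow> real" and f' :: "complex \<Rightarrow> complex \<Rightarrow>\<^sub>L real" and f'' :: "complex \<Rightarrow> complex \<Rightarrow>\<^sub>L complex \<Rightarrow>\<^sub>L real"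
  assumes U: "open U" "z \<in> U"
    and d1: "\<And>z. z \<in> U \<Longrightarrow> (f has_derivative blinfun_apply (f' z)) (at z)"
    and d2: "\<And>z. z \<in> U \<Longrightarrow> (f' has_derivative blinfun_apply (f'' z)) (at z)"
    and c: "continuous_on U f''" and h: "norm h = 1" and k: "norm k = 1"
  shows "f'' z h k = f'' z k h"
proof (rule ccontr)
  assume ne: "f'' z h k \<noteq> f'' z k h"
  define e where "e = dist (f'' z h k) (f'' z k h) / 2"
  have e: "0 < e" using ne by (simp add: e_def)
  have cont: "continuous (at z) (\<lambda>w. f'' w a b)" for a b
  proof -
    have "continuous_on U (\<lambda>w. f'' w a b)" by (intro continuous_intros c)
    then show ?thesis using U by (simp add: continuous_on_eq_continuous_at)
  qed
  have "\<exists>d>0. \<forall>w. dist w z < d \<longrightarrow> dist (f'' w a b) (f'' z a b) < e" for a b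
    using cont[of a b] e unfolding continuous_at_eps_delta by blast
  then obtain d where d: "0 < d" "\<And>w. dist w z < d \<Longrightarrow> dist (f'' w h k) (f'' z h k) < e"
    and d': "\<exists>d>0. \<forall>w. dist w z < d \<longrightarrow> dist (f'' w k h) (f'' z k h) < e" by metis
  from d' obtain d' where d': "0 < d'" "\<And>w. dist w z < d' \<Longrightarrow> dist (f'' w k h) (f'' z k h) < e" by blast
  obtain r where r: "0 < r" "cball z r \<subseteq> U" using U open_contains_cball by blast
  \<comment> \<open>The intermediate points lie within \<open>2 * s\<close> of \<open>z\<close>, so
    \<open>s\<close> is at most half the radius available in \<open>U\<close> and strictly less than
    half of both continuity radii.\<close>
  define s where "s = min (r / 2) (min (d / 4) (d' / 4))"
  have s: "0 < s" "2 * s \<le> r" "2 * s < d" "2 * s < d'" using r d d' by (auto simp: s_def min_def)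
  have sU: "cball z (2 * s) \<subseteq> U" using r(2) s(2) subset_cball[of "2 * s" r z] by blast
  obtain w where w: "w \<in> cball z (2 * s)"
    "f (z + of_real s * h + of_real s * k) - f (z + of_real s * h) - f (z + of_real s * k) + f z = s * (s * f'' w k h)"
    using second_difference[OF d1 d2 s(1) sU h k] by blast
  obtain w' where w': "w' \<in> cball z (2 * s)"
    "f (z + of_real s * k + of_real s * h) - f (z + of_real s * k) - f (z + of_real s * h) + f z = s * (s * f'' w' h k)"
    using second_difference[OF d1 d2 s(1) sU k h] by blast
  have "z + of_real s * k + of_real s * h = z + of_real s * h + of_real s * k" by simp
  with w(2) w'(2) have "s * (s * f'' w k h) = s * (s * f'' w' h k)" by (simp only:)
  then have eq: "f'' w k h = f'' w' h k" using s(1) by simp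
  have "dist (f'' w k h) (f'' z k h) < e" "dist (f'' w' h k) (f'' z h k) < e"
    using w(1) w'(1) s by (auto intro!: d(2) d'(2) simp: dist_commute)
  then show False unfolding eq e_def using dist_triangle3[of "f'' z h k" "f'' z k h" "f'' w' h k"] by simp
qed

lemma real_linear_functional_complex:
  assumes "linear (L :: complex \<Rightarrow> real)"
  shows "L h = Re h * L 1 + Im h * L \<i>"
proof -
  have "h = Re h *\<^sub>R 1 + Im h *\<^sub>R \<i>" by (simp add: complex_eq_iff)
  then have "L h = L (Re h *\<^sub>R 1 + Im h *\<^sub>R \<i>)" by simp
  also have "\<dots> = Re h * L 1 + Im h * L \<i>"
    by (simp add: linear_add[OF assms] linear_cmul[OF assms])
  finally show ?thesis .
qed

text \<open>The inner directional derivative is identified on the disk only; the outer one therefore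
  uses agreement near 0 along the line.\<close>

lemma C2_on_laplacian:
  fixes f :: "complex \<Rightarrow> real" and f' :: "complex \<Rightarrow> complex \<Rightarrow>\<^sub>L real" and f'' :: "complex \<Rightarrow> complex \<Rightarrow>\<^sub>L complex \<Rightarrow>\<^sub>L real"
  assumes d1: "\<And>z. z \<in> disk \<Longrightarrow> (f has_derivative blinfun_apply (f' z)) (at z)"
    and d2: "\<And>z. z \<in> disk \<Longrightarrow> (f' has_derivative blinfun_apply (f'' z)) (at z)"
    and z: "z \<in> disk"
  shows "laplacian f z = f'' z 1 1 + f'' z \<i> \<i>"
proof -
  have 1: "dir_deriv v f w = f' w v" if "w \<in> disk" for w v
    unfolding dir_deriv_def
    by (rule DERIV_imp_deriv, rule has_real_derivative_along_line) (simp add: d1[OF that])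
  have 2: "dir_deriv v (dir_deriv v f) z = f'' z v v" for v
  proof -
    have l: "((\<lambda>t. f' (z + of_real t * v) v) has_real_derivative f'' z v v) (at 0)"
      by (rule has_real_derivative_along_line) (simp add: blinfun_partial_deriv[OF d2[OF z]])
    have "open ((\<lambda>t::real. z + of_real t * v) -` disk)"
      by (intro open_vimage continuous_intros) auto
    then have "eventually (\<lambda>t::real. t \<in> (\<lambda>t::real. z + of_real t * v) -` disk) (nhds 0)"
      by (rule eventually_nhds_in_open) (use z in simp)
    then have "eventually (\<lambda>t::real. dir_deriv v f (z + of_real t * v) = f' (z + of_real t * v) v) (nhds 0)"
      by (rule eventually_mono) (rule 1, simp)
    then have "deriv (\<lambda>t::real. dir_deriv v f (z + of_real t * v)) 0 = deriv (\<lambda>t. f' (z + of_real t * v) v) 0"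
      by (intro deriv_cong_ev) auto
    then show ?thesis using DERIV_imp_deriv[OF l] unfolding dir_deriv_def[of v "dir_deriv v f"] by simp
  qed
  show ?thesis by (simp add: laplacian_def 2)
qed

text \<open>\<open>df\<close> is half of \<open>f_x - \<i> f_y\<close>, and its conjugate derivative
  is a quarter of the Laplacian. Symmetry of the second derivative is what makes that derivative
  real and hence the two mixed derivatives equal.\<close>

lemma C2_on_wirtinger:
  assumes "C2_on disk f"
  obtains df lap where "C2w disk (\<lambda>z. of_real (f z)) df (\<lambda>z. cnj (df z)) lap"
    "\<And>z. z \<in> disk \<Longrightarrow> Re (lap z) = laplacian f z / 4"
proof -
  from assms obtain f' :: "complex \<Rightarrow> complex \<Rightarrow>\<^sub>L real" and f'' :: "complex \<Rightarrow> complex \<Rightarrow>\<^sub>L complex \<Rightarrow>\<^sub>L real"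
    where d: "\<forall>z\<in>disk. (f has_derivative blinfun_apply (f' z)) (at z)"
      "\<forall>z\<in>disk. (f' has_derivative blinfun_apply (f'' z)) (at z)" and c: "continuous_on disk f''"
    unfolding C2_on_def by blast
  note d1 = bspec[OF d(1)] and d2 = bspec[OF d(2)]
  define df where "df z = (of_real (f' z 1) - \<i> * of_real (f' z \<i>)) / 2" for z
  define lap where "lap z = complex_of_real ((f'' z 1 1 + f'' z \<i> \<i>) / 4)" for z
  define r where "r z = ((of_real (f'' z 1 1) - \<i> * of_real (f'' z 1 \<i>)) - \<i> * (of_real (f'' z \<i> 1) - \<i> * of_real (f'' z \<i> \<i>))) / 4" for z
  have sym: "f'' z 1 \<i> = f'' z \<i> 1" if "z \<in> disk" for z
    by (rule second_derivative_symmetric[OF open_ball that d1 d2 c]) simp_all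
  have c'': "continuous_on disk (\<lambda>z. f'' z a b)" for a b by (intro continuous_intros c)
  have c': "continuous_on disk (\<lambda>z. f' z a)" for a
  proof -
    have "continuous_on disk f'"
      by (rule has_derivative_continuous_on) (use d2 in \<open>blast intro: has_derivative_at_withinI\<close>)
    then show ?thesis by (intro continuous_intros)
  qed
  have lin1: "f' z h = Re h * f' z 1 + Im h * f' z \<i>" for z h
    by (rule real_linear_functional_complex[OF bounded_linear.linear[OF blinfun.bounded_linear_right]])
  have lin2: "f'' z h a = Re h * f'' z 1 a + Im h * f'' z \<i> a" for z h a
  proof -
    have "linear (\<lambda>h. blinfun_apply (blinfun_apply (f'' z) h) a)"
      by (rule bounded_linear.linear[OF bounded_linear_compose[OF blinfun.bounded_linear_left blinfun.bounded_linear_right]])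
    from real_linear_functional_complex[OF this] show ?thesis .
  qed
  have cdf: "continuous_on disk df" unfolding df_def by (intro continuous_intros c') simp
  have F: "C1w disk (\<lambda>z. of_real (f z)) df (\<lambda>z. cnj (df z))"
  proof (rule C1wI)
    fix z assume z: "z \<in> disk"
    have "((\<lambda>w. complex_of_real (f w)) has_derivative (\<lambda>h. of_real (f' z h))) (at z)"
      by (rule bounded_linear.has_derivative[OF bounded_linear_of_real d1[OF z]])
    moreover have "complex_of_real (f' z h) = df z * h + cnj (df z) * cnj h" for h
      unfolding lin1[of z h] df_def by (simp add: complex_eq_iff field_simps)
    ultimately show "has_wirt (\<lambda>z. of_real (f z)) (df z) (cnj (df z)) z"
      unfolding has_wirt_def by simp
  qed (intro cdf continuous_on_cnj)+
  have D: "C1w disk df r lap"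
  proof (rule C1wI)
    fix z assume z: "z \<in> disk"
    have da: "((\<lambda>w. complex_of_real (f' w a)) has_derivative (\<lambda>h. of_real (f'' z h a))) (at z)" for a
      by (rule bounded_linear.has_derivative[OF bounded_linear_of_real blinfun_partial_deriv[OF d2[OF z]]])
    have "(df has_derivative (\<lambda>h. (of_real (f'' z h 1) - \<i> * of_real (f'' z h \<i>)) / 2)) (at z)"
      unfolding df_def[abs_def]
      by (rule bounded_linear.has_derivative[OF bounded_linear_divide has_derivative_diff[OF da has_derivative_mult_right[OF da]]])
    moreover have "(of_real (f'' z h 1) - \<i> * of_real (f'' z h \<i>)) / 2 = r z * h + lap z * cnj h" for h
      unfolding lin2[of z h] r_def lap_def using sym[OF z] by (simp add: complex_eq_iff field_simps)
    ultimately show "has_wirt df (r z) (lap z) z"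
      unfolding has_wirt_def by simp
  next
    show "continuous_on disk r" unfolding r_def by (intro continuous_intros c'') simp
    show "continuous_on disk lap" unfolding lap_def by (intro continuous_intros c'') simp
  qed
  have "C1w disk (\<lambda>z. cnj (df z)) lap (\<lambda>z. cnj (r z))"
    using C1w_cnj[OF D] by (simp add: lap_def[abs_def])
  with F D have "C2w disk (\<lambda>z. of_real (f z)) df (\<lambda>z. cnj (df z)) lap" unfolding C2w_def by blast
  moreover have "Re (lap z) = laplacian f z / 4" if "z \<in> disk" for z
    using C2_on_laplacian[OF d1 d2 that] by (simp add: lap_def)
  ultimately show thesis by (rule that)
qed

text \<open>Beyond the threshold of class \<E> the slope is at most \<open>c / 32\<close>; below it
  the Lipschitz bound is absorbed into the multiple \<open>1 + d * b\<close> of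
  \<open>\<tau> w\<close>. Thus the growth condition of the locale has no threshold.\<close>

theorem class_E_imp_slow_weight:
  assumes "class_E \<omega>"
  obtains \<phi> \<tau> df lap c c1 c2 B \<beta> where "slow_weight \<phi> \<tau> df lap c c1 c2 B \<beta>"
    "\<And>z. z \<in> disk \<Longrightarrow> \<omega> z = exp (- 2 * \<phi> z)"
proof -
  from assms obtain \<tau> where a: "associated_function \<omega> \<tau>" and
    gr: "\<forall>m::nat. 1 \<le> m \<longrightarrow> (\<exists>b t. 0 < b \<and> 0 < t \<and> t < 1 / real m \<and>
          (\<forall>z\<in>disk. \<forall>\<xi>\<in>disk. b * \<tau> \<xi> < norm (z - \<xi>) \<longrightarrow> \<tau> z \<le> \<tau> \<xi> + t * norm (z - \<xi>)))"
    unfolding class_E_def by blast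
  from a obtain \<phi> where L: "class_L \<tau>" and C2: "C2_on disk \<phi>" and \<omega>: "\<forall>z\<in>disk. \<omega> z = exp (- 2 * \<phi> z)"
    and lp: "\<forall>z\<in>disk. 0 < laplacian \<phi> z" and cmp: "comparable_on disk (\<lambda>z. laplacian \<phi> z powr (- 1 / 2)) \<tau>"
    unfolding associated_function_def by blast
  from L obtain c1 c2 where tp: "\<forall>z\<in>disk. 0 < \<tau> z" and c1: "\<forall>z\<in>disk. \<tau> z \<le> c1 * (1 - norm z)"
    and c2: "\<forall>z\<in>disk. \<forall>\<zeta>\<in>disk. \<bar>\<tau> z - \<tau> \<zeta>\<bar> \<le> c2 * norm (z - \<zeta>)" unfolding class_L_def by blast
  from cmp obtain C where C: "0 < C" "\<forall>z\<in>disk. inverse C * \<tau> z \<le> laplacian \<phi> z powr (- 1 / 2) \<and> laplacian \<phi> z powr (- 1 / 2) \<le> C * \<tau> z"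
    unfolding comparable_on_def by blast
  obtain df lap where W: "C2w disk (\<lambda>z. of_real (\<phi> z)) df (\<lambda>z. cnj (df z)) lap"
    "\<And>z. z \<in> disk \<Longrightarrow> Re (lap z) = laplacian \<phi> z / 4"
    by (rule C2_on_wirtinger[OF C2]) (assumption | rule that)+
  \<comment> \<open>Comparability gives
    \<open>laplacian \<phi> z >= 1 / (C^2 * (\<tau> z)^2)\<close>, and \<open>2 * Re (lap z)\<close>
    is half the Laplacian; \<open>c^2 = 1 / (4 * C^2)\<close> leaves a factor 2 of room.\<close>
  define c where "c = 1 / (2 * C)"
  have c: "0 < c" using C(1) by (simp add: c_def)
  \<comment> \<open>Slopes below \<open>1 / m\<close> are then below \<open>c / 32\<close>.\<close>
  obtain m :: nat where m: "32 / c < real m" using reals_Archimedean2 by blast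
  have m1: "1 \<le> m"
  proof -
    have "0 < real m" using m c by (meson divide_pos_pos less_trans zero_less_numeral)
    then show ?thesis by simp
  qed
  from gr m1 obtain b t where bt: "0 < b" "0 < t" "t < 1 / real m"
    "\<forall>z\<in>disk. \<forall>\<xi>\<in>disk. b * \<tau> \<xi> < norm (z - \<xi>) \<longrightarrow> \<tau> z \<le> \<tau> \<xi> + t * norm (z - \<xi>)" by blast
  have tc: "t \<le> c / 32"
  proof -
    have "1 / real m < c / 32" using m c m1 by (simp add: field_simps)
    then show ?thesis using bt(3) by simp
  qed
  \<comment> \<open>The constants of class \<L> carry no sign in the hypotheses; the maximum with 1
    makes them positive.\<close>
  define d where "d = max c2 1"
  have d: "0 < d" "c2 \<le> d" by (auto simp: d_def)
  have lapbd: "1 / (C\<^sup>2 * (\<tau> z)\<^sup>2) \<le> laplacian \<phi> z \<and> laplacian \<phi> z \<le> C\<^sup>2 / (\<tau> z)\<^sup>2" if z: "z \<in> disk" for z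
  proof -
    let ?l = "laplacian \<phi> z"
    let ?x = "?l powr (- 1 / 2)"
    have l: "0 < ?l" and t: "0 < \<tau> z" using lp tp z by auto
    have x2: "?x\<^sup>2 = 1 / ?l"
    proof -
      have "?x\<^sup>2 = ?l powr (- 1 / 2 + - 1 / 2)" unfolding power2_eq_square by (rule powr_add[symmetric])
      also have "- 1 / 2 + - 1 / 2 = (- 1 :: real)" by simp
      finally show ?thesis using l by (simp add: powr_minus_divide)
    qed
    have "inverse C * \<tau> z \<le> ?x" "?x \<le> C * \<tau> z" using C(2) z by auto
    then have "(inverse C * \<tau> z)\<^sup>2 \<le> ?x\<^sup>2" "?x\<^sup>2 \<le> (C * \<tau> z)\<^sup>2"
      using C(1) t by (auto intro!: power_mono)
    then have "(inverse C * \<tau> z)\<^sup>2 \<le> 1 / ?l" "1 / ?l \<le> C\<^sup>2 * (\<tau> z)\<^sup>2" unfolding x2 by (simp_all add: power_mult_distrib)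
    then show ?thesis using l t C(1) by (simp add: field_simps)
  qed
  have "slow_weight \<phi> \<tau> df lap c (max c1 1) d (C\<^sup>2) (1 + d * b)"
  proof (rule slow_weight.intro)
    show "C2w disk (\<lambda>z. of_real (\<phi> z)) df (\<lambda>z. cnj (df z)) lap" by (rule W(1))
    show "0 < c" "0 < max c1 1" "0 < d" "0 < C\<^sup>2" "0 < 1 + d * b"
      using c d bt C(1) by (auto simp: add_pos_pos)
    fix z w :: complex
    assume z: "z \<in> disk"
    show t: "0 < \<tau> z" using tp z by blast
    have "c1 * (1 - norm z) \<le> max c1 1 * (1 - norm z)" using z by (intro mult_right_mono) auto
    then show "\<tau> z \<le> max c1 1 * (1 - norm z)" using c1 z by (meson order_trans)
    show "c\<^sup>2 / (\<tau> z)\<^sup>2 \<le> 2 * Re (lap z)"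
    proof -
      have "c\<^sup>2 / (\<tau> z)\<^sup>2 = 1 / (C\<^sup>2 * (\<tau> z)\<^sup>2) / 4" by (simp add: c_def power_divide power_mult_distrib)
      also have "\<dots> \<le> laplacian \<phi> z / 4" using lapbd[OF z] by (intro divide_right_mono) auto
      also have "\<dots> \<le> 2 * Re (lap z)" using W(2)[OF z] bspec[OF lp z] by simp
      finally show ?thesis .
    qed
    show "Re (lap z) \<le> C\<^sup>2 / (\<tau> z)\<^sup>2"
    proof -
      have "0 < laplacian \<phi> z" using lp z by blast
      then show ?thesis using W(2)[OF z] lapbd[OF z] by linarith
    qed
    assume w: "w \<in> disk"
    have lip: "\<bar>\<tau> z - \<tau> w\<bar> \<le> d * norm (z - w)"
      using c2 z w mult_right_mono[OF d(2), of "norm (z - w)"] by (meson norm_ge_zero order_trans)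
    then show "\<bar>\<tau> z - \<tau> w\<bar> \<le> d * norm (z - w)" .
    have tw: "0 < \<tau> w" using tp w by blast
    show "\<tau> z \<le> (1 + d * b) * \<tau> w + c / 32 * norm (z - w)"
    proof (cases "b * \<tau> w < norm (z - w)")
      case True
      then have "\<tau> z \<le> \<tau> w + t * norm (z - w)" using bt(4) z w by blast
      also have "\<dots> \<le> (1 + d * b) * \<tau> w + c / 32 * norm (z - w)"
      proof (rule add_mono)
        show "t * norm (z - w) \<le> c / 32 * norm (z - w)" by (rule mult_right_mono[OF tc]) simp
        have "0 \<le> d * b * \<tau> w" using d bt tw by simp
        then show "\<tau> w \<le> (1 + d * b) * \<tau> w" by (simp add: distrib_right)
      qed
      finally show ?thesis .
    next
      case False
      then have "d * norm (z - w) \<le> d * (b * \<tau> w)" using d by (intro mult_left_mono) auto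
      moreover have "0 \<le> c / 32 * norm (z - w)" using c by simp
      ultimately show ?thesis using lip by (simp add: distrib_right)
    qed
  qed
  then show thesis by (rule that) (use \<omega> in blast)
qed

section \<open>The duality theorem\<close>

lemma space_disk_area [simp]: "space disk_area = disk"
  by (simp add: disk_area_def space_scale_measure space_restrict_space)

text \<open>\<open>disk_area\<close> rescales the completed Lebesgue measure; for a Borel function
  \<open>g\<close> the completion changes nothing. \<open>h\<close> only has to agree with
  \<open>g\<close> on the disk, as weights are unconstrained elsewhere.\<close>

lemma disk_area_conversion:
  fixes g h :: "complex \<Rightarrow> 'b::{banach, second_countable_topology}"
  assumes g: "g \<in> borel_measurable diskm" and eq: "\<And>z. z \<in> disk \<Longrightarrow> h z = g z"
  shows "integrable disk_area h \<longleftrightarrow> integrable diskm g" "integral\<^sup>L disk_area h = (1 / pi) *\<^sub>R integral\<^sup>L diskm g"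
proof -
  let ?i = "\<lambda>z. indicator disk z *\<^sub>R g z"
  have im: "?i \<in> borel_measurable lborel"
    using g by (subst (asm) borel_measurable_restrict_space_iff) auto
  have gl: "g \<in> borel_measurable (lebesgue_on disk)"
    by (subst borel_measurable_restrict_space_iff) (auto intro: measurable_completion[OF im])
  have d: "disk_area = density (lebesgue_on disk) (\<lambda>_. ennreal (1 / pi))"
    unfolding disk_area_def by (rule measure_eqI) (auto simp: emeasure_density_const)
  have L: "integrable (lebesgue_on disk) g \<longleftrightarrow> integrable diskm g"
    by (subst (1 2) integrable_restrict_space) (auto simp: integrable_completion[OF im])
  have R: "integral\<^sup>L (lebesgue_on disk) g = integral\<^sup>L diskm g"
    by (subst (1 2) integral_restrict_space) (auto simp: integral_completion[OF im])
  have "integrable disk_area h \<longleftrightarrow> integrable disk_area g"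
    by (rule Bochner_Integration.integrable_cong) (simp_all add: eq)
  also have "\<dots> \<longleftrightarrow> integrable (lebesgue_on disk) (\<lambda>z. (1 / pi) *\<^sub>R g z)"
    unfolding d by (rule integrable_density[OF gl]) auto
  also have "\<dots> \<longleftrightarrow> integrable (lebesgue_on disk) g"
  proof
    assume "integrable (lebesgue_on disk) (\<lambda>z. (1 / pi) *\<^sub>R g z)"
    then have "integrable (lebesgue_on disk) (\<lambda>z. pi *\<^sub>R ((1 / pi) *\<^sub>R g z))"
      by (rule integrable_scaleR_right)
    then show "integrable (lebesgue_on disk) g" by simp
  qed (rule integrable_scaleR_right)
  also note L
  finally show "integrable disk_area h \<longleftrightarrow> integrable diskm g" .
  have "integral\<^sup>L disk_area h = integral\<^sup>L disk_area g"
    by (rule Bochner_Integration.integral_cong) (simp_all add: eq)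
  also have "\<dots> = integral\<^sup>L (lebesgue_on disk) (\<lambda>z. (1 / pi) *\<^sub>R g z)"
    unfolding d by (rule integral_density[OF gl]) auto
  also have "\<dots> = (1 / pi) *\<^sub>R integral\<^sup>L diskm g" unfolding R[symmetric] by simp
  finally show "integral\<^sup>L disk_area h = (1 / pi) *\<^sub>R integral\<^sup>L diskm g" .
qed

text \<open>\<open>v_def\<close> has the form of a meta-level equation, so that the
  \<open>defines\<close> clause of the theorem discharges it as it stands.\<close>

locale weighted_pairing = slow_weight +
  fixes \<omega> :: "complex \<Rightarrow> real" and v :: "complex \<Rightarrow> real"
  assumes omega: "\<And>z. z \<in> disk \<Longrightarrow> \<omega> z = exp (- 2 * \<phi> z)"
    and v_def: "v \<equiv> \<lambda>z. sqrt (\<omega> z)"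
begin

lemma v_eq: "z \<in> disk \<Longrightarrow> v z = exp (- \<phi> z)"
proof -
  assume "z \<in> disk"
  then have "\<omega> z = (exp (- \<phi> z))\<^sup>2" by (simp add: omega power2_eq_square flip: exp_add)
  then show ?thesis by (simp add: v_def)
qed

lemma norm_v: "z \<in> disk \<Longrightarrow> norm (f z) * v z = norm (gex f z)"
  by (simp add: v_eq gex_def norm_mult)

lemma analytic_holomorphic: "f \<in> analytic_disk \<Longrightarrow> f holomorphic_on disk"
  by (simp add: analytic_disk_def)

lemma norm_gex_measurable: "f \<in> analytic_disk \<Longrightarrow> (\<lambda>z. norm (gex f z)) \<in> borel_measurable diskm"
  using gex_measurable[OF analytic_holomorphic] by measurable

lemma A1_eq: "A1 v = A1set"
proof -
  have "integrable disk_area (\<lambda>z. norm (f z) * v z) \<longleftrightarrow> integrable diskm (\<lambda>z. norm (gex f z))"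
    if "f \<in> analytic_disk" for f
    by (rule disk_area_conversion(1)[OF norm_gex_measurable[OF that] norm_v])
  then show ?thesis unfolding A1_def A1set_def by blast
qed

lemma A1_norm_eq: "f \<in> analytic_disk \<Longrightarrow> A1_norm v f = (\<integral>z. norm (gex f z) \<partial>diskm) / pi"
  unfolding A1_norm_def by (subst disk_area_conversion(2)[OF norm_gex_measurable norm_v]) simp_all

lemma A1_norm_nonneg: "f \<in> analytic_disk \<Longrightarrow> 0 \<le> A1_norm v f"
  by (simp add: A1_norm_eq)

lemma pairing_integrand:
  assumes "f \<in> analytic_disk" "g \<in> analytic_disk"
  shows "(\<lambda>z. gex f z * cnj (gex g z)) \<in> borel_measurable diskm"
    "z \<in> disk \<Longrightarrow> f z * cnj (g z) * of_real (\<omega> z) = gex f z * cnj (gex g z)"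
proof -
  show "(\<lambda>z. gex f z * cnj (gex g z)) \<in> borel_measurable diskm"
    using gex_measurable[OF analytic_holomorphic[OF assms(1)]] gex_measurable[OF analytic_holomorphic[OF assms(2)]]
    by measurable
  assume "z \<in> disk"
  then have "\<omega> z = exp (- \<phi> z) * exp (- \<phi> z)" by (simp add: omega flip: exp_add)
  then show "f z * cnj (g z) * of_real (\<omega> z) = gex f z * cnj (gex g z)"
    by (simp add: gex_def)
qed

lemma pairing_eq: "f \<in> analytic_disk \<Longrightarrow> g \<in> analytic_disk \<Longrightarrow> pairing \<omega> f g = ip diskm (gex f) (gex g) / of_real pi"
  unfolding pairing_def ip_def
  by (subst disk_area_conversion(2)[OF pairing_integrand]) (simp_all add: scaleR_conv_of_real)

lemma Ainf_iff: "g \<in> Ainf v \<longleftrightarrow> g \<in> analytic_disk \<and> (\<exists>M. \<forall>z\<in>disk. norm (gex g z) \<le> M)"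
  unfolding Ainf_def bdd_above_def by (auto simp: norm_v)

lemma Ainf_norm_upper: "g \<in> Ainf v \<Longrightarrow> z \<in> disk \<Longrightarrow> norm (gex g z) \<le> Ainf_norm v g"
  unfolding Ainf_norm_def norm_v[symmetric] by (rule cSUP_upper) (auto simp: Ainf_def)

lemma Ainf_norm_least: "(\<And>z. z \<in> disk \<Longrightarrow> norm (gex g z) \<le> M) \<Longrightarrow> Ainf_norm v g \<le> M"
  unfolding Ainf_norm_def by (rule cSUP_least) (auto simp: norm_v)

lemma Ainf_norm_nonneg: "g \<in> Ainf v \<Longrightarrow> 0 \<le> Ainf_norm v g"
  by (rule order_trans[OF norm_ge_zero[of "gex g 0"] Ainf_norm_upper]) simp_all

lemma A1_analytic: "f \<in> A1 v \<Longrightarrow> f \<in> analytic_disk"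
  by (simp add: A1_def)

lemma Ainf_analytic: "g \<in> Ainf v \<Longrightarrow> g \<in> analytic_disk"
  by (simp add: Ainf_def)

lemma gex_integrable:
  assumes "f \<in> A1 v"
  shows "integrable diskm (gex f)"
proof -
  have "integrable diskm (\<lambda>z. norm (gex f z))"
    using assms unfolding A1_eq A1set_def by blast
  then show ?thesis
    by (rule iffD1[OF integrable_norm_iff[OF gex_measurable[OF analytic_holomorphic[OF A1_analytic[OF assms]]]]])
qed

lemma pairing_integrable:
  assumes "f \<in> A1 v" "g \<in> Ainf v"
  shows "integrable disk_area (\<lambda>z. f z * cnj (g z) * of_real (\<omega> z))" "integrable diskm (\<lambda>z. gex f z * cnj (gex g z))"
proof -
  note fg = A1_analytic[OF assms(1)] Ainf_analytic[OF assms(2)]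
  show "integrable diskm (\<lambda>z. gex f z * cnj (gex g z))"
    by (rule bounded_pairing(1)[OF gex_integrable[OF assms(1)] analytic_holomorphic[OF fg(2)] Ainf_norm_upper[OF assms(2)]])
  then show "integrable disk_area (\<lambda>z. f z * cnj (g z) * of_real (\<omega> z))"
    using disk_area_conversion(1)[OF pairing_integrand[OF fg]] by blast
qed

lemma pairing_bound:
  assumes "f \<in> A1 v" "g \<in> Ainf v"
  shows "norm (pairing \<omega> f g) \<le> Ainf_norm v g * A1_norm v f"
proof -
  note fg = A1_analytic[OF assms(1)] Ainf_analytic[OF assms(2)]
  have "norm (ip diskm (gex f) (gex g)) \<le> Ainf_norm v g * (\<integral>z. norm (gex f z) \<partial>diskm)"
    by (rule bounded_pairing(2)[OF gex_integrable[OF assms(1)] analytic_holomorphic[OF fg(2)] Ainf_norm_upper[OF assms(2)]])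
  then have "norm (ip diskm (gex f) (gex g)) / pi \<le> Ainf_norm v g * (\<integral>z. norm (gex f z) \<partial>diskm) / pi"
    by (rule divide_right_mono) simp
  then show ?thesis by (simp add: pairing_eq[OF fg] A1_norm_eq[OF fg(1)] norm_divide)
qed

lemma pairing_add: "f \<in> A1 v \<Longrightarrow> h \<in> A1 v \<Longrightarrow> g \<in> Ainf v \<Longrightarrow> pairing \<omega> (\<lambda>z. f z + h z) g = pairing \<omega> f g + pairing \<omega> h g"
  using Bochner_Integration.integral_add[OF pairing_integrable(1) pairing_integrable(1), of f g h g]
  by (simp add: pairing_def distrib_right)

lemma pairing_scale: "pairing \<omega> (\<lambda>z. a * f z) g = a * pairing \<omega> f g"
  by (simp add: pairing_def mult.assoc)

lemma pairing_bounded: "g \<in> Ainf v \<Longrightarrow> bounded_functional_on (A1 v) (A1_norm v) (\<lambda>f. pairing \<omega> f g)"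
  unfolding bounded_functional_on_def using pairing_add pairing_scale pairing_bound by blast

lemma pairing_injective:
  assumes g: "g \<in> Ainf v" "g' \<in> Ainf v" and eq: "\<And>f. f \<in> A1 v \<Longrightarrow> pairing \<omega> f g = pairing \<omega> f g'"
  shows "g = g'"
proof
  fix z
  note an = Ainf_analytic[OF g(1)] Ainf_analytic[OF g(2)]
  let ?d = "\<lambda>z. g z - g' z"
  have gd: "gex ?d z = gex g z - gex g' z" for z by (simp add: gex_def left_diff_distrib)
  have "?d z = 0"
  proof (rule pairing_nondegenerate[of ?d "Ainf_norm v g + Ainf_norm v g'"])
    show "?d \<in> analytic_disk"
      using an by (auto simp: analytic_disk_def intro: holomorphic_on_diff)
    show "norm (gex ?d z) \<le> Ainf_norm v g + Ainf_norm v g'" if "z \<in> disk" for z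
      unfolding gd using norm_triangle_ineq4[of "gex g z" "gex g' z"] Ainf_norm_upper[OF g(1) that] Ainf_norm_upper[OF g(2) that]
      by linarith
    fix f assume f: "f \<in> A1set"
    then have f': "f \<in> A1 v" by (simp add: A1_eq)
    have "ip diskm (gex f) (gex ?d) = ip diskm (gex f) (gex g) - ip diskm (gex f) (gex g')"
      unfolding ip_def gd complex_cnj_diff right_diff_distrib
      by (rule Bochner_Integration.integral_diff[OF pairing_integrable(2)[OF f' g(1)] pairing_integrable(2)[OF f' g(2)]])
    also have "\<dots> = 0"
      using eq[OF f'] by (simp add: pairing_eq[OF A1_analytic[OF f']] an)
    finally show "ip diskm (gex f) (gex ?d) = 0" .
  qed
  then show "g z = g' z" by simp
qed

text \<open>Both the pairing and the A1 norm carry a factor 1/pi against their Borel counterparts,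
  so \<open>duality\<close> is applied to \<open>pi * \<Lambda>\<close> with the same constant
  \<open>C\<close>.\<close>

lemma representation:
  assumes add: "\<And>f g. f \<in> A1 v \<Longrightarrow> g \<in> A1 v \<Longrightarrow> \<Lambda> (\<lambda>z. f z + g z) = \<Lambda> f + \<Lambda> g"
    and scale: "\<And>a f. f \<in> A1 v \<Longrightarrow> \<Lambda> (\<lambda>z. a * f z) = a * \<Lambda> f"
    and bound: "\<And>f. f \<in> A1 v \<Longrightarrow> norm (\<Lambda> f) \<le> C * A1_norm v f" and C: "0 \<le> C"
  shows "\<exists>g \<in> Ainf v. Ainf_norm v g \<le> C * Kinf \<and> (\<forall>f\<in>A1 v. \<Lambda> f = pairing \<omega> f g)"
proof -
  obtain g where g: "g \<in> analytic_disk" "\<And>z. z \<in> disk \<Longrightarrow> norm (gex g z) \<le> C * Kinf"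
    "\<And>f. f \<in> A1set \<Longrightarrow> of_real pi * \<Lambda> f = ip diskm (gex f) (gex g)"
  proof (rule duality[of "\<lambda>f. of_real pi * \<Lambda> f" C])
    show "of_real pi * \<Lambda> (\<lambda>z. f z + h z) = of_real pi * \<Lambda> f + of_real pi * \<Lambda> h" if "f \<in> A1set" "h \<in> A1set" for f h
      using add that by (simp add: A1_eq distrib_left)
    show "of_real pi * \<Lambda> (\<lambda>z. a * f z) = a * (of_real pi * \<Lambda> f)" if "f \<in> A1set" for a f
      using scale that by (simp add: A1_eq)
    show "norm (of_real pi * \<Lambda> f) \<le> C * (\<integral>z. norm (gex f z) \<partial>diskm)" if "f \<in> A1set" for f
    proof -
      have f: "f \<in> A1 v" using that by (simp add: A1_eq)
      have "norm (of_real pi * \<Lambda> f) = pi * norm (\<Lambda> f)" by (simp add: norm_mult)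
      also have "\<dots> \<le> pi * (C * A1_norm v f)" by (rule mult_left_mono[OF bound[OF f]]) simp
      also have "\<dots> = C * (\<integral>z. norm (gex f z) \<partial>diskm)" by (simp add: A1_norm_eq[OF A1_analytic[OF f]])
      finally show ?thesis .
    qed
    show "0 \<le> C" by (rule C)
  qed (assumption | rule that)+
  have gA: "g \<in> Ainf v" unfolding Ainf_iff using g(1,2) by blast
  show ?thesis
  proof (intro bexI[OF _ gA] conjI ballI)
    show "Ainf_norm v g \<le> C * Kinf" by (rule Ainf_norm_least[OF g(2)])
    fix f assume f: "f \<in> A1 v"
    have "of_real pi * \<Lambda> f = ip diskm (gex f) (gex g)" using g(3) f by (simp add: A1_eq)
    then have "\<Lambda> f = ip diskm (gex f) (gex g) / of_real pi" by (simp add: field_simps)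
    then show "\<Lambda> f = pairing \<omega> f g" by (simp add: pairing_eq[OF A1_analytic[OF f] g(1)])
  qed
qed

lemma representation_unique:
  assumes "bounded_functional_on (A1 v) (A1_norm v) \<Lambda>"
  shows "\<exists>!g. g \<in> Ainf v \<and> (\<forall>f\<in>A1 v. \<Lambda> f = pairing \<omega> f g)"
proof -
  from assms obtain C where L: "\<And>f g. f \<in> A1 v \<Longrightarrow> g \<in> A1 v \<Longrightarrow> \<Lambda> (\<lambda>z. f z + g z) = \<Lambda> f + \<Lambda> g"
    "\<And>a f. f \<in> A1 v \<Longrightarrow> \<Lambda> (\<lambda>z. a * f z) = a * \<Lambda> f"
    "\<And>f. f \<in> A1 v \<Longrightarrow> norm (\<Lambda> f) \<le> C * A1_norm v f"
    unfolding bounded_functional_on_def by blast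
  \<comment> \<open>The bound in \<open>bounded_functional_on\<close> comes without a sign.\<close>
  have "norm (\<Lambda> f) \<le> max C 0 * A1_norm v f" if "f \<in> A1 v" for f
    using L(3)[OF that] mult_right_mono[OF max.cobounded1[of C 0] A1_norm_nonneg[OF A1_analytic[OF that]]]
    by linarith
  from representation[OF L(1,2) this max.cobounded2] obtain g
    where g: "g \<in> Ainf v" "\<forall>f\<in>A1 v. \<Lambda> f = pairing \<omega> f g"
    by blast
  show ?thesis
  proof (rule ex1I[of _ g])
    show "g \<in> Ainf v \<and> (\<forall>f\<in>A1 v. \<Lambda> f = pairing \<omega> f g)" using g by blast
    fix g' assume g': "g' \<in> Ainf v \<and> (\<forall>f\<in>A1 v. \<Lambda> f = pairing \<omega> f g')"
    show "g' = g"
    proof (rule pairing_injective[OF _ g(1)])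
      show "g' \<in> Ainf v" using g' by blast
      show "pairing \<omega> f g' = pairing \<omega> f g" if "f \<in> A1 v" for f
        using bspec[OF g(2) that] bspec[OF conjunct2[OF g'] that] by (rule trans[OF sym, rotated])
    qed
  qed
qed

text \<open>For the second inequality the functional of \<open>g\<close> is represented anew, with
  its own norm as the constant; the representative obeys the desired bound and by injectivity it is
  \<open>g\<close>.\<close>

lemma norm_equivalence:
  assumes g: "g \<in> Ainf v"
  shows "functional_norm (A1 v) (A1_norm v) (\<lambda>f. pairing \<omega> f g) \<le> Ainf_norm v g"
    "Ainf_norm v g \<le> functional_norm (A1 v) (A1_norm v) (\<lambda>f. pairing \<omega> f g) * Kinf"
proof -
  let ?F = "functional_norm (A1 v) (A1_norm v) (\<lambda>f. pairing \<omega> f g)"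
  let ?S = "{f \<in> A1 v. A1_norm v f \<le> 1}"
  have z: "(\<lambda>z. 0) \<in> ?S" by (simp add: A1_def analytic_disk_def A1_norm_def)
  have le: "norm (pairing \<omega> f g) \<le> Ainf_norm v g" if f: "f \<in> ?S" for f
  proof -
    have "norm (pairing \<omega> f g) \<le> Ainf_norm v g * A1_norm v f" using f by (intro pairing_bound g) simp
    also have "\<dots> \<le> Ainf_norm v g * 1" using f by (intro mult_left_mono Ainf_norm_nonneg g) simp
    finally show ?thesis by simp
  qed
  show "?F \<le> Ainf_norm v g"
    unfolding functional_norm_def by (rule cSUP_least[OF _ le]) (use z in blast)
  have upper: "norm (pairing \<omega> f g) \<le> ?F" if "f \<in> ?S" for f
    unfolding functional_norm_def by (rule cSUP_upper[OF that]) (use le in \<open>auto intro!: bdd_aboveI2\<close>)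
  have F0: "0 \<le> ?F" using upper[OF z] norm_ge_zero order_trans by blast
  have bd: "norm (pairing \<omega> f g) \<le> ?F * A1_norm v f" if f: "f \<in> A1 v" for f
  \<comment> \<open>Scaling into the unit ball requires a nonzero norm; for norm zero
    \<open>pairing_bound\<close> makes the pairing vanish.\<close>
  proof (cases "A1_norm v f = 0")
    case True
    then show ?thesis using pairing_bound[OF f g] by simp
  next
    case False
    let ?N = "A1_norm v f"
    have N: "0 < ?N" using False A1_norm_nonneg[OF A1_analytic[OF f]] by simp
    let ?u = "\<lambda>z. of_real (1 / ?N) * f z"
    have nu: "(\<lambda>z. norm (?u z) * v z) = (\<lambda>z. (1 / ?N) * (norm (f z) * v z))"
      unfolding norm_mult norm_of_real using N by (simp add: fun_eq_iff)
    have "?u holomorphic_on disk"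
      by (intro holomorphic_on_mult holomorphic_on_const analytic_holomorphic A1_analytic f)
    then have "?u \<in> analytic_disk"
      using A1_analytic[OF f] by (simp add: analytic_disk_def)
    moreover have "integrable disk_area (\<lambda>z. norm (?u z) * v z)"
      unfolding nu using f by (intro integrable_mult_right) (simp add: A1_def)
    moreover have "A1_norm v ?u = (1 / ?N) * ?N"
      unfolding A1_norm_def[of v ?u] nu integral_mult_right_zero unfolding A1_norm_def[of v f, symmetric] ..
    then have "A1_norm v ?u = 1" using False by simp
    ultimately have "?u \<in> ?S" by (simp add: A1_def)
    from upper[OF this] have "norm (of_real (1 / ?N) * pairing \<omega> f g) \<le> ?F" unfolding pairing_scale .
    then have "1 / ?N * norm (pairing \<omega> f g) \<le> ?F" using N unfolding norm_mult norm_of_real by simp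
    then show ?thesis using N by (simp add: field_simps)
  qed
  from representation[OF pairing_add[OF _ _ g] pairing_scale bd F0]
  obtain g' where g': "g' \<in> Ainf v" "Ainf_norm v g' \<le> ?F * Kinf" "\<forall>f\<in>A1 v. pairing \<omega> f g = pairing \<omega> f g'" by blast
  have "g = g'" by (rule pairing_injective[OF g g'(1)]) (use g'(3) in blast)
  then show "Ainf_norm v g \<le> ?F * Kinf" using g'(2) by simp
qed

lemma norms_comparable:
  "comparable_on (Ainf v) (\<lambda>g. functional_norm (A1 v) (A1_norm v) (\<lambda>f. pairing \<omega> f g)) (Ainf_norm v)"
  unfolding comparable_on_def
proof (intro exI[of _ "max 1 Kinf"] conjI ballI)
  let ?C = "max 1 Kinf"
  show C: "0 < ?C" by simp
  fix g assume g: "g \<in> Ainf v"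
  let ?F = "functional_norm (A1 v) (A1_norm v) (\<lambda>f. pairing \<omega> f g)"
  note e = norm_equivalence[OF g]
  note n = Ainf_norm_nonneg[OF g]
  have K: "0 < Kinf" using K1_pos del_pos sc_pos by (simp add: Kinf_def)
  have "0 \<le> ?F * Kinf" using e(2) n by linarith
  then have F: "0 \<le> ?F" using K by (simp add: zero_le_mult_iff)
  have "Ainf_norm v g \<le> ?F * ?C" using e(2) mult_left_mono[OF max.cobounded2[of Kinf 1] F] by linarith
  then show "inverse ?C * Ainf_norm v g \<le> ?F" using C by (simp add: field_simps del: max_less_iff_conj)
  show "?F \<le> ?C * Ainf_norm v g" using e(1) mult_right_mono[OF max.cobounded1[of 1 Kinf] n] by simp
qed

end

theorem theorem6p3:
  fixes \<omega> v :: "complex \<Rightarrow> real"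
  assumes "class_E \<omega>"
  defines "v \<equiv> \<lambda>z. sqrt (\<omega> z)"
  shows "(\<forall>g\<in>Ainf v.
            (\<forall>f\<in>A1 v. integrable disk_area (\<lambda>z. f z * cnj (g z) * of_real (\<omega> z))) \<and>
            bounded_functional_on (A1 v) (A1_norm v) (\<lambda>f. pairing \<omega> f g)) \<and>
         (\<forall>\<Lambda>. bounded_functional_on (A1 v) (A1_norm v) \<Lambda> \<longrightarrow>
            (\<exists>!g. g \<in> Ainf v \<and> (\<forall>f\<in>A1 v. \<Lambda> f = pairing \<omega> f g))) \<and>
         comparable_on (Ainf v)
            (\<lambda>g. functional_norm (A1 v) (A1_norm v) (\<lambda>f. pairing \<omega> f g)) (Ainf_norm v)"
proof -
  obtain \<phi> \<tau> df lap c c1 c2 B \<beta> where S: "slow_weight \<phi> \<tau> df lap c c1 c2 B \<beta>"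
    and \<omega>: "\<And>z. z \<in> disk \<Longrightarrow> \<omega> z = exp (- 2 * \<phi> z)"
    by (rule class_E_imp_slow_weight[OF assms(1)]) (assumption | rule that)+
  interpret weighted_pairing \<phi> \<tau> df lap c c1 c2 B \<beta> \<omega> v
    by (rule weighted_pairing.intro[OF S weighted_pairing_axioms.intro[OF \<omega> v_def]])
  show ?thesis
    by (intro conjI ballI allI impI pairing_integrable(1) pairing_bounded representation_unique norms_comparable)
qed

end
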